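(* Let $\Vert\cdot\Vert$ be any norm on $\mathrm{Lie}(\widetilde G)$ and $\Vert\cdot\Vert_{\tilde g}$ the associated left-invariant Finsler norm on $T_{\tilde g}\widetilde G$. Let $\widetilde X\in\mathrm{Lie}(\widetilde G)=T_{\mathrm{Id}}\widetilde G$. Then for almost every trajectory, \[\frac1t\log\Vert d\varphi_t(\mathrm{Id})(\widetilde X)\Vert_{\varphi_t(\mathrm{Id})}\xrightarrow[t\to+\infty]{}\begin{cases}\alpha & \text{if } \widetilde X\in\mathrm{Lie}(\widetilde G)\setminus V^0_\infty,\\ 0&\text{if } \widetilde X\in V^0_\infty\setminus V^-_\infty,\\ -\alpha&\text{if }\widetilde X\in V^-_\infty\setminus\{0\}.\end{cases}\]
   Context: Let $d$ be a positive integer. Minkowski space $\mathbb{R}^{1,d}=\mathbb{R}\times\mathbb{R}^d$ has canonical basis $e_0,\dots,e_d$ and quadratic form $q(\xi)=(\xi^0)^2-\sum_{i=1}^d(\xi^i)^2$ with bilinear form $q(\cdot,\cdot)$; $Q=\mathrm{diag}(1,-1,\dots,-1)$. Let $G=\{g\in SL_{d+1}(\mathbb{R}): gQg^t=Q,\ q(ge_0,e_0)>0\}$ and $\widetilde G=G\ltimes\mathbb{R}^{1,d}$ the Poincaré group: pairs $(g,\xi)$ with $(g,\xi)(h,\eta)=(gh,\xi+g\eta)$, identity $\mathrm{Id}=(I,0)$. $\mathrm{Lie}(\widetilde G)=\mathrm{Lie}(G)\times\mathbb{R}^{1,d}$, $\mathrm{Lie}(G)=\{\begin{pmatrix}0&b^t\\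 b&C\end{pmatrix}: b\in\mathbb{R}^d, C^t=-C\}$, bracket $[(X,x),(Y,y)]=([X,Y],Xy-Yx)$, adjoint action $\mathrm{Ad}(g,\xi)(X,x)=(gXg^{-1},gx-gXg^{-1}\xi)$; $\widetilde X^l$ is the left-invariant vector field of $\widetilde X$. Set $V_i=e_0e_i^t+e_ie_0^t$, $V_{ij}=e_ie_j^t-e_je_i^t$, $H_0=(0,e_0)$, $K=\{\mathrm{diag}(1,k):k\in SO(d)\}$, $S(r,\theta)=\exp(r\sum_i\theta^iV_i)$. Fix $\sigma\ge0$ and a Borel measure $\nu$ on $(0,\infty)$ with $\int\min(1,r^2)\nu(dr)<\infty$, with $\sigma>0$ or $\nu\ne0$, and assume $\int_1^\infty r\,\nu(dr)<\infty$. Let $d\theta$ be the uniform probability on $\mathbb S^{d-1}$ and $\tilde g_t=(g_t,\xi_t)$ the left Lévy process in $\widetilde G$ from $\mathrm{Id}$ with generator $\widetilde{\mathcal L}f(\tilde g)=H_0^lf(\tilde g)+\frac{\sigma^2}{2}\sum_i(V_i^l)^2f(\tilde g)+\int_0^\infty\int_{\mathbb S^{d-1}}\big(f(\tilde gS(r,\theta))-f(\tilde g)-r\mathbf 1_{r\le1}\sum_i\theta^iV_i^lf(\tilde g)\big)d\theta\,\nu(dr)$; $\xi_t=\int_0^tg_se_0ds$. The associated left-invariant stochastic flow is $\varphi_t(\tilde g)=\tilde g\,\tilde g_t$. Iwasawa: $\mathcal N=\mathrm{span}\{V_i-V_{1i}:2\le i\le d\}$, $N=\exp\mathcal N$, $A=\{\exp(uV_1)\}$,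 $G=NAK$ uniquely; write $g_t=n_ta_tk_t$, $a_t=\exp(\alpha_tV_1)$. It is known that almost surely: $\alpha_t/t\to\alpha$, a deterministic constant $\alpha>0$; $n_t\to n_\infty\in N$; and $-\frac12 q(n_\infty^{-1}\xi_t,e_0+e_1)\to\lambda_\infty$ for some random $\lambda_\infty>0$. Set $\tilde g_\infty=(n_\infty,\lambda_\infty(e_0-e_1))\in\widetilde G$. Let $\overline{\mathcal N}=\mathrm{span}\{V_i+V_{1i}:2\le i\le d\}$, $\mathcal M=\mathrm{span}\{V_{ij}:2\le i<j\le d\}$, $U^-=\mathbb{R}(e_0-e_1)$, $U^0=\mathrm{span}\{e_2,\dots,e_d\}$, $U^+=\mathbb{R}(e_0+e_1)$, and $\widetilde U^+=\overline{\mathcal N}\times U^+$, $\widetilde U^0=(\mathbb{R}V_1\oplus\mathcal M)\times U^0$, $\widetilde U^-=\mathcal N\times U^-$ (the eigenspaces of $\mathrm{ad}(V_1,0)$ for eigenvalues $1,0,-1$). Define the random subspaces $V^-_\infty=\mathrm{Ad}(\tilde g_\infty)(\widetilde U^+)\subset V^0_\infty=\mathrm{Ad}(\tilde g_\infty)(\widetilde U^0\oplus\widetilde U^+)$. *)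

theory Defs
  imports "HOL-Probability.Probability"
begin

(* Minkowski space R^{1,d}: coordinates indexed by 'd option; None is the time index 0,
   Some i (i :: 'd) are the spatial indices 1..d. *)
type_synonym 'd mvec = "real ^ ('d option)"
type_synonym 'd mmat = "real ^ ('d option) ^ ('d option)"
type_synonym 'd pg = "'d mmat \<times> 'd mvec"   (* ambient space of the Poincare group / its Lie algebra *)

definition ev :: "'d::finite option \<Rightarrow> 'd mvec" where
  "ev j = axis j 1"

(* matrix units e_a e_b^t *)
definition Emat :: "'d::finite option \<Rightarrow> 'd option \<Rightarrow> 'd mmat" where
  "Emat a b = (\<chi> i j. if i = a \<and> j = b then 1 else 0)"

definition Qmat :: "'d::finite mmat" where
  "Qmat = (\<chi> i j. if i = j then (if i = None then 1 else -1) else 0)"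

definition qform :: "'d::finite mvec \<Rightarrow> 'd mvec \<Rightarrow> real" where
  "qform x y = x $ None * y $ None - (\<Sum>i\<in>UNIV. x $ Some i * y $ Some i)"

definition Ggrp :: "'d::finite mmat set" where
  "Ggrp = {g. det g = 1 \<and> g ** Qmat ** transpose g = Qmat \<and> qform (g *v ev None) (ev None) > 0}"

definition Gtilde :: "'d::finite pg set" where
  "Gtilde = {(g, \<xi>). g \<in> Ggrp}"

definition pmult :: "'d::finite pg \<Rightarrow> 'd pg \<Rightarrow> 'd pg" where
  "pmult a b = (fst a ** fst b, snd a + fst a *v snd b)"

definition pinv :: "'d::finite pg \<Rightarrow> 'd pg" where
  "pinv a = (matrix_inv (fst a), - (matrix_inv (fst a) *v snd a))"

definition pId :: "'d::finite pg" where
  "pId = (mat 1, 0)"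

definition lieG :: "'d::finite mmat set" where
  "lieG = {X. X $ None $ None = 0 \<and> (\<forall>i. X $ None $ Some i = X $ Some i $ None)
              \<and> (\<forall>i j. X $ Some i $ Some j = - X $ Some j $ Some i)}"

definition lieT :: "'d::finite pg set" where
  "lieT = {(X, x). X \<in> lieG}"

(* matrix powers and matrix exponential *)
definition mpow :: "'d::finite mmat \<Rightarrow> nat \<Rightarrow> 'd mmat" where
  "mpow X n = (((**) X) ^^ n) (mat 1)"

definition matexp :: "'d::finite mmat \<Rightarrow> 'd mmat" where
  "matexp X = (\<Sum>n. (1 / fact n) *\<^sub>R mpow X n)"

(* exponential map of the Poincare group *)
definition texp :: "'d::finite pg \<Rightarrow> 'd pg" where
  "texp Y = (matexp (fst Y), (\<Sum>n. (1 / fact (Suc n)) *\<^sub>R (mpow (fst Y) n *v snd Y)))"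

(* Ad(g,xi)(X,x) = (g X g^{-1}, g x - g X g^{-1} xi) *)
definition Adt :: "'d::finite pg \<Rightarrow> 'd pg \<Rightarrow> 'd pg" where
  "Adt a Y = (fst a ** fst Y ** matrix_inv (fst a),
              fst a *v snd Y - (fst a ** fst Y ** matrix_inv (fst a)) *v snd a)"

definition Vb :: "'d::finite \<Rightarrow> 'd mmat" where
  "Vb i = Emat None (Some i) + Emat (Some i) None"

definition Vij :: "'d::finite \<Rightarrow> 'd \<Rightarrow> 'd mmat" where
  "Vij i j = Emat (Some i) (Some j) - Emat (Some j) (Some i)"

(* left-invariant vector field of Y applied to f: Y^l f (g) = d/ds f(g exp(sY)) |_{s=0} *)
definition lfield :: "'d::finite pg \<Rightarrow> ('d pg \<Rightarrow> real) \<Rightarrow> 'd pg \<Rightarrow> real" where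
  "lfield Y f g = deriv (\<lambda>s. f (pmult g (texp (s *\<^sub>R Y)))) 0"

definition H0 :: "'d::finite pg" where
  "H0 = (0, ev None)"

definition Vt :: "'d::finite \<Rightarrow> 'd pg" where
  "Vt i = (Vb i, 0)"

definition Smap :: "real \<Rightarrow> real ^ 'd \<Rightarrow> 'd::finite pg" where
  "Smap r \<theta> = (matexp (r *\<^sub>R (\<Sum>i\<in>UNIV. (\<theta> $ i) *\<^sub>R Vb i)), 0)"

(* uniform probability measure on the unit sphere S^{d-1} of R^d *)
definition sphere_unif :: "(real ^ 'd::finite) measure" where
  "sphere_unif = distr (uniform_measure lborel (ball 0 1)) borel (\<lambda>x. (1 / norm x) *\<^sub>R x)"

(* the generator \<tilde>L *)
definition genL :: "real \<Rightarrow> real measure \<Rightarrow> ('d::finite pg \<Rightarrow> real) \<Rightarrow> 'd pg \<Rightarrow> real" where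
  "genL \<sigma> \<nu> f g =
     lfield H0 f g + (\<sigma>\<^sup>2 / 2) * (\<Sum>i\<in>UNIV. lfield (Vt i) (lfield (Vt i) f) g)
     + (\<integral>r. (\<integral>\<theta>. (f (pmult g (Smap r \<theta>)) - f g
            - (if r \<le> 1 then r else 0) * (\<Sum>i\<in>UNIV. (\<theta> $ i) * lfield (Vt i) f g)) \<partial>sphere_unif) \<partial>\<nu>)"

(* test functions: C^2 with compact support on the ambient space *)
definition C2c :: "('d::finite pg \<Rightarrow> real) \<Rightarrow> bool" where
  "C2c f \<longleftrightarrow> (\<exists>Df D2f.
      (\<forall>x. (f has_derivative blinfun_apply (Df x)) (at x)) \<and>
      (\<forall>x. (Df has_derivative blinfun_apply (D2f x)) (at x)) \<and>
      continuous_on UNIV D2f \<and> compact (closure {x. f x \<noteq> 0}))"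

(* natural filtration of the process *)
definition natfilt :: "'w measure \<Rightarrow> (real \<Rightarrow> 'w \<Rightarrow> 'd::finite pg) \<Rightarrow> real \<Rightarrow> 'w measure" where
  "natfilt M X s = sigma (space M)
     {X u -` B \<inter> space M | u B. 0 \<le> u \<and> u \<le> s \<and> B \<in> sets borel}"

(* left Levy process in \<tilde>G started at Id with generator \<tilde>L, characterised by the
   martingale problem: cadlag paths in \<tilde>G, X_0 = Id, and
   f(X_t) - f(X_0) - int_0^t Lf(X_u) du is a martingale for the natural filtration *)
definition left_levy_process ::
  "real \<Rightarrow> real measure \<Rightarrow> 'w measure \<Rightarrow> (real \<Rightarrow> 'w \<Rightarrow> 'd::finite pg) \<Rightarrow> bool" where
  "left_levy_process \<sigma> \<nu> M X \<longleftrightarrow>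
     prob_space M \<and>
     (\<forall>t\<ge>0. X t \<in> borel_measurable M) \<and>
     (\<forall>\<omega>\<in>space M. X 0 \<omega> = pId) \<and>
     (\<forall>\<omega>\<in>space M. \<forall>t\<ge>0. X t \<omega> \<in> Gtilde) \<and>
     (\<forall>\<omega>\<in>space M. \<forall>t\<ge>0. continuous (at_right t) (\<lambda>s. X s \<omega>)) \<and>
     (\<forall>\<omega>\<in>space M. \<forall>t>0. \<exists>l. ((\<lambda>s. X s \<omega>) \<longlongrightarrow> l) (at_left t)) \<and>
     (\<forall>f. C2c f \<longrightarrow> (\<forall>s t. 0 \<le> s \<longrightarrow> s \<le> t \<longrightarrow>
        (AE \<omega> in M. real_cond_exp M (natfilt M X s)
            (\<lambda>\<omega>. f (X t \<omega>) - f (X s \<omega>) - integral {s..t} (\<lambda>u. genL \<sigma> \<nu> f (X u \<omega>))) \<omega> = 0)))"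

(* Iwasawa decomposition G = N A K, with e_1 = e_{Some i1} *)
definition calN :: "'d::finite \<Rightarrow> 'd mmat set" where
  "calN i1 = span {Vb i - Vij i1 i | i. i \<noteq> i1}"

definition calNbar :: "'d::finite \<Rightarrow> 'd mmat set" where
  "calNbar i1 = span {Vb i + Vij i1 i | i. i \<noteq> i1}"

definition calM :: "'d::finite \<Rightarrow> 'd mmat set" where
  "calM i1 = span {Vij i j | i j. i \<noteq> i1 \<and> j \<noteq> i1 \<and> i \<noteq> j}"

definition Ngrp :: "'d::finite \<Rightarrow> 'd mmat set" where
  "Ngrp i1 = matexp ` calN i1"

definition Kgrp :: "'d::finite mmat set" where
  "Kgrp = {k. \<exists>k'::real^'d^'d. orthogonal_matrix k' \<and> det k' = 1 \<and>
             k = (\<chi> a b. case (a, b) of (None, None) \<Rightarrow> 1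
                     | (Some i, Some j) \<Rightarrow> k' $ i $ j | _ \<Rightarrow> 0)}"

definition iw_alpha :: "'d::finite \<Rightarrow> 'd mmat \<Rightarrow> real" where
  "iw_alpha i1 g = (THE u. \<exists>n\<in>Ngrp i1. \<exists>k\<in>Kgrp. g = n ** matexp (u *\<^sub>R Vb i1) ** k)"

definition iw_N :: "'d::finite \<Rightarrow> 'd mmat \<Rightarrow> 'd mmat" where
  "iw_N i1 g = (THE n. n \<in> Ngrp i1 \<and> (\<exists>u. \<exists>k\<in>Kgrp. g = n ** matexp (u *\<^sub>R Vb i1) ** k))"

(* eigenspaces of ad(V_1,0) *)
definition Ut_plus :: "'d::finite \<Rightarrow> 'd pg set" where
  "Ut_plus i1 = calNbar i1 \<times> span {ev None + ev (Some i1)}"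

definition Ut_zero :: "'d::finite \<Rightarrow> 'd pg set" where
  "Ut_zero i1 = {A + B | A B. A \<in> span {Vb i1} \<and> B \<in> calM i1} \<times> span {ev (Some i) | i. i \<noteq> i1}"

definition Ut_minus :: "'d::finite \<Rightarrow> 'd pg set" where
  "Ut_minus i1 = calN i1 \<times> span {ev None - ev (Some i1)}"

(* a norm on a subspace S *)
definition norm_on :: "'a::real_vector set \<Rightarrow> ('a \<Rightarrow> real) \<Rightarrow> bool" where
  "norm_on S N \<longleftrightarrow> (\<forall>x\<in>S. N x \<ge> 0 \<and> (N x = 0 \<longleftrightarrow> x = 0)) \<and>
     (\<forall>x\<in>S. \<forall>c. N (c *\<^sub>R x) = \<bar>c\<bar> * N x) \<and>
     (\<forall>x\<in>S. \<forall>y\<in>S. N (x + y) \<le> N x + N y)"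

(* left-invariant Finsler norm on T_g \<tilde>G associated with N: \<parallel>v\<parallel>_g = N(dL_{g^{-1}}(g) v) *)
definition finsler :: "('d::finite pg \<Rightarrow> real) \<Rightarrow> 'd pg \<Rightarrow> 'd pg \<Rightarrow> real" where
  "finsler N g v = N (frechet_derivative (\<lambda>h. pmult (pinv g) h) (at g) v)"

(* differential at Id of the flow \<phi>_t(h) = h \<tilde>g_t *)
definition dflow :: "'d::finite pg \<Rightarrow> 'd pg \<Rightarrow> 'd pg" where
  "dflow gt Y = frechet_derivative (\<lambda>h. pmult h gt) (at pId) Y"

end

(* With p = g e_0 one has |g^-1 v|^2 = 2 q(v,p)^2 - q(v,v) and |g^-1 X g|^2 = -4 q(Xp,Xp) - tr X^2, so every norm
 in the theorem is governed by the process p_t and by xi_t = int_0^t p_s ds.  Applying the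
 martingale problem to truncations of ln |A g_t| gives ln |g_t^-1 v| = int_0^t D_v(g_s) ds + o(t).  The drift D_v is
 one constant alpha for all null v, is bounded below by a positive constant for all v if d >= 2, and alpha = 0 if d = 1.
 For d >= 2 the horospherical coordinate converges at rate alpha to a limit whose null direction eta is almost
 surely not orthogonal to a given nonzero v, by the growth of |g_t^-1 v|; hence a fixed nonzero Y is almost surely
 outside the middle subspace, and its growth rate is alpha. For d = 1 all rates vanish. *)
theory Submission
 imports Defs
begin

section \<open>Minkowski geometry\<close>

text \<open>The martingale problem only speaks about compactly supported C^2 functions, and the
  jumps have a first moment but possibly no second one. Hence the law of large numbers is proved by
  truncation: up to time 2^k the logarithm is cut off smoothly at a scale R comparable to 2^k. The
  carre du champ of the result is at most a constant times sigma^2/R^2 + int min(1, r^2/R^2) nu(dr),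
  and 2^k times this is summable in k because int_1^oo r nu(dr) is finite; a maximal inequality and
  Borel-Cantelli follow. R is so large a multiple of 2^k that the drift alone cannot carry the
  logarithm out of the range where the cutoff is the identity, so no stopping times occur. The
  random base point of an increment is handled by a countable partition adapted to the filtration.
  The delicate pathwise quantity is q(Z xi_t, p_t), of apparent size e^(2 alpha t); antisymmetry of
  Z under q removes one factor e^(alpha t). To exclude the middle subspace, the random eigenvalue of
  Z on the limiting null direction is confined to a finite deterministic set, which leaves finitely
  many fixed vectors to test.\<close>

lemma sum_option:
 fixes f :: "'d::finite option => 'a::comm_monoid_add"
 shows "sum f UNIV = f None + (\<Sum>i\<in>UNIV. f (Some i))" by (simp add: UNIV_option_conv sum.reindex)

definition mk :: "real => real ^ 'd => 'd::finite mvec" where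
 "mk a b = (\<chi> j. case j of None => a | Some i => b $ i)"

definition sp :: "'d::finite mvec => real ^ 'd" where
 "sp u = (\<chi> i. u $ Some i)"

lemma mk_None [simp]: "mk a b $ None = a" and mk_Some [simp]: "mk a b $ Some i = b $ i"
 and sp_nth [simp]: "sp u $ i = u $ Some i" and sp_mk [simp]: "sp (mk a b) = b" by (auto simp: mk_def sp_def vec_eq_iff)

lemma mvec_eqI: "x $ None = y $ None ==> (!!i. x $ Some i = y $ Some i) ==> x = y" by (metis not_None_eq vec_eq_iff)

lemma mk_sp [simp]: "mk (u $ None) (sp u) = u" by (auto intro: mvec_eqI)

lemma inner_mvec: "inner x y = x $ None * y $ None + inner (sp x) (sp y)" by (simp add: inner_vec_def sum_option)

lemma sp_add: "sp (x + y) = sp x + sp y" and sp_diff: "sp (x - y) = sp x - sp y"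
 and sp_scaleR: "sp (c *\<^sub>R x) = c *\<^sub>R sp x" and sp_zero: "sp 0 = 0" by (auto simp: vec_eq_iff)

lemmas sp_simps = sp_add sp_diff sp_scaleR sp_zero

lemma norm_mvec: "(norm x)\<^sup>2 = (x $ None)\<^sup>2 + (norm (sp x))\<^sup>2" unfolding power2_norm_eq_inner inner_mvec by (simp add: power2_eq_square)

lemma qform_inner: "qform x y = 2 * x $ None * y $ None - inner x y" by (simp add: qform_def inner_vec_def sum_option)

lemma qform_sp: "qform x y = x $ None * y $ None - inner (sp x) (sp y)" by (simp add: qform_def inner_vec_def)

lemma qform_commute: "qform x y = qform y x" by (simp add: qform_inner inner_commute)

lemma qform_add_left: "qform (x + y) z = qform x z + qform y z"
 and qform_add_right: "qform z (x + y) = qform z x + qform z y"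
 and qform_diff_left: "qform (x - y) z = qform x z - qform y z"
 and qform_diff_right: "qform z (x - y) = qform z x - qform z y"
 and qform_scaleR_left: "qform (c *\<^sub>R x) z = c * qform x z"
 and qform_scaleR_right: "qform z (c *\<^sub>R x) = c * qform z x"
 and qform_zero_left: "qform 0 z = 0" and qform_zero_right: "qform z 0 = 0" by (simp_all add: qform_inner algebra_simps inner_simps)

lemmas qform_simps = qform_add_left qform_add_right qform_diff_left qform_diff_right
 qform_scaleR_left qform_scaleR_right qform_zero_left qform_zero_right

lemma ev_None: "ev None = mk 1 0" and ev_Some: "ev (Some i) = mk 0 (axis i 1)" by (auto intro!: mvec_eqI simp: ev_def axis_def)

lemma Qmat_mult: "Qmat *v x = mk (x $ None) (- sp x)" by (rule mvec_eqI) (simp_all add: Qmat_def matrix_vector_mult_def if_distrib[of "%u. u * _"] cong: if_cong)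

lemma qform_Qmat: "qform x y = inner x (Qmat *v y)" by (simp add: qform_sp inner_mvec Qmat_mult)

lemma Qmat_sym: "transpose Qmat = Qmat" by (auto simp: transpose_def Qmat_def vec_eq_iff)

lemma Qmat_Qmat: "Qmat ** Qmat = mat 1" by (simp add: matrix_eq matrix_vector_mul_assoc[symmetric] Qmat_mult mvec_eqI)

lemma Qmat_Qmat_left: "Qmat ** (Qmat ** A) = A" by (simp add: matrix_mul_assoc Qmat_Qmat)

lemma Qmat_Qmat_right: "(A ** Qmat) ** Qmat = A" by (simp add: matrix_mul_assoc[symmetric] Qmat_Qmat)

lemma norm_Qmat_mult [simp]: "norm (Qmat *v x) = norm x"
proof -
 have "(norm (Qmat *v x))\<^sup>2 = (norm x)\<^sup>2" by (simp add: norm_mvec Qmat_mult)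
 then show ?thesis by simp
qed

lemma inner_transpose: "inner (A *v x) (y::real^'m) = inner x (transpose A *v y)" for A :: "real^'n^'m" by (metis dot_lmul_matrix inner_commute transpose_matrix_vector)

text \<open>The isometry relation makes \<open>Qmat ** transpose g ** Qmat\<close> a right inverse,
  and one-sided inverses of square matrices are two-sided. \<open>matrix_inv\<close> is a choice, so
  it has to be identified with this explicit inverse before anything can be computed with
  it.\<close>

lemma Ggrp_inverse:
 assumes "g \<in> Ggrp"
 shows "g ** (Qmat ** transpose g ** Qmat) = mat 1" "(Qmat ** transpose g ** Qmat) ** g = mat 1"
 "matrix_inv g = Qmat ** transpose g ** Qmat" "transpose g ** Qmat ** g = Qmat"
proof -
 have "g ** Qmat ** transpose g = Qmat" using assms by (simp add: Ggrp_def)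
 then show 1: "g ** (Qmat ** transpose g ** Qmat) = mat 1" by (simp add: matrix_mul_assoc Qmat_Qmat)
 then show 2: "(Qmat ** transpose g ** Qmat) ** g = mat 1" by (simp add: matrix_left_right_inverse)
 show "matrix_inv g = Qmat ** transpose g ** Qmat"
proof -
 have "g ** matrix_inv g = mat 1 & matrix_inv g ** g = mat 1" unfolding matrix_inv_def by (rule someI_ex) (use 1 2 in blast)
 then show ?thesis by (metis 2 matrix_mul_assoc matrix_mul_lid matrix_mul_rid)
qed
 have "Qmat ** ((Qmat ** transpose g ** Qmat) ** g) = Qmat" by (simp add: 2)
 then show "transpose g ** Qmat ** g = Qmat" by (simp add: matrix_mul_assoc Qmat_Qmat)
qed

lemma qform_Ggrp [simp]:
 assumes "g \<in> Ggrp" shows "qform (g *v x) (g *v y) = qform x y"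
proof -
 have "qform (g *v x) (g *v y) = inner x ((transpose g ** Qmat ** g) *v y)" unfolding qform_Qmat inner_transpose by (simp add: matrix_vector_mul_assoc matrix_mul_assoc del: transpose_matrix_vector)
 then show ?thesis by (simp add: Ggrp_inverse[OF assms] qform_Qmat)
qed

lemma Ggrp_matrix_inv [simp]:
 assumes "g \<in> Ggrp"
 shows "matrix_inv g ** g = mat 1" "g ** matrix_inv g = mat 1"
 "matrix_inv g *v (g *v x) = x" "g *v (matrix_inv g *v x) = x" using Ggrp_inverse[OF assms] by (simp_all add: matrix_vector_mul_assoc)

lemma qform_matrix_inv: 
 assumes "g \<in> Ggrp" shows "qform (matrix_inv g *v x) y = qform x (g *v y)" using qform_Ggrp[OF assms, of "matrix_inv g *v x" y] by (simp add: assms)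

lemma qform_ev_None: "qform x (ev None) = x $ None" by (simp add: qform_sp ev_None)

text \<open>The Euclidean square of a vector is twice its squared time component minus its q-square.
  The time component of \<open>matrix_inv g *v x\<close> is its q-product with e_0, and moving g to
  the other side turns it into q(x, g e_0); the q-square is invariant.\<close>

lemma norm_matrix_inv:
 assumes "g \<in> Ggrp"
 shows "(norm (matrix_inv g *v x))\<^sup>2 = 2 * (qform x (g *v ev None))\<^sup>2 - qform x x"
proof -
 let ?y = "matrix_inv g *v x"
 have "(norm ?y)\<^sup>2 = 2 * (?y $ None)\<^sup>2 - qform ?y ?y" unfolding power2_norm_eq_inner by (simp add: qform_inner power2_eq_square)
 moreover have "?y $ None = qform x (g *v ev None)" by (simp add: qform_matrix_inv[OF assms, symmetric] qform_ev_None)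
 moreover have "qform ?y ?y = qform x x" by (simp add: qform_matrix_inv[OF assms] assms)
 ultimately show ?thesis by simp
qed

lemma Ggrp_orbit:
 assumes "g \<in> Ggrp"
 defines "p \<equiv> g *v ev None"
 shows "qform p p = 1" "p $ None \<ge> 1" "norm (sp p) < p $ None" "(norm p)\<^sup>2 = 2 * (p $ None)\<^sup>2 - 1"
proof -
 show 1: "qform p p = 1" using assms by (simp add: qform_ev_None) (simp add: ev_None)
 have pos: "p $ None > 0" using assms by (simp add: Ggrp_def qform_ev_None)
 have 2: "(p $ None)\<^sup>2 = 1 + (norm (sp p))\<^sup>2" using 1 unfolding power2_norm_eq_inner by (simp add: qform_sp power2_eq_square)
 show "p $ None \<ge> 1" using 2 pos by (smt (verit, best) zero_le_power2 one_power2 power2_le_imp_le)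
 show "norm (sp p) < p $ None" using 2 pos by (smt (verit) power2_less_imp_less)
 show "(norm p)\<^sup>2 = 2 * (p $ None)\<^sup>2 - 1" using 2 by (simp add: norm_mvec)
qed

lemma mat_1_Ggrp: "mat 1 \<in> Ggrp" by (simp add: Ggrp_def qform_ev_None) (simp add: ev_None)

lemma GgrpI:
 assumes "det g = 1" "g ** Qmat ** transpose g = Qmat" "(g *v ev None) $ None > 0"
 shows "g \<in> Ggrp" using assms by (simp add: Ggrp_def qform_ev_None)

text \<open>Cauchy-Schwarz on the spatial parts. This positivity keeps the orientation condition of
  \<open>Ggrp\<close> under products and makes the horospherical height positive.\<close>

lemma qform_future_pos:
 assumes "norm (sp x) < x $ None" "norm (sp y) <= y $ None" "y $ None > 0"
 shows "qform x y > 0"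
proof -
 have "inner (sp x) (sp y) <= norm (sp x) * norm (sp y)" by (rule norm_cauchy_schwarz)
 also have "... <= norm (sp x) * y $ None" using assms by (intro mult_left_mono) auto
 also have "... < x $ None * y $ None" using assms by simp
 finally show ?thesis by (simp add: qform_sp)
qed

lemma matrix_inv_None:
 assumes "g \<in> Ggrp" shows "(matrix_inv g *v ev None) $ None = (g *v ev None) $ None"
 and "norm (sp (matrix_inv g *v ev None)) < (matrix_inv g *v ev None) $ None"
proof -
 let ?y = "matrix_inv g *v ev None"
 show 1: "?y $ None = (g *v ev None) $ None" by (metis assms qform_commute qform_ev_None qform_matrix_inv)
 have "qform ?y ?y = 1" by (simp add: qform_matrix_inv assms qform_ev_None) (simp add: ev_None)
 then have "(?y $ None)\<^sup>2 = 1 + (norm (sp ?y))\<^sup>2" unfolding power2_norm_eq_inner by (simp add: qform_sp power2_eq_square)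
 then show "norm (sp ?y) < ?y $ None" using 1 Ggrp_orbit(2)[OF assms] by (smt (verit) power2_less_imp_less)
qed

lemma Ggrp_mult:
 assumes g: "g \<in> Ggrp" and h: "h \<in> Ggrp"
 shows "g ** h \<in> Ggrp"
proof (rule GgrpI)
 show "det (g ** h) = 1" using assms by (simp add: Ggrp_def det_mul)
 have "(g ** h) ** Qmat ** transpose (g ** h) = g ** (h ** Qmat ** transpose h) ** transpose g" by (simp add: matrix_transpose_mul matrix_mul_assoc)
 also have "... = Qmat" using assms by (simp add: Ggrp_def)
 finally show "(g ** h) ** Qmat ** transpose (g ** h) = Qmat" .
 \<comment> \<open>The inverse of g also maps e_0 to a future timelike vector, because g and its
   inverse have the same time-time entry (\<open>matrix_inv_None\<close>).\<close>
 have "((g ** h) *v ev None) $ None = qform (h *v ev None) (matrix_inv g *v ev None)" by (metis g h matrix_vector_mul_assoc qform_ev_None qform_matrix_inv qform_commute)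
 also have "... > 0" using matrix_inv_None[OF g] Ggrp_orbit[OF h] Ggrp_orbit(2)[OF g] by (intro qform_future_pos) auto
 finally show "((g ** h) *v ev None) $ None > 0" .
qed

lemma Ggrp_inv_mem:
 assumes g: "g \<in> Ggrp" shows "matrix_inv g \<in> Ggrp"
proof (rule GgrpI)
 have "det g * det (matrix_inv g) = 1" by (metis det_I det_mul Ggrp_matrix_inv(2) g)
 then show "det (matrix_inv g) = 1" using g by (simp add: Ggrp_def)
 show "(matrix_inv g *v ev None) $ None > 0" using matrix_inv_None(1)[OF g] Ggrp_orbit(2)[OF g] by simp
 have "matrix_inv g ** Qmat ** transpose (matrix_inv g) = Qmat ** (transpose g ** Qmat ** (g ** Qmat))" by (simp add: Ggrp_inverse(3)[OF g] matrix_transpose_mul matrix_mul_assoc Qmat_sym Qmat_Qmat_right)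
 also have "... = Qmat" by (simp add: matrix_mul_assoc Ggrp_inverse(4)[OF g] Qmat_Qmat)
 finally show "matrix_inv g ** Qmat ** transpose (matrix_inv g) = Qmat" .
qed

section \<open>Frobenius norms\<close>

lemma norm_matrix_rows: "(norm A)\<^sup>2 = (\<Sum>i\<in>UNIV. (norm (A $ i))\<^sup>2)" for A :: "real^'n^'m" by (simp add: norm_vec_def L2_set_def sum_nonneg)

lemma norm_vec2: "(norm x)\<^sup>2 = (\<Sum>i\<in>UNIV. (x $ i)\<^sup>2)" for x :: "real^'n" by (simp add: norm_vec_def L2_set_def sum_nonneg)

lemma norm_matrix_entries: "(norm A)\<^sup>2 = (\<Sum>i\<in>UNIV. \<Sum>j\<in>UNIV. (A $ i $ j)\<^sup>2)" for A :: "real^'n^'m" by (simp only: norm_matrix_rows norm_vec2)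

lemma norm_transpose_matrix [simp]: "norm (transpose A) = norm A" for A :: "real^'n^'m"
proof -
 have "(norm (transpose A))\<^sup>2 = (norm A)\<^sup>2" unfolding norm_matrix_entries by (simp add: transpose_def) (rule sum.swap)
 then show ?thesis by simp
qed

lemma norm_matrix_vector_le: "norm (A *v x) <= norm A * norm x" for A :: "real^'n^'m"
proof (rule power2_le_imp_le)
 have "(norm (A *v x))\<^sup>2 = (\<Sum>i\<in>UNIV. (inner (A $ i) x)\<^sup>2)" by (simp add: norm_vec2 matrix_vector_mul_component)
 also have "... <= (\<Sum>i\<in>UNIV. (norm (A $ i))\<^sup>2 * (norm x)\<^sup>2)" by (intro sum_mono) (metis Cauchy_Schwarz_ineq power2_norm_eq_inner)
 also have "... = (norm A * norm x)\<^sup>2" by (simp add: norm_matrix_rows power_mult_distrib sum_distrib_right)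
 finally show "(norm (A *v x))\<^sup>2 <= (norm A * norm x)\<^sup>2" .
qed simp

lemma norm_matrix_cols: "(norm A)\<^sup>2 = (\<Sum>j\<in>UNIV. (norm (A *v axis j 1))\<^sup>2)" for A :: "real^'n^'m"
proof -
 have "(norm (A *v axis j 1))\<^sup>2 = (\<Sum>i\<in>UNIV. (A $ i $ j)\<^sup>2)" for j by (simp add: norm_vec2 matrix_vector_mult_basis column_def)
 then show ?thesis unfolding norm_matrix_entries by (subst sum.swap) simp
qed

lemma norm_matrix_mult_le: "norm (A ** B) <= norm A * norm B" for A :: "real^'n^'m" and B :: "real^'k^'n"
proof (rule power2_le_imp_le)
 have "(norm (A ** B))\<^sup>2 = (\<Sum>j\<in>UNIV. (norm (A *v (B *v axis j 1)))\<^sup>2)" by (simp add: norm_matrix_cols matrix_vector_mul_assoc)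
 also have "... <= (\<Sum>j\<in>UNIV. (norm A * norm (B *v axis j 1))\<^sup>2)" by (intro sum_mono power_mono norm_matrix_vector_le) auto
 also have "... = (norm A * norm B)\<^sup>2" by (simp add: norm_matrix_cols[of B] power_mult_distrib sum_distrib_left)
 finally show "(norm (A ** B))\<^sup>2 <= (norm A * norm B)\<^sup>2" .
qed simp

lemma norm_matrix_inv_Ggrp:
 assumes "g \<in> Ggrp" shows "norm (matrix_inv g) = norm g"
proof -
 have Q: "(norm (Qmat ** A))\<^sup>2 = (norm A)\<^sup>2" for A :: "'a mmat" unfolding norm_matrix_cols by (simp add: matrix_vector_mul_assoc[symmetric])
 then have Q1: "norm (Qmat ** A) = norm A" for A :: "'a mmat" by simp
 have Q2: "norm (A ** Qmat) = norm A" for A :: "'a mmat" by (metis Q1 Qmat_sym matrix_transpose_mul norm_transpose_matrix)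
 show ?thesis by (simp add: Ggrp_inverse(3)[OF assms] Q1 Q2)
qed

text \<open>Sum \<open>norm_matrix_inv\<close> over the basis vectors: the squares q(e_j, p)^2 add
  up to |p|^2 and the signature contributes d - 1. So the orbit point of e_0 controls the whole
  matrix.\<close>

lemma norm_Ggrp:
 assumes "g \<in> Ggrp" shows "(norm (g :: 'd::finite mmat))\<^sup>2 = 2 * (norm (g *v ev None))\<^sup>2 - 1 + real CARD('d)"
proof -
 let ?p = "g *v ev None"
 have "(norm (matrix_inv g))\<^sup>2 = (\<Sum>j\<in>UNIV. 2 * (qform (axis j 1) ?p)\<^sup>2 - qform (axis j 1) (axis j 1))" by (simp add: norm_matrix_cols norm_matrix_inv[OF assms])
 also have "... = 2 * (norm ?p)\<^sup>2 - 1 + real CARD('d)"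
proof -
 have 1: "qform (axis None 1) ?p = ?p $ None" "qform (axis None 1) (axis None 1) = (1::real)" using qform_commute[of "ev None" ?p] qform_ev_None[of ?p] qform_ev_None[of "ev None"] by (auto simp: ev_def axis_def)
 have 2: "qform (axis (Some i) 1) ?p = - (?p $ Some i)" "qform (axis (Some i) 1) (axis (Some i) 1) = (-1::real)" for i using ev_Some[of i] by (auto simp: ev_def qform_sp inner_axis')
 have 3: "(norm ?p)\<^sup>2 = (?p $ None)\<^sup>2 + (\<Sum>i\<in>UNIV. (?p $ Some i)\<^sup>2)" by (simp only: norm_mvec[of ?p] norm_vec2[of "sp ?p"] sp_nth)
 have "(\<Sum>j\<in>UNIV. 2 * (qform (axis j 1) ?p)\<^sup>2 - qform (axis j 1) (axis j 1))
 = 2 * (?p $ None)\<^sup>2 - 1 + (\<Sum>i\<in>UNIV. 2 * (?p $ Some i)\<^sup>2 + (1::real))" by (simp only: sum_option 1 2) simp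
 then show ?thesis by (simp only: 3 sum.distrib sum_distrib_left[symmetric]) simp
qed
 finally show ?thesis by (simp add: norm_matrix_inv_Ggrp[OF assms])
qed

section \<open>The Lie algebra of G and the norms of its conjugates\<close>

lemma lieG_None: "X \<in> lieG ==> X $ None $ None = 0"
 and lieG_sym: "X \<in> lieG ==> X $ None $ Some i = X $ Some i $ None"
 and lieG_antisym: "X \<in> lieG ==> X $ Some i $ Some j = - X $ Some j $ Some i" unfolding lieG_def by blast+

text \<open>Conjugation by Q flips exactly the entries with one time and one space index, which
  turns the block description into a coordinate-free identity. Stability under conjugation and
  antisymmetry under q then become matrix algebra.\<close>

lemma lieG_iff: "X \<in> lieG \<longleftrightarrow> transpose X = - (Qmat ** X ** Qmat)"
proof -
 have *: "(Qmat ** X ** Qmat) $ i $ j = (if (i = None) = (j = None) then 1 else -1) * X $ i $ j" for i j by (simp add: matrix_matrix_mult_def Qmat_def if_distrib[of "%u. u * _"] if_distrib[of "%u. _ * u"] cong: if_cong)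
 have t: "transpose X $ i $ j = X $ j $ i" "(- (Qmat ** X ** Qmat)) $ i $ j = - ((Qmat ** X ** Qmat) $ i $ j)" for i j by (simp_all add: transpose_def)
 show ?thesis
proof
 assume X: "X \<in> lieG"
 show "transpose X = - (Qmat ** X ** Qmat)"
proof (intro vec_eq_iff[THEN iffD2] allI)
 fix i j show "transpose X $ i $ j = (- (Qmat ** X ** Qmat)) $ i $ j"
proof (cases i)
case None
 then show ?thesis by (cases j) (simp_all only: t * lieG_None[OF X] lieG_sym[OF X], simp_all)
next
case (Some a)
 then show ?thesis
proof (cases j)
case None
 then show ?thesis using Some lieG_sym[OF X, of a] by (simp only: t *) simp
next
case (Some b)
 then show ?thesis using \<open>i = Some a\<close> lieG_antisym[OF X, of b a] by (simp only: t * option.distinct if_True simp_thms mult_1)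
qed
qed
qed
next
 assume "transpose X = - (Qmat ** X ** Qmat)"
 then have "transpose X $ i $ j = (- (Qmat ** X ** Qmat)) $ i $ j" for i j by (rule arg_cong)
 then have e: "X $ j $ i = - ((if (i = None) = (j = None) then 1 else -1) * X $ i $ j)" for i j unfolding t * .
 show "X \<in> lieG" unfolding lieG_def
proof (intro CollectI conjI allI)
 show "X $ None $ None = 0" using e[of None None] by simp
 show "X $ None $ Some i = X $ Some i $ None" for i using e[of "Some i" None] by simp
 show "X $ Some i $ Some j = - X $ Some j $ Some i" for i j using e[of "Some j" "Some i"] by (simp only: option.simps if_True simp_thms mult_1 mult_minus1)
qed
qed
qed

lemma lieG_qform:
 assumes "X \<in> lieG" shows "qform (X *v x) y = - qform x (X *v y)"
proof -
 have "qform (X *v x) y = inner x ((transpose X ** Qmat) *v y)" unfolding qform_Qmat inner_transpose by (simp add: matrix_vector_mul_assoc del: transpose_matrix_vector)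
 also have "transpose X ** Qmat = - (Qmat ** X)"
proof -
 have "transpose X ** Qmat = - ((Qmat ** X ** Qmat) ** Qmat)" using assms unfolding lieG_iff by (simp add: matrix_matrix_mult_def vec_eq_iff sum_negf)
 then show ?thesis by (simp add: Qmat_Qmat_right)
qed
 also have "inner x ((- (Qmat ** X)) *v y) = - qform x (X *v y)" by (simp add: qform_Qmat matrix_vector_mul_assoc) (simp add: matrix_vector_mult_def inner_vec_def sum_negf)
 finally show ?thesis .
qed

lemma lieG_qform_self: "X \<in> lieG ==> qform (X *v x) x = 0" using lieG_qform[of X x x] qform_commute[of x "X *v x"] by simp

lemma matrix_scaleR_mult: "(c *\<^sub>R A) ** B = c *\<^sub>R (A ** B)" "A ** (c *\<^sub>R B) = c *\<^sub>R (A ** B)"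
 for A :: "real^'n^'m" and B :: "real^'k^'n" by (simp_all add: matrix_matrix_mult_def vec_eq_iff sum_distrib_left algebra_simps)

lemma matrix_add_mult: "(A + B) ** C = A ** C + B ** C" "(A - B) ** C = A ** C - B ** C" "C' ** (A - B) = C' ** A - C' ** B"
 "(- A) ** C = - (A ** C)" "C' ** (- A) = - (C' ** A)"
 for A :: "real^'n^'m" and C' :: "real^'m^'l" by (simp_all add: matrix_matrix_mult_def vec_eq_iff sum_subtractf sum.distrib sum_negf algebra_simps)

lemma lieG_conj:
 assumes "X \<in> lieG" "g \<in> Ggrp" shows "matrix_inv g ** X ** g \<in> lieG"
proof -
 have X: "transpose X = - (Qmat ** X ** Qmat)" using assms(1) lieG_iff by blast
 have "transpose (matrix_inv g ** X ** g) = - (transpose g ** (Qmat ** X ** Qmat) ** (Qmat ** g ** Qmat))" by (simp add: matrix_transpose_mul X Ggrp_inverse(3)[OF assms(2)] Qmat_sym matrix_add_mult matrix_mul_assoc)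
 also have "... = - (Qmat ** (Qmat ** transpose g ** Qmat ** X ** g) ** Qmat)" by (simp add: matrix_mul_assoc Qmat_Qmat Qmat_Qmat_right)
 finally show ?thesis unfolding lieG_iff by (simp add: Ggrp_inverse(3)[OF assms(2)])
qed

text \<open>For \<open>X = (0, b\<^sup>t; b, C)\<close> one has \<open>|X|\<^sup>2 = 2|b|\<^sup>2 + |C|\<^sup>2\<close> and \<open>tr X\<^sup>2 = 2|b|\<^sup>2 - |C|\<^sup>2\<close>.\<close>

lemma norm_lieG:
 assumes "X \<in> lieG" shows "(norm X)\<^sup>2 = - 4 * qform (X *v ev None) (X *v ev None) - trace (X ** X)"
proof -
 have t: "trace (X ** X) = (\<Sum>i\<in>UNIV. \<Sum>j\<in>UNIV. X $ i $ j * X $ j $ i)" by (simp add: trace_def matrix_matrix_mult_def)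
 have b: "(X *v ev None) $ j = X $ j $ None" for j by (simp add: ev_def matrix_vector_mult_basis column_def)
 have q: "qform (X *v ev None) (X *v ev None) = - (\<Sum>i\<in>UNIV. (X $ Some i $ None)\<^sup>2)" using assms by (simp add: qform_def b lieG_None power2_eq_square)
 have e: "X $ Some i $ Some j * X $ Some j $ Some i = - (X $ Some i $ Some j)\<^sup>2" for i j using lieG_antisym[OF assms, of j i] by (simp add: power2_eq_square)
 show ?thesis unfolding t norm_matrix_entries sum_option q by (simp add: lieG_sym[OF assms] lieG_None[OF assms] e sum_negf sum.distrib sum_subtractf power2_eq_square)
qed

text \<open>Apply \<open>norm_lieG\<close> to the conjugate: the trace of its square is invariant,
  and its first column is \<open>matrix_inv g\<close> applied to X p, whose q-square is that of X
  p.\<close>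

lemma norm_lieG_conj:
 assumes "X \<in> lieG" "g \<in> Ggrp"
 shows "(norm (matrix_inv g ** X ** g))\<^sup>2 = - 4 * qform (X *v (g *v ev None)) (X *v (g *v ev None)) - trace (X ** X)"
proof -
 let ?Y = "matrix_inv g ** X ** g"
 have 1: "?Y *v ev None = matrix_inv g *v (X *v (g *v ev None))" by (simp add: matrix_vector_mul_assoc matrix_mul_assoc)
 have "?Y ** ?Y = matrix_inv g ** X ** (g ** matrix_inv g) ** (X ** g)" by (simp add: matrix_mul_assoc)
 then have 2: "?Y ** ?Y = matrix_inv g ** ((X ** X) ** g)" by (simp add: assms matrix_mul_assoc)
 have "trace (?Y ** ?Y) = trace (X ** X)" unfolding 2 by (subst trace_mul_sym) (simp add: assms matrix_mul_assoc[symmetric])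
 then show ?thesis using norm_lieG[OF lieG_conj[OF assms]] unfolding 1 by (simp add: qform_matrix_inv assms)
qed

section \<open>Exponentials and the Iwasawa decomposition\<close>

lemma sum_matrix_vector: "(\<Sum>i\<in>I. A i) *v u = (\<Sum>i\<in>I. A i *v u)" for A :: "'i => real^'n^'m" by (induction I rule: infinite_finite_induct) (simp_all add: matrix_vector_mult_add_rdistrib)

lemma Emat_mult: "Emat a b *v u = u $ b *\<^sub>R ev a"
proof -
 have "(\<Sum>j\<in>UNIV. (if i = a & j = b then 1 else 0) * u $ j) = (if i = a then u $ b else 0)" for i by (cases "i = a") (simp_all add: if_distrib[of "%c. c * _"] cong: if_cong)
 then show ?thesis by (simp add: vec_eq_iff Emat_def ev_def axis_def matrix_vector_mult_def)
qed

lemma Vb_mult: "Vb i *v u = u $ Some i *\<^sub>R ev None + u $ None *\<^sub>R ev (Some i)" by (simp add: Vb_def matrix_vector_mult_add_rdistrib Emat_mult)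

lemma Vij_mult: "Vij i j *v u = u $ Some j *\<^sub>R ev (Some i) - u $ Some i *\<^sub>R ev (Some j)" by (simp add: Vij_def matrix_vector_mult_diff_rdistrib Emat_mult)

lemma ev_None_nth [simp]: "ev None $ None = 1" "ev None $ Some i = 0"
 and ev_Some_nth [simp]: "ev (Some i) $ None = 0" "ev (Some i) $ Some j = (if j = i then 1 else 0)" by (auto simp: ev_def axis_def)

lemma axis_1_nth: "axis i (1::real) $ j = (if j = i then 1 else 0)" by (auto simp: axis_def)

definition Vth :: "real^'d::finite => 'd mmat" where
 "Vth th = (\<Sum>i\<in>UNIV. (th $ i) *\<^sub>R Vb i)"

lemma Vth_mult: "Vth th *v u = mk (inner th (sp u)) (u $ None *\<^sub>R th)"
proof (rule mvec_eqI)
 have e: "Vth th *v u = (\<Sum>i\<in>UNIV. th $ i *\<^sub>R (u $ Some i *\<^sub>R ev None + u $ None *\<^sub>R ev (Some i)))" by (simp add: Vth_def sum_matrix_vector scaleR_matrix_vector_assoc[symmetric] Vb_mult)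
 show "(Vth th *v u) $ None = mk (inner th (sp u)) (u $ None *\<^sub>R th) $ None" by (simp add: e inner_vec_def)
 show "(Vth th *v u) $ Some i = mk (inner th (sp u)) (u $ None *\<^sub>R th) $ Some i" for i by (simp add: e if_distrib[of "%c. _ * c"] mult.commute cong: if_cong)
qed

lemma Vth_sym: "transpose (Vth th) = Vth th" by (simp add: Vth_def Vb_def Emat_def transpose_def vec_eq_iff conj_commute add.commute)

lemma Vth_Qmat: "Vth th ** Qmat = - (Qmat ** Vth th)"
proof -
 have "(Vth th ** Qmat + Qmat ** Vth th) *v x = 0" for x by (rule mvec_eqI) (simp_all add: matrix_vector_mult_add_rdistrib matrix_vector_mul_assoc[symmetric] Vth_mult Qmat_mult)
 then have "Vth th ** Qmat + Qmat ** Vth th = 0" by (simp add: matrix_eq)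
 then show ?thesis by (simp add: eq_neg_iff_add_eq_0)
qed

lemma Vth_cube: "norm th = 1 ==> Vth th ** Vth th ** Vth th = Vth th" by (simp add: matrix_eq matrix_vector_mul_assoc[symmetric] Vth_mult dot_square_norm)

lemma Vth_axis: "Vth (axis i 1) = Vb i" by (simp add: Vth_def axis_def if_distrib[of "%c. c *\<^sub>R _"] cong: if_cong)

section \<open>Closed forms of matrix exponentials; boosts\<close>

lemma mpow_0: "mpow X 0 = mat 1" and mpow_Suc: "mpow X (Suc n) = X ** mpow X n" by (simp_all add: mpow_def)

lemma mpow_scaleR: "mpow (c *\<^sub>R X) n = c ^ n *\<^sub>R mpow X n" by (induction n) (simp_all add: mpow_0 mpow_Suc matrix_scaleR_mult)

text \<open>All odd powers are X and all even powers from the second on are X^2, so the series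
  splits into sinh and cosh. The power 0 is the identity instead of X^2, which accounts for the
  correction \<open>mat 1 - X ** X\<close>.\<close>

lemma matexp_cube:
 assumes "X ** X ** X = X"
 shows "matexp (r *\<^sub>R X) = mat 1 + sinh r *\<^sub>R X + (cosh r - 1) *\<^sub>R (X ** X)"
proof -
 have m: "mpow X (Suc n) = (if even (Suc n) then X ** X else X)" for n by (induction n) (auto simp: mpow_Suc mpow_0 matrix_mul_assoc assms)
 have t: "(1 / fact n) *\<^sub>R mpow (r *\<^sub>R X) n = (if even n then r^n /\<^sub>R fact n else 0) *\<^sub>R (X ** X)
 + (if even n then 0 else r^n /\<^sub>R fact n) *\<^sub>R X + (if n = 0 then mat 1 - X ** X else 0)" for n by (cases n) (simp_all add: mpow_scaleR m mpow_0 divide_inverse mult.commute del: mpow_Suc)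
 have "(%n. (1 / fact n) *\<^sub>R mpow (r *\<^sub>R X) n) sums
 (cosh r *\<^sub>R (X ** X) + sinh r *\<^sub>R X + (mat 1 - X ** X))" unfolding t by (intro sums_add bounded_linear.sums[OF bounded_linear_scaleR_left] cosh_converges sinh_converges)
 (rule sums_single[of 0 "%_. mat 1 - X ** X"])
 then show ?thesis unfolding matexp_def by (simp add: sums_iff algebra_simps)
qed

lemma matexp_nilpotent:
 assumes "X ** X ** X = 0"
 shows "matexp X = mat 1 + X + (1/2) *\<^sub>R (X ** X)"
proof -
 have z: "mpow X n = 0" if "n \<notin> {..<3}" for n
proof -
 have "mpow X (3 + k) = 0" for k
proof (induction k)
case 0
 have "mpow X 3 = X ** X ** X" by (simp add: numeral_3_eq_3 mpow_Suc mpow_0 matrix_mul_assoc)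
 then show ?case using assms by simp
next
case (Suc k)
 have "mpow X (3 + Suc k) = X ** mpow X (3 + k)" by (simp only: add_Suc_right mpow_Suc)
 then show ?case by (simp add: Suc matrix_matrix_mult_def vec_eq_iff)
qed
 from this[of "n - 3"] show ?thesis using that by simp
qed
 have "matexp X = (\<Sum>n<3. (1 / fact n) *\<^sub>R mpow X n)" unfolding matexp_def by (rule suminf_finite) (auto simp: z)
 then show ?thesis by (simp add: numeral_3_eq_3 mpow_Suc mpow_0 lessThan_Suc fact_2[unfolded numeral_2_eq_2])
qed

lemma matexp_0: "matexp 0 = mat 1" using matexp_nilpotent[of 0] by (simp add: matrix_matrix_mult_def vec_eq_iff)

text \<open>The exponential of r times \<open>Vth th\<close> for a unit vector th. The closed form
  makes sense for every th and is visibly continuous in both arguments, which is what joint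
  measurability in r and th rests on.\<close>

definition boost :: "real => real^'d::finite => 'd mmat" where
 "boost r th = mat 1 + sinh r *\<^sub>R Vth th + (cosh r - 1) *\<^sub>R (Vth th ** Vth th)"

lemma matexp_Vth: "norm th = 1 ==> matexp (r *\<^sub>R Vth th) = boost r th" by (simp add: boost_def matexp_cube Vth_cube)

lemma boost_mult: "boost r th *v u = u + sinh r *\<^sub>R (Vth th *v u) + (cosh r - 1) *\<^sub>R (Vth th *v (Vth th *v u))" by (simp add: boost_def matrix_vector_mult_add_rdistrib scaleR_matrix_vector_assoc[symmetric] matrix_vector_mul_assoc)

lemma boost_0 [simp]: "boost 0 th = mat 1" by (simp add: boost_def)

lemma boost_sym: "transpose (boost r th) = boost r th"
proof -
 have tadd: "transpose (A + B) = transpose A + transpose B" for A B :: "'a mmat" by (simp add: transpose_def vec_eq_iff)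
 show ?thesis by (simp add: boost_def tadd transpose_scalar matrix_transpose_mul Vth_sym)
qed

lemma boost_add:
 assumes "norm th = 1" shows "boost (r + s) th = boost r th ** boost s th"
proof -
 let ?V = "Vth th"
 have c: "?V *v (?V *v (?V *v u)) = ?V *v u" for u by (metis Vth_cube[OF assms] matrix_vector_mul_assoc)
 show ?thesis by (simp add: matrix_eq matrix_vector_mul_assoc[symmetric] boost_mult cosh_add sinh_add
 matrix_vector_right_distrib matrix_vector_mult_scaleR c algebra_simps)
qed

lemma boost_Qmat: 
 assumes "norm th = 1" shows "boost r th ** Qmat ** transpose (boost r th) = Qmat"
proof -
 let ?V = "Vth th"
 have VQ: "?V *v (Qmat *v u) = - (Qmat *v (?V *v u))" for u by (simp add: matrix_vector_mul_assoc Vth_Qmat) (simp add: matrix_vector_mult_def vec_eq_iff sum_negf)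
 have mneg: "?V *v (- u) = - (?V *v u)" for u :: "'a mvec" by (simp add: matrix_vector_mult_def vec_eq_iff sum_negf)
 have bQ: "boost r th *v (Qmat *v u) = Qmat *v (boost (-r) th *v u)" for u by (simp add: boost_mult VQ mneg matrix_vector_right_distrib matrix_vector_mult_scaleR algebra_simps)
 have "boost (-r) th ** boost r th = mat 1" by (metis boost_add[OF assms] boost_0 add.left_inverse)
 then show ?thesis by (simp add: boost_sym matrix_eq matrix_vector_mul_assoc[symmetric] bQ)
qed

lemma boost_ev_None: "norm th = 1 ==> boost r th *v ev None = mk (cosh r) (sinh r *\<^sub>R th)" by (rule mvec_eqI) (simp_all add: boost_mult Vth_mult ev_None dot_square_norm)

lemma det_square_nonneg: "0 <= det (A ** A)" for A :: "real^'n^'n" by (simp add: det_mul)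

lemma det_Qmat_nonzero: "det (Qmat :: 'd::finite mmat) ~= 0" by (metis Qmat_Qmat det_I det_mul mult_zero_left zero_neq_one)

text \<open>An isometry of q has determinant 1 or -1, so a sign suffices. Boosts and elements of N
  are squares of themselves at half the parameter, hence have nonnegative determinant.\<close>

lemma det_isometry:
 fixes g :: "'d::finite mmat"
 assumes "g ** Qmat ** transpose g = Qmat" "0 <= det g" shows "det g = 1"
proof -
 have "det g * det g = 1" using arg_cong[OF assms(1), of det] det_Qmat_nonzero[where 'd='d] by (simp add: det_mul)
 then show ?thesis using assms(2) by (simp add: square_eq_1_iff)
qed

lemma boost_Ggrp: 
 assumes "norm th = 1" shows "boost r th \<in> Ggrp"
proof (rule GgrpI)
 show "boost r th ** Qmat ** transpose (boost r th) = Qmat" by (rule boost_Qmat[OF assms])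
 moreover have "boost r th = boost (r/2) th ** boost (r/2) th" by (metis boost_add[OF assms] field_sum_of_halves)
 ultimately show "det (boost r th) = 1" by (metis det_isometry det_square_nonneg)
qed (simp add: boost_ev_None assms)

section \<open>The horospherical subgroup N\<close>

definition Nw :: "'d::finite => real^'d => 'd mmat" where
 "Nw i1 w = (\<Sum>i\<in>UNIV. w $ i *\<^sub>R (Vb i - Vij i1 i))"

text \<open>The exponential series of \<open>Nw i1 w\<close>, which stops after the square. The sum
  in \<open>Nw\<close> runs over all spatial indices so that w can be a plain vector; it lies in
  \<open>calN\<close> when \<open>w $ i1 = 0\<close>, a condition carried through all lemmas on
  \<open>nexp\<close>.\<close>

definition nexp :: "'d::finite => real^'d => 'd mmat" where
 "nexp i1 w = mat 1 + Nw i1 w + (1/2) *\<^sub>R (Nw i1 w ** Nw i1 w)"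

abbreviation zeta :: "'d::finite => 'd mvec" where
 "zeta i1 \<equiv> ev None - ev (Some i1)"

lemma Nw_mult: "Nw i1 w *v u = mk (inner w (sp u)) (- (inner w (sp u)) *\<^sub>R axis i1 1 + (u $ None + u $ Some i1) *\<^sub>R w)"
proof (rule mvec_eqI)
 have e: "Nw i1 w *v u = (\<Sum>i\<in>UNIV. w $ i *\<^sub>R (u $ Some i *\<^sub>R ev None + u $ None *\<^sub>R ev (Some i)
 - (u $ Some i *\<^sub>R ev (Some i1) - u $ Some i1 *\<^sub>R ev (Some i))))" by (simp add: Nw_def sum_matrix_vector scaleR_matrix_vector_assoc[symmetric] matrix_vector_mult_diff_rdistrib Vb_mult Vij_mult)
 show "(Nw i1 w *v u) $ None = mk (inner w (sp u)) (- (inner w (sp u)) *\<^sub>R axis i1 1 + (u $ None + u $ Some i1) *\<^sub>R w) $ None" by (simp add: e inner_vec_def)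
 have "(Nw i1 w *v u) $ Some i = (\<Sum>j\<in>UNIV. w $ j * (u $ None + u $ Some i1) * (if i = j then 1 else 0))
 - (\<Sum>j\<in>UNIV. w $ j * u $ Some j) * (if i = i1 then 1 else 0)" for i unfolding e sum_distrib_right sum_subtractf[symmetric] sum_component by (intro sum.cong refl) (auto simp: algebra_simps)
 moreover have "(\<Sum>j\<in>UNIV. w $ j * (u $ None + u $ Some i1) * (if i = j then 1 else 0)) = w $ i * (u $ None + u $ Some i1)" for i by (simp add: if_distrib[of "%c. _ * c"] cong: if_cong)
 ultimately show "(Nw i1 w *v u) $ Some i = mk (inner w (sp u)) (- (inner w (sp u)) *\<^sub>R axis i1 1 + (u $ None + u $ Some i1) *\<^sub>R w) $ Some i" for i by (simp add: inner_vec_def axis_1_nth)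
qed

lemma nexp_mult:
 assumes "w $ i1 = 0"
 shows "nexp i1 w *v u = u + inner w (sp u) *\<^sub>R zeta i1 + (u $ None + u $ Some i1) *\<^sub>R mk 0 w
 + ((u $ None + u $ Some i1) * (norm w)\<^sup>2 / 2) *\<^sub>R zeta i1"
proof -
 have n: "nexp i1 w *v u = u + Nw i1 w *v u + (1/2) *\<^sub>R (Nw i1 w *v (Nw i1 w *v u))" by (simp add: nexp_def matrix_vector_mult_add_rdistrib scaleR_matrix_vector_assoc[symmetric] matrix_vector_mul_assoc)
 have w: "inner w (axis i1 1) = 0" using assms by (simp add: inner_axis)
 show ?thesis by (rule mvec_eqI) (simp_all add: n Nw_mult inner_simps w assms power2_norm_eq_inner axis_1_nth)
qed

lemma Nw_cube:
 assumes "w $ i1 = 0" shows "Nw i1 w ** Nw i1 w ** Nw i1 w = 0"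
proof -
 have w: "inner w (axis i1 1) = 0" using assms by (simp add: inner_axis)
 have "(Nw i1 w ** Nw i1 w ** Nw i1 w) *v u = 0 *v u" for u by (rule mvec_eqI) (simp_all add: matrix_vector_mul_assoc[symmetric] Nw_mult inner_simps w assms axis_1_nth)
 then show ?thesis by (subst matrix_eq) blast
qed

lemma matexp_Nw: "w $ i1 = 0 ==> matexp (Nw i1 w) = nexp i1 w" by (simp add: nexp_def matexp_nilpotent Nw_cube)

lemma calN_eq: "calN i1 = {Nw i1 w | w. w $ i1 = 0}"
proof
 show "calN i1 \<subseteq> {Nw i1 w | w. w $ i1 = 0}"
proof
 fix X assume "X \<in> calN i1"
 then show "X \<in> {Nw i1 w | w. w $ i1 = 0}" unfolding calN_def
proof (induction rule: span_induct_alt)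
case base
 show ?case by (intro CollectI exI[of _ 0]) (simp add: Nw_def)
next
case (step c x y)
 then obtain i w where *: "x = Vb i - Vij i1 i" "i ~= i1" "y = Nw i1 w" "w $ i1 = 0" by auto
 have "c *\<^sub>R x = Nw i1 (c *\<^sub>R axis i 1)" by (simp add: * Nw_def axis_def if_distrib[of "%u. _ * u"] if_distrib[of "%c. c *\<^sub>R _"] cong: if_cong)
 then have "c *\<^sub>R x + y = Nw i1 (c *\<^sub>R axis i 1 + w)" by (simp add: * Nw_def scaleR_add_left sum.distrib)
 moreover have "(c *\<^sub>R axis i 1 + w) $ i1 = 0" using * by (simp add: axis_def)
 ultimately show ?case by blast
qed
qed
 show "{Nw i1 w | w. w $ i1 = 0} \<subseteq> calN i1"
proof clarify
 fix w :: "real^'a" assume w: "w $ i1 = 0"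
 have "w $ i *\<^sub>R (Vb i - Vij i1 i) \<in> calN i1" for i unfolding calN_def using w by (cases "i = i1") (auto intro!: span_mul intro: span_base span_zero)
 then show "Nw i1 w \<in> calN i1" unfolding Nw_def calN_def by (intro span_sum)
qed
qed

lemma Ngrp_eq: "Ngrp i1 = {nexp i1 w | w. w $ i1 = 0}" unfolding Ngrp_def calN_eq by (auto simp: image_iff matexp_Nw) (metis matexp_Nw)

lemma nexp_add:
 assumes "w $ i1 = 0" "v $ i1 = 0" shows "nexp i1 (w + v) = nexp i1 w ** nexp i1 v"
proof -
 have 1: "(w + v) $ i1 = 0" using assms by simp
 have i: "inner w (axis i1 1) = 0" using assms by (simp add: inner_axis)
 have "nexp i1 (w + v) *v u = (nexp i1 w ** nexp i1 v) *v u" for u unfolding matrix_vector_mul_assoc[symmetric] nexp_mult[OF 1] nexp_mult[OF assms(1)] nexp_mult[OF assms(2)] by (rule mvec_eqI) (simp_all add: assms sp_simps inner_simps ev_None ev_Some i power2_norm_eq_inner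
 inner_commute[of v w] axis_1_nth algebra_simps add_divide_distrib)
 then show ?thesis by (subst matrix_eq) blast
qed

lemma qform_nexp:
 assumes "w $ i1 = 0" shows "qform (nexp i1 w *v x) (nexp i1 w *v y) = qform x y"
proof -
 have i: "inner w (axis i1 1) = 0" "inner (axis i1 1) w = 0" "inner (axis i1 1) (axis i1 (1::real)) = 1"
 "inner (sp x) (axis i1 1) = x $ Some i1" "inner (axis i1 1) (sp y) = y $ Some i1" for x y :: "'a mvec" using assms by (simp_all add: inner_axis inner_commute[of "axis i1 1"])
 show ?thesis by (simp add: nexp_mult[OF assms] qform_sp sp_simps inner_simps ev_None ev_Some i power2_norm_eq_inner
 inner_commute[of "sp x" w] assms algebra_simps add_divide_distrib)
qed

lemma isometryI:
 fixes g :: "'d::finite mmat"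
 assumes "!!x y. qform (g *v x) (g *v y) = qform x y"
 shows "g ** Qmat ** transpose g = Qmat"
proof -
 have "inner x ((transpose g ** Qmat ** g) *v y) = inner x (Qmat *v y)" for x y :: "'d mvec" using assms[of x y] unfolding qform_Qmat inner_transpose by (simp add: matrix_vector_mul_assoc matrix_mul_assoc del: transpose_matrix_vector)
 then have "transpose g ** Qmat ** g = Qmat" by (metis matrix_eq vector_eq_ldot)
 then have "(Qmat ** transpose g ** Qmat) ** g = mat 1" by (metis Qmat_Qmat matrix_mul_assoc)
 then have "g ** (Qmat ** transpose g ** Qmat) = mat 1" using matrix_left_right_inverse by blast
 then have "(g ** (Qmat ** transpose g ** Qmat)) ** Qmat = Qmat" by simp
 then show ?thesis by (simp add: matrix_mul_assoc Qmat_Qmat_right)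
qed

lemma nexp_ev_None:
 assumes "w $ i1 = 0"
 shows "nexp i1 w *v ev None = ev None + mk 0 w + ((norm w)\<^sup>2 / 2) *\<^sub>R zeta i1" by (simp add: nexp_mult[OF assms]) (simp add: ev_None)

lemma nexp_Ggrp:
 assumes "w $ i1 = 0" shows "nexp i1 w \<in> Ggrp"
proof (rule GgrpI)
 show 1: "nexp i1 w ** Qmat ** transpose (nexp i1 w) = Qmat" by (intro isometryI qform_nexp assms)
 have "nexp i1 w = nexp i1 (w /\<^sub>R 2) ** nexp i1 (w /\<^sub>R 2)" using nexp_add[of "w /\<^sub>R 2" i1 "w /\<^sub>R 2"] assms by (simp add: scaleR_add_left[symmetric])
 then show "det (nexp i1 w) = 1" by (metis 1 det_isometry det_square_nonneg)
 show "(nexp i1 w *v ev None) $ None > 0" by (simp add: nexp_ev_None assms add_pos_nonneg)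
qed

section \<open>The compact factor K as the stabiliser of e_0\<close>

lemma det_option:
 fixes A :: "'d::finite mmat"
 assumes "A $ None $ None = 1" "!!i. A $ None $ Some i = 0"
 shows "det A = det (\<chi> i j. A $ Some i $ Some j)"
proof -
 let ?S = "{p. p permutes (UNIV :: 'd option set)}"
 let ?m = "map_option :: ('d => 'd) => _"
 have inj: "inj_on ?m {p. p permutes UNIV}" by (intro inj_onI ext) (metis option.inject option.simps(9))
 have per: "?m p permutes UNIV" if "p permutes UNIV" for p :: "'d => 'd"
proof -
 have "inj (?m p)" using that by (intro option.inj_map permutes_inj)
 then show ?thesis by (intro inj_imp_permutes) simp_all
qed
 \<comment> \<open>Only permutations fixing \<open>None\<close> survive in the determinant, since
   the first row of A is that of the identity. These are exactly the \<open>map_option\<close>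
   images of permutations of the spatial indices.\<close>
 have img: "?m ` {p. p permutes UNIV} = {p \<in> ?S. p None = None}"
proof
 show "?m ` {p. p permutes UNIV} \<subseteq> {p \<in> ?S. p None = None}" using per by auto
 show "{p \<in> ?S. p None = None} \<subseteq> ?m ` {p. p permutes UNIV}"
proof clarify
 fix p assume p: "p permutes (UNIV :: 'd option set)" "p None = None"
 then have injp: "inj p" by (simp add: permutes_inj)
 have ne: "p (Some i) ~= None" for i using injp p(2) by (metis injD option.distinct(1))
 define r where "r i = the (p (Some i))" for i
 have pr: "p = ?m r" 
proof
 show "p x = ?m r x" for x using p(2) ne by (cases x) (auto simp: r_def)
qed
 have "inj r" using injp unfolding pr by (auto simp: inj_def) (metis option.inject option.simps(9))
 then have "r permutes UNIV" by (intro inj_imp_permutes) simp_all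
 then show "p \<in> ?m ` {p. p permutes UNIV}" using pr by blast
qed
qed
 \<comment> \<open>Induction over transpositions: \<open>map_option\<close> sends a transposition to
   a transposition.\<close>
 have sgn: "sign (?m p) = sign p" if "p permutes UNIV" for p :: "'d => 'd" using that finite_class.finite_UNIV
proof (induction p rule: permutes_induct)
case id
 show ?case by (simp add: option.map_id0[unfolded id_def] id_def)
next
case (swap a b p)
 have t: "?m (Transposition.transpose a b) = Transposition.transpose (Some a) (Some b)"
proof
 show "?m (Transposition.transpose a b) x = Transposition.transpose (Some a) (Some b) x" for x by (cases x) (auto simp: Transposition.transpose_def)
qed
 have "?m (Transposition.transpose a b \<circ> p) = Transposition.transpose (Some a) (Some b) \<circ> ?m p" by (simp add: fun_eq_iff t[symmetric] option.map_comp)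
 moreover have "permutation p" "permutation (?m p)" using swap per unfolding permutation_permutes by (metis finite_class.finite_UNIV)+
 ultimately show ?case using swap by (metis sign_compose permutation_swap_id sign_swap_id option.inject)
qed
 have "det A = (\<Sum>p\<in>{p \<in> ?S. p None = None}. of_int (sign p) * (\<Prod>i\<in>UNIV. A $ i $ p i))" unfolding det_def
proof (rule sum.mono_neutral_right)
 show "\<forall>p\<in>?S - {p \<in> ?S. p None = None}. of_int (sign p) * (\<Prod>i\<in>UNIV. A $ i $ p i) = 0"
proof
 fix p assume "p \<in> ?S - {p \<in> ?S. p None = None}"
 then have "A $ None $ p None = 0" using assms(2) by (cases "p None") auto
 then show "of_int (sign p) * (\<Prod>i\<in>UNIV. A $ i $ p i) = 0" by (simp add: prod_zero_iff) blast
qed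
qed (auto simp: finite_permutations)
 also have "... = (\<Sum>p\<in>{p. p permutes (UNIV::'d set)}. of_int (sign (?m p)) * (\<Prod>i\<in>UNIV. A $ i $ ?m p i))" unfolding img[symmetric] by (simp add: sum.reindex inj)
 also have "... = (\<Sum>p\<in>{p. p permutes (UNIV::'d set)}. of_int (sign p) * (\<Prod>i\<in>UNIV. A $ Some i $ Some (p i)))" by (intro sum.cong refl) (simp add: sgn UNIV_option_conv prod.reindex assms(1))
 finally show ?thesis by (simp add: det_def)
qed

lemma Kgrp_fix: "k \<in> Kgrp ==> k *v ev None = ev None"
proof -
 assume k: "k \<in> Kgrp"
 have "(k *v ev None) $ j = k $ j $ None" for j by (simp add: ev_def matrix_vector_mult_basis column_def)
 then show ?thesis using k by (intro mvec_eqI) (auto simp: Kgrp_def)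
qed

text \<open>Fixing e_0 determines the first column; the relation g^t Q g = Q then determines the
  first row. What remains is a spatial block, orthogonal by the isometry relation and of determinant
  1 by \<open>det_option\<close>.\<close>

lemma KgrpI:
 assumes k: "k \<in> Ggrp" and f: "k *v ev None = ev None" shows "k \<in> Kgrp"
proof -
 have c: "k $ j $ None = ev None $ j" for j using arg_cong[OF f, of "%v. v $ j"] by (simp add: ev_def matrix_vector_mult_basis column_def)
 have "Qmat *v ev None = (transpose k ** Qmat) *v (k *v ev None)" using Ggrp_inverse(4)[OF k] by (metis matrix_vector_mul_assoc)
 also have "... = transpose k *v ev None" unfolding f by (simp add: matrix_vector_mul_assoc[symmetric] Qmat_mult ev_None del: transpose_matrix_vector)
 finally have "transpose k *v ev None = ev None" by (simp add: Qmat_mult ev_None del: transpose_matrix_vector)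
 then have r: "k $ None $ j = ev None $ j" for j using arg_cong[of "transpose k *v ev None" "ev None" "%v. v $ j"] by (simp add: ev_def matrix_vector_mult_basis column_def transpose_def del: transpose_matrix_vector)
 define k' :: "real^'a^'a" where "k' = (\<chi> i j. k $ Some i $ Some j)"
 have "det k' = 1" using det_option[of k] r k by (simp add: k'_def Ggrp_def)
 moreover have "k' ** transpose k' = mat 1"
proof -
 have "k ** Qmat ** transpose k = Qmat" using k by (simp add: Ggrp_def)
 then have "k ** (Qmat ** transpose k) = Qmat" by (simp add: matrix_mul_assoc)
 then have "(k ** (Qmat ** transpose k)) $ Some i $ Some j = Qmat $ Some i $ Some j" for i j by (simp only:)
 moreover have "(Qmat ** transpose k) $ a $ Some j = Qmat $ a $ a * k $ Some j $ a" for a j by (simp add: matrix_matrix_mult_def Qmat_def transpose_def if_distrib[of "%u. u * _"] cong: if_cong)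
 ultimately have "(\<Sum>a\<in>UNIV. k $ Some i $ a * (Qmat $ a $ a * k $ Some j $ a)) = Qmat $ Some i $ Some j" for i j by (simp add: matrix_matrix_mult_def)
 then have "(\<Sum>a\<in>UNIV. k $ Some i $ Some a * k $ Some j $ Some a) = (if i = j then 1 else 0)" for i j
proof -
 have "(\<Sum>a\<in>UNIV. k $ Some i $ a * (Qmat $ a $ a * k $ Some j $ a)) = - (\<Sum>a\<in>UNIV. k $ Some i $ Some a * k $ Some j $ Some a)" unfolding sum_option c by (simp add: Qmat_def sum_negf)
 then show ?thesis using \<open>(\<Sum>a\<in>UNIV. k $ Some i $ a * (Qmat $ a $ a * k $ Some j $ a)) = Qmat $ Some i $ Some j\<close> by (simp add: Qmat_def split: if_splits)
qed
 then show ?thesis by (simp add: k'_def matrix_matrix_mult_def transpose_def mat_def vec_eq_iff)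
qed
 then have "orthogonal_matrix k'" by (metis orthogonal_matrix_def matrix_left_right_inverse)
 moreover have "k = (\<chi> a b. case (a, b) of (None, None) => 1 | (Some i, Some j) => k' $ i $ j | _ => 0)" using c r by (auto simp: vec_eq_iff k'_def ev_def axis_def split: option.split)
 ultimately show ?thesis unfolding Kgrp_def by blast
qed

section \<open>Iwasawa coordinates read off the orbit point of e_0\<close>

definition hgt :: "'d::finite => 'd mmat => real" where
 "hgt i1 g = qform (g *v ev None) (zeta i1)"

text \<open>Together with \<open>hgt\<close> these are horospherical coordinates based at the null
  vector \<open>zeta i1\<close>. Since K fixes e_0 and N fixes zeta, \<open>hgt\<close> is e^u for g
  = n exp(u V_1) k, and \<open>hor\<close> recovers w from n = \<open>nexp i1 w\<close>. The entry
  at i1 is set to 0 so that the value is admissible for \<open>nexp\<close>.\<close>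

definition hor :: "'d::finite => 'd mmat => real^'d" where
 "hor i1 g = (\<chi> i. if i = i1 then 0 else (g *v ev None) $ Some i / hgt i1 g)"

lemma qform_zeta: "qform u (zeta i1) = u $ None + u $ Some i1" by (simp add: qform_diff_right qform_ev_None) (simp add: qform_sp ev_Some inner_axis)

lemma hgt_pos: 
 assumes "g \<in> Ggrp" shows "hgt i1 g > 0" unfolding hgt_def using Ggrp_orbit[OF assms] by (intro qform_future_pos) (simp_all add: sp_simps ev_None ev_Some)

lemma boost_e1: "boost u (axis i1 1) *v ev None = (exp u / 2) *\<^sub>R (ev None + ev (Some i1)) + (exp (-u) / 2) *\<^sub>R zeta i1" by (rule mvec_eqI) (simp_all add: boost_ev_None axis_1_nth cosh_field_def sinh_field_def add_divide_distrib diff_divide_distrib)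

lemma nexp_e1:
 assumes "w $ i1 = 0"
 shows "nexp i1 w *v (ev None + ev (Some i1)) = ev None + ev (Some i1) + 2 *\<^sub>R mk 0 w + (norm w)\<^sup>2 *\<^sub>R zeta i1"
 and "nexp i1 w *v zeta i1 = zeta i1" using assms by (simp_all add: nexp_mult[OF assms] sp_simps ev_None ev_Some inner_simps inner_axis)

lemma iwasawa_orbit:
 assumes "w $ i1 = 0"
 shows "(nexp i1 w ** boost u (axis i1 1)) *v ev None
 = (exp u / 2) *\<^sub>R (ev None + ev (Some i1) + 2 *\<^sub>R mk 0 w + (norm w)\<^sup>2 *\<^sub>R zeta i1) + (exp (-u) / 2) *\<^sub>R zeta i1"
proof -
 have "A *v (a *\<^sub>R x + b *\<^sub>R y) = a *\<^sub>R (A *v x) + b *\<^sub>R (A *v y)" for A :: "'a mmat" and a b x y by (simp add: matrix_vector_right_distrib matrix_vector_mult_scaleR)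
 then show ?thesis by (simp only: matrix_vector_mul_assoc[symmetric] boost_e1 nexp_e1[OF assms])
qed

lemma iwasawa_coords:
 assumes g: "g = nexp i1 w ** boost u (axis i1 1) ** k" and w: "w $ i1 = 0" and k: "k \<in> Kgrp"
 shows "hgt i1 g = exp u" "hor i1 g = w"
proof -
 have p: "g *v ev None = (exp u / 2) *\<^sub>R (ev None + ev (Some i1) + 2 *\<^sub>R mk 0 w + (norm w)\<^sup>2 *\<^sub>R zeta i1) + (exp (-u) / 2) *\<^sub>R zeta i1" unfolding g iwasawa_orbit[OF w, symmetric] by (simp add: matrix_vector_mul_assoc[symmetric] Kgrp_fix[OF k])
 show h: "hgt i1 g = exp u" unfolding hgt_def qform_zeta p by (simp add: w algebra_simps)
 show "hor i1 g = w" unfolding hor_def h p by (simp add: vec_eq_iff w)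
qed

lemma hor_i1: "hor i1 g $ i1 = 0" by (simp add: hor_def)

text \<open>\<open>hgt\<close> and \<open>hor\<close> give p_0 + p_1 and the remaining spatial
  coordinates of p; the normalisation q(p, p) = 1 then yields p_0 - p_1 = 1/h + h |w|^2. The first
  summand grows with h along a null direction depending only on w, the second decays.\<close>

lemma orbit_eq:
 assumes g: "g \<in> Ggrp"
 shows "g *v ev None = (hgt i1 g / 2) *\<^sub>R (nexp i1 (hor i1 g) *v (ev None + ev (Some i1))) + (1 / (2 * hgt i1 g)) *\<^sub>R zeta i1"
proof -
 let ?p = "g *v ev None" and ?h = "hgt i1 g" and ?w = "hor i1 g"
 have h: "?h > 0" by (rule hgt_pos[OF g])
 have hp: "?h = ?p $ None + ?p $ Some i1" by (simp add: hgt_def qform_zeta)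
 have "qform ?p ?p = 1" by (rule Ggrp_orbit[OF g])
 then have q: "(?p $ None)\<^sup>2 - (\<Sum>i\<in>UNIV. (?p $ Some i)\<^sup>2) = 1" by (simp add: qform_def power2_eq_square)
 have s: "(\<Sum>i\<in>UNIV. (?p $ Some i)\<^sup>2) = (?p $ Some i1)\<^sup>2 + ?h\<^sup>2 * (norm ?w)\<^sup>2"
proof -
 have "?h\<^sup>2 * (norm ?w)\<^sup>2 = (\<Sum>i\<in>UNIV. if i = i1 then 0 else (?p $ Some i)\<^sup>2)" unfolding norm_vec2 sum_distrib_left using h by (intro sum.cong) (auto simp: hor_def power_divide)
 moreover have "(\<Sum>i\<in>UNIV. (?p $ Some i)\<^sup>2) = (\<Sum>i\<in>UNIV. (if i = i1 then (?p $ Some i1)\<^sup>2 else 0) + (if i = i1 then 0 else (?p $ Some i)\<^sup>2))" by (intro sum.cong) auto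
 ultimately show ?thesis by (simp add: sum.distrib)
qed
 have d: "?h * (?p $ None - ?p $ Some i1) = 1 + ?h\<^sup>2 * (norm ?w)\<^sup>2" using q unfolding s by (simp add: hp power2_eq_square algebra_simps)
 have d': "?p $ None - ?p $ Some i1 = 1 / ?h + ?h * (norm ?w)\<^sup>2" using d h by (simp add: field_simps power2_eq_square)
 have A: "?p $ None = (?h + (1 / ?h + ?h * (norm ?w)\<^sup>2)) / 2" and B: "?p $ Some i1 = (?h - (1 / ?h + ?h * (norm ?w)\<^sup>2)) / 2" using hp d' by (simp_all only:) (simp_all add: field_simps)
 show ?thesis
proof (rule mvec_eqI)
 show "?p $ None = ((?h / 2) *\<^sub>R (nexp i1 ?w *v (ev None + ev (Some i1))) + (1 / (2 * ?h)) *\<^sub>R zeta i1) $ None" unfolding A nexp_e1(1)[OF hor_i1] by (simp add: algebra_simps add_divide_distrib)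
 show "?p $ Some i = ((?h / 2) *\<^sub>R (nexp i1 ?w *v (ev None + ev (Some i1))) + (1 / (2 * ?h)) *\<^sub>R zeta i1) $ Some i" for i
proof (cases "i = i1")
case True
 then show ?thesis unfolding True B nexp_e1(1)[OF hor_i1] by (simp add: hor_i1 algebra_simps add_divide_distrib diff_divide_distrib)
next
case False
 then show ?thesis using h unfolding nexp_e1(1)[OF hor_i1] by simp (simp add: hor_def)
qed
qed
qed

text \<open>The product of the N and A factors built from the two coordinates has the same orbit
  point as g, so the remaining factor fixes e_0 and lies in K.\<close>

lemma iwasawa_exists:
 assumes g: "g \<in> Ggrp"
 shows "\<exists>k\<in>Kgrp. g = nexp i1 (hor i1 g) ** boost (ln (hgt i1 g)) (axis i1 1) ** k"
proof -
 let ?h = "nexp i1 (hor i1 g) ** boost (ln (hgt i1 g)) (axis i1 1)"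
 have h: "?h \<in> Ggrp" by (intro Ggrp_mult nexp_Ggrp boost_Ggrp hor_i1) simp
 have e: "?h *v ev None = g *v ev None" using orbit_eq[OF g, of i1] hgt_pos[OF g, of i1] unfolding iwasawa_orbit[OF hor_i1] nexp_e1[OF hor_i1] by (simp add: exp_minus field_simps)
 have "matrix_inv ?h ** g \<in> Kgrp"
proof (rule KgrpI)
 show "matrix_inv ?h ** g \<in> Ggrp" by (intro Ggrp_mult Ggrp_inv_mem h g)
 show "(matrix_inv ?h ** g) *v ev None = ev None" by (metis e h Ggrp_matrix_inv(3) matrix_vector_mul_assoc)
qed
 moreover have "g = ?h ** (matrix_inv ?h ** g)" by (simp add: matrix_mul_assoc h)
 ultimately show ?thesis by blast
qed

lemma iw_alpha_eq:
 assumes g: "g \<in> Ggrp" shows "iw_alpha i1 g = ln (hgt i1 g)" unfolding iw_alpha_def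
proof (rule the_equality)
 have m: "matexp (u *\<^sub>R Vb i1) = boost u (axis i1 1)" for u by (simp add: matexp_Vth Vth_axis[symmetric])
 show "\<exists>n\<in>Ngrp i1. \<exists>k\<in>Kgrp. g = n ** matexp (ln (hgt i1 g) *\<^sub>R Vb i1) ** k" unfolding m Ngrp_eq using iwasawa_exists[OF g, of i1] hor_i1 by blast
 fix u assume "\<exists>n\<in>Ngrp i1. \<exists>k\<in>Kgrp. g = n ** matexp (u *\<^sub>R Vb i1) ** k"
 then show "u = ln (hgt i1 g)" unfolding m Ngrp_eq using iwasawa_coords(1) by fastforce
qed

lemma iw_N_eq:
 assumes g: "g \<in> Ggrp" shows "iw_N i1 g = nexp i1 (hor i1 g)" unfolding iw_N_def
proof (rule the_equality)
 have m: "matexp (u *\<^sub>R Vb i1) = boost u (axis i1 1)" for u by (simp add: matexp_Vth Vth_axis[symmetric])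
 show "nexp i1 (hor i1 g) \<in> Ngrp i1 & (\<exists>u. \<exists>k\<in>Kgrp. g = nexp i1 (hor i1 g) ** matexp (u *\<^sub>R Vb i1) ** k)" unfolding m Ngrp_eq using iwasawa_exists[OF g, of i1] hor_i1 by blast
 fix n assume "n \<in> Ngrp i1 & (\<exists>u. \<exists>k\<in>Kgrp. g = n ** matexp (u *\<^sub>R Vb i1) ** k)"
 then show "n = nexp i1 (hor i1 g)" unfolding m Ngrp_eq using iwasawa_coords(2) by fastforce
qed

text \<open>Horospherical coordinates form the upper half space model: height \<open>1 / hgt\<close>, horizontal part \<open>hor\<close>.\<close>

lemma hor_dist:
 assumes g: "g \<in> Ggrp" and h: "h \<in> Ggrp"
 shows "(norm (hor i1 g - hor i1 h))\<^sup>2 <= 2 * qform (g *v ev None) (h *v ev None) / (hgt i1 g * hgt i1 h)"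
proof -
 let ?a = "hgt i1 g" and ?b = "hgt i1 h" and ?w = "hor i1 g" and ?v = "hor i1 h"
 have pos: "?a > 0" "?b > 0" using hgt_pos g h by auto
 have z: "?w $ i1 = 0" "?v $ i1 = 0" by (rule hor_i1)+
 have i: "inner ?w (axis i1 1) = 0" "inner (axis i1 1) ?v = 0" "inner (axis i1 1) (axis i1 (1::real)) = 1" using z by (simp_all add: inner_axis inner_commute[of "axis i1 1"])
 \<comment> \<open>The distance formula of the upper half space, the left side being the hyperbolic
   cosine of the distance. Dropping the two positive terms without w gives the bound.\<close>
 have "qform (g *v ev None) (h *v ev None) = ?a * ?b / 2 * (norm (?w - ?v))\<^sup>2 + ?a / (2 * ?b) + ?b / (2 * ?a)" unfolding orbit_eq[OF g, of i1] orbit_eq[OF h, of i1] nexp_e1[OF z(1)] nexp_e1[OF z(2)] using pos unfolding power2_norm_eq_inner by (simp add: qform_sp sp_simps ev_None ev_Some inner_simps i inner_commute[of ?v ?w] z) (simp add: field_simps)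
 then have "?a * ?b / 2 * (norm (?w - ?v))\<^sup>2 <= qform (g *v ev None) (h *v ev None)" using pos by (simp add: add_nonneg_nonneg)
 then show ?thesis using pos by (simp add: field_simps)
qed

section \<open>Test functions\<close>

text \<open>Continuous differentiability in the bounded-linear form of \<open>C2c\<close>, so that
  \<open>C2c\<close> splits into \<open>C2b\<close> and a support condition. Boundedness of values
  or derivatives is not part of the notion; it is tracked separately by \<open>bnd\<close>.\<close>

definition C1b :: "('a::real_normed_vector => 'b::real_normed_vector) => bool" where
 "C1b F \<longleftrightarrow> (\<exists>DF. (\<forall>x. (F has_derivative blinfun_apply (DF x)) (at x)) & continuous_on UNIV DF)"

definition C2b :: "('a::real_normed_vector => real) => bool" where
 "C2b f \<longleftrightarrow> (\<exists>Df. (\<forall>x. (f has_derivative blinfun_apply (Df x)) (at x)) & C1b Df)"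

lemma C2c_iff: "C2c f \<longleftrightarrow> C2b f & compact (closure {x. f x ~= 0})" unfolding C2c_def C2b_def C1b_def by blast

lemma C1bI:
 assumes "!!x. (F has_derivative D x) (at x)" "!!x h. D x h = blinfun_apply (DF x) h" "continuous_on UNIV DF"
 shows "C1b F"
proof -
 have "D = (%x. blinfun_apply (DF x))" using assms(2) by auto
 then show ?thesis using assms(1,3) unfolding C1b_def by auto
qed

lemma C2bI:
 assumes "!!x. (f has_derivative D x) (at x)" "!!x h. D x h = blinfun_apply (Df x) h" "C1b Df"
 shows "C2b f"
proof -
 have "D = (%x. blinfun_apply (Df x))" using assms(2) by auto
 then show ?thesis using assms(1,3) unfolding C2b_def by auto
qed

lemma C1b_continuous: "C1b F ==> continuous_on UNIV F" unfolding C1b_def by (meson continuous_at_imp_continuous_on has_derivative_continuous)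

lemma C2b_C1b: "C2b f ==> C1b f" unfolding C2b_def using C1b_continuous unfolding C1b_def by blast

lemma C2b_continuous: "C2b f ==> continuous_on UNIV f" by (simp add: C2b_C1b C1b_continuous)

lemma C1b_const: "C1b (%x. c)" by (rule C1bI[of _ "%x h. 0" "%x. 0"]) simp_all

lemma C1b_add:
 assumes "C1b F" "C1b G" shows "C1b (%x. F x + G x)"
proof -
 obtain DF DG where D: "!!x. (F has_derivative blinfun_apply (DF x)) (at x)" "continuous_on UNIV DF"
 "!!x. (G has_derivative blinfun_apply (DG x)) (at x)" "continuous_on UNIV DG" using assms unfolding C1b_def by metis
 show ?thesis by (rule C1bI[OF has_derivative_add[OF D(1) D(3)], of "%x. DF x + DG x"])
 (use D in \<open>auto simp: blinfun.add_left intro!: continuous_intros\<close>)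
qed

lemma C1b_scaleR:
 assumes "C1b f" "C1b F" shows "C1b (%x. f x *\<^sub>R F x)"
proof -
 obtain Df DF where D: "!!x. (f has_derivative blinfun_apply (Df x)) (at x)" "continuous_on UNIV Df"
 "!!x. (F has_derivative blinfun_apply (DF x)) (at x)" "continuous_on UNIV DF" using assms unfolding C1b_def by metis
 have c: "continuous_on UNIV f" "continuous_on UNIV F" using assms by (simp_all add: C1b_continuous)
 let ?D = "%x. f x *\<^sub>R DF x + (blinfun_scaleR_left (F x) o\<^sub>L Df x)"
 have "continuous_on UNIV ?D" using D c bounded_linear.continuous_on[OF bounded_linear_blinfun_scaleR_left c(2)] by (intro continuous_on_add continuous_on_scaleR bounded_bilinear.continuous_on[OF bounded_bilinear_blinfun_compose])
 then show ?thesis by (intro C1bI[OF has_derivative_scaleR[OF D(1) D(3)], of ?D])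
 (simp_all add: blinfun.add_left blinfun.scaleR_left)
qed

lemma C1b_compose:
 fixes k k' :: "real => real"
 assumes "C1b f" "!!x. (k has_real_derivative k' x) (at x)" "continuous_on UNIV k'"
 shows "C1b (%x. k (f x))"
proof -
 obtain Df where D: "!!x. (f has_derivative blinfun_apply (Df x)) (at x)" "continuous_on UNIV Df" using assms unfolding C1b_def by metis
 have c: "continuous_on UNIV f" using assms by (simp add: C1b_continuous)
 have "continuous_on UNIV (%x. k' (f x) *\<^sub>R Df x)" using D c continuous_on_compose2[OF assms(3) c] by (intro continuous_on_scaleR) auto
 then show ?thesis by (intro C1bI[OF has_derivative_compose[OF D(1) assms(2)[unfolded has_field_derivative_def]], of "%x. k' (f x) *\<^sub>R Df x"])
 (simp_all add: blinfun.scaleR_left)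
qed

lemma C2b_const: "C2b (%x. c)" by (rule C2bI[of _ "%x h. 0" "%x. 0"]) (simp_all add: C1b_const)

lemma C2b_linear: "bounded_linear f ==> C2b f" unfolding C2b_def by (intro exI[of _ "%x. Blinfun f"])
 (simp add: C1b_const bounded_linear_Blinfun_apply bounded_linear_imp_has_derivative)

lemma C2b_add:
 assumes "C2b f" "C2b g" shows "C2b (%x. f x + g x)"
proof -
 obtain Df Dg where D: "!!x. (f has_derivative blinfun_apply (Df x)) (at x)" "C1b Df"
 "!!x. (g has_derivative blinfun_apply (Dg x)) (at x)" "C1b Dg" using assms unfolding C2b_def by metis
 show ?thesis by (rule C2bI[OF has_derivative_add[OF D(1) D(3)], of "%x. Df x + Dg x"])
 (simp_all add: blinfun.add_left C1b_add D)
qed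

lemma C2b_mult:
 assumes "C2b f" "C2b g" shows "C2b (%x. f x * g x)"
proof -
 obtain Df Dg where D: "!!x. (f has_derivative blinfun_apply (Df x)) (at x)" "C1b Df"
 "!!x. (g has_derivative blinfun_apply (Dg x)) (at x)" "C1b Dg" using assms unfolding C2b_def by metis
 have "C1b (%x. f x *\<^sub>R Dg x + g x *\<^sub>R Df x)" using assms by (intro C1b_add C1b_scaleR C2b_C1b D)
 then show ?thesis by (intro C2bI[OF has_derivative_mult[OF D(1) D(3)], of "%x. f x *\<^sub>R Dg x + g x *\<^sub>R Df x"])
 (simp_all add: blinfun.add_left blinfun.scaleR_left mult.commute)
qed

lemma C2b_sum: "finite I ==> (!!i. i \<in> I ==> C2b (f i)) ==> C2b (%x. \<Sum>i\<in>I. f i x)" by (induction I rule: finite_induct) (simp_all add: C2b_const C2b_add)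

lemma C2b_compose:
 fixes k k' k'' :: "real => real"
 assumes "C2b f" "!!x. (k has_real_derivative k' x) (at x)"
 "!!x. (k' has_real_derivative k'' x) (at x)" "continuous_on UNIV k''"
 shows "C2b (%x. k (f x))"
proof -
 obtain Df where D: "!!x. (f has_derivative blinfun_apply (Df x)) (at x)" "C1b Df" using assms unfolding C2b_def by metis
 have "C1b (%x. k' (f x) *\<^sub>R Df x)" using C1b_compose[OF C2b_C1b[OF assms(1)] assms(3,4)] D by (intro C1b_scaleR)
 then show ?thesis by (intro C2bI[OF has_derivative_compose[OF D(1) assms(2)[unfolded has_field_derivative_def]], of "%x. k' (f x) *\<^sub>R Df x"])
 (simp_all add: blinfun.scaleR_left)
qed

lemma C2b_norm_square:
 fixes L :: "'a::real_normed_vector => 'b::euclidean_space"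
 assumes "bounded_linear L" shows "C2b (%x. (norm (L x))\<^sup>2)"
proof -
 have "C2b (%x. \<Sum>b\<in>Basis. (inner (L x) b) * (inner (L x) b))" by (intro C2b_sum C2b_mult C2b_linear bounded_linear_inner_left_comp assms) auto
 then show ?thesis unfolding power2_norm_eq_inner by (subst euclidean_inner) simp
qed

section \<open>The spline that truncates logarithms\<close>

lemma max_power_deriv:
 "((%x. (max 0 (x::real)) ^ Suc (Suc n)) has_real_derivative real (Suc (Suc n)) * (max 0 x) ^ Suc n) (at x)"
proof -
 consider "x > 0" | "x < 0" | "x = 0" by linarith
 then show ?thesis
proof cases
case 1
 have "((%x. x ^ Suc (Suc n)) has_real_derivative real (Suc (Suc n)) * (max 0 x) ^ Suc n) (at x)" using 1 DERIV_pow[of "Suc (Suc n)" x] by simp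
 then show ?thesis by (rule has_field_derivative_transform_within_open[of _ _ _ "{0<..}"]) (use 1 in auto)
next
case 2
 have "((%x. 0) has_real_derivative real (Suc (Suc n)) * (max 0 x) ^ Suc n) (at x)" using 2 by simp
 then show ?thesis by (rule has_field_derivative_transform_within_open[of _ _ _ "{..<0}"]) (use 2 in auto)
next
case 3
 have b: "norm ((max 0 h) ^ Suc (Suc n) / h) <= \<bar>h\<bar> ^ Suc n" for h :: real by (cases "h > 0") (simp_all add: max_def mult_nonpos_nonneg)
 have "((%h::real. \<bar>h\<bar> ^ Suc n) \<longlongrightarrow> 0) (at 0)" by (auto intro!: tendsto_eq_intros)
 then have "((%h. (max 0 h) ^ Suc (Suc n) / h) \<longlongrightarrow> (0::real)) (at 0)" by (rule Lim_null_comparison[rotated]) (use b in auto)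
 then show ?thesis using 3 by (simp add: DERIV_def)
qed
qed

text \<open>A \<open>C\<^sup>2\<close> cubic spline that is the identity on \<open>[-1, 1]\<close> and constant outside \<open>[-3, 3]\<close>.\<close>

definition phi :: "real => real" where
 "phi x = x - ((max 0 (x-1))^3 - 2 * (max 0 (x-2))^3 + (max 0 (x-3))^3) / 6
 + ((max 0 (-x-1))^3 - 2 * (max 0 (-x-2))^3 + (max 0 (-x-3))^3) / 6"

definition phi1 :: "real => real" where
 "phi1 x = 1 - ((max 0 (x-1))^2 - 2 * (max 0 (x-2))^2 + (max 0 (x-3))^2) / 2
 - ((max 0 (-x-1))^2 - 2 * (max 0 (-x-2))^2 + (max 0 (-x-3))^2) / 2"

definition phi2 :: "real => real" where
 "phi2 x = - (max 0 (x-1) - 2 * max 0 (x-2) + max 0 (x-3))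
 + (max 0 (-x-1) - 2 * max 0 (-x-2) + max 0 (-x-3))"

lemma max_cube_deriv: "(f has_real_derivative D) (at x) ==> ((%x. (max 0 (f x)) ^ 3) has_real_derivative 3 * (max 0 (f x))\<^sup>2 * D) (at x)" using DERIV_chain2[where g=f and f="%y. (max 0 y) ^ Suc (Suc 1)", OF max_power_deriv[of 1 "f x"]] by (simp add: numeral_3_eq_3 numeral_2_eq_2)

lemma max_square_deriv: "(f has_real_derivative D) (at x) ==> ((%x. (max 0 (f x))\<^sup>2) has_real_derivative 2 * max 0 (f x) * D) (at x)" using DERIV_chain2[where g=f and f="%y. (max 0 y) ^ Suc (Suc 0)", OF max_power_deriv[of 0 "f x"]] by (simp add: numeral_2_eq_2)

lemma phi_deriv: "(phi has_real_derivative phi1 x) (at x)"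
proof -
 have a: "((%x. (max 0 (x - k)) ^ 3) has_real_derivative 3 * (max 0 (x - k))\<^sup>2) (at x)"
 "((%x. (max 0 (- x - k)) ^ 3) has_real_derivative - (3 * (max 0 (- x - k))\<^sup>2)) (at x)" for k :: real
proof -
 have d: "((%x. x - k) has_real_derivative 1) (at x)" "((%x. - x - k) has_real_derivative -1) (at x)" by (auto intro!: derivative_eq_intros)
 show "((%x. (max 0 (x - k)) ^ 3) has_real_derivative 3 * (max 0 (x - k))\<^sup>2) (at x)"
 "((%x. (max 0 (- x - k)) ^ 3) has_real_derivative - (3 * (max 0 (- x - k))\<^sup>2)) (at x)" using max_cube_deriv[OF d(1)] max_cube_deriv[OF d(2)] by simp_all
qed
 note d1 = DERIV_cdivide[OF DERIV_add[OF DERIV_diff[OF a(1)[of 1] DERIV_cmult[OF a(1)[of 2], of 2]] a(1)[of 3]], of 6]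
 note d2 = DERIV_cdivide[OF DERIV_add[OF DERIV_diff[OF a(2)[of 1] DERIV_cmult[OF a(2)[of 2], of 2]] a(2)[of 3]], of 6]
 show ?thesis unfolding phi_def by (rule DERIV_cong[OF DERIV_add[OF DERIV_diff[OF DERIV_ident d1] d2]]) (simp add: phi1_def field_simps)
qed

lemma phi1_deriv: "(phi1 has_real_derivative phi2 x) (at x)"
proof -
 have a: "((%x. (max 0 (x - k))\<^sup>2) has_real_derivative 2 * (max 0 (x - k))) (at x)"
 "((%x. (max 0 (- x - k))\<^sup>2) has_real_derivative - (2 * (max 0 (- x - k)))) (at x)" for k :: real
proof -
 have d: "((%x. x - k) has_real_derivative 1) (at x)" "((%x. - x - k) has_real_derivative -1) (at x)" by (auto intro!: derivative_eq_intros)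
 show "((%x. (max 0 (x - k))\<^sup>2) has_real_derivative 2 * (max 0 (x - k))) (at x)"
 "((%x. (max 0 (- x - k))\<^sup>2) has_real_derivative - (2 * (max 0 (- x - k)))) (at x)" using max_square_deriv[OF d(1)] max_square_deriv[OF d(2)] by simp_all
qed
 note d1 = DERIV_cdivide[OF DERIV_add[OF DERIV_diff[OF a(1)[of 1] DERIV_cmult[OF a(1)[of 2], of 2]] a(1)[of 3]], of 2]
 note d2 = DERIV_cdivide[OF DERIV_add[OF DERIV_diff[OF a(2)[of 1] DERIV_cmult[OF a(2)[of 2], of 2]] a(2)[of 3]], of 2]
 show ?thesis unfolding phi1_def by (rule DERIV_cong[OF DERIV_diff[OF DERIV_diff[OF DERIV_const d1] d2]]) (simp add: phi2_def field_simps)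
qed

lemma phi2_continuous: "continuous_on UNIV phi2" unfolding phi2_def by (intro continuous_intros)

lemma phi2_bound: "\<bar>phi2 x\<bar> <= 1" unfolding phi2_def by (simp add: max_def abs_if)

lemma phi1_cases:
 shows "\<bar>x\<bar> <= 1 ==> phi1 x = 1" "3 <= \<bar>x\<bar> ==> phi1 x = 0"
 "1 <= \<bar>x\<bar> ==> \<bar>x\<bar> <= 2 ==> phi1 x = 1 - (\<bar>x\<bar> - 1)\<^sup>2 / 2"
 "2 <= \<bar>x\<bar> ==> \<bar>x\<bar> <= 3 ==> phi1 x = (3 - \<bar>x\<bar>)\<^sup>2 / 2" unfolding phi1_def by (auto simp: max_def abs_if power2_eq_square field_simps split: if_splits)

lemma phi1_bounds: "0 <= phi1 x" "phi1 x <= 1"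
proof -
 consider "\<bar>x\<bar> <= 1" | "1 <= \<bar>x\<bar>" "\<bar>x\<bar> <= 2" | "2 <= \<bar>x\<bar>" "\<bar>x\<bar> <= 3" | "3 <= \<bar>x\<bar>" by linarith
 then have "0 <= phi1 x & phi1 x <= 1"
proof cases
case 2
 have "(\<bar>x\<bar> - 1)\<^sup>2 <= 1" using 2 by (intro power_le_one) auto
 then show ?thesis using phi1_cases(3)[OF 2] by auto
next
case 3
 have "(3 - \<bar>x\<bar>)\<^sup>2 <= 1" using 3 by (intro power_le_one) auto
 then show ?thesis unfolding phi1_cases(4)[OF 3] by simp
qed (simp_all add: phi1_cases)
 then show "0 <= phi1 x" "phi1 x <= 1" by auto
qed

lemma phi_id: "\<bar>x\<bar> <= 1 ==> phi x = x" unfolding phi_def by (auto simp: max_def abs_if)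

lemma phi_top: "3 <= x ==> phi x = 2" and phi_bot: "x <= -3 ==> phi x = -2" unfolding phi_def by (auto simp: max_def power3_eq_cube field_simps)

lemma phi_mono: "x <= y ==> phi x <= phi y" by (rule DERIV_nonneg_imp_nondecreasing[of x y phi]) (use phi_deriv phi1_bounds in blast)+

lemma phi_bound: "\<bar>phi x\<bar> <= 2" using phi_mono[of x "max x 3"] phi_mono[of "min x (-3)" x] phi_top[of "max x 3"] phi_bot[of "min x (-3)"] by (simp add: abs_le_iff)

lemma phi_less_1: "phi x < 1 ==> x < 1" and phi_gr_m1: "phi x > -1 ==> x > -1" using phi_mono[of 1 x] phi_mono[of x "-1"] phi_id[of 1] phi_id[of "-1"] by force+

lemma phi_inv: "\<bar>phi x\<bar> < 1 ==> \<bar>x\<bar> < 1" using phi_less_1[of x] phi_gr_m1[of x] by (auto simp: abs_less_iff)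

lemma taylor2_bound:
 fixes c c' c'' :: "real => real"
 assumes "!!s. (c has_real_derivative c' s) (at s)" "!!s. (c' has_real_derivative c'' s) (at s)"
 "!!s. \<bar>c'' s\<bar> <= B"
 shows "\<bar>c (z + h) - c z - h * c' z\<bar> <= B * h\<^sup>2 / 2"
proof -
 define d where "d m = (if m = 0 then c else if m = 1 then c' else c'')" for m :: nat
 have "\<exists>t. c (z + h) = (\<Sum>m<2. d m z / fact m * (z + h - z) ^ m) + d 2 t / fact 2 * (z + h - z) ^ 2"
proof (cases "h = 0")
case True
 then show ?thesis by (simp add: numeral_2_eq_2 d_def)
next
case False
 have "\<exists>t. (if z + h < z then z + h < t & t < z else z < t & t < z + h) &
 c (z + h) = (\<Sum>m<2. d m z / fact m * (z + h - z) ^ m) + d 2 t / fact 2 * (z + h - z) ^ 2" by (rule Taylor[where a = "min z (z + h)" and b = "max z (z + h)"])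
 (use False assms(1,2) in \<open>auto simp: d_def less_2_cases_iff\<close>)
 then show ?thesis by blast
qed
 then obtain t where "c (z + h) = (\<Sum>m<2. d m z / fact m * (z + h - z) ^ m) + d 2 t / fact 2 * (z + h - z) ^ 2" by blast
 then have "c (z + h) = c z + h * c' z + c'' t / 2 * h\<^sup>2" by (simp add: numeral_2_eq_2 d_def fact_2[unfolded numeral_2_eq_2])
 then have "\<bar>c (z + h) - c z - h * c' z\<bar> = \<bar>c'' t\<bar> / 2 * h\<^sup>2" by (simp add: abs_mult)
 also have "... <= B / 2 * h\<^sup>2" using assms(3)[of t] by (intro mult_right_mono) auto
 finally show ?thesis by simp
qed

lemma lipschitz_deriv_bound:
 fixes c c' :: "real => real"
 assumes "!!s. (c has_real_derivative c' s) (at s)" "!!s. \<bar>c' s\<bar> <= B"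
 shows "\<bar>c x - c y\<bar> <= B * \<bar>x - y\<bar>" using field_differentiable_bound[of UNIV c c' B x y] assms by auto

lemma phi_lipschitz: "\<bar>phi x - phi y\<bar> <= \<bar>x - y\<bar>" using lipschitz_deriv_bound[of phi phi1 1] phi_deriv phi1_bounds by (auto simp: abs_le_iff)

lemma phi_taylor: "\<bar>phi (z + h) - phi z - h * phi1 z\<bar> <= h\<^sup>2 / 2" using taylor2_bound[of phi phi1 phi2 1 z h] phi_deriv phi1_deriv phi2_bound by auto

text \<open>As a function of s = |.|^2 this is \<open>phi\<close> of ln |.| / R - c, whence the
  factor 2. Below exp(2 R (c - 3)) it is constantly -2, so the value -2 for s <= 0 continues it
  smoothly and composition with a squared norm is C^2 even where that norm vanishes.\<close>

definition kap :: "real => real => real => real" where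
 "kap R c s = (if s <= 0 then -2 else phi (ln s / (2 * R) - c))"

definition kap1 :: "real => real => real => real" where
 "kap1 R c s = (if s <= 0 then 0 else phi1 (ln s / (2 * R) - c) * (1 / (2 * R * s)))"

definition kap2 :: "real => real => real => real" where
 "kap2 R c s = (if s <= 0 then 0 else phi2 (ln s / (2 * R) - c) * (1 / (2 * R * s))\<^sup>2
 - phi1 (ln s / (2 * R) - c) * (1 / (2 * R * s\<^sup>2)))"

lemma kap_small:
 assumes "R > 0" "s < exp (2 * R * (c - 3))"
 shows "kap R c s = -2" "kap1 R c s = 0" "kap2 R c s = 0"
proof -
 have *: "ln s / (2 * R) - c <= -3" if "s > 0"
proof -
 have "ln s <= 2 * R * (c - 3)" using assms that by (metis ln_exp ln_mono exp_gt_zero less_imp_le)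
 then show ?thesis using assms by (simp add: field_simps)
qed
 have p2: "phi2 y = 0" if "y <= -3" for y using that by (simp add: phi2_def max_def)
 show "kap R c s = -2" "kap1 R c s = 0" "kap2 R c s = 0" using * phi1_cases(2) p2 by (auto simp: kap_def kap1_def kap2_def phi_bot)
qed

lemma kap_deriv:
 assumes "R > 0"
 shows "(kap R c has_real_derivative kap1 R c s) (at s)" "(kap1 R c has_real_derivative kap2 R c s) (at s)"
 "isCont (kap2 R c) s"
proof -
 have A: "(kap R c has_real_derivative kap1 R c s) (at s) & (kap1 R c has_real_derivative kap2 R c s) (at s)
 & isCont (kap2 R c) s"
proof (cases "s > 0")
case True
 have l: "((%s. ln s / (2 * R) - c) has_real_derivative 1 / (2 * R * s)) (at s)" using True assms by (auto intro!: derivative_eq_intros simp: field_simps)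
 have 1: "((%s. phi (ln s / (2 * R) - c)) has_real_derivative kap1 R c s) (at s)" using True DERIV_chain2[OF phi_deriv l] by (simp add: kap1_def)
 have 2: "((%s. phi1 (ln s / (2 * R) - c) * (1 / (2 * R * s))) has_real_derivative kap2 R c s) (at s)"
proof -
 have "((%s. 1 / (2 * R * s)) has_real_derivative - (1 / (2 * R * s\<^sup>2))) (at s)" using True assms by (auto intro!: derivative_eq_intros simp: field_simps power2_eq_square)
 from DERIV_mult[OF DERIV_chain2[OF phi1_deriv l] this] show ?thesis using True by (simp add: kap2_def power2_eq_square algebra_simps)
qed
 have o: "isCont phi1 x" "isCont phi2 x" for x using phi1_deriv DERIV_isCont phi2_continuous continuous_on_eq_continuous_at by blast+
 have 3: "isCont (%s. phi2 (ln s / (2 * R) - c) * (1 / (2 * R * s))\<^sup>2 - phi1 (ln s / (2 * R) - c) * (1 / (2 * R * s\<^sup>2))) s" using True assms by (intro continuous_intros isCont_o2[OF _ o(1)] isCont_o2[OF _ o(2)]) auto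
 have "(kap R c has_real_derivative kap1 R c s) (at s)" by (rule has_field_derivative_transform_within_open[OF 1, of "{0<..}"]) (use True in \<open>auto simp: kap_def\<close>)
 moreover have "(kap1 R c has_real_derivative kap2 R c s) (at s)" by (rule has_field_derivative_transform_within_open[OF 2, of "{0<..}"]) (use True in \<open>auto simp: kap1_def\<close>)
 moreover have "isCont (kap2 R c) s"
proof -
 have "\<forall>\<^sub>F x in nhds s. kap2 R c x = phi2 (ln x / (2 * R) - c) * (1 / (2 * R * x))\<^sup>2 - phi1 (ln x / (2 * R) - c) * (1 / (2 * R * x\<^sup>2))" using eventually_nhds_in_open[of "{0<..}" s] True by (auto elim!: eventually_mono simp: kap2_def)
 then show ?thesis using 3 by (simp add: isCont_cong)
qed
 ultimately show ?thesis by blast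
next
case False
 let ?U = "{..<exp (2 * R * (c - 3))}"
 have s: "s \<in> ?U" using False by (simp add: not_less) (meson exp_gt_zero le_less_trans)
 have "(kap R c has_real_derivative kap1 R c s) (at s)" by (rule has_field_derivative_transform_within_open[of "%_. -2" _ _ ?U]) (use s kap_small[OF assms] in auto)
 moreover have "(kap1 R c has_real_derivative kap2 R c s) (at s)" by (rule has_field_derivative_transform_within_open[of "%_. 0" _ _ ?U]) (use s kap_small[OF assms] in auto)
 moreover have "isCont (kap2 R c) s"
proof -
 have "\<forall>\<^sub>F x in nhds s. kap2 R c x = 0" using eventually_nhds_in_open[of ?U s] s by (auto elim!: eventually_mono simp: kap_small[OF assms])
 then show ?thesis by (simp add: isCont_cong)
qed
 ultimately show ?thesis by blast
qed
 then show "(kap R c has_real_derivative kap1 R c s) (at s)" "(kap1 R c has_real_derivative kap2 R c s) (at s)"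
 "isCont (kap2 R c) s" by auto
qed

lemma C2b_kap: "R > 0 ==> C2b f ==> C2b (%x. kap R c (f x))" by (rule C2b_compose[OF _ kap_deriv(1) kap_deriv(2)]) 
 (auto simp: continuous_on_eq_continuous_at kap_deriv(3))

lemma kap_norm: 
 assumes "u ~= 0" shows "kap R c ((norm u)\<^sup>2) = phi (ln (norm u) / R - c)" using assms by (simp add: kap_def ln_realpow)

section \<open>The uniform measure on the sphere\<close>

lemma emeasure_unit_ball_nonzero: "emeasure lborel (ball (0::'a::euclidean_space) 1) ~= 0" using content_ball_pos[of 1 "0::'a"] by (auto simp: measure_def)

text \<open>Uniqueness of translation invariant measures by Fubini. Let m be the image measure and A
  the unit ball. Integrating 1_A(x) 1_B(x + y) in the two orders gives m(A) times the Lebesgue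
  measure of B on one side and the Lebesgue measure of A times m(B) on the other; T preserves the
  ball, so the factors for A cancel.\<close>

lemma lborel_distr_orthogonal:
 fixes T :: "'a::euclidean_space => 'a"
 assumes T: "orthogonal_transformation T"
 shows "distr lborel borel T = lborel"
proof -
 have lin: "linear T" and bij: "bij T" using T orthogonal_transformation_linear orthogonal_transformation_bij by blast+
 have Tm [measurable]: "T \<in> borel_measurable borel" using lin linear_continuous_on linear_conv_bounded_linear borel_measurable_continuous_onI by blast
 define S where "S = inv T"
 have TS: "T (S y) = y" for y unfolding S_def using bij by (simp add: bij_is_surj surj_f_inv_f)
 have Sorth: "orthogonal_transformation S" unfolding S_def using T orthogonal_transformation_inv by blast
 have Sm [measurable]: "S \<in> borel_measurable borel" using Sorth orthogonal_transformation_linear linear_continuous_on linear_conv_bounded_linear borel_measurable_continuous_onI by blast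
 let ?m = "distr lborel borel T"
 have pre: "T -` ball 0 n = ball 0 n" for n using T by (auto simp: orthogonal_transformation_norm)
 have ball: "emeasure ?m (ball 0 n) = emeasure lborel (ball (0::'a) n)" for n :: real using pre[of n] by (simp add: emeasure_distr)
 have sf: "sigma_finite_measure ?m"
proof
 show "\<exists>A. countable A & A \<subseteq> sets ?m & \<Union> A = space ?m & (\<forall>a\<in>A. emeasure ?m a ~= \<infinity>)"
proof (intro exI conjI)
 show "\<Union> (range (%n::nat. ball (0::'a) (real n))) = space ?m" by (auto simp: reals_Archimedean2)
 show "\<forall>a\<in>range (%n::nat. ball (0::'a) (real n)). emeasure ?m a ~= \<infinity>" using emeasure_lborel_ball_finite[of "0::'a"] by (auto simp: ball less_top[symmetric])
qed auto
qed
 interpret m: sigma_finite_measure ?m by (rule sf)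
 interpret P: pair_sigma_finite ?m "lborel :: 'a measure" by standard
 have plus: "(\<integral>\<^sup>+x. h (y + x) \<partial>lborel) = (\<integral>\<^sup>+x. h x \<partial>lborel)"
 if [measurable]: "h \<in> borel_measurable borel" for h and y :: 'a using nn_integral_distr[of "(+) y" lborel borel h] by (simp add: lborel_distr_plus)
 have mplus: "(\<integral>\<^sup>+x. h (y + x) \<partial>?m) = (\<integral>\<^sup>+x. h x \<partial>?m)"
 if [measurable]: "h \<in> borel_measurable borel" for h and y :: 'a
proof -
 have "(\<integral>\<^sup>+x. h (y + x) \<partial>?m) = (\<integral>\<^sup>+x. h (T (S y + x)) \<partial>lborel)" by (simp add: nn_integral_distr linear_add[OF lin] TS)
 also have "... = (\<integral>\<^sup>+x. h (T x) \<partial>lborel)" by (rule plus[of "%x. h (T x)"]) simp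
 finally show ?thesis by (simp add: nn_integral_distr)
qed
 have reflA: "(\<integral>\<^sup>+y. indicator (ball 0 1) (x - y) \<partial>lborel) = emeasure lborel (ball (0::'a) 1)" for x :: 'a
proof -
 have "(\<integral>\<^sup>+y. indicator (ball 0 1) (x - y) \<partial>lborel) = (\<integral>\<^sup>+y. indicator (ball (0::'a) 1) (- x + y) \<partial>lborel)" by (intro nn_integral_cong) (auto simp: indicator_def dist_norm norm_minus_commute)
 also have "... = (\<integral>\<^sup>+y. indicator (ball (0::'a) 1) y \<partial>lborel)" by (rule plus) (intro borel_measurable_indicator borel_open open_ball)
 finally show ?thesis by simp
qed
 show ?thesis
proof (rule measure_eqI)
 fix B assume "B \<in> sets ?m"
 then have B [measurable]: "B \<in> sets borel" by simp
 define A where "A = ball (0::'a) 1"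
 have A [measurable]: "A \<in> sets borel" by (simp add: A_def)
 have prod: "(%p. indicator A (fst p) * indicator B (fst p + snd p) :: ennreal) \<in> borel_measurable (borel \<Otimes>\<^sub>M borel)"
 "(%p. indicator A (fst p - snd p) * indicator B (fst p) :: ennreal) \<in> borel_measurable (borel \<Otimes>\<^sub>M borel)" by measurable
 have s: "sets (?m \<Otimes>\<^sub>M (lborel :: 'a measure)) = sets (borel \<Otimes>\<^sub>M borel)" by (intro sets_pair_measure_cong) simp_all
 have prod': "case_prod (%x y. indicator A x * indicator B (x + y) :: ennreal) \<in> borel_measurable (?m \<Otimes>\<^sub>M lborel)"
 "case_prod (%x y. indicator A (x - y) * indicator B x :: ennreal) \<in> borel_measurable (?m \<Otimes>\<^sub>M lborel)" using prod by (simp_all only: measurable_cong_sets[OF s HOL.refl] split_beta')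
 have ind: "(\<integral>\<^sup>+x. indicator C x * c \<partial>?m) = emeasure ?m C * c" if "C \<in> sets borel" for C c using that by (subst nn_integral_multc) (simp_all del: emeasure_distr)
 have inB: "(\<integral>\<^sup>+y. c * indicator B (x + y) \<partial>lborel) = c * emeasure lborel B" for c x by (subst nn_integral_cmult) (simp_all add: plus[of "indicator B"])
 have "emeasure ?m A * emeasure lborel B = (\<integral>\<^sup>+x. (\<integral>\<^sup>+y. indicator A x * indicator B (x + y) \<partial>lborel) \<partial>?m)" unfolding inB by (rule ind[symmetric]) simp
 also have "... = (\<integral>\<^sup>+y. (\<integral>\<^sup>+x. indicator A x * indicator B (x + y) \<partial>?m) \<partial>lborel)" by (rule P.Fubini'[OF prod'(1), symmetric])
 also have "... = (\<integral>\<^sup>+y. (\<integral>\<^sup>+x. indicator A (x - y) * indicator B x \<partial>?m) \<partial>lborel)"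
proof (rule nn_integral_cong)
 fix y
 have "(%x. indicator A (x - y) * indicator B x :: ennreal) \<in> borel_measurable borel" by measurable
 from mplus[OF this, of y]
 show "(\<integral>\<^sup>+x. indicator A x * indicator B (x + y) \<partial>?m) = (\<integral>\<^sup>+x. indicator A (x - y) * indicator B x \<partial>?m)" by (simp add: add.commute)
qed
 also have "... = (\<integral>\<^sup>+x. (\<integral>\<^sup>+y. indicator A (x - y) * indicator B x \<partial>lborel) \<partial>?m)" by (rule P.Fubini'[OF prod'(2)])
 also have "... = (\<integral>\<^sup>+x. indicator B x * emeasure lborel A \<partial>?m)"
proof (rule nn_integral_cong)
 fix x
 have "(%y. indicator A (x - y) :: ennreal) \<in> borel_measurable lborel" by measurable
 then show "(\<integral>\<^sup>+y. indicator A (x - y) * indicator B x \<partial>lborel) = indicator B x * emeasure lborel A" by (subst nn_integral_multc) (simp_all add: reflA[folded A_def] mult.commute)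
qed
 also have "... = emeasure lborel A * emeasure ?m B" by (subst ind) (simp_all add: mult.commute)
 finally have e: "emeasure lborel A * emeasure lborel B = emeasure lborel A * emeasure ?m B" by (simp add: ball A_def)
 have "emeasure lborel A ~= 0" unfolding A_def by (rule emeasure_unit_ball_nonzero)
 moreover have "emeasure lborel A ~= \<top>" using emeasure_lborel_ball_finite[of "0::'a" 1] by (auto simp: A_def)
 ultimately show "emeasure ?m B = emeasure lborel B" using e by (simp add: ennreal_mult_cancel_left)
qed simp
qed

lemma sphere_unif_measurable [measurable]: "(%x. (1 / norm x) *\<^sub>R x) \<in> borel_measurable (borel :: (real^'d::finite) measure)" by measurable

lemma sets_sphere_unif [measurable_cong, simp]: "sets sphere_unif = sets borel" by (simp add: sphere_unif_def)

lemma space_sphere_unif [simp]: "space sphere_unif = UNIV" by (simp add: sphere_unif_def)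

lemma prob_space_unif_ball: "prob_space (uniform_measure lborel (ball (0::real^'d::finite) 1))" using emeasure_unit_ball_nonzero[where 'a="real^'d"] emeasure_lborel_ball_finite[of "0::real^'d" 1] by (intro prob_space_uniform_measure) (auto simp: null_sets_def)

lemma prob_space_sphere_unif: "prob_space (sphere_unif :: (real^'d::finite) measure)" unfolding sphere_unif_def by (intro prob_space.prob_space_distr prob_space_unif_ball) simp

lemma AE_sphere_unif: "AE th in sphere_unif. norm (th :: real^'d::finite) = 1"
proof -
 have "AE x in (lborel :: (real^'d) measure). x ~= 0" by (rule AE_I'[of "{0}"]) (auto simp: null_sets_def)
 then have "AE x in uniform_measure lborel (ball (0::real^'d) 1). norm ((1 / norm x) *\<^sub>R x) = 1" by (intro AE_uniform_measureI) (auto elim: AE_mp)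
 then show ?thesis unfolding sphere_unif_def by (subst AE_distr_iff) auto
qed

lemma sphere_unif_distr_orthogonal:
 fixes T :: "real^'d::finite => real^'d"
 assumes T: "orthogonal_transformation T"
 shows "distr sphere_unif borel T = sphere_unif"
proof -
 have lin: "linear T" using T orthogonal_transformation_linear by blast
 have Tm [measurable]: "T \<in> borel_measurable borel" using lin linear_continuous_on linear_conv_bounded_linear borel_measurable_continuous_onI by blast
 let ?U = "uniform_measure lborel (ball (0::real^'d) 1)"
 let ?N = "%x::real^'d. (1 / norm x) *\<^sub>R x"
 have U: "emeasure ?U (T -` C) = emeasure ?U C" if C: "C \<in> sets borel" for C
proof -
 have [measurable]: "T -` C \<in> sets borel" using measurable_sets[OF Tm C] by simp
 have "ball 0 1 \<inter> T -` C = T -` (ball 0 1 \<inter> C)" using T by (auto simp: orthogonal_transformation_norm)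
 moreover have "emeasure lborel (T -` (ball 0 1 \<inter> C)) = emeasure (distr lborel borel T) (ball 0 1 \<inter> C)" using C by (simp add: emeasure_distr)
 ultimately show ?thesis using C by (simp add: lborel_distr_orthogonal[OF T])
qed
 show ?thesis
proof (rule measure_eqI)
 fix B assume "B \<in> sets (distr sphere_unif borel T)"
 then have B [measurable]: "B \<in> sets borel" by simp
 have [measurable]: "T -` B \<in> sets borel" "?N -` B \<in> sets borel"  using measurable_sets[OF Tm B] measurable_sets[OF sphere_unif_measurable B] by simp_all
 have "?N -` (T -` B) = T -` (?N -` B)" using T by (auto simp: orthogonal_transformation_norm linear_cmul[OF lin])
 then show "emeasure (distr sphere_unif borel T) B = emeasure sphere_unif B" using U[of "?N -` B"] unfolding sphere_unif_def by (simp add: emeasure_distr distr_distr vimage_comp[symmetric])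
qed simp
qed

lemma sphere_unif_integral_orthogonal:
 fixes h :: "real^'d::finite => real" and T :: "real^'d => real^'d"
 assumes "orthogonal_transformation T" and h [measurable]: "h \<in> borel_measurable borel"
 shows "(\<integral>th. h (T th) \<partial>sphere_unif) = (\<integral>th. h th \<partial>sphere_unif)"
proof -
 have [measurable]: "T \<in> borel_measurable borel" using assms(1) orthogonal_transformation_linear linear_continuous_on linear_conv_bounded_linear borel_measurable_continuous_onI by blast
 have "(\<integral>th. h (T th) \<partial>sphere_unif) = (\<integral>th. h th \<partial>distr sphere_unif borel T)" by (subst integral_distr) auto
 then show ?thesis by (simp add: sphere_unif_distr_orthogonal[OF assms(1)])
qed

lemma sphere_unif_integral_uminus:
 fixes h :: "real^'d::finite => real"
 assumes "h \<in> borel_measurable borel"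
 shows "(\<integral>th. h (- th) \<partial>sphere_unif) = (\<integral>th. h th \<partial>sphere_unif)" by (rule sphere_unif_integral_orthogonal[OF _ assms])
 (simp add: orthogonal_transformation_def linear_uminus)

text \<open>Some orthogonal map takes b to c. Hence averages over the sphere see a vector only
  through its length, which later makes the drift a function of one real parameter.\<close>

lemma sphere_unif_inner:
 fixes h :: "real => real" and b c :: "real^'d::finite"
 assumes "h \<in> borel_measurable borel" "norm b = norm c"
 shows "(\<integral>th. h (inner b th) \<partial>sphere_unif) = (\<integral>th. h (inner c th) \<partial>sphere_unif)"
proof -
 obtain T where T: "orthogonal_transformation T" "T b = c" using orthogonal_transformation_exists[OF assms(2)] by metis
 have "inner b th = inner c (T th)" for th using T by (metis orthogonal_transformation_def)
 then show ?thesis using sphere_unif_integral_orthogonal[OF T(1), of "%th. h (inner c th)"] assms(1) by simp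
qed

text \<open>By symmetry all coordinates have the same second moment, and these moments sum to
  1.\<close>

lemma sphere_unif_square:
 fixes b :: "real^'d::finite"
 shows "(\<integral>th. (inner b th)\<^sup>2 \<partial>sphere_unif) = (norm b)\<^sup>2 / CARD('d)"
proof -
 interpret prob_space "sphere_unif :: (real^'d) measure" by (rule prob_space_sphere_unif)
 define I where "I i = (\<integral>th. (inner (axis i 1) (th::real^'d))\<^sup>2 \<partial>sphere_unif)" for i
 have int: "integrable sphere_unif (%th::real^'d. (inner c th)\<^sup>2)" for c
proof (rule integrable_const_bound[where B = "(norm c)\<^sup>2"])
 show "AE th in sphere_unif. norm ((inner c th)\<^sup>2) <= (norm c)\<^sup>2" using AE_sphere_unif
proof eventually_elim
case (elim th)
 then show ?case using Cauchy_Schwarz_ineq2[of c th] abs_le_square_iff[of "inner c th" "norm c"] by simp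
qed
qed simp
 have eq: "I i = I j" for i j unfolding I_def by (rule sphere_unif_inner) auto
 have "(\<Sum>i\<in>UNIV. I i) = (\<integral>th. (\<Sum>i\<in>UNIV. (inner (axis i 1) (th::real^'d))\<^sup>2) \<partial>sphere_unif)" unfolding I_def by (subst Bochner_Integration.integral_sum) (auto simp: int)
 also have "... = (\<integral>th. 1 \<partial>(sphere_unif :: (real^'d) measure))"
proof (rule integral_cong_AE)
 show "AE th in sphere_unif. (\<Sum>i\<in>UNIV. (inner (axis i 1) (th::real^'d))\<^sup>2) = 1" using AE_sphere_unif by eventually_elim (simp add: inner_axis' norm_vec2[symmetric])
qed auto
 finally have "(\<Sum>i\<in>UNIV. I i) = 1" using prob_space by simp
 moreover have "(\<Sum>j\<in>UNIV. I j) = (\<Sum>j\<in>(UNIV::'d set). I i)" for i by (intro sum.cong HOL.refl eq)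
 ultimately have "real CARD('d) * I i = 1" for i by simp
 then have Ii: "I i = 1 / CARD('d)" for i by (simp add: field_simps)
 have "(\<integral>th. (inner b th)\<^sup>2 \<partial>sphere_unif) = (\<integral>th. (inner (norm b *\<^sub>R axis undefined 1) (th::real^'d))\<^sup>2 \<partial>sphere_unif)" by (rule sphere_unif_inner) auto
 also have "... = (norm b)\<^sup>2 * I undefined" by (simp add: I_def power_mult_distrib)
 finally show ?thesis by (simp add: Ii)
qed

section \<open>The jump measure\<close>

locale levy_measure =
 fixes sg :: real and nu :: "real measure"
 assumes nu_borel [measurable_cong, simp]: "sets nu = sets borel"
 and nu_support: "emeasure nu {..0} = 0"
 and nu_levy: "(\<integral>\<^sup>+ r. ennreal (min 1 (r\<^sup>2)) \<partial>nu) < \<infinity>"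
 and nu_moment: "(\<integral>\<^sup>+ r. ennreal (r * indicator {1..} r) \<partial>nu) < \<infinity>"
begin

lemma space_nu [simp]: "space nu = UNIV" using sets_eq_imp_space_eq[OF nu_borel] by simp

lemma nu_pos: "AE r in nu. r > 0" by (rule AE_I'[of "{..0}"]) (auto simp: null_sets_def nu_support)

text \<open>Comparable to min(r^2, r): the common majorant of all jump integrals, quadratic for
  small jumps after compensation and linear for large ones.\<close>

definition wt :: "real => real" where "wt r = min 1 (r\<^sup>2) + r * indicator {1..} r"

lemma wt_measurable [measurable]: "wt \<in> borel_measurable borel" unfolding wt_def by measurable

lemma wt_nonneg: "0 <= wt r" by (auto simp: wt_def indicator_def)

lemma wt_le1: "0 < r ==> r <= 1 ==> r\<^sup>2 <= wt r" and wt_ge1: "1 <= r ==> r <= wt r" "1 <= r ==> 1 <= wt r"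
 and wt_pos: "r > 0 ==> wt r > 0" using power_le_one[of r 2] one_le_power[of r 2] by (auto simp: wt_def indicator_def min_def add_pos_nonneg)

lemma integrable_wt: "integrable nu wt"
proof -
 have "integrable nu (%r. min 1 (r\<^sup>2))" using nu_levy by (intro integrableI_bounded) auto
 moreover have "integrable nu (%r. r * indicator {1..} r)"
proof (rule integrableI_bounded)
 have "norm (r * indicator {1..} r :: real) = r * indicator {1..} r" for r :: real by (auto simp: indicator_def)
 then show "(\<integral>\<^sup>+ r. ennreal (norm (r * indicator {1..} r :: real)) \<partial>nu) < \<infinity>" using nu_moment by simp
qed measurable
 ultimately have "integrable nu (%r. min 1 (r\<^sup>2) + r * indicator {1..} r)" by (rule Bochner_Integration.integrable_add)
 then show ?thesis by (simp add: wt_def[abs_def])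
qed

text \<open>\<open>wt\<close> is integrable and positive on r > 0, so by Markov the level sets at
  1/(n+1) have finite mass; they exhaust the half line and the rest is null. This is needed for
  Fubini in the jump variable.\<close>

lemma sigma_finite_nu: "sigma_finite_measure nu"
proof
 let ?A = "%n::nat. {r. wt r \<ge> 1 / Suc n}"
 have fin: "emeasure nu (?A n) ~= \<infinity>" for n
proof -
 have "emeasure nu {r\<in>space nu. 1 / Suc n <= wt r} <= ennreal ((1 / (1 / Suc n)) * (\<integral>r. wt r \<partial>nu))" by (rule integral_Markov_inequality) (auto intro!: integrable_wt wt_nonneg)
 then have "emeasure nu (?A n) <= ennreal ((1 / (1 / Suc n)) * (\<integral>r. wt r \<partial>nu))" by simp
 from neq_top_trans[OF ennreal_neq_top this] show ?thesis by simp
qed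
 show "\<exists>A. countable A & A \<subseteq> sets nu & \<Union> A = space nu & (\<forall>a\<in>A. emeasure nu a ~= \<infinity>)"
proof (intro exI conjI)
 have "\<exists>n. wt r \<ge> 1 / Suc n" if "r > 0" for r using reals_Archimedean[OF wt_pos[OF that]] by (auto simp: inverse_eq_divide intro: less_imp_le)
 then show "\<Union> (insert {..0} (range ?A)) = space nu" by (auto simp: not_le[symmetric])
 show "\<forall>a\<in>insert {..0} (range ?A). emeasure nu a ~= \<infinity>" using fin nu_support by simp
qed auto
qed

sublocale nu: sigma_finite_measure nu by (rule sigma_finite_nu)

text \<open>Up to a constant, the carre du champ of a logarithm truncated at scale R, see
  \<open>Gam_kf\<close>.\<close>

definition epsR :: "real => real" where
 "epsR R = sg\<^sup>2 / R\<^sup>2 + (\<integral>r. min 1 (r\<^sup>2 / R\<^sup>2) \<partial>nu)"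

lemma min_scale:
 assumes "c > 0" "0 <= x"
 shows "min 1 (x / c) <= max 1 (1 / c) * min 1 (x::real)"
proof (cases "x <= 1")
case True
 have "x / c <= max 1 (1 / c) * x" using assms by (simp add: mult_right_mono[of "1/c" _ x, simplified])
 then show ?thesis using True by simp
qed (use assms in auto)

lemma min_wt: "R > 0 ==> r > 0 ==> min 1 (r\<^sup>2 / R\<^sup>2) <= max 1 (1 / R\<^sup>2) * wt r"
proof -
 assume "R > 0" "r > 0"
 then have "min 1 (r\<^sup>2 / R\<^sup>2) <= max 1 (1 / R\<^sup>2) * min 1 (r\<^sup>2)" by (intro min_scale) auto
 also have "... <= max 1 (1 / R\<^sup>2) * wt r" using \<open>r > 0\<close> by (intro mult_left_mono) (auto simp: wt_def indicator_def)
 finally show ?thesis .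
qed

lemma integrable_AE_bound:
 fixes f :: "real => real"
 assumes "f \<in> borel_measurable borel" "!!r. r > 0 ==> \<bar>f r\<bar> <= C * wt r"
 shows "integrable nu f"
proof (rule Bochner_Integration.integrable_bound[of _ "%r. C * wt r"])
 show "AE r in nu. norm (f r) <= norm (C * wt r)" using nu_pos by eventually_elim (use assms(2) in \<open>auto intro: order_trans[OF _ abs_ge_self]\<close>)
qed (use assms integrable_wt in auto)

lemma integrable_min: "R > 0 ==> integrable nu (%r. min 1 (r\<^sup>2 / R\<^sup>2))" by (rule integrable_AE_bound[of _ "max 1 (1 / R\<^sup>2)"]) (auto simp: min_wt)

lemma epsR_0: "epsR 0 = 0" by (simp add: epsR_def)

lemma epsR_nonneg: "0 <= epsR R" by (simp add: epsR_def)

lemma epsR_antimono: 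
 assumes "0 < R" "R <= R'" shows "epsR R' <= epsR R"
proof -
 have "x / R'\<^sup>2 <= x / R\<^sup>2" if "x \<ge> 0" for x using assms that by (intro divide_left_mono mult_pos_pos power_mono) auto
 then show ?thesis unfolding epsR_def using assms by (intro add_mono integral_mono integrable_min min.mono) auto
qed

lemma epsR_scale:
 assumes "c > 0" "R > 0" shows "epsR (c * R) <= max 1 (1 / c\<^sup>2) * epsR R"
proof -
 have "sg\<^sup>2 / (c * R)\<^sup>2 <= max 1 (1 / c\<^sup>2) * (sg\<^sup>2 / R\<^sup>2)" using mult_right_mono[of "1 / c\<^sup>2" "max 1 (1 / c\<^sup>2)" "sg\<^sup>2 / R\<^sup>2"] by (simp add: power_mult_distrib)
 moreover have "(\<integral>r. min 1 (r\<^sup>2 / (c * R)\<^sup>2) \<partial>nu) <= (\<integral>r. max 1 (1 / c\<^sup>2) * min 1 (r\<^sup>2 / R\<^sup>2) \<partial>nu)"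
proof (intro integral_mono)
 show "min 1 (r\<^sup>2 / (c * R)\<^sup>2) <= max 1 (1 / c\<^sup>2) * min 1 (r\<^sup>2 / R\<^sup>2)" for r using min_scale[of "c\<^sup>2" "r\<^sup>2 / R\<^sup>2"] assms by (simp add: power_mult_distrib field_simps)
qed (use assms in \<open>auto intro: integrable_min\<close>)
 ultimately show ?thesis by (simp add: epsR_def algebra_simps)
qed

text \<open>Each term is at most 4 r^2 / (r + i)^2, which is dominated by a telescoping difference.
  The term i = 0 vanishes because division by zero gives 0.\<close>

lemma sum_min_bound:
 fixes r :: real assumes "r > 0"
 shows "(\<Sum>i<Suc n. min 1 (r\<^sup>2 / (real i)\<^sup>2)) <= 4 * r\<^sup>2 * (1 / r - 1 / (r + n))"
proof (induction n)
case (Suc n)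
 let ?m = "real (Suc n)"
 have m: "?m > 0" by simp
 have "min 1 (r\<^sup>2 / ?m\<^sup>2) <= 2 * r\<^sup>2 / (r\<^sup>2 + ?m\<^sup>2)"
proof (cases "r\<^sup>2 <= ?m\<^sup>2")
case True
 have "r\<^sup>2 / ?m\<^sup>2 <= 2 * r\<^sup>2 / (r\<^sup>2 + ?m\<^sup>2)" using True m assms by (simp add: divide_simps add_pos_pos)
 then show ?thesis by simp
next
case False
 then have "1 <= 2 * r\<^sup>2 / (r\<^sup>2 + ?m\<^sup>2)" using m assms by (simp add: divide_simps add_pos_pos)
 then show ?thesis by simp
qed
 also have "... <= 4 * r\<^sup>2 / (r + ?m)\<^sup>2"
proof -
 have "(r + ?m)\<^sup>2 <= 2 * (r\<^sup>2 + ?m\<^sup>2)" using sum_squares_bound[of r ?m] by (simp add: power2_sum algebra_simps)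
 then have "4 * r\<^sup>2 / (2 * (r\<^sup>2 + ?m\<^sup>2)) <= 4 * r\<^sup>2 / (r + ?m)\<^sup>2" using m assms by (intro divide_left_mono) (auto simp: zero_less_mult_iff add_pos_pos)
 moreover have "4 * a / (2 * X) = 2 * a / X" for a X :: real by simp
 ultimately show ?thesis by (simp only:)
qed
 also have "... <= 4 * r\<^sup>2 * (1 / (r + n) - 1 / (r + ?m))"
proof -
 have "1 / (r + n) - 1 / (r + ?m) = 1 / ((r + n) * (r + ?m))" using assms by (simp add: field_simps add_pos_nonneg)
 moreover have "1 / (r + ?m)\<^sup>2 <= 1 / ((r + n) * (r + ?m))" using assms by (intro divide_left_mono) (auto simp: power2_eq_square add_pos_nonneg intro!: mult_right_mono)
 ultimately show ?thesis using mult_left_mono[of "1 / (r + ?m)\<^sup>2" "1 / ((r + n) * (r + ?m))" "4 * r\<^sup>2"] by simp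
qed
 finally show ?case using Suc.IH by (simp add: algebra_simps)
qed simp

text \<open>Summing min(1, r^2/n^2) over n first gives O(r^2) for r <= 1 and O(r) for r >= 1, that
  is O(\<open>wt\<close>). The first moment of the large jumps enters the law of large numbers
  here.\<close>

lemma summable_epsR: "summable (%n. epsR (real n))"
proof -
 have s2: "summable (%n. 1 / (real n)\<^sup>2)" using inverse_power_summable[of 2, where 'a=real] by (simp add: inverse_eq_divide)
 define S where "S = (\<Sum>n. 1 / (real n)\<^sup>2)"
 have S: "(\<Sum>i<n. 1 / (real i)\<^sup>2) <= S" "0 <= S" for n unfolding S_def using s2 by (auto intro!: sum_le_suminf suminf_nonneg)
 have b: "(\<Sum>i<n. min 1 (r\<^sup>2 / (real i)\<^sup>2)) <= (4 + S) * wt r" if r: "r > 0" for r n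
proof (cases "r <= 1")
case True
 have "(\<Sum>i<n. min 1 (r\<^sup>2 / (real i)\<^sup>2)) <= (\<Sum>i<n. r\<^sup>2 * (1 / (real i)\<^sup>2))" by (intro sum_mono) simp
 also have "... <= r\<^sup>2 * S" unfolding sum_distrib_left[symmetric] by (intro mult_left_mono S) simp
 also have "... <= wt r * (4 + S)" using wt_le1[OF r True] S(2) wt_nonneg by (intro mult_mono) auto
 finally show ?thesis by (simp add: mult.commute)
next
case False
 have "(\<Sum>i<n. min 1 (r\<^sup>2 / (real i)\<^sup>2)) <= (\<Sum>i<Suc n. min 1 (r\<^sup>2 / (real i)\<^sup>2))" by simp
 also have "... <= 4 * r\<^sup>2 * (1 / r - 1 / (r + n))" by (rule sum_min_bound[OF r])
 also have "... <= 4 * r\<^sup>2 * (1 / r)" using r by (intro mult_left_mono) auto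
 also have "... = 4 * r" using r by (simp add: power2_eq_square)
 also have "... <= 4 * wt r" using wt_ge1[of r] False by simp
 also have "... <= (4 + S) * wt r" using S(2) wt_nonneg by (intro mult_right_mono) auto
 finally show ?thesis .
qed
 have i: "integrable nu (%r. min 1 (r\<^sup>2 / (real n)\<^sup>2))" for n by (cases "n = 0") (auto intro: integrable_min)
 have "summable (%n. \<integral>r. min 1 (r\<^sup>2 / (real n)\<^sup>2) \<partial>nu)"
proof (rule summableI_nonneg_bounded)
 show "(\<Sum>k<n. \<integral>r. min 1 (r\<^sup>2 / (real k)\<^sup>2) \<partial>nu) <= (\<integral>r. (4 + S) * wt r \<partial>nu)" for n
proof -
 have "(\<Sum>k<n. \<integral>r. min 1 (r\<^sup>2 / (real k)\<^sup>2) \<partial>nu) = (\<integral>r. (\<Sum>k<n. min 1 (r\<^sup>2 / (real k)\<^sup>2)) \<partial>nu)" by (simp add: i)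
 also have "... <= (\<integral>r. (4 + S) * wt r \<partial>nu)"
proof (rule integral_mono_AE)
 show "AE r in nu. (\<Sum>k<n. min 1 (r\<^sup>2 / (real k)\<^sup>2)) <= (4 + S) * wt r" using nu_pos by eventually_elim (rule b)
qed (auto simp: i integrable_wt)
 finally show ?thesis .
qed
qed simp
 then show ?thesis unfolding epsR_def using summable_mult[OF s2, of "sg\<^sup>2"] by (intro summable_add) auto
qed

lemma summable_epsR_scaled: "c > 0 ==> summable (%n. epsR (c * real n))"
proof (rule summable_comparison_test'[OF summable_mult[OF summable_epsR, of "max 1 (1 / c\<^sup>2)"]])
 fix n :: nat assume "c > 0"
 then show "norm (epsR (c * real n)) <= max 1 (1 / c\<^sup>2) * epsR (real n)" by (cases "n = 0") (auto simp: epsR_nonneg epsR_scale epsR_0)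
qed

text \<open>Cauchy condensation, as \<open>epsR\<close> decreases on the positive axis. This is the
  form used for time blocks of length 2^n with truncation at scale c 2^n.\<close>

lemma summable_epsR_dyadic: "c > 0 ==> summable (%n. 2 ^ n * epsR (c * 2 ^ n))" using condensation_test[of "%n. epsR (c * real n)"] summable_epsR_scaled[of c] by (simp add: epsR_nonneg epsR_antimono)

text \<open>R times the error, up to a constant, of replacing the generator of the truncated
  logarithm by its linearisation (\<open>Gkf_expand\<close>). The minimum combines the Taylor bound
  and the Lipschitz bound of the truncation.\<close>

definition rem :: "real => real" where
 "rem R = sg\<^sup>2 / R + (\<integral>r. min (r\<^sup>2 / R) (2 * r) \<partial>nu)"

lemma rem_bound: 
 assumes "R \<ge> 1" "r > 0" shows "\<bar>min (r\<^sup>2 / R) (2 * r)\<bar> <= 2 * wt r"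
proof (cases "r <= 1")
case True
 have "r\<^sup>2 / R <= r\<^sup>2" using assms by (simp add: field_simps mult_left_mono[of 1 R "r\<^sup>2", simplified])
 then show ?thesis using assms wt_le1[OF assms(2) True] wt_nonneg[of r] by (auto simp: min_def)
next
case False
 then show ?thesis using assms wt_ge1[of r] by (auto simp: min_def)
qed

lemma integrable_rem: "R \<ge> 1 ==> integrable nu (%r. min (r\<^sup>2 / R) (2 * r))" by (rule integrable_AE_bound[of _ 2]) (measurable, rule rem_bound)

text \<open>Dominated convergence with majorant 2 \<open>wt\<close>: the quadratic alternative tends
  to 0 for each fixed jump size.\<close>

lemma rem_tendsto:
 assumes "filterlim R at_top sequentially" "!!n. R n \<ge> 1"
 shows "(%n. rem (R n)) \<longlonglongrightarrow> 0"
proof -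
 have z: "(%n. c / R n) \<longlonglongrightarrow> 0" for c using assms(1) by (intro real_tendsto_divide_at_top[OF tendsto_const])
 have "(%n. \<integral>r. min (r\<^sup>2 / R n) (2 * r) \<partial>nu) \<longlonglongrightarrow> (\<integral>r. 0 \<partial>nu)"
proof (rule integral_dominated_convergence[where w = "%r. 2 * wt r"])
 show "AE r in nu. (%n. min (r\<^sup>2 / R n) (2 * r)) \<longlonglongrightarrow> 0" using nu_pos
proof eventually_elim
case (elim r)
 have "(%n. min (r\<^sup>2 / R n) (2 * r)) \<longlonglongrightarrow> min 0 (2 * r)" by (intro tendsto_min z tendsto_const)
 then show ?case using elim by simp
qed
 show "AE r in nu. norm (min (r\<^sup>2 / R n) (2 * r)) <= 2 * wt r" for n using nu_pos by eventually_elim (simp only: real_norm_def, rule rem_bound[OF assms(2)])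
qed (auto simp: integrable_wt)
 then show ?thesis unfolding rem_def using tendsto_add[OF z[of "sg\<^sup>2"]] by fastforce
qed

end

section \<open>Functions along one-parameter subgroups\<close>

lemma bounded_bilinear_matrix_mult: "bounded_bilinear ((**) :: real^'n^'m => real^'k^'n => real^'k^'m)" by (rule bounded_bilinear.intro)
 (auto simp: matrix_add_ldistrib matrix_add_mult matrix_scaleR_mult norm_matrix_mult_le intro!: exI[of _ 1])

lemma bounded_bilinear_matrix_vector: "bounded_bilinear ((*v) :: real^'n^'m => real^'n => real^'m)" by (rule bounded_bilinear.intro)
 (auto simp: matrix_vector_mult_add_rdistrib matrix_vector_right_distrib scaleR_matrix_vector_assoc
 matrix_vector_mult_scaleR norm_matrix_vector_le intro!: exI[of _ 1])

lemmas continuous_on_matrix_mult [continuous_intros] = bounded_bilinear.continuous_on[OF bounded_bilinear_matrix_mult]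
lemmas continuous_on_matrix_vector [continuous_intros] = bounded_bilinear.continuous_on[OF bounded_bilinear_matrix_vector]
lemmas tendsto_matrix_mult [tendsto_intros] = bounded_bilinear.tendsto[OF bounded_bilinear_matrix_mult]
lemmas tendsto_matrix_vector [tendsto_intros] = bounded_bilinear.tendsto[OF bounded_bilinear_matrix_vector]

lemma borel_measurable_matrix_mult [measurable (raw)]:
 fixes f :: "'a => real^'n^'m" and g :: "'a => real^'k^'n"
 assumes "f \<in> borel_measurable M" "g \<in> borel_measurable M"
 shows "(%x. f x ** g x) \<in> borel_measurable M" by (rule borel_measurable_continuous_Pair[OF assms]) (intro continuous_intros)

lemma borel_measurable_matrix_vector [measurable (raw)]:
 fixes f :: "'a => real^'n^'m" and g :: "'a => real^'n"
 assumes "f \<in> borel_measurable M" "g \<in> borel_measurable M"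
 shows "(%x. f x *v g x) \<in> borel_measurable M" by (rule borel_measurable_continuous_Pair[OF assms]) (intro continuous_intros)

lemma continuous_on_Vth [continuous_intros]: "continuous_on S f ==> continuous_on S (%x. Vth (f x))" unfolding Vth_def by (intro continuous_intros)

lemma continuous_on_boost [continuous_intros]: 
 "continuous_on S f ==> continuous_on S g ==> continuous_on S (%x. boost (f x) (g x))" unfolding boost_def cosh_field_def sinh_field_def by (intro continuous_intros) auto

section \<open>Right multiplication by boosts and the exponentials occurring in the
  generator\<close>

definition mv :: "'d::finite pg => real => real^'d => 'd pg" where
 "mv x r th = (fst x ** boost r th, snd x)"

lemma mv_measurable [measurable (raw)]:
 assumes "f \<in> borel_measurable M" "g \<in> borel_measurable M" "h \<in> borel_measurable M"
 shows "(%w. mv (f w) (g w) (h w)) \<in> borel_measurable M"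
proof -
 have [measurable]: "(%w. boost (g w) (h w)) \<in> borel_measurable M" by (rule borel_measurable_continuous_Pair[OF assms(2,3)]) (intro continuous_intros)
 have [measurable]: "(%w. fst (f w)) \<in> borel_measurable M" "(%w. snd (f w)) \<in> borel_measurable M" using assms(1) by (auto intro!: borel_measurable_continuous_on[of _ f] continuous_intros)
 show ?thesis unfolding mv_def by measurable
qed

lemma mv_Gtilde: "x \<in> Gtilde ==> norm th = 1 ==> mv x r th \<in> Gtilde" by (auto simp: Gtilde_def mv_def Ggrp_mult boost_Ggrp)

lemma mv_0 [simp]: "mv x 0 th = x" by (simp add: mv_def)

text \<open>Normalising the direction expresses S(r, th) through \<open>boost\<close> for every th,
  so the integrand of the generator is Borel on all of R^d and not only on the sphere. At th = 0
  both sides are the identity, since 1 / norm th is then 0.\<close>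

lemma Smap_eq: "Smap r th = (boost (r * norm th) ((1 / norm th) *\<^sub>R th), 0)"
proof (cases "th = 0")
case True
 then show ?thesis by (simp add: Smap_def matexp_0)
next
case False
 have "r *\<^sub>R Vth th = (r * norm th) *\<^sub>R Vth ((1 / norm th) *\<^sub>R th)" using False by (simp add: Vth_def scaleR_sum_right)
 then show ?thesis using False by (simp add: Smap_def Vth_def[symmetric] matexp_Vth)
qed

lemma pmult_Smap_mv: "pmult x (Smap r th) = mv x (r * norm th) ((1 / norm th) *\<^sub>R th)" by (simp add: pmult_def Smap_eq mv_def)

lemma texp_Vt: "pmult x (texp (s *\<^sub>R Vt i)) = mv x s (axis i 1)"
proof -
 have "matexp (s *\<^sub>R Vb i) = boost s (axis i 1)" by (simp add: matexp_Vth Vth_axis[symmetric])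
 then show ?thesis by (simp add: pmult_def texp_def Vt_def mv_def)
qed

lemma texp_H0:
 fixes x :: "'d::finite pg"
 shows "pmult x (texp (s *\<^sub>R H0)) = (fst x, snd x + s *\<^sub>R (fst x *v ev None))"
proof -
 have m: "(1 / fact (Suc n)) *\<^sub>R (mpow (0 :: 'd mmat) n *v (s *\<^sub>R ev None)) = (if n = 0 then s *\<^sub>R ev None else 0)" for n
proof (cases n)
case 0
 then show ?thesis by (simp add: mpow_0)
next
case (Suc k)
 have "mpow (0 :: 'd mmat) n = 0" by (simp add: Suc mpow_Suc matrix_matrix_mult_def vec_eq_iff)
 then show ?thesis using Suc by simp
qed
 have "(\<Sum>n. (1 / fact (Suc n)) *\<^sub>R (mpow (0 :: 'd mmat) n *v (s *\<^sub>R ev None))) = s *\<^sub>R ev None" unfolding m using sums_single[of 0 "%_. s *\<^sub>R ev None"] by (simp add: sums_iff)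
 then show ?thesis by (simp add: pmult_def texp_def H0_def matexp_0 matrix_vector_mult_scaleR)
qed

text \<open>First and second derivatives \<open>d1\<close>, \<open>d2\<close> in the directions \<open>V\<^sub>th\<close>, and the derivative \<open>h\<close> along \<open>H\<^sub>0\<close>.\<close>

definition fld :: "('d::finite pg => real) => ('d pg => real^'d => real) => ('d pg => real^'d => real)
 => ('d pg => real) => bool" where
 "fld f d1 d2 h \<longleftrightarrow> f \<in> borel_measurable borel & h \<in> borel_measurable borel
 & (\<forall>th. (%x. d1 x th) \<in> borel_measurable borel & (%x. d2 x th) \<in> borel_measurable borel)
 & (\<forall>x\<in>Gtilde. ((%s. f (fst x, snd x + s *\<^sub>R (fst x *v ev None))) has_real_derivative h x) (at 0)
 & (\<forall>th. norm th = 1 --> d1 x th = (\<Sum>i\<in>UNIV. th $ i * d1 x (axis i 1))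
 & (\<forall>r. ((%r. f (mv x r th)) has_real_derivative d1 (mv x r th) th) (at r)
 & ((%r. d1 (mv x r th) th) has_real_derivative d2 (mv x r th) th) (at r))))"

definition bnd :: "real => ('d::finite pg => real) => ('d pg => real^'d => real) => ('d pg => real^'d => real)
 => ('d pg => real) => bool" where
 "bnd C f d1 d2 h \<longleftrightarrow> (\<forall>x\<in>Gtilde. \<bar>f x\<bar> <= C & \<bar>h x\<bar> <= C & (\<forall>th. norm th = 1 --> \<bar>d1 x th\<bar> <= C & \<bar>d2 x th\<bar> <= C))"

lemma fldD:
 assumes "fld f d1 d2 h"
 shows "f \<in> borel_measurable borel" "h \<in> borel_measurable borel" "(%x. d1 x th) \<in> borel_measurable borel"
 "(%x. d2 x th) \<in> borel_measurable borel"
 "x \<in> Gtilde ==> ((%s. f (fst x, snd x + s *\<^sub>R (fst x *v ev None))) has_real_derivative h x) (at 0)"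
 "x \<in> Gtilde ==> norm th = 1 ==> d1 x th = (\<Sum>i\<in>UNIV. th $ i * d1 x (axis i 1))"
 "x \<in> Gtilde ==> norm th = 1 ==> ((%r. f (mv x r th)) has_real_derivative d1 (mv x r th) th) (at r)"
 "x \<in> Gtilde ==> norm th = 1 ==> ((%r. d1 (mv x r th) th) has_real_derivative d2 (mv x r th) th) (at r)" using assms unfolding fld_def by blast+

lemma fld_mult:
 assumes f: "fld f d1 d2 h" and g: "fld g e1 e2 k"
 shows "fld (%x. f x * g x) (%x th. f x * e1 x th + d1 x th * g x)
 (%x th. f x * e2 x th + 2 * d1 x th * e1 x th + d2 x th * g x) (%x. f x * k x + h x * g x)"
proof -
 note m [measurable] = fldD(1-4)[OF f] fldD(1-4)[OF g]
 show ?thesis unfolding fld_def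
proof (intro conjI allI ballI impI)
 fix x :: "'a pg" and th :: "real^'a" and r :: real assume x: "x \<in> Gtilde"
 show "((%s. f (fst x, snd x + s *\<^sub>R (fst x *v ev None)) * g (fst x, snd x + s *\<^sub>R (fst x *v ev None)))
 has_real_derivative f x * k x + h x * g x) (at 0)" using DERIV_mult[OF fldD(5)[OF f x] fldD(5)[OF g x]] by (simp add: algebra_simps)
 assume t: "norm th = 1"
 show "f x * e1 x th + d1 x th * g x = (\<Sum>i\<in>UNIV. th $ i * (f x * e1 x (axis i 1) + d1 x (axis i 1) * g x))" unfolding fldD(6)[OF f x t] fldD(6)[OF g x t] by (simp add: sum_distrib_left sum_distrib_right sum.distrib[symmetric] algebra_simps)
 show "((%r. f (mv x r th) * g (mv x r th)) has_real_derivative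
 f (mv x r th) * e1 (mv x r th) th + d1 (mv x r th) th * g (mv x r th)) (at r)" using DERIV_mult[OF fldD(7)[OF f x t] fldD(7)[OF g x t]] by (simp add: algebra_simps)
 show "((%r. f (mv x r th) * e1 (mv x r th) th + d1 (mv x r th) th * g (mv x r th)) has_real_derivative
 f (mv x r th) * e2 (mv x r th) th + 2 * d1 (mv x r th) th * e1 (mv x r th) th + d2 (mv x r th) th * g (mv x r th)) (at r)" by (rule DERIV_cong[OF DERIV_add[OF DERIV_mult[OF fldD(7)[OF f x t] fldD(8)[OF g x t]]
 DERIV_mult[OF fldD(8)[OF f x t] fldD(7)[OF g x t]]]]) (simp add: algebra_simps)
qed measurable
qed

lemma fld_affine:
 assumes f: "fld f d1 d2 h"
 shows "fld (%x. a + b * f x) (%x th. b * d1 x th) (%x th. b * d2 x th) (%x. b * h x)"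
proof -
 note m [measurable] = fldD(1-4)[OF f]
 show ?thesis unfolding fld_def
proof (intro conjI allI ballI impI)
 fix x :: "'a pg" and th :: "real^'a" and r :: real assume x: "x \<in> Gtilde"
 show "((%s. a + b * f (fst x, snd x + s *\<^sub>R (fst x *v ev None))) has_real_derivative b * h x) (at 0)" using DERIV_add[OF DERIV_const DERIV_cmult[OF fldD(5)[OF f x]]] by simp
 assume t: "norm th = 1"
 show "b * d1 x th = (\<Sum>i\<in>UNIV. th $ i * (b * d1 x (axis i 1)))" unfolding fldD(6)[OF f x t] by (simp add: sum_distrib_left algebra_simps)
 show "((%r. a + b * f (mv x r th)) has_real_derivative b * d1 (mv x r th) th) (at r)" using DERIV_add[OF DERIV_const DERIV_cmult[OF fldD(7)[OF f x t]]] by simp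
 show "((%r. b * d1 (mv x r th) th) has_real_derivative b * d2 (mv x r th) th) (at r)" using DERIV_cmult[OF fldD(8)[OF f x t]] by simp
qed measurable
qed

lemma fld_snd:
 assumes [measurable]: "k \<in> borel_measurable borel" "k' \<in> borel_measurable borel"
 and d: "!!x. x \<in> Gtilde ==> ((%s. k (snd x + s *\<^sub>R (fst x *v ev None))) has_real_derivative k' x) (at 0)"
 shows "fld (%x. k (snd x)) (%x th. 0) (%x th. 0) k'"
proof -
 have [measurable]: "snd \<in> borel_measurable (borel :: ('a pg) measure)" by (intro borel_measurable_continuous_onI continuous_intros)
 have "(%x::'a pg. k (snd x)) \<in> borel_measurable borel" by measurable
 then show ?thesis unfolding fld_def using d by (auto simp: mv_def)
qed

section \<open>The logarithmic norm along boosts and its truncation\<close>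

lemma inner_matrix_mult: "inner (A ** B) C = inner A (C ** transpose B)" for A :: "real^'n^'m" and B :: "real^'k^'n"
proof -
 have "inner (A ** B) C = (\<Sum>i\<in>UNIV. \<Sum>j\<in>UNIV. \<Sum>l\<in>UNIV. A $ i $ l * B $ l $ j * C $ i $ j)" by (simp add: inner_vec_def matrix_matrix_mult_def sum_distrib_right)
 also have "... = (\<Sum>i\<in>UNIV. \<Sum>l\<in>UNIV. \<Sum>j\<in>UNIV. A $ i $ l * B $ l $ j * C $ i $ j)" by (intro sum.cong refl sum.swap)
 also have "... = inner A (C ** transpose B)" by (simp add: inner_vec_def matrix_matrix_mult_def transpose_def sum_distrib_left algebra_simps)
 finally show ?thesis .
qed

lemma norm_Vth_mult_le: "norm th = 1 ==> norm (Vth th *v u) <= norm u"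
proof (rule power2_le_imp_le)
 assume "norm th = 1"
 then show "(norm (Vth th *v u))\<^sup>2 <= (norm u)\<^sup>2" using Cauchy_Schwarz_ineq2[of th "sp u"] abs_le_square_iff[of "inner th (sp u)" "norm (sp u)"] by (simp add: Vth_mult norm_mvec)
qed simp

lemma norm_mult_Vth_le:
 assumes "norm th = 1" shows "norm (U ** Vth th) <= norm (U :: real^('d::finite option)^'m)"
proof (rule power2_le_imp_le)
 have "norm (U ** Vth th) = norm (Vth th ** transpose U)" by (metis norm_transpose_matrix matrix_transpose_mul Vth_sym)
 then have "(norm (U ** Vth th))\<^sup>2 = (\<Sum>j\<in>UNIV. (norm (Vth th *v (transpose U *v axis j 1)))\<^sup>2)" by (simp only: norm_matrix_cols matrix_vector_mul_assoc)
 also have "... <= (\<Sum>j\<in>UNIV. (norm (transpose U *v axis j 1))\<^sup>2)" by (intro sum_mono power_mono norm_Vth_mult_le assms) simp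
 also have "... = (norm U)\<^sup>2" by (simp only: norm_matrix_cols[symmetric] norm_transpose_matrix)
 finally show "(norm (U ** Vth th))\<^sup>2 <= (norm U)\<^sup>2" .
qed simp

text \<open>The left factor A is kept general because it takes three roles: the identity for
  cutoffs, members of a countable dense set for increments from a random base point, and a single
  row for the norm of g^-1 v.\<close>

definition lnF :: "real^('d::finite option)^'m => 'd pg => real" where
 "lnF A x = ln (norm (A ** fst x))"

definition lnF1 :: "real^('d::finite option)^'m => 'd pg => real^'d => real" where
 "lnF1 A x th = inner (A ** fst x ** Vth th) (A ** fst x) / (norm (A ** fst x))\<^sup>2"

definition lnF2 :: "real^('d::finite option)^'m => 'd pg => real^'d => real" where
 "lnF2 A x th = 2 * (norm (A ** fst x ** Vth th))\<^sup>2 / (norm (A ** fst x))\<^sup>2 - 2 * (lnF1 A x th)\<^sup>2"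

lemma fst_snd_measurable [measurable]:
 "fst \<in> borel_measurable (borel :: ('a::second_countable_topology \<times> 'b::second_countable_topology) measure)"
 "snd \<in> borel_measurable (borel :: ('a::second_countable_topology \<times> 'b::second_countable_topology) measure)" by (intro borel_measurable_continuous_onI continuous_intros)+

lemma lnF_measurable [measurable]:
 "lnF A \<in> borel_measurable borel" "(%x. lnF1 A x th) \<in> borel_measurable borel" "(%x. lnF2 A x th) \<in> borel_measurable borel" unfolding lnF_def lnF1_def lnF2_def by measurable

lemma mult_Ggrp_nonzero:
 assumes "A ~= 0" "g \<in> Ggrp" shows "A ** g ~= 0"
proof
 assume "A ** g = 0"
 then have "A ** (g ** matrix_inv g) = 0" by (simp only: matrix_mul_assoc bounded_bilinear.zero_left[OF bounded_bilinear_matrix_mult])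
 then show False using assms by simp
qed

text \<open>For unit th the matrix \<open>Vth th\<close> does not increase norms, so the logarithmic
  norm is 1-Lipschitz along boosts. Large jumps are therefore controlled by the first moment of
  nu.\<close>

lemma lnF1_bound: 
 assumes "norm th = 1" shows "\<bar>lnF1 A x th\<bar> <= 1"
proof -
 let ?U = "A ** fst x"
 have "\<bar>inner (?U ** Vth th) ?U\<bar> <= norm ?U * norm ?U" using Cauchy_Schwarz_ineq2[of "?U ** Vth th" ?U] mult_right_mono[OF norm_mult_Vth_le[OF assms, of ?U], of "norm ?U"] by simp
 then show ?thesis by (cases "?U = 0") (simp_all add: lnF1_def power2_eq_square)
qed

text \<open>Nonnegativity is Cauchy-Schwarz and says that the logarithmic norm is convex along
  boosts.\<close>

lemma lnF2_bounds: 
 assumes "norm th = 1" shows "0 <= lnF2 A x th" "lnF2 A x th <= 2"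
proof -
 let ?U = "A ** fst x" and ?W = "A ** fst x ** Vth th"
 have "(lnF1 A x th)\<^sup>2 <= (norm ?W)\<^sup>2 / (norm ?U)\<^sup>2"
proof (cases "?U = 0")
case False
 have "(inner ?W ?U)\<^sup>2 <= (norm ?W)\<^sup>2 * (norm ?U)\<^sup>2" using Cauchy_Schwarz_ineq[of ?W ?U] by (simp add: power2_norm_eq_inner)
 then have "(inner ?W ?U)\<^sup>2 / ((norm ?U)\<^sup>2)\<^sup>2 <= (norm ?W)\<^sup>2 * (norm ?U)\<^sup>2 / ((norm ?U)\<^sup>2)\<^sup>2" by (intro divide_right_mono) auto
 then show ?thesis using False by (simp add: lnF1_def power_divide power2_eq_square)
qed (simp add: lnF1_def)
 then show "0 <= lnF2 A x th" by (simp add: lnF2_def)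
 have "(norm ?W)\<^sup>2 <= (norm ?U)\<^sup>2" by (intro power_mono norm_mult_Vth_le assms) simp
 then have "2 * (norm ?W)\<^sup>2 / (norm ?U)\<^sup>2 <= 2" by (cases "?U = 0") (simp_all only: divide_le_eq, simp_all)
 then show "lnF2 A x th <= 2" using zero_le_power2[of "lnF1 A x th"] unfolding lnF2_def by linarith
qed

lemma lnF1_linear: "lnF1 A x th = (\<Sum>i\<in>UNIV. th $ i * lnF1 A x (axis i 1))"
proof -
 have "U ** Vth th = (\<Sum>i\<in>UNIV. th $ i *\<^sub>R (U ** Vb i))" for U :: "real^('a option)^'b" unfolding Vth_def by (simp add: bounded_bilinear.sum_right[OF bounded_bilinear_matrix_mult] matrix_scaleR_mult)
 then show ?thesis by (simp add: lnF1_def inner_sum_left sum_divide_distrib Vth_axis)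
qed

lemma boost_deriv:
 assumes "norm th = 1"
 shows "((%r. boost r th) has_vector_derivative boost r th ** Vth th) (at r)"
proof -
 let ?V = "Vth th"
 have "((%r. boost r th) has_vector_derivative (0 + cosh r *\<^sub>R ?V + (sinh r) *\<^sub>R (?V ** ?V))) (at r)" unfolding boost_def by (intro has_vector_derivative_add has_vector_derivative_const has_vector_derivative_scaleR[THEN has_vector_derivative_eq_rhs] 
 | (auto intro!: derivative_eq_intros)[1])+ 
 moreover have "boost r th ** ?V = 0 + cosh r *\<^sub>R ?V + (sinh r) *\<^sub>R (?V ** ?V)" unfolding boost_def by (simp add: matrix_add_mult matrix_scaleR_mult Vth_cube[OF assms] algebra_simps)
 ultimately show ?thesis by simp
qed

lemma lnF_deriv:
 fixes A :: "real^('d::finite option)^'m"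
 assumes "A ~= 0" "x \<in> Gtilde" "norm th = 1"
 shows "((%r. lnF A (mv x r th)) has_real_derivative lnF1 A (mv x r th) th) (at r)"
 "((%r. lnF1 A (mv x r th) th) has_real_derivative lnF2 A (mv x r th) th) (at r)"
proof -
 let ?V = "Vth th"
 define W where "W r = A ** (fst x ** boost r th)" for r
 have W: "W r = A ** fst (mv x r th)" for r by (simp add: W_def mv_def)
 have W0: "W r ~= 0" for r unfolding W using mult_Ggrp_nonzero[OF assms(1)] mv_Gtilde[OF assms(2,3), of r] by (auto simp: Gtilde_def)
 have dW: "(W has_vector_derivative W r ** ?V) (at r)" for r
proof -
 have "bounded_linear (%B. A ** (fst x ** B))" by (intro bounded_linear_compose[OF bounded_bilinear.bounded_linear_right[OF bounded_bilinear_matrix_mult]]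
 bounded_bilinear.bounded_linear_right[OF bounded_bilinear_matrix_mult])
 from bounded_linear.has_vector_derivative[OF this boost_deriv[OF assms(3)]]
 show ?thesis by (simp add: W_def[abs_def] matrix_mul_assoc)
qed
 have dWV: "((%r. W r ** ?V) has_vector_derivative W r ** ?V ** ?V) (at r)" for r by (rule bounded_linear.has_vector_derivative[OF bounded_bilinear.bounded_linear_left[OF bounded_bilinear_matrix_mult] dW])
 have ip: "((%r. inner (P r) (Q r)) has_real_derivative inner (P r) Q' + inner P' (Q r)) (at r)"
 if "(P has_vector_derivative P') (at r)" "(Q has_vector_derivative Q') (at r)" for P Q :: "real => real^('d option)^'m" and P' Q' r using bounded_bilinear.has_vector_derivative[OF bounded_bilinear_inner that] by (simp add: has_real_derivative_iff_has_vector_derivative)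
 have dn: "((%r. inner (W r) (W r)) has_real_derivative 2 * inner (W r ** ?V) (W r)) (at r)" for r by (rule DERIV_cong[OF ip[OF dW dW]]) (simp add: inner_commute)
 have di: "((%r. inner (W r ** ?V) (W r)) has_real_derivative 2 * (norm (W r ** ?V))\<^sup>2) (at r)" for r by (rule DERIV_cong[OF ip[OF dWV dW]]) (simp add: inner_matrix_mult[of "W r ** ?V" ?V "W r"] Vth_sym power2_norm_eq_inner)
 have p: "inner (W r) (W r) > 0" for r using W0 by simp
 have l: "lnF A (mv x r th) = ln (inner (W r) (W r)) / 2" for r using W0[of r] by (simp add: lnF_def W[symmetric] power2_norm_eq_inner[symmetric] ln_realpow)
 have l1: "lnF1 A (mv x r th) th = inner (W r ** ?V) (W r) / inner (W r) (W r)" for r by (simp add: lnF1_def W[symmetric] power2_norm_eq_inner)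
 show "((%r. lnF A (mv x r th)) has_real_derivative lnF1 A (mv x r th) th) (at r)" unfolding l l1 by (rule DERIV_cong[OF DERIV_cdivide[OF DERIV_chain2[OF DERIV_ln_divide[OF p] dn]]]) simp
 show "((%r. lnF1 A (mv x r th) th) has_real_derivative lnF2 A (mv x r th) th) (at r)" unfolding lnF2_def l1 W[symmetric] power2_norm_eq_inner by (rule DERIV_cong[OF DERIV_divide[OF di dn]])
 (use p[of r] in \<open>simp_all add: power2_norm_eq_inner\<close>, simp add: power2_eq_square field_simps)
qed

lemma lnF_lipschitz:
 assumes "A ~= 0" "x \<in> Gtilde" "norm th = 1"
 shows "\<bar>lnF A (mv x r th) - lnF A x\<bar> <= \<bar>r\<bar>" using lipschitz_deriv_bound[of "%r. lnF A (mv x r th)" _ 1 r 0, OF lnF_deriv(1)[OF assms] lnF1_bound[OF assms(3)]] by simp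

text \<open>Written through the squared norm, hence C^2 on the whole ambient space of pairs; on the
  group it is \<open>phi\<close> of the rescaled and centred \<open>lnF\<close>
  (\<open>kf_eq\<close>).\<close>

definition kf :: "real => real => real^('d::finite option)^'m => 'd pg => real" where
 "kf R c A x = kap R c ((norm (A ** fst x))\<^sup>2)"

definition kf1 :: "real => real => real^('d::finite option)^'m => 'd pg => real^'d => real" where
 "kf1 R c A x th = phi1 (lnF A x / R - c) / R * lnF1 A x th"

definition kf2 :: "real => real => real^('d::finite option)^'m => 'd pg => real^'d => real" where
 "kf2 R c A x th = phi2 (lnF A x / R - c) / R\<^sup>2 * (lnF1 A x th)\<^sup>2 + phi1 (lnF A x / R - c) / R * lnF2 A x th"

lemma phi_measurable [measurable]: "phi \<in> borel_measurable borel" "phi1 \<in> borel_measurable borel" "phi2 \<in> borel_measurable borel" unfolding phi_def phi1_def phi2_def by measurable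

lemma C2b_kf: "R > 0 ==> C2b (kf R c A)" unfolding kf_def[abs_def] by (intro C2b_kap C2b_norm_square bounded_linear_compose[OF bounded_bilinear.bounded_linear_right[OF bounded_bilinear_matrix_mult]]
 bounded_linear_fst)

lemma kf_eq: "A ~= 0 ==> x \<in> Gtilde ==> kf R c A x = phi (lnF A x / R - c)" unfolding kf_def lnF_def by (rule kap_norm) (auto simp: Gtilde_def mult_Ggrp_nonzero)

lemma fld_kf:
 assumes "R > 0" "A ~= 0"
 shows "fld (kf R c A) (kf1 R c A) (kf2 R c A) (%x. 0)" unfolding fld_def
proof (intro conjI allI ballI impI)
 show "kf R c A \<in> borel_measurable borel" by (intro borel_measurable_continuous_onI C2b_continuous C2b_kf assms)
 fix x :: "'a pg" and th :: "real^'a" and r :: real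
 show "(%x. kf1 R c A x th) \<in> borel_measurable borel" "(%x. kf2 R c A x th) \<in> borel_measurable borel" unfolding kf1_def kf2_def by measurable
 assume x: "x \<in> Gtilde"
 show "((%s. kf R c A (fst x, snd x + s *\<^sub>R (fst x *v ev None))) has_real_derivative 0) (at 0)" by (simp add: kf_def)
 assume t: "norm th = 1"
 show "kf1 R c A x th = (\<Sum>i\<in>UNIV. th $ i * kf1 R c A x (axis i 1))" unfolding kf1_def lnF1_linear[of A x th] by (simp add: sum_distrib_left algebra_simps)
 have e: "kf R c A (mv x r th) = phi (lnF A (mv x r th) / R - c)" for r by (intro kf_eq assms mv_Gtilde x t)
 have d: "((%r. lnF A (mv x r th) / R - c) has_real_derivative lnF1 A (mv x r th) th / R) (at r)" using DERIV_diff[OF DERIV_cdivide[OF lnF_deriv(1)[OF assms(2) x t]] DERIV_const] by simp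
 show "((%r. kf R c A (mv x r th)) has_real_derivative kf1 R c A (mv x r th) th) (at r)" unfolding e kf1_def using DERIV_chain2[OF phi_deriv d] by simp
 show "((%r. kf1 R c A (mv x r th) th) has_real_derivative kf2 R c A (mv x r th) th) (at r)" unfolding kf1_def kf2_def by (rule DERIV_cong[OF DERIV_mult[OF DERIV_cdivide[OF DERIV_chain2[OF phi1_deriv d]] lnF_deriv(2)[OF assms(2) x t]]])
 (simp add: power2_eq_square mult_ac)
qed simp_all

lemma kf_bounds:
 assumes "R > 0" "norm th = 1"
 shows "\<bar>kf R c A x\<bar> <= 2" "\<bar>kf1 R c A x th\<bar> <= 1 / R" "\<bar>kf2 R c A x th\<bar> <= 1 / R\<^sup>2 + 2 / R"
proof -
 show "\<bar>kf R c A x\<bar> <= 2" by (auto simp: kf_def kap_def phi_bound)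
 have a: "\<bar>phi1 y\<bar> <= 1" for y using phi1_bounds[of y] by auto
 have b: "(lnF1 A x th)\<^sup>2 <= 1" using lnF1_bound[OF assms(2), of A x] by (simp add: abs_square_le_1)
 have "\<bar>phi1 (lnF A x / R - c)\<bar> * \<bar>lnF1 A x th\<bar> <= 1 * 1" by (intro mult_mono a lnF1_bound assms) auto
 then show "\<bar>kf1 R c A x th\<bar> <= 1 / R" using assms by (simp add: kf1_def abs_mult divide_simps)
 have "\<bar>phi2 (lnF A x / R - c)\<bar> * (lnF1 A x th)\<^sup>2 <= 1 * 1" by (intro mult_mono phi2_bound b) auto
 then have 1: "\<bar>phi2 (lnF A x / R - c) / R\<^sup>2 * (lnF1 A x th)\<^sup>2\<bar> <= 1 / R\<^sup>2" using assms by (simp add: abs_mult divide_simps)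
 have "\<bar>phi1 (lnF A x / R - c)\<bar> * \<bar>lnF2 A x th\<bar> <= 1 * 2" using lnF2_bounds[OF assms(2), of A x] by (intro mult_mono a) auto
 then have 2: "\<bar>phi1 (lnF A x / R - c) / R * lnF2 A x th\<bar> <= 2 / R" using assms by (simp add: abs_mult divide_simps)
 show "\<bar>kf2 R c A x th\<bar> <= 1 / R\<^sup>2 + 2 / R" unfolding kf2_def using 1 2 by linarith
qed

section \<open>The generator\<close>

lemma vec_nth_measurable [measurable (raw)]:
 fixes f :: "'a => real^'n"
 shows "f \<in> borel_measurable M ==> (%x. f x $ i) \<in> borel_measurable M" by (rule borel_measurable_continuous_on[of "%v. v $ i"]) (intro continuous_intros)

context levy_measure
begin

definition dint :: "(real => real^'d::finite => real) => real" where
 "dint k = (\<integral>r. (\<integral>th. k r th \<partial>sphere_unif) \<partial>nu)"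

text \<open>Joint measurability together with an integrable radial majorant. The majorant is
  required on r > 0 and unit directions, which carry the full mass of nu and of the sphere measure;
  it justifies every exchange of limit and jump integral below.\<close>

definition dom :: "(real => real^'d::finite => real) => (real => real) => bool" where
 "dom k b \<longleftrightarrow> (%p. k (fst p) (snd p)) \<in> borel_measurable (borel \<Otimes>\<^sub>M borel) & integrable nu b
 & (\<forall>r>0. \<forall>th. norm th = 1 --> \<bar>k r th\<bar> <= b r)"

lemma dom_measurable:
 fixes k :: "real => real^'d::finite => real"
 assumes "dom k b" shows "k r \<in> borel_measurable borel" "(%r. \<integral>th. k r th \<partial>sphere_unif) \<in> borel_measurable nu"
proof -
 have [measurable]: "(%p. k (fst p) (snd p)) \<in> borel_measurable (borel \<Otimes>\<^sub>M borel)" using assms by (simp add: dom_def)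
 have "(%th. (%p. k (fst p) (snd p)) (r, th)) \<in> borel_measurable borel" by measurable
 then show "k r \<in> borel_measurable borel" by simp
 interpret prob_space "sphere_unif :: (real^'d) measure" by (rule prob_space_sphere_unif)
 have "(%(r, th). k r th) \<in> borel_measurable (nu \<Otimes>\<^sub>M sphere_unif)" by (simp add: split_beta') measurable
 then show "(%r. \<integral>th. k r th \<partial>sphere_unif) \<in> borel_measurable nu"  by (rule borel_measurable_lebesgue_integral)
qed

lemma dom_AE:
 fixes k :: "real => real^'d::finite => real"
 assumes "dom k b" "r > 0" shows "AE th in sphere_unif. \<bar>k r th\<bar> <= b r" using AE_sphere_unif by eventually_elim (use assms in \<open>auto simp: dom_def\<close>)

lemma dom_inner:
 fixes k :: "real => real^'d::finite => real"
 assumes "dom k b" "r > 0"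
 shows "integrable sphere_unif (k r)" "\<bar>\<integral>th. k r th \<partial>sphere_unif\<bar> <= b r"
proof -
 interpret prob_space "sphere_unif :: (real^'d) measure" by (rule prob_space_sphere_unif)
 have [measurable]: "k r \<in> borel_measurable borel" by (rule dom_measurable[OF assms(1)])
 show i: "integrable sphere_unif (k r)" by (rule integrable_const_bound[where B = "b r"]) (use dom_AE[OF assms] in auto)
 have "\<bar>\<integral>th. k r th \<partial>sphere_unif\<bar> <= (\<integral>th. \<bar>k r th\<bar> \<partial>sphere_unif)" by (rule integral_abs_bound)
 also have "... <= (\<integral>th. b r \<partial>(sphere_unif :: (real^'d) measure))" by (rule integral_mono_AE) (use i dom_AE[OF assms] in auto)
 finally show "\<bar>\<integral>th. k r th \<partial>sphere_unif\<bar> <= b r" using prob_space by simp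
qed

lemma dom_outer:
 fixes k :: "real => real^'d::finite => real"
 assumes "dom k b" 
 shows "integrable nu (%r. \<integral>th. k r th \<partial>sphere_unif)" "\<bar>dint k\<bar> <= (\<integral>r. b r \<partial>nu)"
proof -
 have b: "integrable nu b" using assms by (simp add: dom_def)
 have ae: "AE r in nu. \<bar>\<integral>th. k r th \<partial>sphere_unif\<bar> <= b r" using nu_pos by eventually_elim (rule dom_inner[OF assms])
 show i: "integrable nu (%r. \<integral>th. k r th \<partial>sphere_unif)"
proof (rule Bochner_Integration.integrable_bound[OF b dom_measurable(2)[OF assms]])
 show "AE r in nu. norm (\<integral>th. k r th \<partial>sphere_unif) <= norm (b r)" using ae by eventually_elim auto
qed
 have "\<bar>dint k\<bar> <= (\<integral>r. \<bar>\<integral>th. k r th \<partial>sphere_unif\<bar> \<partial>nu)" unfolding dint_def by (rule integral_abs_bound)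
 also have "... <= (\<integral>r. b r \<partial>nu)" by (rule integral_mono_AE) (use i b ae in auto)
 finally show "\<bar>dint k\<bar> <= (\<integral>r. b r \<partial>nu)" .
qed

lemma dint_cong:
 fixes k l :: "real => real^'d::finite => real"
 assumes "dom k b" "dom l c" "!!r th. r > 0 ==> norm th = 1 ==> k r th = l r th"
 shows "dint k = dint l" unfolding dint_def
proof (rule integral_cong_AE)
 show "AE r in nu. (\<integral>th. k r th \<partial>sphere_unif) = (\<integral>th. l r th \<partial>sphere_unif)" using nu_pos
proof eventually_elim
case (elim r)
 have "AE th in sphere_unif. k r th = l r th" using AE_sphere_unif by eventually_elim (use assms(3) elim in auto)
 then show ?case using dom_measurable(1)[OF assms(1)] dom_measurable(1)[OF assms(2)] by (intro integral_cong_AE) auto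
qed
qed (rule dom_measurable(2)[OF assms(1)] dom_measurable(2)[OF assms(2)])+

lemma dom_linear:
 fixes k l :: "real => real^'d::finite => real"
 assumes "dom k b" "dom l c"
 shows "dom (%r th. u * k r th + v * l r th) (%r. \<bar>u\<bar> * b r + \<bar>v\<bar> * c r)" unfolding dom_def
proof (intro conjI allI impI)
 have [measurable]: "(%p. k (fst p) (snd p)) \<in> borel_measurable (borel \<Otimes>\<^sub>M borel)" "(%p. l (fst p) (snd p)) \<in> borel_measurable (borel \<Otimes>\<^sub>M borel)" using assms by (simp_all add: dom_def)
 show "(%p. u * k (fst p) (snd p) + v * l (fst p) (snd p)) \<in> borel_measurable (borel \<Otimes>\<^sub>M borel)" by measurable
 show "integrable nu (%r. \<bar>u\<bar> * b r + \<bar>v\<bar> * c r)" using assms by (simp add: dom_def)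
 fix r th assume "r > (0::real)" "norm (th::real^'d) = 1"
 then have "\<bar>k r th\<bar> <= b r" "\<bar>l r th\<bar> <= c r" using assms by (auto simp: dom_def)
 then have "\<bar>u * k r th\<bar> <= \<bar>u\<bar> * b r" "\<bar>v * l r th\<bar> <= \<bar>v\<bar> * c r" by (simp_all add: abs_mult mult_left_mono)
 then show "\<bar>u * k r th + v * l r th\<bar> <= \<bar>u\<bar> * b r + \<bar>v\<bar> * c r" by linarith
qed

lemma dint_linear:
 fixes k l :: "real => real^'d::finite => real"
 assumes "dom k b" "dom l c"
 shows "dint (%r th. u * k r th + v * l r th) = u * dint k + v * dint l"
proof -
 have "dint (%r th. u * k r th + v * l r th) = (\<integral>r. u * (\<integral>th. k r th \<partial>sphere_unif) + v * (\<integral>th. l r th \<partial>sphere_unif) \<partial>nu)" unfolding dint_def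
proof (rule integral_cong_AE)
 show "AE r in nu. (\<integral>th. u * k r th + v * l r th \<partial>sphere_unif) = u * (\<integral>th. k r th \<partial>sphere_unif) + v * (\<integral>th. l r th \<partial>sphere_unif)" using nu_pos by eventually_elim (simp add: dom_inner[OF assms(1)] dom_inner[OF assms(2)])
qed (use dom_measurable(2)[OF dom_linear[OF assms, of u v]] dom_measurable(2)[OF assms(1)] dom_measurable(2)[OF assms(2)] in auto)
 then show ?thesis using dom_outer(1)[OF assms(1)] dom_outer(1)[OF assms(2)] by (simp add: dint_def)
qed

text \<open>Dominated convergence applied twice, on the sphere with the constant b r and then in r
  with b.\<close>

lemma dint_convergence:
 fixes l :: "real => real^'d::finite => real"
 assumes "!!n. dom (k n) b" "dom l c" "!!r th. r > 0 ==> norm th = 1 ==> (%n. k n r th) \<longlonglongrightarrow> l r th"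
 shows "(%n. dint (k n)) \<longlonglongrightarrow> dint l" unfolding dint_def
proof (rule integral_dominated_convergence[where w = b])
 show "AE r in nu. (%n. \<integral>th. k n r th \<partial>sphere_unif) \<longlonglongrightarrow> (\<integral>th. l r th \<partial>sphere_unif)" using nu_pos
proof eventually_elim
case (elim r)
 interpret prob_space "sphere_unif :: (real^'d) measure" by (rule prob_space_sphere_unif)
 show ?case
proof (rule integral_dominated_convergence[where w = "%_. b r"])
 show "AE th in sphere_unif. (%n. k n r th) \<longlonglongrightarrow> l r th" using AE_sphere_unif by eventually_elim (use assms(3) elim in auto)
 show "AE th in sphere_unif. norm (k n r th) <= b r" for n using dom_AE[OF assms(1) elim] by simp
qed (use dom_measurable(1)[OF assms(1)] dom_measurable(1)[OF assms(2)] in auto)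
qed
 show "AE r in nu. norm (\<integral>th. k n r th \<partial>sphere_unif) <= b r" for n using nu_pos by eventually_elim (simp add: dom_inner(2)[OF assms(1)])
qed (use assms(1)[of 0] dom_measurable(2)[OF assms(1)] dom_measurable(2)[OF assms(2)] in \<open>auto simp: dom_def\<close>)

lemma dint_measurable:
 fixes k :: "'a => real => real^'d::finite => real"
 assumes [measurable]: "(%p. k (fst p) (fst (snd p)) (snd (snd p))) \<in> borel_measurable (N \<Otimes>\<^sub>M (borel \<Otimes>\<^sub>M borel))"
 shows "(%x. dint (k x)) \<in> borel_measurable N"
proof -
 interpret prob_space "sphere_unif :: (real^'d) measure" by (rule prob_space_sphere_unif)
 have "(%p. (%p. k (fst p) (fst (snd p)) (snd (snd p))) (fst (fst p), (snd (fst p), snd p))) \<in> borel_measurable ((N \<Otimes>\<^sub>M nu) \<Otimes>\<^sub>M sphere_unif)" by measurable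
 then have "(%(y, th). k (fst y) (snd y) th) \<in> borel_measurable ((N \<Otimes>\<^sub>M nu) \<Otimes>\<^sub>M sphere_unif)" by (simp add: split_beta')
 then have [measurable]: "(%y. \<integral>th. k (fst y) (snd y) th \<partial>sphere_unif) \<in> borel_measurable (N \<Otimes>\<^sub>M nu)" by (rule borel_measurable_lebesgue_integral)
 then have "(%(x, r). \<integral>th. k x r th \<partial>sphere_unif) \<in> borel_measurable (N \<Otimes>\<^sub>M nu)" by (simp add: split_beta')
 then show ?thesis unfolding dint_def by (rule nu.borel_measurable_lebesgue_integral)
qed

section \<open>Generator and carre du champ in closed form\<close>

definition Jf :: "('d::finite pg => real) => ('d pg => real^'d => real) => 'd pg => real => real^'d => real" where
 "Jf f d1 x r th = f (mv x r th) - f x - (if r <= 1 then r else 0) * (\<Sum>i\<in>UNIV. th $ i * d1 x (axis i 1))"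

text \<open>The generator computed from supplied derivatives instead of \<open>deriv\<close>. It
  stays meaningful and measurable for functions such as \<open>lnF\<close> that are not themselves
  test functions.\<close>

definition Gf :: "('d::finite pg => real) => ('d pg => real^'d => real) => ('d pg => real^'d => real) => ('d pg => real) => 'd pg => real" where
 "Gf f d1 d2 h x = h x + sg\<^sup>2 / 2 * (\<Sum>i\<in>UNIV. d2 x (axis i 1)) + dint (Jf f d1 x)"

text \<open>The carre du champ L(f^2) - 2 f L f, see \<open>Gf_square\<close>.\<close>

definition Gam :: "('d::finite pg => real) => ('d pg => real^'d => real) => 'd pg => real" where
 "Gam f d1 x = sg\<^sup>2 * (\<Sum>i\<in>UNIV. (d1 x (axis i 1))\<^sup>2) + dint (%r th. (f (mv x r th) - f x)\<^sup>2)"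

text \<open>The derivatives in \<open>genL\<close> agree with the supplied ones on the group. The
  jump integrands agree for unit directions only, which is almost everywhere for the sphere
  measure.\<close>

lemma genL_eq:
 assumes f: "fld f d1 d2 h" and x: "x \<in> Gtilde"
 shows "genL sg nu f x = Gf f d1 d2 h x"
proof -
 note m [measurable] = fldD(1-4)[OF f]
 have H: "lfield H0 f x = h x" unfolding lfield_def texp_H0 using fldD(5)[OF f x] by (rule DERIV_imp_deriv)
 have V: "lfield (Vt i) f y = d1 y (axis i 1)" if "y \<in> Gtilde" for y i unfolding lfield_def texp_Vt using fldD(7)[OF f that, of "axis i 1" 0] by (intro DERIV_imp_deriv) simp
 have VV: "lfield (Vt i) (lfield (Vt i) f) x = d2 x (axis i 1)" for i
proof -
 have "lfield (Vt i) (lfield (Vt i) f) x = deriv (%s. d1 (mv x s (axis i 1)) (axis i 1)) 0" unfolding lfield_def[of "Vt i" "lfield (Vt i) f"] texp_Vt by (simp add: V mv_Gtilde x)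
 also have "... = d2 x (axis i 1)" using fldD(8)[OF f x, of "axis i 1" 0] by (intro DERIV_imp_deriv) simp
 finally show ?thesis .
qed
 have inner: "(\<integral>th. (f (pmult x (Smap r th)) - f x - (if r <= 1 then r else 0) * (\<Sum>i\<in>UNIV. (th $ i) * lfield (Vt i) f x)) \<partial>sphere_unif)
 = (\<integral>th. Jf f d1 x r th \<partial>sphere_unif)" for r
proof (rule integral_cong_AE)
 show "AE th in sphere_unif. f (pmult x (Smap r th)) - f x - (if r <= 1 then r else 0) * (\<Sum>i\<in>UNIV. (th $ i) * lfield (Vt i) f x) = Jf f d1 x r th" using AE_sphere_unif by eventually_elim (simp add: Jf_def V x pmult_Smap_mv)
 show "(%th. f (pmult x (Smap r th)) - f x - (if r <= 1 then r else 0) * (\<Sum>i\<in>UNIV. (th $ i) * lfield (Vt i) f x)) \<in> borel_measurable sphere_unif" unfolding pmult_Smap_mv by measurable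
 show "Jf f d1 x r \<in> borel_measurable sphere_unif" unfolding Jf_def[abs_def] by measurable
qed
 show ?thesis unfolding genL_def Gf_def dint_def inner H VV ..
qed

lemma Gf_measurable:
 assumes f: "fld f d1 d2 h" shows "Gf f d1 d2 h \<in> borel_measurable borel"
proof -
 note m [measurable] = fldD(1-4)[OF f]
 have [measurable]: "(%x. dint (Jf f d1 x)) \<in> borel_measurable borel" by (rule dint_measurable) (simp add: Jf_def, measurable)
 show ?thesis unfolding Gf_def[abs_def] by measurable
qed

lemma Gam_measurable:
 assumes f: "fld f d1 d2 h" shows "Gam f d1 \<in> borel_measurable borel"
proof -
 note m [measurable] = fldD(1-4)[OF f]
 have [measurable]: "(%x. dint (%r th. (f (mv x r th) - f x)\<^sup>2)) \<in> borel_measurable borel" by (rule dint_measurable) measurable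
 show ?thesis unfolding Gam_def[abs_def] by measurable
qed

lemma J_taylor:
 assumes f: "fld f d1 d2 h" and x: "x \<in> Gtilde" and t: "norm th = 1"
 and d2: "!!y. y \<in> Gtilde ==> \<bar>d2 y th\<bar> <= B"
 shows "\<bar>f (mv x r th) - f x - r * d1 x th\<bar> <= B * r\<^sup>2 / 2" using taylor2_bound[OF fldD(7)[OF f x t] fldD(8)[OF f x t], of B 0 r] d2[OF mv_Gtilde[OF x t]] by simp

lemma f_lipschitz:
 assumes f: "fld f d1 d2 h" and x: "x \<in> Gtilde" and t: "norm th = 1"
 and d1: "!!y. y \<in> Gtilde ==> \<bar>d1 y th\<bar> <= B"
 shows "\<bar>f (mv x r th) - f x\<bar> <= B * \<bar>r\<bar>" using lipschitz_deriv_bound[OF fldD(7)[OF f x t], of B r 0] d1[OF mv_Gtilde[OF x t]] by simp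

lemma dom_wt:
 fixes k :: "real => real^'d::finite => real"
 assumes "(%p. k (fst p) (snd p)) \<in> borel_measurable (borel \<Otimes>\<^sub>M borel)"
 "!!r th. 0 < r ==> r <= 1 ==> norm th = 1 ==> \<bar>k r th\<bar> <= B * r\<^sup>2"
 "!!r th. 1 <= r ==> norm th = 1 ==> \<bar>k r th\<bar> <= B * r" "0 <= B"
 shows "dom k (%r. B * wt r)" unfolding dom_def
proof (intro conjI allI impI)
 fix r th assume r: "(0::real) < r" and t: "norm (th::real^'d) = 1"
 show "\<bar>k r th\<bar> <= B * wt r"
proof (cases "r <= 1")
case True
 show ?thesis using assms(2)[OF r True t] mult_left_mono[OF wt_le1[OF r True] assms(4)] by linarith
next
case False
 then show ?thesis using assms(3)[of r, OF _ t] mult_left_mono[OF wt_ge1(1)[of r] assms(4)] by simp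
qed
qed (use assms integrable_wt in auto)

lemma Jf_dom:
 fixes f :: "'d::finite pg => real"
 assumes f: "fld f d1 d2 h" and b: "bnd C f d1 d2 h" and x: "x \<in> Gtilde"
 shows "dom (Jf f d1 x) (%r. 2 * C * wt r)"
proof (rule dom_wt)
 note m [measurable] = fldD(1-4)[OF f]
 have C: "0 <= C" using b x unfolding bnd_def by (meson abs_ge_zero order_trans)
 then show "0 <= 2 * C" by simp
 define s where "s i = d1 x (axis i 1)" for i
 show "(%p. Jf f d1 x (fst p) (snd p)) \<in> borel_measurable (borel \<Otimes>\<^sub>M borel)" unfolding Jf_def s_def[symmetric] by measurable
 fix r :: real and th :: "real^'d" assume t: "norm th = 1"
 note s = fldD(6)[OF f x t, symmetric]
 { assume r: "0 < r" "r <= 1"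
 have "\<bar>Jf f d1 x r th\<bar> <= C * r\<^sup>2 / 2" using J_taylor[OF f x t, of C r] b t r by (auto simp: Jf_def s bnd_def)
 also have "... <= 2 * C * r\<^sup>2" using mult_nonneg_nonneg[OF C, of "r\<^sup>2"] by simp
 finally show "\<bar>Jf f d1 x r th\<bar> <= 2 * C * r\<^sup>2" . }
 assume r: "1 <= r"
 have fx: "\<bar>f x\<bar> <= C" "\<bar>f (mv x r th)\<bar> <= C" using b x mv_Gtilde[OF x t, of r] by (auto simp: bnd_def)
 show "\<bar>Jf f d1 x r th\<bar> <= 2 * C * r"
\<comment> \<open>At r = 1 the compensator is still present, so the Taylor bound is used there;
  beyond 1 it is absent and the sup bound applies.\<close>
proof (cases "r = 1")
case True
 have "\<bar>Jf f d1 x r th\<bar> <= C * r\<^sup>2 / 2" using J_taylor[OF f x t, of C r] b t True by (auto simp: Jf_def s bnd_def)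
 then show ?thesis using True C by simp
next
case False
 then have "\<bar>Jf f d1 x r th\<bar> <= 2 * C" using fx r by (simp add: Jf_def)
 also have "... <= 2 * C * r" using r C by (simp add: mult_left_mono[of 1 r "2 * C", simplified])
 finally show ?thesis .
qed
qed

lemma square_dom:
 fixes f :: "'d::finite pg => real"
 assumes f: "fld f d1 d2 h" and b: "bnd C f d1 d2 h" and x: "x \<in> Gtilde"
 shows "dom (%r th. (f (mv x r th) - f x)\<^sup>2) (%r. 4 * C\<^sup>2 * wt r)"
proof (rule dom_wt)
 note m [measurable] = fldD(1-4)[OF f]
 have C: "0 <= C" using b x unfolding bnd_def by (meson abs_ge_zero order_trans)
 show "0 <= 4 * C\<^sup>2" by simp
 show "(%p. (f (mv x (fst p) (snd p)) - f x)\<^sup>2) \<in> borel_measurable (borel \<Otimes>\<^sub>M borel)" by measurable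
 fix r :: real and th :: "real^'d" assume t: "norm th = 1"
 have "\<bar>f (mv x r th) - f x\<bar> <= C * \<bar>r\<bar>" using f_lipschitz[OF f x t, of C r] b t by (auto simp: bnd_def)
 from power_mono[OF this, of 2] have l: "(f (mv x r th) - f x)\<^sup>2 <= C\<^sup>2 * r\<^sup>2" by (simp add: power_mult_distrib)
 { assume r: "0 < r" "r <= 1"
 have "C\<^sup>2 * r\<^sup>2 <= 4 * C\<^sup>2 * r\<^sup>2" by (intro mult_right_mono) auto
 then show "\<bar>(f (mv x r th) - f x)\<^sup>2\<bar> <= 4 * C\<^sup>2 * r\<^sup>2" unfolding abs_power2 using l by linarith }
 assume r: "1 <= r"
 have fx: "\<bar>f x\<bar> <= C" "\<bar>f (mv x r th)\<bar> <= C" using b x mv_Gtilde[OF x t, of r] by (auto simp: bnd_def)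
 then have "\<bar>f (mv x r th) - f x\<bar> <= 2 * C" by linarith
 from power_mono[OF this, of 2] have "(f (mv x r th) - f x)\<^sup>2 <= 4 * C\<^sup>2" by (simp add: power_mult_distrib)
 also have "... <= 4 * C\<^sup>2 * r" using r by (simp add: mult_left_mono[of 1 r "4 * C\<^sup>2", simplified])
 finally show "\<bar>(f (mv x r th) - f x)\<^sup>2\<bar> <= 4 * C\<^sup>2 * r" by simp
qed

text \<open>The jump integrand of f^2 is 2 f(x) times that of f plus the squared increment, and the
  second derivative of f^2 leaves 2 (f')^2 in the same way.\<close>

lemma Gf_square:
 fixes f :: "'d::finite pg => real"
 assumes f: "fld f d1 d2 h" and b: "bnd C f d1 d2 h" and x: "x \<in> Gtilde"
 shows "Gf (%x. f x * f x) (%x th. f x * d1 x th + d1 x th * f x)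
 (%x th. f x * d2 x th + 2 * d1 x th * d1 x th + d2 x th * f x) (%x. f x * h x + h x * f x) x
 = 2 * f x * Gf f d1 d2 h x + Gam f d1 x"
proof -
 have J: "Jf (%x. f x * f x) (%x th. f x * d1 x th + d1 x th * f x) x
 = (%r th. 2 * f x * Jf f d1 x r th + 1 * (f (mv x r th) - f x)\<^sup>2)"
proof (intro ext)
 fix r :: real and th :: "real^'d"
 have "(\<Sum>i\<in>UNIV. th $ i * (f x * d1 x (axis i 1) + d1 x (axis i 1) * f x)) = 2 * f x * (\<Sum>i\<in>UNIV. th $ i * d1 x (axis i 1))" by (simp add: sum_distrib_left algebra_simps)
 then show "Jf (%x. f x * f x) (%x th. f x * d1 x th + d1 x th * f x) x r th = 2 * f x * Jf f d1 x r th + 1 * (f (mv x r th) - f x)\<^sup>2" unfolding Jf_def by (simp add: power2_eq_square algebra_simps)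
qed
 have S: "(\<Sum>i\<in>UNIV. f x * d2 x (axis i 1) + 2 * d1 x (axis i 1) * d1 x (axis i 1) + d2 x (axis i 1) * f x)
 = 2 * f x * (\<Sum>i\<in>UNIV. d2 x (axis i 1)) + 2 * (\<Sum>i\<in>UNIV. (d1 x (axis i 1))\<^sup>2)" by (simp add: sum_distrib_left sum.distrib power2_eq_square algebra_simps)
 show ?thesis unfolding Gf_def Gam_def J S dint_linear[OF Jf_dom[OF f b x] square_dom[OF f b x]] by (simp add: algebra_simps)
qed

text \<open>One constant for both \<open>Gf_bound\<close> and \<open>Gam_bound\<close>. The summand
  1 pays for the derivative along H_0 and also gives \<open>KG\<close> >= 1.\<close>

definition KG :: "'d::finite itself => real" where
 "KG _ = 1 + sg\<^sup>2 * real CARD('d) + 4 * (\<integral>r. wt r \<partial>nu)"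

lemma KG_nonneg: "0 <= KG TYPE('d::finite)" unfolding KG_def by (intro add_nonneg_nonneg mult_nonneg_nonneg) (simp_all add: wt_nonneg)

lemma Gf_bound:
 fixes f :: "'d::finite pg => real"
 assumes f: "fld f d1 d2 h" and b: "bnd C f d1 d2 h" and x: "x \<in> Gtilde"
 shows "\<bar>Gf f d1 d2 h x\<bar> <= C * KG TYPE('d)"
proof -
 have C: "0 <= C" using b x unfolding bnd_def by (meson abs_ge_zero order_trans)
 have w: "0 <= (\<integral>r. wt r \<partial>nu)" by (simp add: wt_nonneg)
 have 1: "\<bar>h x\<bar> <= C" using b x by (auto simp: bnd_def)
 have "\<bar>\<Sum>i\<in>UNIV. d2 x (axis i 1)\<bar> <= (\<Sum>i\<in>(UNIV::'d set). C)" by (rule order_trans[OF sum_abs sum_mono]) (use b x in \<open>auto simp: bnd_def\<close>)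
 then have 2: "\<bar>sg\<^sup>2 / 2 * (\<Sum>i\<in>UNIV. d2 x (axis i 1))\<bar> <= sg\<^sup>2 / 2 * (real CARD('d) * C)" by (simp add: abs_mult mult_left_mono)
 have 3: "\<bar>dint (Jf f d1 x)\<bar> <= 2 * C * (\<integral>r. wt r \<partial>nu)" using dom_outer(2)[OF Jf_dom[OF f b x]] by simp
 have "sg\<^sup>2 / 2 * (real CARD('d) * C) <= sg\<^sup>2 * (real CARD('d) * C)" using C by (intro mult_right_mono) auto
 moreover have "2 * C * (\<integral>r. wt r \<partial>nu) <= 4 * C * (\<integral>r. wt r \<partial>nu)" using C w by (intro mult_right_mono) auto
 ultimately show ?thesis using 1 2 3 unfolding Gf_def KG_def by (simp add: algebra_simps)
qed

lemma Gam_nonneg: "0 <= Gam f d1 x" unfolding Gam_def dint_def by (simp add: sum_nonneg)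

lemma Gam_bound:
 fixes f :: "'d::finite pg => real"
 assumes f: "fld f d1 d2 h" and b: "bnd C f d1 d2 h" and x: "x \<in> Gtilde"
 shows "Gam f d1 x <= C\<^sup>2 * KG TYPE('d)"
proof -
 have "(\<Sum>i\<in>UNIV. (d1 x (axis i 1))\<^sup>2) <= (\<Sum>i\<in>(UNIV::'d set). C\<^sup>2)"
proof (rule sum_mono)
 fix i have "\<bar>d1 x (axis i 1)\<bar> <= C" using b x by (auto simp: bnd_def)
 from power_mono[OF this, of 2] show "(d1 x (axis i 1))\<^sup>2 <= C\<^sup>2" by simp
qed
 then have "sg\<^sup>2 * (\<Sum>i\<in>UNIV. (d1 x (axis i 1))\<^sup>2) <= sg\<^sup>2 * (real CARD('d) * C\<^sup>2)" by (simp add: mult_left_mono)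
 moreover have "\<bar>dint (%r th. (f (mv x r th) - f x)\<^sup>2)\<bar> <= 4 * C\<^sup>2 * (\<integral>r. wt r \<partial>nu)" using dom_outer(2)[OF square_dom[OF f b x]] by simp
 moreover have "C\<^sup>2 * KG TYPE('d) = C\<^sup>2 + sg\<^sup>2 * (real CARD('d) * C\<^sup>2) + 4 * C\<^sup>2 * (\<integral>r. wt r \<partial>nu)" by (simp add: KG_def algebra_simps)
 ultimately show ?thesis unfolding Gam_def using zero_le_power2[of C] by linarith
qed

end

section \<open>The martingale problem\<close>

text \<open>The square of the integral is an integral over the plane, which the diagonal splits into
  two triangles of equal contribution.\<close>

lemma has_integral_half_square:
 fixes a :: "real => real"
 assumes [measurable]: "a \<in> borel_measurable borel" and b: "!!u. \<bar>a u\<bar> <= K * indicator {s..t} u"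
 shows "(\<integral>u. a u * (\<integral>v. indicator {u..} v * a v \<partial>lborel) \<partial>lborel) = (\<integral>u. a u \<partial>lborel)\<^sup>2 / 2"
proof -
 have ia: "integrable lborel a"
proof (rule Bochner_Integration.integrable_bound[of lborel "%u. K * indicator {s..t} u"])
 show "AE u in lborel. norm (a u) <= norm (K * indicator {s..t} u :: real)" using b by (auto intro: order_trans[OF _ abs_ge_self])
 have "integrable lborel (indicator {s..t} :: real => real)" by (rule integrable_real_indicator) (auto simp: emeasure_lborel_Icc_eq)
 then show "integrable lborel (%u. K * indicator {s..t} u :: real)" by simp
qed simp
 define B where "B = (%p::real \<times> real. a (fst p) * a (snd p))"
 have iB: "integrable (lborel \<Otimes>\<^sub>M lborel) B"
proof -
 have "integrable (lborel \<Otimes>\<^sub>M lborel) (%(x, y). a x * a y)" by (rule lborel_pair.Fubini_integrable) (auto simp: ia abs_mult intro!: integrable_abs integrable_mult_left)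
 then show ?thesis by (simp add: B_def split_beta')
qed
 let ?P = "%p::real\<times>real. indicator {p. fst p <= snd p} p * B p"
 let ?Q = "%p::real\<times>real. indicator {p. snd p < fst p} p * B p"
 have m [measurable]: "{p::real\<times>real. fst p <= snd p} \<in> sets (borel \<Otimes>\<^sub>M borel)" "{p::real\<times>real. snd p < fst p} \<in> sets (borel \<Otimes>\<^sub>M borel)"
 "{p::real\<times>real. snd p <= fst p} \<in> sets (borel \<Otimes>\<^sub>M borel)" unfolding borel_prod by (rule borel_closed borel_open closed_Collect_le open_Collect_less continuous_intros)+
 have iP: "integrable (lborel \<Otimes>\<^sub>M lborel) ?P" "integrable (lborel \<Otimes>\<^sub>M lborel) ?Q"
 "integrable (lborel \<Otimes>\<^sub>M lborel) (%p. indicator {p. snd p <= fst p} p * B p)" by (auto intro!: integrable_real_mult_indicator iB simp: mult.commute[of _ "B _"])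
 have 1: "(\<integral>p. B p \<partial>(lborel \<Otimes>\<^sub>M lborel)) = (\<integral>u. a u \<partial>lborel)\<^sup>2" using lborel_pair.integral_fst'[OF iB] by (simp add: B_def power2_eq_square)
 have 2: "(\<integral>p. ?P p \<partial>(lborel \<Otimes>\<^sub>M lborel)) = (\<integral>u. a u * (\<integral>v. indicator {u..} v * a v \<partial>lborel) \<partial>lborel)"
proof -
 have "(\<integral>v. ?P (u, v) \<partial>lborel) = a u * (\<integral>v. indicator {u..} v * a v \<partial>lborel)" for u
proof -
 have "?P (u, v) = a u * (indicator {u..} v * a v)" for v by (auto simp: B_def indicator_def)
 then show ?thesis by simp
qed
 then show ?thesis using lborel_pair.integral_fst'[OF iP(1)] by simp
qed
 have 3: "(\<integral>p. ?Q p \<partial>(lborel \<Otimes>\<^sub>M lborel)) = (\<integral>u. a u * (\<integral>v. indicator {u..} v * a v \<partial>lborel) \<partial>lborel)"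
proof -
 \<comment> \<open>The strict triangle turns into the closed one at the cost of the single point u =
   v.\<close>
 have "(\<integral>u. ?Q (u, v) \<partial>lborel) = a v * (\<integral>u. indicator {v..} u * a u \<partial>lborel)" for v
proof -
 have "(\<integral>u. ?Q (u, v) \<partial>lborel) = (\<integral>u. a v * (indicator {v..} u * a u) \<partial>lborel)"
proof (rule integral_cong_AE)
 show "AE u in lborel. ?Q (u, v) = a v * (indicator {v..} u * a u)" using AE_lborel_singleton[of v] by eventually_elim (auto simp: B_def indicator_def)
 show "(%u. ?Q (u, v)) \<in> borel_measurable lborel" unfolding B_def fst_conv snd_conv by measurable
qed measurable
 then show ?thesis by simp
qed
 moreover define Q where "Q = ?Q"
 ultimately have "(\<integral>u. Q (u, v) \<partial>lborel) = a v * (\<integral>u. indicator {v..} u * a u \<partial>lborel)" for v by simp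
 then show ?thesis using lborel_pair.integral_snd[of "%u v. Q (u, v)"] iP(2) unfolding Q_def[symmetric] by simp
qed
 have "B p = ?P p + ?Q p" for p by (auto simp: indicator_def)
 then have "(\<integral>p. B p \<partial>(lborel \<Otimes>\<^sub>M lborel)) = (\<integral>p. ?P p + ?Q p \<partial>(lborel \<Otimes>\<^sub>M lborel))" by (rule Bochner_Integration.integral_cong[OF refl])
 also have "... = (\<integral>p. ?P p \<partial>(lborel \<Otimes>\<^sub>M lborel)) + (\<integral>p. ?Q p \<partial>(lborel \<Otimes>\<^sub>M lborel))" by (rule Bochner_Integration.integral_add[OF iP(1,2)])
 finally show ?thesis using 1 2 3 by simp
qed

locale levy_proc = levy_measure sg nu for sg nu +
 fixes M :: "'w measure" and X :: "real => 'w => 'd::finite pg"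
 assumes levy: "left_levy_process sg nu M X"
begin

sublocale prob_space M using levy by (simp add: left_levy_process_def)

lemma X_meas [measurable]: "t \<ge> 0 ==> X t \<in> borel_measurable M"
 and X_0: "om \<in> space M ==> X 0 om = pId"
 and X_G: "om \<in> space M ==> t \<ge> 0 ==> X t om \<in> Gtilde"
 and X_right: "om \<in> space M ==> t \<ge> 0 ==> continuous (at_right t) (%s. X s om)"
 and X_left: "om \<in> space M ==> t > 0 ==> \<exists>l. ((%s. X s om) \<longlongrightarrow> l) (at_left t)" using levy by (auto simp: left_levy_process_def)

abbreviation "F \<equiv> natfilt M X"

lemma space_F [simp]: "space (F s) = space M" by (simp add: natfilt_def space_measure_of_conv)

lemma sets_F: "sets (F s) = sigma_sets (space M) {X u -` B \<inter> space M | u B. 0 <= u & u <= s & B \<in> sets borel}" unfolding natfilt_def by (rule sets_measure_of) auto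

lemma subalg: "subalgebra M (F s)"
proof -
 have "sigma_sets (space M) {X u -` B \<inter> space M | u B. 0 <= u & u <= s & B \<in> sets borel} \<subseteq> sets M" by (rule sets.sigma_sets_subset) (auto intro: measurable_sets[OF X_meas])
 then show ?thesis by (simp add: subalgebra_def sets_F)
qed

lemma F_mono: "s <= t ==> sets (F s) \<subseteq> sets (F t)" unfolding sets_F by (rule sigma_sets_mono', rule Collect_mono, clarify) (rule exI, rule exI, rule conjI[OF refl], auto)

lemma F_mono_measurable: "s <= t ==> f \<in> measurable (F s) N ==> f \<in> measurable (F t) N" using F_mono[of s t] by (auto simp: measurable_def)

lemma F_M: "f \<in> measurable (F s) N ==> f \<in> measurable M N" by (rule measurable_from_subalg[OF subalg])

lemma X_F: "0 <= u ==> u <= s ==> X u \<in> borel_measurable (F s)" by (rule measurableI) (simp, unfold sets_F space_F, rule sigma_sets.Basic, blast)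

lemma X_right_tendsto:
 assumes "om \<in> space M" "0 <= s" "!!n. s <= a n" "a \<longlonglongrightarrow> s"
 shows "(%n. X (a n) om) \<longlonglongrightarrow> X s om"
proof -
 have "continuous (at s within {s..}) (%s. X s om)" using X_right[OF assms(1,2)] by (simp add: at_within_Ici_at_right)
 from continuous_within_tendsto_compose[OF this _ assms(4)] assms(3) show ?thesis by simp
qed

abbreviation cl :: "real => real => real" where "cl t u \<equiv> max 0 (min t u)"

text \<open>Progressive measurability from right continuity. Time is rounded to grid points on the
  right and clamped to [0, t], so every approximation is a countable patchwork of variables
  measurable at time t.\<close>

lemma prog:
 assumes "0 <= t" shows "(%p. X (cl t (fst p)) (snd p)) \<in> borel_measurable (borel \<Otimes>\<^sub>M F t)"
proof -
 \<comment> \<open>The +1 after the floor puts the grid point to the right of u, as right continuity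
   requires.\<close>
 define a where "a n u = cl t ((real_of_int \<lfloor>u * real (Suc n)\<rfloor> + 1) / real (Suc n))" for n u
 have a: "cl t u <= a n u" "a n u <= cl t u + 1 / real (Suc n)" for n u
proof -
 let ?m = "real (Suc n)" and ?q = "(real_of_int \<lfloor>u * real (Suc n)\<rfloor> + 1) / real (Suc n)"
 have "u * ?m <= real_of_int \<lfloor>u * ?m\<rfloor> + 1" "real_of_int \<lfloor>u * ?m\<rfloor> <= u * ?m" by linarith+
 then have "u <= ?q" "?q <= u + 1 / ?m" by (simp_all add: field_simps del: of_nat_Suc)
 moreover have "0 < 1 / ?m" by simp
 ultimately show "cl t u <= a n u" "a n u <= cl t u + 1 / ?m" unfolding a_def by (auto simp: max_def min_def simp del: of_nat_Suc)
qed
 show ?thesis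
proof (rule borel_measurable_LIMSEQ_metric)
 fix n
 have A: "(%p. X (cl t ((real_of_int i + 1) / real (Suc n))) (snd p)) \<in> borel_measurable (borel \<Otimes>\<^sub>M F t)" for i :: int
proof -
 have "X (cl t ((real_of_int i + 1) / real (Suc n))) \<in> borel_measurable (F t)" by (rule X_F) (use assms in auto)
 then show ?thesis by (rule measurable_compose[OF measurable_snd])
qed
 have B: "(%p. \<lfloor>fst p * real (Suc n)\<rfloor>) \<in> measurable (borel \<Otimes>\<^sub>M F t) (count_space UNIV)" by measurable
 show "(%p. X (a n (fst p)) (snd p)) \<in> borel_measurable (borel \<Otimes>\<^sub>M F t)" unfolding a_def by (rule measurable_compose_countable[OF A B])
next
 fix p :: "real \<times> 'w" assume p: "p \<in> space (borel \<Otimes>\<^sub>M F t)"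
 have "(%n. cl t (fst p) + 1 / real (Suc n)) \<longlonglongrightarrow> cl t (fst p) + 0" by (intro tendsto_add tendsto_const LIMSEQ_Suc[OF lim_1_over_n])
 then have l: "(%n. cl t (fst p) + 1 / real (Suc n)) \<longlonglongrightarrow> cl t (fst p)" by (simp only: add_0_right)
 have "(%n. a n (fst p)) \<longlonglongrightarrow> cl t (fst p)" by (rule tendsto_sandwich[OF always_eventually always_eventually tendsto_const l]) (use a in blast)+
 then show "(%n. X (a n (fst p)) (snd p)) \<longlonglongrightarrow> X (cl t (fst p)) (snd p)" using a(1) p by (intro X_right_tendsto) (auto simp only: space_pair_measure space_F mem_Times_iff max.cobounded1)
qed
qed

definition Gb :: "('d pg => real) => real => bool" where
 "Gb G K \<longleftrightarrow> G \<in> borel_measurable borel & (\<forall>x\<in>Gtilde. \<bar>G x\<bar> <= K)"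

definition ig :: "('d pg => real) => real => real => 'w => real" where
 "ig G s t om = integral {s..t} (%u. G (X u om))"

text \<open>The Lebesgue counterpart of \<open>ig\<close>, whose gauge integral comes from the
  martingale problem. The integrand is extended by zero and its time argument clamped, which makes
  it jointly measurable in time and trajectory.\<close>

definition aG :: "('d pg => real) => real => real => 'w => real => real" where
 "aG G s t om u = indicator {s..t} u * G (X (cl t u) om)"

lemma aG_measurable:
 assumes "Gb G K" "0 <= t" shows "(%p. aG G s t (snd p) (fst p)) \<in> borel_measurable (borel \<Otimes>\<^sub>M F t)"
proof -
 have [measurable]: "G \<in> borel_measurable borel" using assms by (simp add: Gb_def)
 note [measurable] = prog[OF assms(2)]
 show ?thesis unfolding aG_def by measurable
qed

lemma aG_measurable_path:
 assumes "Gb G K" "0 <= t" "om \<in> space M" shows "aG G s t om \<in> borel_measurable borel"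
proof -
 have "(%u. (%p. aG G s t (snd p) (fst p)) (u, om)) \<in> borel_measurable borel" by (rule measurable_compose[OF measurable_Pair2' aG_measurable[OF assms(1,2)]]) (use assms(3) in simp)
 then show ?thesis by simp
qed

lemma aG_bound: "Gb G K ==> 0 <= t ==> om \<in> space M ==> \<bar>aG G s t om u\<bar> <= K * indicator {s..t} u" using X_G[of om "cl t u"] by (auto simp: aG_def indicator_def Gb_def)

lemma ig_lebesgue:
 assumes "Gb G K" "0 <= s" "s <= t" "om \<in> space M"
 shows "integrable lborel (aG G s t om)" "ig G s t om = (\<integral>u. aG G s t om u \<partial>lborel)"
 "(%u. G (X u om)) integrable_on {s..t}"
 "\<bar>ig G s t om\<bar> <= K * (t - s)"
proof -
 have t: "0 <= t" using assms by simp
 note [measurable] = aG_measurable_path[OF assms(1) t assms(4)]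
 have iI: "integrable lborel (%u. K * indicator {s..t} u :: real)"
proof -
 have "integrable lborel (indicator {s..t} :: real => real)" by (rule integrable_real_indicator) (auto simp: emeasure_lborel_Icc_eq)
 then show ?thesis by simp
qed
 show i: "integrable lborel (aG G s t om)" by (rule Bochner_Integration.integrable_bound[OF iI])
 (use aG_bound[OF assms(1) t assms(4)] in \<open>auto intro: order_trans[OF _ abs_ge_self]\<close>)
 have e: "aG G s t om u = indicator {s..t} u *\<^sub>R G (X (cl t u) om)" for u by (simp add: aG_def)
 have si: "set_integrable lborel {s..t} (%u. G (X (cl t u) om))" using i unfolding set_integrable_def e[symmetric] by (simp add: aG_def[abs_def])
 have c: "G (X u om) = G (X (cl t u) om)" if "u \<in> {s..t}" for u using that assms by (auto simp: max_def min_def)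
 show "ig G s t om = (\<integral>u. aG G s t om u \<partial>lborel)" using set_borel_integral_eq_integral(2)[OF si] Henstock_Kurzweil_Integration.integral_cong[of "{s..t}", OF c] by (simp add: ig_def set_lebesgue_integral_def aG_def[abs_def])
 show "(%u. G (X u om)) integrable_on {s..t}" using set_borel_integral_eq_integral(1)[OF si] integrable_cong[of "{s..t}", OF c] by simp
 have "\<bar>\<integral>u. aG G s t om u \<partial>lborel\<bar> <= (\<integral>u. \<bar>aG G s t om u\<bar> \<partial>lborel)" by (rule integral_abs_bound)
 also have "... <= (\<integral>u. K * indicator {s..t} u \<partial>lborel)" by (rule integral_mono) (use i iI aG_bound[OF assms(1) t assms(4)] in auto)
 also have "... = K * (t - s)" using assms by simp
 finally show "\<bar>ig G s t om\<bar> <= K * (t - s)" using \<open>ig G s t om = _\<close> by simp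
qed

lemma ig_split:
 assumes "Gb G K" "0 <= s" "s <= u" "u <= t" "om \<in> space M"
 shows "ig G s t om = ig G s u om + ig G u t om" unfolding ig_def using assms by (intro Henstock_Kurzweil_Integration.integral_combine[symmetric] ig_lebesgue(3)[of G K]) auto

lemma ig_measurable:
 assumes "Gb G K" "0 <= s" "s <= t" shows "ig G s t \<in> borel_measurable (F t)"
proof -
 have "(%(om, u). aG G s t om u) \<in> borel_measurable (F t \<Otimes>\<^sub>M lborel)"
proof -
 have "0 <= t" using assms by simp
 note [measurable] = aG_measurable[OF assms(1) this, of s]
 have "(%q. (%p. aG G s t (snd p) (fst p)) (snd q, fst q)) \<in> borel_measurable (F t \<Otimes>\<^sub>M lborel)" by measurable
 then show ?thesis by (simp add: split_beta')
qed
 then have "(%om. \<integral>u. aG G s t om u \<partial>lborel) \<in> borel_measurable (F t)" by (rule lborel.borel_measurable_lebesgue_integral)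
 then show ?thesis by (rule measurable_cong[THEN iffD1, rotated]) (use ig_lebesgue(2)[OF assms] in auto)
qed

lemma integrable_bounded: 
 fixes f :: "'w => real"
 assumes "f \<in> borel_measurable M" "!!om. om \<in> space M ==> \<bar>f om\<bar> <= K"
 shows "integrable M f" by (rule integrable_const_bound[where B = K]) (use assms in auto)

lemma ig_Fubini:
 fixes Z :: "real => 'w => real"
 assumes "Gb G K" "0 <= s" "s <= t" "(%p. Z (fst p) (snd p)) \<in> borel_measurable (borel \<Otimes>\<^sub>M M)"
 and Zb: "!!u om. om \<in> space M ==> \<bar>Z u om\<bar> <= B"
 shows "(\<integral>om. (\<integral>u. Z u om * aG G s t om u \<partial>lborel) \<partial>M) = (\<integral>u. (\<integral>om. Z u om * aG G s t om u \<partial>M) \<partial>lborel)"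
proof -
 interpret P: pair_sigma_finite M "lborel :: real measure" by standard
 have t: "0 <= t" using assms by simp
 have B: "0 <= B" using Zb not_empty abs_ge_zero order_trans by blast
 have "(%x. x) \<in> measurable M (F t)" by (rule F_M[of _ t]) simp
 then have "(%p. (fst p, snd p)) \<in> measurable (borel \<Otimes>\<^sub>M M) (borel \<Otimes>\<^sub>M F t)" by (intro measurable_Pair measurable_fst measurable_compose[OF measurable_snd])
 from measurable_compose[OF this aG_measurable[OF assms(1) t, of s]]
 have [measurable]: "(%p. aG G s t (snd p) (fst p)) \<in> borel_measurable (borel \<Otimes>\<^sub>M M)" by simp
 note [measurable] = assms(4)
 have m: "(%q. (%p. Z (fst p) (snd p) * aG G s t (snd p) (fst p)) (snd q, fst q)) \<in> borel_measurable (M \<Otimes>\<^sub>M lborel)" by measurable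
 have "integrable (M \<Otimes>\<^sub>M lborel) (%(om, u). Z u om * aG G s t om u)"
proof (rule P.Fubini_integrable)
 show "(%(om, u). Z u om * aG G s t om u) \<in> borel_measurable (M \<Otimes>\<^sub>M lborel)" using m by (simp add: split_beta')
 have iI: "integrable lborel (%u. B * (K * indicator {s..t} u) :: real)"
proof -
 have "integrable lborel (indicator {s..t} :: real => real)" by (rule integrable_real_indicator) (auto simp: emeasure_lborel_Icc_eq)
 then show ?thesis by simp
qed
 have b: "\<bar>Z u om * aG G s t om u\<bar> <= B * (K * indicator {s..t} u)" if "om \<in> space M" for om u unfolding abs_mult by (intro mult_mono Zb aG_bound[OF assms(1) t] that B) simp
 have pm: "(%u. Z u om * aG G s t om u) \<in> borel_measurable lborel" if "om \<in> space M" for om using measurable_compose[OF measurable_Pair1'[OF that] m] by simp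
 have pi: "integrable lborel (%u. Z u om * aG G s t om u)" if "om \<in> space M" for om by (rule Bochner_Integration.integrable_bound[OF iI pm[OF that]]) (use b[OF that] in \<open>auto intro: order_trans[OF _ abs_ge_self]\<close>)
 then show "AE om in M. integrable lborel (%u. case (om, u) of (om, u) => Z u om * aG G s t om u)" by auto
 show "integrable M (%om. \<integral>u. norm (case (om, u) of (om, u) => Z u om * aG G s t om u) \<partial>lborel)"
proof (rule integrable_bounded)
 have "(%(om, u). \<bar>Z u om * aG G s t om u\<bar>) \<in> borel_measurable (M \<Otimes>\<^sub>M lborel)" using borel_measurable_abs[OF m] by (simp add: split_beta')
 then show "(%om. \<integral>u. norm (case (om, u) of (om, u) => Z u om * aG G s t om u) \<partial>lborel) \<in> borel_measurable M" using lborel.borel_measurable_lebesgue_integral[of "%om u. \<bar>Z u om * aG G s t om u\<bar>" M] by simp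
 fix om assume w: "om \<in> space M"
 have "(\<integral>u. \<bar>Z u om * aG G s t om u\<bar> \<partial>lborel) <= (\<integral>u. B * (K * indicator {s..t} u) \<partial>lborel)" by (rule integral_mono) (use pi[OF w] iI b[OF w] in auto)
 then show "\<bar>\<integral>u. norm (case (om, u) of (om, u) => Z u om * aG G s t om u) \<partial>lborel\<bar> <= (\<integral>u. B * (K * indicator {s..t} u) \<partial>lborel)" by simp
qed
qed
 from P.Fubini_integral[OF this] show ?thesis by simp
qed

end

section \<open>From compactly supported test functions to bounded C^2 functions\<close>

definition cutoff :: "real => ('d::finite pg => real) => ('d pg => real^'d => real) => ('d pg => real^'d => real)
 => ('d pg => real) => bool" where
 "cutoff R cu e1 e2 k \<longleftrightarrow> fld cu e1 e2 k & C2b cu & bounded {x. cu x ~= 0} &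
 (\<forall>x\<in>Gtilde. \<bar>cu x\<bar> <= 1 & \<bar>k x\<bar> <= 1 / R & (\<forall>th. norm th = 1 --> \<bar>e1 x th\<bar> <= 1 / R & \<bar>e2 x th\<bar> <= 1 / R)
 & (ln (norm (fst x)) <= R & ln (1 + (norm (snd x))\<^sup>2) <= R --> cu x = 1))"

text \<open>A product of a cutoff in ln |g| and one in ln(1 + |xi|^2); the map 1/2 - k/4 sends the
  plateaus -2 and 2 of the spline to 1 and 0. The offsets 6 and 12 are matched: the first factor
  vanishes for |g| >= exp(9 R), and the second starts to vary where 1 + |xi|^2 >= exp(18 R). On the
  common region |g e_0| is at most the root of 1 + |xi|^2, so the derivative along H_0, which
  involves xi . g e_0, is still O(1/R).\<close>

lemma cutoff_exists:
 fixes R :: real assumes R: "R \<ge> 1"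
 shows "\<exists>(cu :: 'd::finite pg => real) e1 e2 k. cutoff R cu e1 e2 k"
proof -
 have R0: "R > 0" using R by simp
 let ?I = "mat 1 :: 'd mmat"
 have I0: "?I ~= 0" by (simp add: mat_def vec_eq_iff)
 define c1 :: "'d pg => real" where "c1 = (%x. 1/2 + (-1/4) * kf R 6 ?I x)"
 define k2 :: "'d mvec => real" where "k2 = (%xi. 1/2 + (-1/4) * kap R 12 (1 + (norm xi)\<^sup>2))"
 define k2' :: "'d pg => real" where "k2' = (%x. (-1/4) * (kap1 R 12 (1 + (norm (snd x))\<^sup>2) * (2 * inner (snd x) (fst x *v ev None))))"
 have f1: "fld c1 (%x th. (-1/4) * kf1 R 6 ?I x th) (%x th. (-1/4) * kf2 R 6 ?I x th) (%x. (-1/4) * 0)" unfolding c1_def by (rule fld_affine[OF fld_kf[OF R0 I0]])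
 have kc: "continuous_on UNIV (kap R 12)" "continuous_on UNIV (kap1 R 12)" by (intro continuous_at_imp_continuous_on ballI DERIV_isCont[OF kap_deriv(1)[OF R0]] DERIV_isCont[OF kap_deriv(2)[OF R0]])+
 have [measurable]: "kap R 12 \<in> borel_measurable borel" "kap1 R 12 \<in> borel_measurable borel" using kc by (auto intro: borel_measurable_continuous_onI)
 have f2: "fld (%x. k2 (snd x)) (%x th. 0) (%x th. 0) k2'"
proof (rule fld_snd)
 show "k2 \<in> borel_measurable borel" unfolding k2_def by measurable
 show "k2' \<in> borel_measurable borel" unfolding k2'_def by measurable
 fix x :: "'d pg"
 let ?v = "fst x *v ev None"
 have "(norm (snd x + s *\<^sub>R ?v))\<^sup>2 = (norm (snd x))\<^sup>2 + s * (2 * inner (snd x) ?v) + s\<^sup>2 * (norm ?v)\<^sup>2" for s unfolding power2_norm_eq_inner by (simp add: inner_simps inner_commute power2_eq_square algebra_simps)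
 then have d: "((%s. 1 + (norm (snd x + s *\<^sub>R ?v))\<^sup>2) has_real_derivative 2 * inner (snd x) ?v) (at 0)" by (auto intro!: derivative_eq_intros)
 have "((%s. kap R 12 (1 + (norm (snd x + s *\<^sub>R ?v))\<^sup>2)) has_real_derivative
 kap1 R 12 (1 + (norm (snd x))\<^sup>2) * (2 * inner (snd x) ?v)) (at 0)" using DERIV_chain2[where g = "%s. 1 + (norm (snd x + s *\<^sub>R ?v))\<^sup>2" and x = 0, OF kap_deriv(1)[OF R0, of 12] d] by simp
 from DERIV_add[OF DERIV_const DERIV_cmult[OF this, of "-1/4"], of "1/2"]
 show "((%s. k2 (snd x + s *\<^sub>R ?v)) has_real_derivative k2' x) (at 0)" unfolding k2_def k2'_def by (simp only: add_0_left)
qed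
 have C2: "C2b (%x. c1 x * k2 (snd x))" unfolding c1_def k2_def by (intro C2b_mult C2b_add C2b_const C2b_kf C2b_kap C2b_norm_square bounded_linear_snd R0)
 have c1b: "0 <= c1 x" "c1 x <= 1" for x using kf_bounds(1)[OF R0, of "axis undefined 1" 6 ?I x] by (auto simp: c1_def abs_le_iff)
 have k2b: "0 <= k2 xi" "k2 xi <= 1" for xi using phi_bound[of "ln (1 + (norm xi)\<^sup>2) / (2 * R) - 12"] by (auto simp: k2_def kap_def abs_le_iff)
 have k2p: "kap R 12 (1 + (norm xi)\<^sup>2) = phi (ln (1 + (norm xi)\<^sup>2) / (2 * R) - 12)" for xi :: "'d mvec"
proof -
 have "1 + (norm xi)\<^sup>2 > 0" by (simp add: add_pos_nonneg)
 then show ?thesis by (simp add: kap_def)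
qed
 have c1z: "norm (fst x) < exp (9 * R)" if "c1 x ~= 0" for x
proof (rule ccontr)
 assume "\<not> norm (fst x) < exp (9 * R)"
 then have n: "norm (fst x) > 0" "exp (9 * R) <= norm (fst x)" using less_le_trans[OF exp_gt_zero] by auto
 then have "9 * R <= ln (norm (fst x))" by (simp add: ln_ge_iff)
 then have "3 <= ln (norm (fst x)) / R - 6" using R0 by (simp add: field_simps)
 then have "kf R 6 ?I x = 2" using n by (simp add: kf_def kap_norm phi_top)
 then show False using that by (simp add: c1_def)
qed
 have k2z: "(norm xi)\<^sup>2 < exp (30 * R)" if "k2 xi ~= 0" for xi
proof (rule ccontr)
 assume "\<not> (norm xi)\<^sup>2 < exp (30 * R)"
 then have "exp (30 * R) <= 1 + (norm xi)\<^sup>2" by simp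
 then have "30 * R <= ln (1 + (norm xi)\<^sup>2)" by (subst ln_ge_iff) (auto simp: add_pos_nonneg)
 then have "3 <= ln (1 + (norm xi)\<^sup>2) / (2 * R) - 12" using R0 by (simp add: field_simps)
 then have "k2 xi = 0" by (simp add: k2_def k2p phi_top)
 then show False using that by simp
qed
 have bdd: "bounded {x. c1 x * k2 (snd x) ~= 0}"
proof (rule bounded_subset)
 show "bounded (cball (0::'d mmat) (exp (9 * R)) \<times> cball (0::'d mvec) (exp (15 * R)))" by (intro bounded_Times bounded_cball)
 show "{x. c1 x * k2 (snd x) ~= 0} \<subseteq> cball 0 (exp (9 * R)) \<times> cball 0 (exp (15 * R))"
proof
 fix x assume "x \<in> {x. c1 x * k2 (snd x) ~= 0}"
 then have "norm (fst x) <= exp (9 * R)" "(norm (snd x))\<^sup>2 <= (exp (15 * R))\<^sup>2" using c1z[of x] k2z[of "snd x"] by (auto simp: exp_double[symmetric])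
 then have "norm (fst x) <= exp (9 * R)" "norm (snd x) <= exp (15 * R)" by (auto intro: power2_le_imp_le)
 then show "x \<in> cball 0 (exp (9 * R)) \<times> cball 0 (exp (15 * R))" by (simp add: mem_Times_iff)
qed
qed
 have k2'b: "\<bar>c1 x * k2' x\<bar> <= 1 / R" for x
proof (cases "c1 x = 0 \<or> kap1 R 12 (1 + (norm (snd x))\<^sup>2) = 0")
case True
 then show ?thesis using R0 by (auto simp: k2'_def)
next
case False
 let ?s = "1 + (norm (snd x))\<^sup>2" and ?n = "norm (snd x)"
 have g: "norm (fst x) <= exp (9 * R)" using False c1z[of x] by auto
 have s: "?s > 0" by (simp add: add_pos_nonneg)
 have "\<not> ?s < exp (2 * R * (12 - 3))" using False kap_small(2)[OF R0, of ?s 12] by auto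
 then have se: "exp (9 * R) ^ 2 <= ?s" by (simp add: exp_double[symmetric])
 have k: "\<bar>kap1 R 12 ?s\<bar> <= 1 / (2 * R * ?s)"
proof -
 have "\<bar>phi1 y * (1 / (2 * R * ?s))\<bar> <= 1 * (1 / (2 * R * ?s))" for y unfolding abs_mult using phi1_bounds[of y] s R0 by (intro mult_mono) auto
 then show ?thesis using s by (simp add: kap1_def)
qed
 have e0: "norm (ev None :: 'd mvec) = 1" by (simp add: ev_def)
 have "\<bar>inner (snd x) (fst x *v ev None)\<bar> <= ?n * norm (fst x *v ev None)" by (rule Cauchy_Schwarz_ineq2)
 also have "... <= ?n * exp (9 * R)" using norm_matrix_vector_le[of "fst x" "ev None"] g e0 by (intro mult_left_mono) auto
 also have "... <= ?s"
proof -
 have "2 * ?n * exp (9 * R) <= ?n\<^sup>2 + (exp (9 * R))\<^sup>2" by (rule sum_squares_bound)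
 then show ?thesis using se by simp
qed
 finally have i: "\<bar>inner (snd x) (fst x *v ev None)\<bar> <= ?s" .
 have "\<bar>c1 x * k2' x\<bar> <= 1 * (1/4 * (1 / (2 * R * ?s) * (2 * ?s)))" unfolding k2'_def abs_mult using c1b[of x] k i s R0 by (intro mult_mono) (auto simp: abs_le_iff)
 also have "... <= 1 / R"
proof -
 have "1 / (2 * R * y) * (2 * y) = 1 / R" if "y > 0" for y using that R0 by (simp add: field_simps)
 from this[OF s] show ?thesis using R0 by (simp only:) (simp add: field_simps)
qed
 finally show ?thesis .
qed
 define cu where "cu = (%x. c1 x * k2 (snd x))"
 let ?e1 = "%x th. c1 x * 0 + (-1/4) * kf1 R 6 ?I x th * k2 (snd x)"
 let ?e2 = "%x th. c1 x * 0 + 2 * ((-1/4) * kf1 R 6 ?I x th) * 0 + (-1/4) * kf2 R 6 ?I x th * k2 (snd x)"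
 let ?k = "%x. c1 x * k2' x + (-1/4) * 0 * k2 (snd x)"
 have "fld cu ?e1 ?e2 ?k" unfolding cu_def by (rule fld_mult[OF f1 f2])
 moreover have "\<bar>cu x\<bar> <= 1" for x unfolding cu_def using c1b[of x] k2b[of "snd x"] by (simp add: abs_mult mult_le_one)
 moreover have "\<bar>?k x\<bar> <= 1 / R" for x using k2'b[of x] by simp
 moreover have "\<bar>?e1 x th\<bar> <= 1 / R" "\<bar>?e2 x th\<bar> <= 1 / R" if t: "norm th = 1" for x th
proof -
 have "\<bar>?e1 x th\<bar> <= 1 / 4 * (1 / R) * 1" using kf_bounds(2)[OF R0 t, of 6 ?I x] k2b[of "snd x"] R0 by (simp only: mult_zero_right add_0_left abs_mult, intro mult_mono) auto
 then show "\<bar>?e1 x th\<bar> <= 1 / R" using R0 by (simp add: field_simps)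
 have "1 / R\<^sup>2 + 2 / R <= 4 / R" using R by (simp add: field_simps power2_eq_square)
 then have "\<bar>kf2 R 6 ?I x th\<bar> <= 4 / R" using kf_bounds(3)[OF R0 t, of 6 ?I x] by linarith
 then have "\<bar>?e2 x th\<bar> <= 1 / 4 * (4 / R) * 1" using k2b[of "snd x"] R0 by (simp only: mult_zero_right add_0_left abs_mult, intro mult_mono) auto
 then show "\<bar>?e2 x th\<bar> <= 1 / R" by simp
qed
 moreover have "cu x = 1" if "x \<in> Gtilde" "ln (norm (fst x)) <= R" "ln (1 + (norm (snd x))\<^sup>2) <= R" for x
proof -
 have "ln (norm (fst x)) / R <= 1" using that R0 by simp
 then have "kf R 6 ?I x = -2" by (simp add: kf_eq[OF I0 that(1)] lnF_def phi_bot)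
 moreover have "ln (1 + (norm (snd x))\<^sup>2) / (2 * R) <= 1" using that R0 by (simp add: field_simps)
 then have "kap R 12 (1 + (norm (snd x))\<^sup>2) = -2" by (simp add: k2p phi_bot)
 ultimately show ?thesis by (simp add: cu_def c1_def k2_def)
qed
 moreover have "C2b cu" "bounded {x. cu x ~= 0}" using C2 bdd by (simp_all add: cu_def)
 ultimately have "cutoff R cu ?e1 ?e2 ?k" unfolding cutoff_def by (intro conjI ballI allI impI) (assumption | simp only:)+
 then show ?thesis by blast
qed

context levy_proc
begin

definition Mt :: "('d pg => real) => ('d pg => real) => real => real => 'w => real" where
 "Mt f L s t om = f (X t om) - f (X s om) - ig L s t om"

lemma Gb_Gf: "fld f d1 d2 h ==> bnd C f d1 d2 h ==> Gb (Gf f d1 d2 h) (C * KG TYPE('d))"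
 for f :: "'d pg => real" unfolding Gb_def using Gf_measurable Gf_bound by blast

lemma Mt_measurable:
 assumes "fld f d1 d2 h" "bnd C f d1 d2 h" "0 <= s" "s <= t"
 shows "Mt f (Gf f d1 d2 h) s t \<in> borel_measurable (F t)"
proof -
 have [measurable]: "f \<in> borel_measurable borel" "X t \<in> borel_measurable (F t)" "X s \<in> borel_measurable (F t)"
 "ig (Gf f d1 d2 h) s t \<in> borel_measurable (F t)" using fldD(1)[OF assms(1)] X_F ig_measurable[OF Gb_Gf[OF assms(1,2)]] assms by auto
 show ?thesis unfolding Mt_def[abs_def] by measurable
qed

lemma Mt_bound:
 assumes "fld f d1 d2 h" "bnd C f d1 d2 h" "0 <= s" "s <= t" "om \<in> space M"
 shows "\<bar>Mt f (Gf f d1 d2 h) s t om\<bar> <= 2 * C + C * KG TYPE('d) * (t - s)"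
proof -
 have "\<bar>f (X t om)\<bar> <= C" "\<bar>f (X s om)\<bar> <= C" using assms X_G by (auto simp: bnd_def)
 moreover have "\<bar>ig (Gf f d1 d2 h) s t om\<bar> <= C * KG TYPE('d) * (t - s)" using ig_lebesgue(4)[OF Gb_Gf[OF assms(1,2)] assms(3-5)] .
 ultimately show ?thesis unfolding Mt_def by linarith
qed

text \<open>The conditional expectation is traded for integration against bounded variables
  measurable at time s. From here on only this integrated form of the martingale property is
  used.\<close>

lemma martingale_C2c:
 fixes Z :: "'w => real"
 assumes f: "fld f d1 d2 h" and b: "bnd C f d1 d2 h" and c: "C2c f" and st: "0 <= s" "s <= t"
 and Z: "Z \<in> borel_measurable (F s)" "!!om. om \<in> space M ==> \<bar>Z om\<bar> <= B"
 shows "(\<integral>om. Z om * Mt f (Gf f d1 d2 h) s t om \<partial>M) = 0"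
proof -
 interpret S: finite_measure_subalgebra M "F s" by (standard) (rule subalg)
 let ?Y = "%om. f (X t om) - f (X s om) - integral {s..t} (%u. genL sg nu f (X u om))"
 have eq: "Mt f (Gf f d1 d2 h) s t om = ?Y om" if "om \<in> space M" for om unfolding Mt_def ig_def using st that by (auto intro!: Henstock_Kurzweil_Integration.integral_cong genL_eq[OF f, symmetric] X_G)
 have mM: "Mt f (Gf f d1 d2 h) s t \<in> borel_measurable M" by (rule F_M[OF Mt_measurable[OF f b st]])
 then have Ym [measurable]: "?Y \<in> borel_measurable M" by (rule measurable_cong[THEN iffD1, rotated]) (rule eq)
 note [measurable] = F_M[OF Z(1)]
 have B: "0 <= B" using Z(2) not_empty abs_ge_zero order_trans by blast
 have int: "integrable M (%om. Z om * ?Y om)"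
proof (rule integrable_bounded)
 fix om assume w: "om \<in> space M"
 show "\<bar>Z om * ?Y om\<bar> <= B * (2 * C + C * KG TYPE('d) * (t - s))" unfolding eq[OF w, symmetric] abs_mult by (intro mult_mono Z(2) w Mt_bound[OF f b st] B) simp
qed measurable
 have "(\<integral>om. Z om * ?Y om \<partial>M) = (\<integral>om. Z om * real_cond_exp M (F s) ?Y om \<partial>M)" by (rule S.real_cond_exp_intg(2)[OF int Z(1) Ym, symmetric])
 also have "... = (\<integral>om. 0 \<partial>M)"
proof (rule integral_cong_AE)
 have "AE om in M. real_cond_exp M (F s) ?Y om = 0" using levy c st unfolding left_levy_process_def by blast
 then show "AE om in M. Z om * real_cond_exp M (F s) ?Y om = 0" by eventually_elim simp
qed measurable
 finally have "(\<integral>om. Z om * ?Y om \<partial>M) = 0" by simp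
 moreover have "(\<integral>om. Z om * Mt f (Gf f d1 d2 h) s t om \<partial>M) = (\<integral>om. Z om * ?Y om \<partial>M)" by (rule Bochner_Integration.integral_cong) (auto simp: eq)
 ultimately show ?thesis by simp
qed

text \<open>Multiply f by cutoffs whose derivative data are O(1/n). The data of the products
  converge pointwise under one common bound, so the generators, their time integrals and the final
  expectation pass to the limit by dominated convergence.\<close>

lemma martingale:
 fixes Z :: "'w => real"
 assumes f: "fld f d1 d2 h" and b: "bnd C f d1 d2 h" and c: "C2b f" and st: "0 <= s" "s <= t"
 and Z: "Z \<in> borel_measurable (F s)" "!!om. om \<in> space M ==> \<bar>Z om\<bar> <= B"
 shows "(\<integral>om. Z om * Mt f (Gf f d1 d2 h) s t om \<partial>M) = 0"
proof -
 have "\<exists>(cu :: 'd pg => real) e1 e2 k. cutoff (real (Suc n)) cu e1 e2 k" for n by (rule cutoff_exists) simp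
 then obtain cu e1 e2 k where P: "!!n. cutoff (real (Suc n)) (cu n :: 'd pg => real) (e1 n) (e2 n) (k n)" by metis
 have ch: "fld (cu n) (e1 n) (e2 n) (k n)" "C2b (cu n)" "bounded {x. cu n x ~= 0}" for n using P[of n] by (simp_all add: cutoff_def)
 have cb: "\<bar>cu n x\<bar> <= 1" "\<bar>k n x\<bar> <= 1 / real (Suc n)" "norm th = 1 ==> \<bar>e1 n x th\<bar> <= 1 / real (Suc n)"
 "norm th = 1 ==> \<bar>e2 n x th\<bar> <= 1 / real (Suc n)" if "x \<in> Gtilde" for n x th using P[of n] that unfolding cutoff_def by blast+
 have z: "(%n. 1 / real (Suc n)) \<longlonglongrightarrow> 0" by (rule LIMSEQ_Suc[OF lim_1_over_n])
 have cl: "(%n. cu n x) \<longlonglongrightarrow> 1" if x: "x \<in> Gtilde" for x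
proof -
 have "eventually (%n. max (ln (norm (fst x))) (ln (1 + (norm (snd x))\<^sup>2)) <= real (Suc n)) sequentially" using eventually_ge_at_top[of "nat \<lceil>max (ln (norm (fst x))) (ln (1 + (norm (snd x))\<^sup>2))\<rceil>"] by eventually_elim linarith
 then have "eventually (%n. cu n x = 1) sequentially" by eventually_elim (use P x in \<open>auto simp: cutoff_def\<close>)
 then show ?thesis by (rule tendsto_eventually)
qed
 have kl: "(%n. k n x) \<longlonglongrightarrow> 0" if x: "x \<in> Gtilde" for x by (rule Lim_null_comparison[OF always_eventually z]) (use cb(2)[OF x] in auto)
 have el: "(%n. e1 n x th) \<longlonglongrightarrow> 0" "(%n. e2 n x th) \<longlonglongrightarrow> 0" if x: "x \<in> Gtilde" "norm th = 1" for x th by (rule Lim_null_comparison[OF always_eventually z], use cb(3,4)[OF x(1)] x(2) in auto)+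
 let ?f = "%n x. f x * cu n x"
 let ?d1 = "%n x th. f x * e1 n x th + d1 x th * cu n x"
 let ?d2 = "%n x th. f x * e2 n x th + 2 * d1 x th * e1 n x th + d2 x th * cu n x"
 let ?h = "%n x. f x * k n x + h x * cu n x"
 have fn: "fld (?f n) (?d1 n) (?d2 n) (?h n)" for n by (rule fld_mult[OF f ch(1)])
 have fb: "\<bar>f x\<bar> <= C" "\<bar>h x\<bar> <= C" "norm th = 1 ==> \<bar>d1 x th\<bar> <= C" "norm th = 1 ==> \<bar>d2 x th\<bar> <= C" if "x \<in> Gtilde" for x th using b that by (auto simp: bnd_def)
 have C: "0 <= C" using fb(1)[of "X 0 undefined"] by (meson X_G abs_ge_zero not_empty order_trans ex_in_conv fb(1) order_refl)
 have bn: "bnd (4 * C) (?f n) (?d1 n) (?d2 n) (?h n)" for n unfolding bnd_def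
proof (intro ballI conjI allI impI)
 fix x :: "'d pg" and th :: "real^'d" assume x: "x \<in> Gtilde"
 have le1: "1 / real (Suc n) <= 1" by simp
 have m: "\<bar>u * v\<bar> <= C" if "\<bar>u\<bar> <= C" "\<bar>v\<bar> <= 1" for u v using mult_mono[OF that C] by (simp add: abs_mult)
 have 1: "\<bar>cu n x\<bar> <= 1" "\<bar>k n x\<bar> <= 1" using cb(1,2)[OF x, of n] le1 by linarith+
 show "\<bar>f x * cu n x\<bar> <= 4 * C" using m[OF fb(1)[OF x] 1(1)] C by linarith
 show "\<bar>f x * k n x + h x * cu n x\<bar> <= 4 * C" using m[OF fb(1)[OF x] 1(2)] m[OF fb(2)[OF x] 1(1)] C by linarith
 assume t: "norm th = 1"
 have 2: "\<bar>e1 n x th\<bar> <= 1" "\<bar>e2 n x th\<bar> <= 1" using cb(3,4)[OF x, of th n] t le1 by linarith+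
 show "\<bar>f x * e1 n x th + d1 x th * cu n x\<bar> <= 4 * C" using m[OF fb(1)[OF x] 2(1)] m[OF fb(3)[OF x t] 1(1)] C by linarith
 show "\<bar>f x * e2 n x th + 2 * d1 x th * e1 n x th + d2 x th * cu n x\<bar> <= 4 * C" using m[OF fb(1)[OF x] 2(2)] m[OF fb(3)[OF x t] 2(1)] m[OF fb(4)[OF x t] 1(1)] C by linarith
qed
 have cn: "C2c (?f n)" for n
proof -
 have "{x. f x * cu n x ~= 0} \<subseteq> {x. cu n x ~= 0}" by auto
 then have "bounded {x. f x * cu n x ~= 0}" by (rule bounded_subset[OF ch(3)])
 then show ?thesis unfolding C2c_iff using C2b_mult[OF c ch(2)] by (simp add: compact_closure)
qed
 let ?L = "Gf f d1 d2 h" and ?Ln = "%n. Gf (?f n) (?d1 n) (?d2 n) (?h n)"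
 let ?K = "4 * C * KG TYPE('d)"
 have lim: "(%n. ?Ln n x) \<longlonglongrightarrow> ?L x" if x: "x \<in> Gtilde" for x
proof -
 have h: "(%n. ?h n x) \<longlonglongrightarrow> h x" using tendsto_add[OF tendsto_mult_left[OF kl[OF x], of "f x"] tendsto_mult_left[OF cl[OF x], of "h x"]] by simp
 have d2: "(%n. ?d2 n x (axis i 1)) \<longlonglongrightarrow> d2 x (axis i 1)" for i using tendsto_add[OF tendsto_add[OF tendsto_mult_left[OF el(2)[OF x], of "axis i 1" "f x"]
 tendsto_mult_left[OF el(1)[OF x], of "axis i 1" "2 * d1 x (axis i 1)"]] tendsto_mult_left[OF cl[OF x], of "d2 x (axis i 1)"]] by simp
 have d1: "(%n. ?d1 n x (axis i 1)) \<longlonglongrightarrow> d1 x (axis i 1)" for i using tendsto_add[OF tendsto_mult_left[OF el(1)[OF x], of "axis i 1" "f x"] tendsto_mult_left[OF cl[OF x], of "d1 x (axis i 1)"]] by simp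
 have ff: "(%n. ?f n y) \<longlonglongrightarrow> f y" if "y \<in> Gtilde" for y using tendsto_mult_left[OF cl[OF that], of "f y"] by simp
 have J: "(%n. dint (Jf (?f n) (?d1 n) x)) \<longlonglongrightarrow> dint (Jf f d1 x)"
proof (rule dint_convergence[OF Jf_dom[OF fn bn x] Jf_dom[OF f b x]])
 fix r :: real and th :: "real^'d" assume t: "norm th = 1"
 show "(%n. Jf (?f n) (?d1 n) x r th) \<longlonglongrightarrow> Jf f d1 x r th" unfolding Jf_def by (intro tendsto_intros ff mv_Gtilde x t d1)
qed
 show ?thesis unfolding Gf_def by (intro tendsto_intros h d2 J)
qed
 have Gn: "Gb (?Ln n) ?K" for n by (rule Gb_Gf[OF fn bn])
 have G: "Gb ?L (C * KG TYPE('d))" by (rule Gb_Gf[OF f b])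
 have t0: "0 <= t" using st by simp
 have iglim: "(%n. ig (?Ln n) s t om) \<longlonglongrightarrow> ig ?L s t om" if w: "om \<in> space M" for om unfolding ig_lebesgue(2)[OF Gn st w] ig_lebesgue(2)[OF G st w]
proof (rule integral_dominated_convergence[where w = "%u. ?K * indicator {s..t} u"])
 have "integrable lborel (indicator {s..t} :: real => real)" by (rule integrable_real_indicator) (auto simp: emeasure_lborel_Icc_eq)
 then show "integrable lborel (%u. ?K * indicator {s..t} u :: real)" by simp
 show "AE u in lborel. (%n. aG (?Ln n) s t om u) \<longlonglongrightarrow> aG ?L s t om u" unfolding aG_def by (intro AE_I2 tendsto_mult_left lim X_G w) simp
 show "AE u in lborel. norm (aG (?Ln n) s t om u) <= ?K * indicator {s..t} u" for n using aG_bound[OF Gn t0 w] by simp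
qed (use aG_measurable_path[OF G t0 w] aG_measurable_path[OF Gn t0 w] in auto)
 have B: "0 <= B" using Z(2) not_empty abs_ge_zero order_trans by blast
 note [measurable] = F_M[OF Z(1)]
 have "(%n. \<integral>om. Z om * Mt (?f n) (?Ln n) s t om \<partial>M) \<longlonglongrightarrow> (\<integral>om. Z om * Mt f ?L s t om \<partial>M)"
proof (rule integral_dominated_convergence[where w = "%_. B * (2 * (4 * C) + ?K * (t - s))"])
 show "(%om. Z om * Mt f ?L s t om) \<in> borel_measurable M" "!!n. (%om. Z om * Mt (?f n) (?Ln n) s t om) \<in> borel_measurable M" using F_M[OF Mt_measurable[OF f b st]] F_M[OF Mt_measurable[OF fn bn st]] by measurable
 show "AE om in M. (%n. Z om * Mt (?f n) (?Ln n) s t om) \<longlonglongrightarrow> Z om * Mt f ?L s t om"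
proof (rule AE_I2)
 fix om assume w: "om \<in> space M"
 have ff: "(%n. ?f n y) \<longlonglongrightarrow> f y" if "y \<in> Gtilde" for y using tendsto_mult_left[OF cl[OF that], of "f y"] by simp
 show "(%n. Z om * Mt (?f n) (?Ln n) s t om) \<longlonglongrightarrow> Z om * Mt f ?L s t om" unfolding Mt_def by (rule tendsto_mult_left) (intro tendsto_diff iglim w ff X_G st t0)
qed
 show "AE om in M. norm (Z om * Mt (?f n) (?Ln n) s t om) <= B * (2 * (4 * C) + ?K * (t - s))" for n using Mt_bound[OF fn bn st] Z(2) B by (auto simp: abs_mult intro!: AE_I2 mult_mono)
qed auto
 moreover have "(\<integral>om. Z om * Mt (?f n) (?Ln n) s t om \<partial>M) = 0" for n by (rule martingale_C2c[OF fn bn cn st Z])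
 ultimately show ?thesis by (simp add: LIMSEQ_const_iff)
qed

end

section \<open>Second moments of martingale increments\<close>

context levy_proc
begin

lemma bnd_square:
 assumes "bnd C f d1 d2 h"
 shows "bnd (4 * C\<^sup>2) (%x. f x * f x) (%x th. f x * d1 x th + d1 x th * f x)
 (%x th. f x * d2 x th + 2 * d1 x th * d1 x th + d2 x th * f x) (%x. f x * h x + h x * f x)" unfolding bnd_def
proof (intro ballI conjI allI impI)
 fix x :: "'a pg" and th :: "real^'a" assume x: "x \<in> Gtilde"
 have m: "\<bar>u * v\<bar> <= C\<^sup>2" if "\<bar>u\<bar> <= C" "\<bar>v\<bar> <= C" for u v using mult_mono[OF that] that by (simp add: abs_mult power2_eq_square order_trans[OF abs_ge_zero])
 have f: "\<bar>f x\<bar> <= C" and h: "\<bar>h x\<bar> <= C" using assms x by (auto simp: bnd_def)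
 show "\<bar>f x * f x\<bar> <= 4 * C\<^sup>2" using m[OF f f] zero_le_power2[of C] by linarith
 show "\<bar>f x * h x + h x * f x\<bar> <= 4 * C\<^sup>2" using m[OF f h] m[OF h f] zero_le_power2[of C] by linarith
 assume t: "norm th = 1"
 have d: "\<bar>d1 x th\<bar> <= C" "\<bar>d2 x th\<bar> <= C" using assms x t by (auto simp: bnd_def)
 show "\<bar>f x * d1 x th + d1 x th * f x\<bar> <= 4 * C\<^sup>2" using m[OF f d(1)] m[OF d(1) f] zero_le_power2[of C] by linarith
 show "\<bar>f x * d2 x th + 2 * d1 x th * d1 x th + d2 x th * f x\<bar> <= 4 * C\<^sup>2" using m[OF f d(2)] m[OF d(1) d(1)] m[OF d(2) f] by linarith
qed

lemma Gb_Gam: 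
 fixes f :: "'d pg => real"
 assumes "fld f d1 d2 h" "bnd C f d1 d2 h" shows "Gb (Gam f d1) (C\<^sup>2 * KG TYPE('d))" unfolding Gb_def using Gam_measurable[OF assms(1)] Gam_bound[OF assms] Gam_nonneg[of f d1] by (simp add: abs_of_nonneg)

lemma ig_cong: "0 <= s ==> om \<in> space M ==> (!!x. x \<in> Gtilde ==> G x = H x) ==> ig G s t om = ig H s t om" unfolding ig_def by (intro Henstock_Kurzweil_Integration.integral_cong) (auto simp: X_G)

lemma ig_linear:
 assumes "Gb G K" "Gb H K'" "0 <= s" "s <= t" "om \<in> space M"
 shows "ig (%x. G x + c * H x) s t om = ig G s t om + c * ig H s t om" unfolding ig_def using Henstock_Kurzweil_Integration.integral_add[OF ig_lebesgue(3)[OF assms(1,3,4,5)] integrable_on_cmult_left[OF ig_lebesgue(3)[OF assms(2,3,4,5)], of c]] by simp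

lemma ig_mono:
 assumes "Gb G K" "0 <= s" "s <= t" "om \<in> space M" "!!x. x \<in> Gtilde ==> G x <= c"
 shows "ig G s t om <= c * (t - s)"
proof -
 have "ig G s t om <= integral {s..t} (%u. c)" unfolding ig_def by (rule integral_le[OF ig_lebesgue(3)[OF assms(1-4)]]) (use assms in \<open>auto simp: X_G\<close>)
 then show ?thesis using assms by (simp add: mult.commute)
qed

lemma ig_mono_ge:
 assumes "Gb G K" "0 <= s" "s <= t" "om \<in> space M" "!!x. x \<in> Gtilde ==> c <= G x"
 shows "c * (t - s) <= ig G s t om"
proof -
 have "integral {s..t} (%u. c) <= ig G s t om" unfolding ig_def by (rule integral_le[OF _ ig_lebesgue(3)[OF assms(1-4)]]) (use assms in \<open>auto simp: X_G\<close>)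
 then show ?thesis using assms by (simp add: mult.commute)
qed

lemma F_indicator: "A \<in> sets (F s) ==> indicator A \<in> borel_measurable (F s)" by simp

text \<open>Write the product of f(X_t) with I = int_s^t Lf(X_u) du as a time integral and split
  f(X_t) at each u into f(X_u), the integral of Lf over [u, t], and a martingale increment. The
  increment integrates to zero against Lf(X_u), and the double integral of Lf over u < v is
  I^2/2.\<close>

lemma martingale_product:
 fixes f :: "'d pg => real"
 assumes f: "fld f d1 d2 h" and b: "bnd C f d1 d2 h" and c: "C2b f" and st: "0 <= s" "s <= t"
 and A: "A \<in> sets (F s)"
 defines "L \<equiv> Gf f d1 d2 h"
 shows "(\<integral>om. indicator A om * (f (X t om) * ig L s t om - ig (%x. f x * L x) s t om - (ig L s t om)\<^sup>2 / 2) \<partial>M) = (0::real)"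
proof -
 let ?K = "C * KG TYPE('d)"
 have L: "Gb L ?K" unfolding L_def by (rule Gb_Gf[OF f b])
 have t0: "0 <= t" using st by simp
 have fm [measurable]: "f \<in> borel_measurable borel" by (rule fldD(1)[OF f])
 have AM: "A \<in> sets M" using A subalg by (auto simp: subalgebra_def)
 have fb: "\<bar>f x\<bar> <= C" if "x \<in> Gtilde" for x using b that by (auto simp: bnd_def)
 have fL: "Gb (%x. f x * L x) (C * ?K)" unfolding Gb_def
proof (intro conjI ballI)
 have [measurable]: "L \<in> borel_measurable borel" using L by (simp add: Gb_def)
 show "(%x. f x * L x) \<in> borel_measurable borel" by measurable
 fix x :: "'d pg" assume x: "x \<in> Gtilde"
 show "\<bar>f x * L x\<bar> <= C * ?K" unfolding abs_mult using L fb[OF x] x by (intro mult_mono) (auto simp: Gb_def intro: order_trans[OF abs_ge_zero])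
qed
 define R where "R u om = (\<integral>v. indicator {u..} v * aG L s t om v \<partial>lborel)" for u om
 have Rig: "R u om = ig L u t om" if w: "om \<in> space M" and u: "u \<in> {s..t}" for u om
proof -
 have "indicator {u..} v * aG L s t om v = aG L u t om v" for v using u by (auto simp: aG_def indicator_def)
 then show ?thesis unfolding R_def using ig_lebesgue(2)[OF L _ _ w, of u t] u st by simp
qed
 \<comment> \<open>The martingale increment from u to t on the event A. Expressed through
   \<open>R\<close> and clamped times, it is jointly measurable and bounded, as Fubini
   requires.\<close>
 define Z where "Z u om = (indicator A om * indicator {s..t} u) * (f (X t om) - f (X (cl t u) om) - R u om)" for u om
 have idM: "(%p. (fst p, snd p)) \<in> measurable (borel \<Otimes>\<^sub>M M) ((borel :: real measure) \<Otimes>\<^sub>M F t)"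
proof -
 have "(%x. x) \<in> measurable M (F t)" by (rule F_M[of _ t]) simp
 then show ?thesis by (intro measurable_Pair measurable_fst measurable_compose[OF measurable_snd])
qed
 have aGm [measurable]: "(%p. aG L s t (snd p) (fst p)) \<in> borel_measurable (borel \<Otimes>\<^sub>M M)" using measurable_compose[OF idM aG_measurable[OF L t0, of s]] by simp
 have Xm [measurable]: "(%p. X (cl t (fst p)) (snd p)) \<in> borel_measurable (borel \<Otimes>\<^sub>M M)" using measurable_compose[OF idM prog[OF t0]] by simp
 have Rm [measurable]: "(%p. R (fst p) (snd p)) \<in> borel_measurable (borel \<Otimes>\<^sub>M M)"
proof -
 have "(%q. indicator {q. fst (fst q) <= snd q} q * (%p. aG L s t (snd p) (fst p)) (snd q, snd (fst q))) \<in> borel_measurable ((borel \<Otimes>\<^sub>M M) \<Otimes>\<^sub>M lborel)" by measurable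
 moreover have "indicator {q. fst (fst q) <= snd q} ((p, v) :: (real \<times> 'w) \<times> real) = (indicator {fst p..} v :: real)" for p v by (auto simp: indicator_def)
 ultimately have "(%(p, v). indicator {fst p..} v * aG L s t (snd p) v) \<in> borel_measurable ((borel \<Otimes>\<^sub>M M) \<Otimes>\<^sub>M lborel)" by (simp add: split_beta' indicator_def)
 then show ?thesis unfolding R_def by (rule lborel.borel_measurable_lebesgue_integral)
qed
 have Zm: "(%p. Z (fst p) (snd p)) \<in> borel_measurable (borel \<Otimes>\<^sub>M M)"
proof -
 note [measurable] = AM X_meas[OF t0]
 show ?thesis unfolding Z_def by measurable
qed
 have C: "0 <= C" using fb X_G[of _ 0] not_empty by (meson abs_ge_zero ex_in_conv order_refl order_trans)
 have K: "0 <= ?K" by (intro mult_nonneg_nonneg C KG_nonneg)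
 have Zb: "\<bar>Z u om\<bar> <= 2 * C + ?K * (t - s)" if w: "om \<in> space M" for u om
proof (cases "u \<in> {s..t} & om \<in> A")
case True
 have "\<bar>R u om\<bar> <= ?K * (t - u)" using ig_lebesgue(4)[OF L _ _ w, of u t] Rig[OF w, of u] True st by auto
 also have "... <= ?K * (t - s)" using True K by (intro mult_left_mono) auto
 finally show ?thesis using True fb[OF X_G[OF w t0]] fb[OF X_G[OF w, of "cl t u"]] unfolding Z_def by simp
next
case False
 have "0 <= ?K * (t - s)" using K st by (intro mult_nonneg_nonneg[of ?K]) auto
 then have "0 <= 2 * C + ?K * (t - s)" using C by linarith
 then show ?thesis using False by (auto simp: Z_def)
qed
 have zero: "(\<integral>om. Z u om * aG L s t om u \<partial>M) = 0" for u
proof (cases "u \<in> {s..t}")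
case False
 then show ?thesis by (simp add: Z_def)
next
case True
 then have u: "s <= u" "u <= t" "0 <= u" using st by auto
 have cu: "cl t u = u" using u by simp
 have "(\<integral>om. Z u om * aG L s t om u \<partial>M) = (\<integral>om. (indicator A om * L (X u om)) * Mt f L u t om \<partial>M)" by (rule Bochner_Integration.integral_cong) (use True u in \<open>auto simp: Z_def aG_def Mt_def Rig cu\<close>)
 also have "... = 0" unfolding L_def
proof (rule martingale[OF f b c u(3,2)])
 have "A \<in> sets (F u)" using A F_mono[OF u(1)] by auto
 moreover have "(%om. L (X u om)) \<in> borel_measurable (F u)" using L X_F[OF u(3) order_refl] by (auto simp: Gb_def intro: measurable_compose)
 ultimately show "(%om. indicator A om * Gf f d1 d2 h (X u om)) \<in> borel_measurable (F u)" unfolding L_def by measurable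
 show "\<bar>indicator A om * Gf f d1 d2 h (X u om)\<bar> <= ?K" if "om \<in> space M" for om using L X_G[OF that u(3)] K by (auto simp: Gb_def L_def indicator_def)
qed
 finally show ?thesis .
qed
 have path: "(\<integral>u. Z u om * aG L s t om u \<partial>lborel) = indicator A om * (f (X t om) * ig L s t om - ig (%x. f x * L x) s t om - (ig L s t om)\<^sup>2 / 2)"
 if w: "om \<in> space M" for om
proof -
 let ?a = "aG L s t om"
 note am [measurable] = aG_measurable_path[OF L t0 w, of s]
 have ab: "\<bar>?a u\<bar> <= ?K * indicator {s..t} u" for u by (rule aG_bound[OF L t0 w])
 have ia: "integrable lborel ?a" by (rule ig_lebesgue(1)[OF L st w])
 have ifa: "integrable lborel (aG (%x. f x * L x) s t om)" by (rule ig_lebesgue(1)[OF fL st w])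
 have aR: "integrable lborel (%u. ?a u * R u om)"
proof (rule Bochner_Integration.integrable_bound)
 show "integrable lborel (%u. ?a u * (?K * (t - s)))" using ia by simp
 have "(%u. R u om) \<in> borel_measurable borel" using measurable_compose[OF measurable_Pair2'[OF w] Rm] by simp
 then show "(%u. ?a u * R u om) \<in> borel_measurable lborel" by measurable
 show "AE u in lborel. norm (?a u * R u om) <= norm (?a u * (?K * (t - s)))"
proof (rule AE_I2)
 fix u show "norm (?a u * R u om) <= norm (?a u * (?K * (t - s)))"
proof (cases "u \<in> {s..t}")
case True
 have "\<bar>R u om\<bar> <= ?K * (t - u)" using ig_lebesgue(4)[OF L _ _ w, of u t] Rig[OF w, of u] True st by auto
 also have "... <= ?K * (t - s)" using True K by (intro mult_left_mono) auto
 finally have "\<bar>R u om\<bar> <= \<bar>?K * (t - s)\<bar>" by linarith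
 then show ?thesis unfolding real_norm_def abs_mult[of "?a u"] by (intro mult_left_mono) auto
qed (simp add: aG_def)
qed
qed
 have "(\<integral>u. Z u om * ?a u \<partial>lborel) = (\<integral>u. indicator A om * (f (X t om) * ?a u - aG (%x. f x * L x) s t om u - ?a u * R u om) \<partial>lborel)" by (rule Bochner_Integration.integral_cong) (auto simp: Z_def aG_def indicator_def algebra_simps)
 also have "... = indicator A om * (f (X t om) * ig L s t om - ig (%x. f x * L x) s t om - (\<integral>u. ?a u * R u om \<partial>lborel))" using ia ifa aR by (simp add: ig_lebesgue(2)[OF L st w] ig_lebesgue(2)[OF fL st w])
 also have "(\<integral>u. ?a u * R u om \<partial>lborel) = (ig L s t om)\<^sup>2 / 2" unfolding R_def ig_lebesgue(2)[OF L st w] by (rule has_integral_half_square[OF am ab])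
 finally show ?thesis .
qed
 have "(\<integral>om. indicator A om * (f (X t om) * ig L s t om - ig (%x. f x * L x) s t om - (ig L s t om)\<^sup>2 / 2) \<partial>M)
 = (\<integral>om. (\<integral>u. Z u om * aG L s t om u \<partial>lborel) \<partial>M)" by (rule Bochner_Integration.integral_cong) (auto simp: path)
 also have "... = (\<integral>u. (\<integral>om. Z u om * aG L s t om u \<partial>M) \<partial>lborel)" by (rule ig_Fubini[OF L st Zm Zb])
 finally show ?thesis by (simp add: zero)
qed

text \<open>Expanding the square leaves three mixed terms, evaluated by the martingale property of
  f^2, by testing the one of f against f(X_s), and by \<open>martingale_product\<close>. The second
  moment on A then equals the expected time integral of the carre du champ on A.\<close>

lemma martingale_square:
 fixes f :: "'d pg => real"
 assumes f: "fld f d1 d2 h" and b: "bnd C f d1 d2 h" and c: "C2b f" and st: "0 <= s" "s <= t"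
 and A: "A \<in> sets (F s)" and g: "!!x. x \<in> Gtilde ==> Gam f d1 x <= ga"
 shows "(\<integral>om. indicator A om * (Mt f (Gf f d1 d2 h) s t om)\<^sup>2 \<partial>M) <= prob A * (ga * (t - s))"
proof -
 define L where "L = Gf f d1 d2 h"
 let ?K = "C * KG TYPE('d)"
 let ?L2 = "Gf (%x. f x * f x) (%x th. f x * d1 x th + d1 x th * f x) (%x th. f x * d2 x th + 2 * d1 x th * d1 x th + d2 x th * f x) (%x. f x * h x + h x * f x)"
 have L: "Gb L ?K" unfolding L_def by (rule Gb_Gf[OF f b])
 have Gm: "Gb (Gam f d1) (C\<^sup>2 * KG TYPE('d))" by (rule Gb_Gam[OF f b])
 note f2 = fld_mult[OF f f] note b2 = bnd_square[OF b]
 have L2: "Gb ?L2 (4 * C\<^sup>2 * KG TYPE('d))" by (rule Gb_Gf[OF f2 b2])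
 have AM [measurable]: "A \<in> sets M" using A subalg by (auto simp: subalgebra_def)
 have fb: "\<bar>f x\<bar> <= C" if "x \<in> Gtilde" for x using b that by (auto simp: bnd_def)
 have fm [measurable]: "f \<in> borel_measurable borel" by (rule fldD(1)[OF f])
 have fL: "Gb (%x. f x * L x) (C * ?K)" unfolding Gb_def
proof (intro conjI ballI)
 have [measurable]: "L \<in> borel_measurable borel" using L by (simp add: Gb_def)
 show "(%x. f x * L x) \<in> borel_measurable borel" by measurable
 fix x :: "'d pg" assume x: "x \<in> Gtilde"
 show "\<bar>f x * L x\<bar> <= C * ?K" unfolding abs_mult using L fb[OF x] x by (intro mult_mono) (auto simp: Gb_def intro: order_trans[OF abs_ge_zero])
qed
 have t0: "0 <= t" using st by simp
 have m [measurable]: "(%om. f (X t om)) \<in> borel_measurable M" "(%om. f (X s om)) \<in> borel_measurable M"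
 "ig L s t \<in> borel_measurable M" "ig (Gam f d1) s t \<in> borel_measurable M" "ig ?L2 s t \<in> borel_measurable M"
 "ig (%x. f x * L x) s t \<in> borel_measurable M" using X_meas[OF t0] X_meas[OF st(1)] F_M[OF ig_measurable[OF L st]] F_M[OF ig_measurable[OF Gm st]]
 F_M[OF ig_measurable[OF L2 st]] F_M[OF ig_measurable[OF fL st]] by auto
 have bd: "\<exists>B. \<forall>om\<in>space M. \<bar>f (X t om)\<bar> <= B & \<bar>f (X s om)\<bar> <= B & \<bar>ig L s t om\<bar> <= B & \<bar>ig (Gam f d1) s t om\<bar> <= B & \<bar>ig (%x. f x * L x) s t om\<bar> <= B" using fb[OF X_G[OF _ t0]] fb[OF X_G[OF _ st(1)]] ig_lebesgue(4)[OF L st] ig_lebesgue(4)[OF Gm st] ig_lebesgue(4)[OF fL st] by (intro exI[of _ "max C (max (?K * (t - s)) (max (C\<^sup>2 * KG TYPE('d) * (t - s)) (C * ?K * (t - s))))"]) (auto simp: le_max_iff_disj)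
 then obtain B where B: "!!om. om \<in> space M ==> \<bar>f (X t om)\<bar> <= B & \<bar>f (X s om)\<bar> <= B & \<bar>ig L s t om\<bar> <= B & \<bar>ig (Gam f d1) s t om\<bar> <= B & \<bar>ig (%x. f x * L x) s t om\<bar> <= B" by blast
 have B0: "0 <= B" using B not_empty by (meson abs_ge_zero ex_in_conv order_trans)
 have mb: "\<bar>indicator A om * (p * q)\<bar> <= B * B" if "\<bar>p\<bar> <= B" "\<bar>q\<bar> <= B" for p q om using mult_mono[OF that B0] B0 by (auto simp: indicator_def abs_mult)
 have mb1: "\<bar>indicator A om * p\<bar> <= B" if "\<bar>p\<bar> <= B" for p om using that B0 by (auto simp: indicator_def)
 have i: "integrable M (%om. indicator A om * (f (X t om) * f (X t om)))" "integrable M (%om. indicator A om * (f (X s om) * f (X s om)))"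
 "integrable M (%om. indicator A om * (f (X t om) * f (X s om)))" "integrable M (%om. indicator A om * (f (X t om) * ig L s t om))"
 "integrable M (%om. indicator A om * (f (X s om) * ig L s t om))" "integrable M (%om. indicator A om * (ig L s t om * ig L s t om))" by (intro integrable_bounded[where K = "B * B"]; measurable; intro mb; use B in blast)+
 have i2: "integrable M (%om. indicator A om * ig (Gam f d1) s t om)" "integrable M (%om. indicator A om * ig (%x. f x * L x) s t om)" by (intro integrable_bounded[where K = "B"]; measurable; intro mb1; use B in blast)+
 let ?I = "%g. (\<integral>om. indicator A om * g om \<partial>M)"
 have ilin: "ig ?L2 s t om = ig (Gam f d1) s t om + 2 * ig (%x. f x * L x) s t om" if w: "om \<in> space M" for om using ig_linear[OF Gm fL st w, of 2] ig_cong[OF st(1) w, of ?L2 "%x. Gam f d1 x + 2 * (f x * L x)" t] Gf_square[OF f b] by (simp add: L_def algebra_simps)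
 have E1: "?I (%om. f (X t om) * f (X t om)) - ?I (%om. f (X s om) * f (X s om)) - ?I (ig (Gam f d1) s t) - 2 * ?I (ig (%x. f x * L x) s t) = 0"
proof -
 have "0 = ?I (Mt (%x. f x * f x) ?L2 s t)" by (rule martingale[OF f2 b2 C2b_mult[OF c c] st F_indicator[OF A], of 1, symmetric]) (auto simp: indicator_def)
 also have "... = (\<integral>om. indicator A om * (f (X t om) * f (X t om)) - indicator A om * (f (X s om) * f (X s om)) - indicator A om * ig (Gam f d1) s t om - 2 * (indicator A om * ig (%x. f x * L x) s t om) \<partial>M)"
proof (rule Bochner_Integration.integral_cong[OF refl])
 fix om assume w: "om \<in> space M"
 show "indicator A om * Mt (%x. f x * f x) ?L2 s t om = indicator A om * (f (X t om) * f (X t om)) - indicator A om * (f (X s om) * f (X s om)) - indicator A om * ig (Gam f d1) s t om - 2 * (indicator A om * ig (%x. f x * L x) s t om)" unfolding Mt_def ilin[OF w] by (simp add: algebra_simps)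
qed
 finally show ?thesis using i i2 by simp
qed
 have E2: "?I (%om. f (X t om) * f (X s om)) - ?I (%om. f (X s om) * f (X s om)) - ?I (%om. f (X s om) * ig L s t om) = 0"
proof -
 have "0 = (\<integral>om. (indicator A om * f (X s om)) * Mt f L s t om \<partial>M)" unfolding L_def
proof (rule martingale[OF f b c st, of _ C, symmetric])
 note [measurable] = A measurable_compose[OF X_F[OF st(1) order_refl] fm]
 show "(%om. indicator A om * f (X s om)) \<in> borel_measurable (F s)" by measurable
 show "\<bar>indicator A om * f (X s om)\<bar> <= C" if "om \<in> space M" for om using fb[OF X_G[OF that st(1)]] by (auto simp: indicator_def)
qed
 also have "... = (\<integral>om. indicator A om * (f (X t om) * f (X s om)) - indicator A om * (f (X s om) * f (X s om)) - indicator A om * (f (X s om) * ig L s t om) \<partial>M)" by (rule Bochner_Integration.integral_cong) (auto simp: Mt_def algebra_simps)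
 finally show ?thesis using i i2 by simp
qed
 have E3: "?I (%om. f (X t om) * ig L s t om) - ?I (ig (%x. f x * L x) s t) - ?I (%om. ig L s t om * ig L s t om) / 2 = 0"
proof -
 have "0 = (\<integral>om. indicator A om * (f (X t om) * ig L s t om - ig (%x. f x * L x) s t om - (ig L s t om)\<^sup>2 / 2) \<partial>M)" using martingale_product[OF f b c st A] unfolding L_def by simp
 also have "... = (\<integral>om. indicator A om * (f (X t om) * ig L s t om) - indicator A om * ig (%x. f x * L x) s t om - indicator A om * (ig L s t om * ig L s t om) / 2 \<partial>M)" by (rule Bochner_Integration.integral_cong) (auto simp: algebra_simps power2_eq_square)
 finally show ?thesis using i i2 by simp
qed
 have "?I (%om. (Mt f L s t om)\<^sup>2) = (\<integral>om. indicator A om * (f (X t om) * f (X t om)) + indicator A om * (f (X s om) * f (X s om))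
 + indicator A om * (ig L s t om * ig L s t om) - 2 * (indicator A om * (f (X t om) * f (X s om)))
 - 2 * (indicator A om * (f (X t om) * ig L s t om)) + 2 * (indicator A om * (f (X s om) * ig L s t om)) \<partial>M)" by (rule Bochner_Integration.integral_cong) (auto simp: Mt_def algebra_simps power2_eq_square)
 also have "... = ?I (%om. f (X t om) * f (X t om)) + ?I (%om. f (X s om) * f (X s om)) + ?I (%om. ig L s t om * ig L s t om)
 - 2 * ?I (%om. f (X t om) * f (X s om)) - 2 * ?I (%om. f (X t om) * ig L s t om) + 2 * ?I (%om. f (X s om) * ig L s t om)" using i by simp
 \<comment> \<open>With I the integral of Lf over [s, t], the terms in f(X_s)^2, f(X_s) I, I^2 and
   the integral of f Lf cancel.\<close>
 also have "... = ?I (ig (Gam f d1) s t)" using E1 E2 E3 by linarith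
 also have "... <= (\<integral>om. indicator A om * (ga * (t - s)) \<partial>M)"
proof (rule integral_mono[OF i2(1)])
 show "indicator A om * ig (Gam f d1) s t om <= indicator A om * (ga * (t - s))" if "om \<in> space M" for om using ig_mono[OF Gm st that g] by (auto simp: indicator_def)
 have "integrable M (indicator A :: 'w => real)" by (rule integrable_real_indicator[OF AM]) (simp add: less_top[symmetric])
 then show "integrable M (%om. indicator A om * (ga * (t - s)))" by simp
qed
 also have "... = prob A * (ga * (t - s))" by simp
 finally show ?thesis unfolding L_def .
qed

end

section \<open>Maximal inequality\<close>

context levy_proc
begin

lemma Mt_split:
 assumes "fld f d1 d2 h" "bnd C f d1 d2 h" "0 <= s" "s <= u" "u <= t" "om \<in> space M"
 shows "Mt f (Gf f d1 d2 h) s t om = Mt f (Gf f d1 d2 h) s u om + Mt f (Gf f d1 d2 h) u t om" unfolding Mt_def using ig_split[OF Gb_Gf[OF assms(1,2)] assms(3-6)] by simp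

text \<open>Kolmogorov's inequality by first passage. Working on an event A known at time s gives
  the bound a factor \<open>prob A\<close>, which is what makes it summable over a partition
  later.\<close>

lemma maximal_discrete:
 fixes f :: "'d pg => real" and u :: "nat => real" and N :: nat
 assumes f: "fld f d1 d2 h" and b: "bnd C f d1 d2 h" and c: "C2b f" and s: "0 <= s"
 and u: "!!k. k <= N ==> s <= u k" "!!j k. j <= k ==> k <= N ==> u j <= u k" 
 and A: "A \<in> sets (F s)" and g: "!!x. x \<in> Gtilde ==> Gam f d1 x <= ga" and d: "dl > 0"
 defines "E \<equiv> {om \<in> A. \<exists>k\<le>N. \<bar>Mt f (Gf f d1 d2 h) s (u k) om\<bar> > dl}"
 shows "E \<in> sets M" "prob E <= prob A * (ga * (u N - s)) / dl\<^sup>2"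
proof -
 define S where "S k = Mt f (Gf f d1 d2 h) s (u k)" for k
 have AM: "A \<in> sets M" and Asp: "A \<subseteq> space M" using A subalg sets.sets_into_space[of A "F s"] by (auto simp: subalgebra_def)
 \<comment> \<open>The event that k is the first index of excess. It is known at time
   \<open>u k\<close>, so the remaining increment integrates to zero against the value reached
   there.\<close>
 define B where "B k = {om \<in> A. \<bar>S k om\<bar> > dl & (\<forall>j<k. \<bar>S j om\<bar> <= dl)}" for k
 have SF: "S j \<in> borel_measurable (F (u k))" if "j <= k" "k <= N" for j k
proof -
 have "S j \<in> borel_measurable (F (u j))" unfolding S_def by (rule Mt_measurable[OF f b s u(1)[OF order_trans[OF that]]])
 then show ?thesis by (rule F_mono_measurable[OF u(2)[OF that]])
qed
 have BF: "B k \<in> sets (F (u k))" if k: "k <= N" for k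
proof -
 have AF: "A \<in> sets (F (u k))" using A F_mono[OF u(1)[OF k]] by auto
 have 1: "{om \<in> space (F (u k)). \<bar>S k om\<bar> > dl} \<in> sets (F (u k))" using SF[OF order_refl k] by measurable
 have "{om \<in> space (F (u k)). \<forall>j\<in>{..<k}. \<bar>S j om\<bar> <= dl} \<in> sets (F (u k))"
proof (rule sets.sets_Collect_finite_All)
 fix j assume "j \<in> {..<k}"
 then have "S j \<in> borel_measurable (F (u k))" using SF k by auto
 then show "{om \<in> space (F (u k)). \<bar>S j om\<bar> <= dl} \<in> sets (F (u k))" by measurable
qed simp
 from sets.Int[OF AF sets.Int[OF 1 this]]
 have "A \<inter> ({om \<in> space (F (u k)). \<bar>S k om\<bar> > dl} \<inter> {om \<in> space (F (u k)). \<forall>j\<in>{..<k}. \<bar>S j om\<bar> <= dl}) \<in> sets (F (u k))" .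
 moreover have "B k = A \<inter> ({om \<in> space (F (u k)). \<bar>S k om\<bar> > dl} \<inter> {om \<in> space (F (u k)). \<forall>j\<in>{..<k}. \<bar>S j om\<bar> <= dl})" using Asp by (auto simp: B_def)
 ultimately show ?thesis by simp
qed
 have BM: "B k \<in> sets M" if "k <= N" for k using BF[OF that] subalg by (auto simp: subalgebra_def)
 have EB: "E = (\<Union>k\<in>{..N}. B k)"
proof
 show "(\<Union>k\<in>{..N}. B k) \<subseteq> E" by (auto simp: E_def B_def S_def)
 show "E \<subseteq> (\<Union>k\<in>{..N}. B k)"
proof
 fix om assume "om \<in> E"
 then obtain k where k: "k <= N" "\<bar>S k om\<bar> > dl" "om \<in> A" by (auto simp: E_def S_def)
 define l where "l = (LEAST k. \<bar>S k om\<bar> > dl)"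
 have "\<bar>S l om\<bar> > dl" "l <= k" "!!j. j < l ==> \<not> \<bar>S j om\<bar> > dl" using LeastI[of "%k. \<bar>S k om\<bar> > dl", OF k(2)] Least_le[of "%k. \<bar>S k om\<bar> > dl", OF k(2)] not_less_Least by (auto simp: l_def)
 then have "om \<in> B l" "l <= N" using k by (auto simp: B_def not_less)
 then show "om \<in> (\<Union>k\<in>{..N}. B k)" by auto
qed
qed
 then show "E \<in> sets M" using BM by auto
 have disj: "disjoint_family_on B {..N}" unfolding disjoint_family_on_def
proof (intro ballI impI)
 fix j k :: nat assume "j ~= k"
 then show "B j \<inter> B k = {}" by (cases j k rule: linorder_cases) (auto simp: B_def)
qed
 have Sb: "\<exists>K. \<forall>k\<le>N. \<forall>om\<in>space M. \<bar>S k om\<bar> <= K"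
proof (rule exI, intro allI impI ballI)
 fix k om assume k: "k <= N" and w: "om \<in> space M"
 have C: "0 <= C" using b X_G[OF w, of 0] unfolding bnd_def by (meson abs_ge_zero order_refl order_trans)
 have "\<bar>S k om\<bar> <= 2 * C + C * KG TYPE('d) * (u k - s)" unfolding S_def by (rule Mt_bound[OF f b s u(1)[OF k] w])
 also have "... <= 2 * C + C * KG TYPE('d) * (u N - s)" using u(2)[OF k order_refl] by (intro add_left_mono mult_left_mono mult_nonneg_nonneg C KG_nonneg) simp
 finally show "\<bar>S k om\<bar> <= 2 * C + C * KG TYPE('d) * (u N - s)" .
qed
 then obtain K where K: "!!k om. k <= N ==> om \<in> space M ==> \<bar>S k om\<bar> <= K" by blast
 have K0: "0 <= K" using K[of 0] not_empty by (meson abs_ge_zero ex_in_conv le0 order_trans)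
 have SM [measurable]: "S k \<in> borel_measurable M" if "k <= N" for k by (rule F_M[OF SF[OF order_refl that]])
 have isq: "integrable M (%om. indicator Q om * (S j om * S k om))" if "j <= N" "k <= N" "Q \<in> sets M" for j k Q
proof (rule integrable_bounded)
 show "(%om. indicator Q om * (S j om * S k om)) \<in> borel_measurable M" using SM[OF that(1)] SM[OF that(2)] that(3) by measurable
 show "\<bar>indicator Q om * (S j om * S k om)\<bar> <= K * K" if "om \<in> space M" for om using mult_mono[OF K[OF \<open>j <= N\<close> that] K[OF \<open>k <= N\<close> that] K0] K0 by (auto simp: indicator_def abs_mult)
qed
 have ge: "dl\<^sup>2 * prob (B k) <= (\<integral>om. indicator (B k) om * (S N om * S N om) \<partial>M)" if k: "k <= N" for k
proof -
 have z: "(\<integral>om. (indicator (B k) om * S k om) * Mt f (Gf f d1 d2 h) (u k) (u N) om \<partial>M) = 0"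
proof (rule martingale[OF f b c])
 show "0 <= u k" using s u(1)[OF k] by simp
 show "u k <= u N" using u(2)[OF k order_refl] .
 show "(%om. indicator (B k) om * S k om) \<in> borel_measurable (F (u k))" using BF[OF k] SF[OF order_refl k] by measurable
 show "\<bar>indicator (B k) om * S k om\<bar> <= K" if "om \<in> space M" for om using K[OF k that] K0 by (auto simp: indicator_def)
qed
 have D: "Mt f (Gf f d1 d2 h) (u k) (u N) om = S N om - S k om" if "om \<in> space M" for om using Mt_split[OF f b s u(1)[OF k] u(2)[OF k order_refl] that] by (simp add: S_def)
 have "0 = (\<integral>om. indicator (B k) om * (S k om * S N om) - indicator (B k) om * (S k om * S k om) \<partial>M)" unfolding z[symmetric] by (rule Bochner_Integration.integral_cong) (auto simp: D algebra_simps)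
 then have e: "(\<integral>om. indicator (B k) om * (S k om * S N om) \<partial>M) = (\<integral>om. indicator (B k) om * (S k om * S k om) \<partial>M)" using isq[OF k _ BM[OF k]] k by simp
 have "dl\<^sup>2 * prob (B k) = (\<integral>om. indicator (B k) om * dl\<^sup>2 \<partial>M)" using BM[OF k] by simp
 also have "... <= (\<integral>om. indicator (B k) om * (S k om * S k om) \<partial>M)"
proof (rule integral_mono)
 have "integrable M (indicator (B k) :: 'w => real)" by (rule integrable_real_indicator[OF BM[OF k]]) (simp add: less_top[symmetric])
 then show "integrable M (%om. indicator (B k) om * dl\<^sup>2)" by simp
 show "integrable M (%om. indicator (B k) om * (S k om * S k om))" by (rule isq[OF k k BM[OF k]])
 show "indicator (B k) om * dl\<^sup>2 <= indicator (B k) om * (S k om * S k om)" for om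
proof (cases "om \<in> B k")
case True
 then have "dl\<^sup>2 <= \<bar>S k om\<bar>\<^sup>2" using d by (intro power_mono) (auto simp: B_def)
 then show ?thesis using True by (simp add: power2_eq_square)
qed simp
qed
 also have "... = 2 * (\<integral>om. indicator (B k) om * (S k om * S N om) \<partial>M) - (\<integral>om. indicator (B k) om * (S k om * S k om) \<partial>M)" using e by simp
 also have "... = (\<integral>om. 2 * (indicator (B k) om * (S k om * S N om)) - indicator (B k) om * (S k om * S k om) \<partial>M)" using isq[OF k _ BM[OF k]] k by simp
 also have "... <= (\<integral>om. indicator (B k) om * (S N om * S N om) \<partial>M)"
proof (rule integral_mono)
 show "2 * (indicator (B k) om * (S k om * S N om)) - indicator (B k) om * (S k om * S k om) <= indicator (B k) om * (S N om * S N om)" for om using sum_squares_bound[of "S k om" "S N om"] by (auto simp: indicator_def power2_eq_square)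
qed (use isq[OF _ _ BM[OF k]] k in auto)
 finally show ?thesis .
qed
 have "dl\<^sup>2 * prob E = (\<Sum>k\<le>N. dl\<^sup>2 * prob (B k))" unfolding EB sum_distrib_left[symmetric] by (subst finite_measure_finite_Union) (use BM disj in auto)
 also have "... <= (\<Sum>k\<le>N. \<integral>om. indicator (B k) om * (S N om * S N om) \<partial>M)" by (intro sum_mono ge) simp
 also have "... = (\<integral>om. (\<Sum>k\<le>N. indicator (B k) om * (S N om * S N om)) \<partial>M)" by (subst Bochner_Integration.integral_sum) (use isq BM in auto)
 also have "... <= (\<integral>om. indicator A om * (S N om * S N om) \<partial>M)"
proof (rule integral_mono)
 show "integrable M (%om. \<Sum>k\<le>N. indicator (B k) om * (S N om * S N om))" by (intro Bochner_Integration.integrable_sum isq BM) auto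
 show "integrable M (%om. indicator A om * (S N om * S N om))" by (rule isq[OF _ _ AM]) auto
 fix om
 have "(\<Sum>k\<le>N. indicator (B k) om) = (indicator (\<Union>k\<in>{..N}. B k) om :: real)" by (rule indicator_UN_disjoint[symmetric]) (use disj in auto)
 also have "... <= indicator A om" by (auto simp: indicator_def B_def)
 finally show "(\<Sum>k\<le>N. indicator (B k) om * (S N om * S N om)) <= indicator A om * (S N om * S N om)" unfolding sum_distrib_right[symmetric] by (intro mult_right_mono) auto
qed
 also have "... <= prob A * (ga * (u N - s))" using martingale_square[OF f b c s u(1)[OF order_refl] A g] by (simp add: S_def power2_eq_square)
 finally show "prob E <= prob A * (ga * (u N - s)) / dl\<^sup>2" using d by (simp add: field_simps)
qed

text \<open>The exceptional sets for dyadic grids increase, so their union obeys the same bound;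
  right continuity extends the estimate from grid points to all times.\<close>

lemma maximal:
 fixes f :: "'d pg => real"
 assumes f: "fld f d1 d2 h" and b: "bnd C f d1 d2 h" and c: "C2b f" and st: "0 <= s" "s < t"
 and A: "A \<in> sets (F s)" and g: "!!x. x \<in> Gtilde ==> Gam f d1 x <= ga" and d: "dl > 0"
 shows "\<exists>E\<in>sets M. prob E <= prob A * (ga * (t - s)) / dl\<^sup>2 &
 (\<forall>om\<in>A - E. \<forall>u\<in>{s..t}. \<bar>Mt f (Gf f d1 d2 h) s u om\<bar> <= dl)"
proof -
 let ?L = "Gf f d1 d2 h"
 define u where "u j k = s + (t - s) * real k / 2 ^ j" for j k :: nat
 define E where "E j = {om \<in> A. \<exists>k\<le>2^j. \<bar>Mt f ?L s (u j k) om\<bar> > dl}" for j :: nat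
 have Asp: "A \<subseteq> space M" using A sets.sets_into_space[of A "F s"] by auto
 have uN: "u j (2^j) = t" for j by (simp add: u_def)
 have E: "E j \<in> sets M" "prob (E j) <= prob A * (ga * (t - s)) / dl\<^sup>2" for j
proof -
 have a: "s <= u j k" for k using st by (simp add: u_def)
 have b': "u j k <= u j l" if "k <= l" for k l using st that by (auto simp: u_def intro!: divide_right_mono mult_left_mono)
 note md = maximal_discrete[where u = "u j" and N = "2^j", OF f b c st(1) a b' A g d]
 show "E j \<in> sets M" unfolding E_def by (rule md(1))
 show "prob (E j) <= prob A * (ga * (t - s)) / dl\<^sup>2" using md(2) unfolding E_def uN .
qed
 have inc: "incseq E"
proof (rule incseq_SucI, rule subsetI)
 fix j om assume "om \<in> E j"
 then obtain k where k: "k <= 2^j" "\<bar>Mt f ?L s (u j k) om\<bar> > dl" "om \<in> A" by (auto simp: E_def)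
 have "u (Suc j) (2 * k) = u j k" by (simp add: u_def)
 then show "om \<in> E (Suc j)" unfolding E_def using k by (auto intro!: exI[of _ "2 * k"])
qed
 have "(%j. prob (E j)) \<longlonglongrightarrow> prob (\<Union>j. E j)" by (rule finite_Lim_measure_incseq) (use E(1) inc in auto)
 then have P: "prob (\<Union>j. E j) <= prob A * (ga * (t - s)) / dl\<^sup>2" by (rule LIMSEQ_le_const2) (use E(2) in auto)
 have "\<bar>Mt f ?L s v om\<bar> <= dl" if w: "om \<in> A" "om \<notin> (\<Union>j. E j)" and v: "v \<in> {s..t}" for om v
proof -
 have grid: "\<bar>Mt f ?L s (u j k) om\<bar> <= dl" if "k <= 2^j" for j k using w that by (auto simp: E_def not_less)
 have wM: "om \<in> space M" using w Asp by auto
 show ?thesis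
proof (cases "v = t")
case True
 then show ?thesis using grid[of "2^0" 0] uN[of 0] by simp
next
case False
 then have vt: "s <= v" "v < t" using v by auto
 define q where "q = (v - s) / (t - s)"
 have q: "0 <= q" "q < 1" using vt by (auto simp: q_def)
 \<comment> \<open>Strictly to the right of v, and still at most 2^j because q < 1.\<close>
 define k where "k j = nat (\<lfloor>q * 2^j\<rfloor> + 1)" for j :: nat
 have kr: "real (k j) = real_of_int \<lfloor>q * 2^j\<rfloor> + 1" for j using q by (simp add: k_def)
 have k1: "k j <= 2^j" for j
proof -
 have "q * 2^j < 2^j" using q by simp
 then have "\<lfloor>q * 2^j\<rfloor> < 2^j" by (simp add: floor_less_iff)
 then show ?thesis unfolding k_def by (simp add: nat_le_iff)
qed
 have vq: "v = s + (t - s) * q" using st by (simp add: q_def)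
 have qk: "q <= real (k j) / 2^j" "real (k j) / 2^j <= q + 1 / 2^j" for j
proof -
 have "q * 2^j <= real (k j)" "real (k j) <= q * 2^j + 1" unfolding kr by linarith+
 then show "q <= real (k j) / 2^j" "real (k j) / 2^j <= q + 1 / 2^j" by (simp_all add: field_simps)
qed
 have lo: "v <= u j (k j)" for j unfolding vq u_def using mult_left_mono[OF qk(1), of "t - s" j] st by simp
 have hi: "u j (k j) <= v + (t - s) * (1 / 2^j)" for j unfolding vq u_def using mult_left_mono[OF qk(2), of "t - s" j] st by (simp add: distrib_left)
 have le_t: "u j (k j) <= t" for j
proof -
 have "real (k j) <= real (2^j)" unfolding of_nat_le_iff by (rule k1)
 then have "real (k j) / 2^j <= 1" by simp
 from mult_left_mono[OF this, of "t - s"] show ?thesis using st by (simp add: u_def)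
qed
 have "(%j. (1/2::real) ^ j) \<longlonglongrightarrow> 0" by (rule LIMSEQ_realpow_zero) auto
 then have "(%j. v + (t - s) * (1 / 2^j)) \<longlonglongrightarrow> v + (t - s) * 0" by (intro tendsto_intros) (simp add: power_one_over)
 then have hl: "(%j. v + (t - s) * (1 / 2^j)) \<longlonglongrightarrow> v" by simp
 have ul: "(%j. u j (k j)) \<longlonglongrightarrow> v" by (rule tendsto_sandwich[OF always_eventually always_eventually tendsto_const hl]) (use lo hi in blast)+
 have v0: "0 <= v" using st vt by simp
 have fl: "(%j. f (X (u j (k j)) om)) \<longlonglongrightarrow> f (X v om)"
proof -
 have "isCont f (X v om)" using C2b_continuous[OF c] continuous_on_eq_continuous_at open_UNIV by blast
 then show ?thesis using X_right_tendsto[OF wM v0 lo ul] by (rule isCont_tendsto_compose)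
qed
 have il: "(%j. ig ?L s (u j (k j)) om) \<longlonglongrightarrow> ig ?L s v om"
proof -
 let ?K = "C * KG TYPE('d)"
 have G: "Gb ?L ?K" by (rule Gb_Gf[OF f b])
 have "\<bar>ig ?L s (u j (k j)) om - ig ?L s v om\<bar> <= ?K * (u j (k j) - v)" for j using ig_split[OF G st(1) vt(1) lo wM, of j] ig_lebesgue(4)[OF G v0 lo wM, of j] by simp
 then have le: "\<forall>j. norm (ig ?L s (u j (k j)) om - ig ?L s v om) <= ?K * (u j (k j) - v)" by (simp only: real_norm_def) blast
 have "(%j. ?K * (u j (k j) - v)) \<longlonglongrightarrow> ?K * (v - v)" by (intro tendsto_intros ul)
 then have z: "(%j. ?K * (u j (k j) - v)) \<longlonglongrightarrow> 0" by (simp only: diff_self mult_zero_right)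
 have "(%j. ig ?L s (u j (k j)) om - ig ?L s v om) \<longlonglongrightarrow> 0" by (rule Lim_null_comparison[OF always_eventually[OF le] z])
 then show ?thesis by (rule LIM_zero_cancel)
qed
 have "(%j. \<bar>Mt f ?L s (u j (k j)) om\<bar>) \<longlonglongrightarrow> \<bar>Mt f ?L s v om\<bar>" unfolding Mt_def by (intro tendsto_intros fl il)
 then show ?thesis by (rule LIMSEQ_le_const2) (use grid[OF k1] in auto)
qed
qed
 then show ?thesis using P E(1) by (intro bexI[of _ "\<Union>j. E j"]) auto
qed

end

section \<open>The truncated logarithm under the generator\<close>

context levy_measure
begin

lemma fld_lnF: "A ~= 0 ==> fld (lnF A) (lnF1 A) (lnF2 A) (%x. 0)"
 for A :: "real^('d::finite option)^'m" unfolding fld_def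
proof (intro conjI allI ballI impI)
 fix x :: "'d pg" and th :: "real^'d" and r :: real
 show "lnF A \<in> borel_measurable borel" "(%x. lnF1 A x th) \<in> borel_measurable borel" "(%x. lnF2 A x th) \<in> borel_measurable borel" by measurable
 assume A: "A ~= 0" and x: "x \<in> Gtilde"
 show "((%s. lnF A (fst x, snd x + s *\<^sub>R (fst x *v ev None))) has_real_derivative 0) (at 0)" by (simp add: lnF_def)
 show "lnF1 A x th = (\<Sum>i\<in>UNIV. th $ i * lnF1 A x (axis i 1))" by (rule lnF1_linear)
 assume t: "norm th = 1"
 show "((%r. lnF A (mv x r th)) has_real_derivative lnF1 A (mv x r th) th) (at r)"
 "((%r. lnF1 A (mv x r th) th) has_real_derivative lnF2 A (mv x r th) th) (at r)" by (rule lnF_deriv[OF A x t])+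
qed simp

text \<open>The generator applied formally to ln |A g|. This function is neither bounded nor C^2 on
  the ambient space, so it reaches the martingale problem only through
  \<open>Gkf_expand\<close>.\<close>

definition drift :: "real^('d::finite option)^'m => 'd pg => real" where
 "drift A = Gf (lnF A) (lnF1 A) (lnF2 A) (%x. 0)"

lemma Jf_lnF_dom:
 fixes A :: "real^('d::finite option)^'m"
 assumes A: "A ~= 0" and x: "x \<in> Gtilde"
 shows "dom (Jf (lnF A) (lnF1 A) x) (%r. 1 * wt r)"
proof (rule dom_wt)
 note f = fld_lnF[OF A]
 define s where "s i = lnF1 A x (axis i 1)" for i
 show "(%p. Jf (lnF A) (lnF1 A) x (fst p) (snd p)) \<in> borel_measurable (borel \<Otimes>\<^sub>M borel)" unfolding Jf_def s_def[symmetric] by measurable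
 fix r :: real and th :: "real^'d" assume t: "norm th = 1"
 have J1: "\<bar>Jf (lnF A) (lnF1 A) x r th\<bar> <= r\<^sup>2" if "r <= 1" using J_taylor[OF f x t, of 2 r] lnF2_bounds[OF t, of A] that by (auto simp: Jf_def lnF1_linear[of A x th])
 then show "0 < r ==> r <= 1 ==> \<bar>Jf (lnF A) (lnF1 A) x r th\<bar> <= 1 * r\<^sup>2" by simp
 assume r: "1 <= r"
 show "\<bar>Jf (lnF A) (lnF1 A) x r th\<bar> <= 1 * r"
proof (cases "r = 1")
case False
 then show ?thesis using lnF_lipschitz[OF A x t, of r] r by (simp add: Jf_def)
qed (use J1 in simp)
qed simp

lemma drift_measurable: "A ~= 0 ==> drift A \<in> borel_measurable borel" unfolding drift_def by (rule Gf_measurable[OF fld_lnF])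

lemma drift_bound:
 fixes A :: "real^('d::finite option)^'m"
 assumes A: "A ~= 0" and x: "x \<in> Gtilde" shows "\<bar>drift A x\<bar> <= KG TYPE('d)"
proof -
 have "\<bar>\<Sum>i\<in>UNIV. lnF2 A x (axis i 1)\<bar> <= (\<Sum>i\<in>(UNIV::'d set). 2)" by (rule order_trans[OF sum_abs sum_mono]) (use lnF2_bounds[of "axis _ 1" A x] in auto)
 then have "\<bar>sg\<^sup>2 / 2 * (\<Sum>i\<in>UNIV. lnF2 A x (axis i 1))\<bar> <= sg\<^sup>2 / 2 * (real CARD('d) * 2)" unfolding abs_mult by (intro mult_mono) auto
 moreover have "\<bar>dint (Jf (lnF A) (lnF1 A) x)\<bar> <= (\<integral>r. wt r \<partial>nu)" using dom_outer(2)[OF Jf_lnF_dom[OF A x]] by simp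
 moreover have "0 <= (\<integral>r. wt r \<partial>nu)" by (simp add: wt_nonneg)
 ultimately show ?thesis unfolding drift_def Gf_def KG_def by simp
qed

definition KE :: "'d::finite itself => real" where "KE _ = real CARD('d) + 16"

text \<open>An increment of the truncated logarithm is at most r/R by the Lipschitz property and at
  most 4 because values lie in [-2, 2]; the squares give 16 min(1, r^2/R^2). This is the 16 in
  \<open>KE\<close>, the dimension coming from the diffusion part.\<close>

lemma Gam_kf:
 fixes A :: "real^('d::finite option)^'m"
 assumes R: "R > 0" and A: "A ~= 0" and x: "x \<in> Gtilde"
 shows "Gam (kf R c A) (kf1 R c A) x <= KE TYPE('d) * epsR R"
proof -
 note f = fld_kf[OF R A, of c]
 have [measurable]: "kf R c A \<in> borel_measurable borel" by (rule fldD(1)[OF f])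
 have "(\<Sum>i\<in>UNIV. (kf1 R c A x (axis i 1))\<^sup>2) <= (\<Sum>i\<in>(UNIV::'d set). 1 / R\<^sup>2)"
proof (rule sum_mono)
 fix i have "\<bar>kf1 R c A x (axis i 1)\<bar> <= 1 / R" by (rule kf_bounds(2)[OF R]) simp
 from power_mono[OF this, of 2] show "(kf1 R c A x (axis i 1))\<^sup>2 <= 1 / R\<^sup>2" by (simp add: power_divide)
qed
 then have 1: "sg\<^sup>2 * (\<Sum>i\<in>UNIV. (kf1 R c A x (axis i 1))\<^sup>2) <= real CARD('d) * (sg\<^sup>2 / R\<^sup>2)" by (rule order_trans[OF mult_left_mono[OF _ zero_le_power2]]) (simp add: mult.commute)
 have "dom (%r th. (kf R c A (mv x r th) - kf R c A x)\<^sup>2) (%r. 16 * min 1 (r\<^sup>2 / R\<^sup>2))" unfolding dom_def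
proof (intro conjI allI impI)
 show "(%p. (kf R c A (mv x (fst p) (snd p)) - kf R c A x)\<^sup>2) \<in> borel_measurable (borel \<Otimes>\<^sub>M borel)" by measurable
 show "integrable nu (%r. 16 * min 1 (r\<^sup>2 / R\<^sup>2))" using integrable_min[OF R] by simp
 fix r th assume r: "(0::real) < r" and t: "norm (th::real^'d) = 1"
 let ?D = "kf R c A (mv x r th) - kf R c A x"
 have "\<bar>?D\<bar> <= 1 / R * \<bar>r\<bar>" by (rule f_lipschitz[OF f x t]) (rule kf_bounds(2)[OF R t])
 from power_mono[OF this, of 2] have a: "?D\<^sup>2 <= r\<^sup>2 / R\<^sup>2" by (simp add: power_divide power_mult_distrib)
 have "\<bar>?D\<bar> <= 4" using kf_bounds(1)[OF R t, of c A x] kf_bounds(1)[OF R t, of c A "mv x r th"] by linarith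
 from power_mono[OF this, of 2] have "?D\<^sup>2 <= 16" by simp
 moreover have "r\<^sup>2 / R\<^sup>2 <= 16 * (r\<^sup>2 / R\<^sup>2)" using divide_nonneg_nonneg[OF zero_le_power2[of r] zero_le_power2[of R]] by linarith
 ultimately show "\<bar>?D\<^sup>2\<bar> <= 16 * min 1 (r\<^sup>2 / R\<^sup>2)" using a by (simp add: min_def)
qed
 from dom_outer(2)[OF this] have 2: "dint (%r th. (kf R c A (mv x r th) - kf R c A x)\<^sup>2) <= 16 * (\<integral>r. min 1 (r\<^sup>2 / R\<^sup>2) \<partial>nu)" by simp
 have 3: "0 <= sg\<^sup>2 / R\<^sup>2" "0 <= (\<integral>r. min 1 (r\<^sup>2 / R\<^sup>2) \<partial>nu)" by simp_all
 have "KE TYPE('d) * epsR R = real CARD('d) * (sg\<^sup>2 / R\<^sup>2) + real CARD('d) * (\<integral>r. min 1 (r\<^sup>2 / R\<^sup>2) \<partial>nu) + 16 * (sg\<^sup>2 / R\<^sup>2) + 16 * (\<integral>r. min 1 (r\<^sup>2 / R\<^sup>2) \<partial>nu)" by (simp add: KE_def epsR_def algebra_simps add_divide_distrib)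
 then show ?thesis unfolding Gam_def using 1 2 3 mult_nonneg_nonneg[OF of_nat_0_le_iff 3(2), of "CARD('d)"] by linarith
qed

lemma bnd_kf:
 assumes "R \<ge> 1" shows "bnd 3 (kf R c A) (kf1 R c A) (kf2 R c A) (%x. 0)"
proof -
 have R: "R > 0" "1 / R <= 1" "1 / R\<^sup>2 <= 1" using assms by (auto simp: field_simps one_le_power)
 show ?thesis unfolding bnd_def
proof (intro ballI conjI allI impI)
 fix x :: "'a pg" and th :: "real^'a"
 show "\<bar>kf R c A x\<bar> <= 3" using kf_bounds(1)[OF R(1), of "axis undefined 1" c A x] by simp
 assume t: "norm th = 1"
 show "\<bar>kf1 R c A x th\<bar> <= 3" using kf_bounds(2)[OF R(1) t, of c A x] R(2) by linarith
 have "2 / R <= 2" using R by (simp add: field_simps)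
 then show "\<bar>kf2 R c A x th\<bar> <= 3" using kf_bounds(3)[OF R(1) t, of c A x] R(3) by linarith
qed simp
qed

abbreviation Gkf :: "real => real => real^('d::finite option)^'m => 'd pg => real" where
 "Gkf R c A \<equiv> Gf (kf R c A) (kf1 R c A) (kf2 R c A) (%x. 0)"

lemma rem_nonneg: "R > 0 ==> 0 <= rem R"
proof -
 assume "R > 0"
 have "0 <= (\<integral>r. min (r\<^sup>2 / R) (2 * r) \<partial>nu)" by (rule integral_nonneg_AE) (use nu_pos \<open>R > 0\<close> in \<open>auto elim!: eventually_mono\<close>)
 then show ?thesis unfolding rem_def using \<open>R > 0\<close> by simp
qed

text \<open>Linearise \<open>phi\<close> at the current value: the linear part reproduces the drift
  with factor \<open>phi1\<close> / R. The Taylor remainder of a jump is bounded by a multiple of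
  r^2/R^2 and, through the Lipschitz bound, of r/R, which is what \<open>rem\<close>
  integrates.\<close>

lemma Gkf_expand:
 fixes A :: "real^('d::finite option)^'m"
 assumes R: "R \<ge> 1" and A: "A ~= 0" and x: "x \<in> Gtilde"
 shows "\<bar>Gkf R c A x - phi1 (lnF A x / R - c) / R * drift A x\<bar> <= (real CARD('d) + 1) * rem R / R"
proof -
 have R0: "R > 0" using R by simp
 note f = fld_kf[OF R0 A, of c]
 define z where "z = lnF A x / R - c"
 define k where "k r th = 1 * Jf (kf R c A) (kf1 R c A) x r th + (- (phi1 z / R)) * Jf (lnF A) (lnF1 A) x r th" for r th
 note dom1 = Jf_dom[OF f bnd_kf[OF R] x] and dom2 = Jf_lnF_dom[OF A x]
 have kd: "dint k = dint (Jf (kf R c A) (kf1 R c A) x) - phi1 z / R * dint (Jf (lnF A) (lnF1 A) x)" unfolding k_def[abs_def] by (subst dint_linear[OF dom1 dom2]) simp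
 have ke: "k r th = phi (z + (lnF A (mv x r th) - lnF A x) / R) - phi z - (lnF A (mv x r th) - lnF A x) / R * phi1 z" if t: "norm th = 1" for r th
proof -
 have "(\<Sum>i\<in>UNIV. th $ i * kf1 R c A x (axis i 1)) = phi1 z / R * (\<Sum>i\<in>UNIV. th $ i * lnF1 A x (axis i 1))" by (simp add: kf1_def z_def sum_distrib_left algebra_simps)
 moreover have "kf R c A (mv x r th) = phi (z + (lnF A (mv x r th) - lnF A x) / R)" using kf_eq[OF A mv_Gtilde[OF x t], of R c r] by (simp add: z_def diff_divide_distrib)
 moreover have "kf R c A x = phi z" by (simp add: kf_eq[OF A x] z_def)
 ultimately show ?thesis unfolding k_def Jf_def by (simp add: algebra_simps diff_divide_distrib)
qed
 have dk: "dom k (%r. 1 / R * min (r\<^sup>2 / R) (2 * r))" unfolding dom_def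
proof (intro conjI allI impI)
 have [measurable]: "(%p. Jf (kf R c A) (kf1 R c A) x (fst p) (snd p)) \<in> borel_measurable (borel \<Otimes>\<^sub>M borel)"
 "(%p. Jf (lnF A) (lnF1 A) x (fst p) (snd p)) \<in> borel_measurable (borel \<Otimes>\<^sub>M borel)" using dom1 dom2 by (simp_all add: dom_def)
 show "(%p. k (fst p) (snd p)) \<in> borel_measurable (borel \<Otimes>\<^sub>M borel)" unfolding k_def by measurable
 show "integrable nu (%r. 1 / R * min (r\<^sup>2 / R) (2 * r))" using integrable_rem[OF R] by simp
 fix r th assume r: "(0::real) < r" and t: "norm (th::real^'d) = 1"
 let ?D = "lnF A (mv x r th) - lnF A x"
 have D: "\<bar>?D\<bar> <= r" using lnF_lipschitz[OF A x t, of r] r by simp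
 have "\<bar>k r th\<bar> <= (?D / R)\<^sup>2 / 2" unfolding ke[OF t] by (rule phi_taylor)
 also have "... <= (r / R)\<^sup>2"
proof -
 have "\<bar>?D / R\<bar> <= r / R" using D R0 by (simp add: divide_right_mono)
 from power_mono[OF this, of 2] have "(?D / R)\<^sup>2 <= (r / R)\<^sup>2" by (simp only: power2_abs abs_ge_zero simp_thms)
 then show ?thesis using zero_le_power2[of "?D / R"] by linarith
qed
 finally have a: "\<bar>k r th\<bar> <= 1 / R * (r\<^sup>2 / R)" by (simp add: power_divide power2_eq_square)
 have "\<bar>phi (z + ?D / R) - phi z\<bar> <= \<bar>?D / R\<bar>" using phi_lipschitz[of "z + ?D / R" z] by simp
 moreover have "\<bar>?D / R * phi1 z\<bar> <= \<bar>?D / R\<bar>" unfolding abs_mult using phi1_bounds[of z] mult_left_mono[of "\<bar>phi1 z\<bar>" 1 "\<bar>?D / R\<bar>"] by linarith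
 ultimately have "\<bar>k r th\<bar> <= 2 * \<bar>?D / R\<bar>" unfolding ke[OF t] by linarith
 also have "... <= 1 / R * (2 * r)" using D R0 by (simp add: divide_right_mono)
 finally have b: "\<bar>k r th\<bar> <= 1 / R * (2 * r)" .
 show "\<bar>k r th\<bar> <= 1 / R * min (r\<^sup>2 / R) (2 * r)" using a b by (simp add: min_def)
qed
 have 1: "\<bar>dint k\<bar> <= 1 / R * (\<integral>r. min (r\<^sup>2 / R) (2 * r) \<partial>nu)" using dom_outer(2)[OF dk] by simp
 let ?S = "\<Sum>i\<in>UNIV. phi2 z / R\<^sup>2 * (lnF1 A x (axis i 1))\<^sup>2"
 have S: "(\<Sum>i\<in>UNIV. kf2 R c A x (axis i 1)) = ?S + phi1 z / R * (\<Sum>i\<in>UNIV. lnF2 A x (axis i 1))" by (simp add: kf2_def z_def sum.distrib sum_distrib_left)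
 have "\<bar>?S\<bar> <= (\<Sum>i\<in>(UNIV::'d set). 1 / R\<^sup>2)"
proof (rule order_trans[OF sum_abs sum_mono])
 fix i :: 'd
 have "(lnF1 A x (axis i 1))\<^sup>2 <= 1" using lnF1_bound[of "axis i 1" A x] by (simp add: abs_square_le_1)
 then have "\<bar>phi2 z\<bar> * (lnF1 A x (axis i 1))\<^sup>2 <= 1 * 1" by (intro mult_mono phi2_bound) auto
 then show "\<bar>phi2 z / R\<^sup>2 * (lnF1 A x (axis i 1))\<^sup>2\<bar> <= 1 / R\<^sup>2" using R0 by (simp add: abs_mult divide_simps)
qed
 then have "\<bar>sg\<^sup>2 / 2 * ?S\<bar> <= sg\<^sup>2 / 2 * (real CARD('d) * (1 / R\<^sup>2))" unfolding abs_mult by (intro mult_mono) auto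
 also have "... <= sg\<^sup>2 * (real CARD('d) * (1 / R\<^sup>2))" by (rule mult_right_mono) auto
 also have "... = real CARD('d) * (sg\<^sup>2 / R) / R" by (simp add: power2_eq_square)
 finally have 2: "\<bar>sg\<^sup>2 / 2 * ?S\<bar> <= real CARD('d) * (sg\<^sup>2 / R) / R" .
 have "Gkf R c A x - phi1 z / R * drift A x = sg\<^sup>2 / 2 * ?S + dint k" unfolding Gf_def drift_def S kd by (simp add: algebra_simps)
 then have "\<bar>Gkf R c A x - phi1 z / R * drift A x\<bar> <= real CARD('d) * (sg\<^sup>2 / R) / R + 1 / R * (\<integral>r. min (r\<^sup>2 / R) (2 * r) \<partial>nu)" using 1 2 by linarith
 also have "... <= (real CARD('d) + 1) * rem R / R"
proof -
 have "0 <= (\<integral>r. min (r\<^sup>2 / R) (2 * r) \<partial>nu)" by (rule integral_nonneg_AE) (use nu_pos R0 in \<open>auto elim!: eventually_mono\<close>)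
 then have "real CARD('d) * (sg\<^sup>2 / R) + (\<integral>r. min (r\<^sup>2 / R) (2 * r) \<partial>nu) <= (real CARD('d) + 1) * rem R"
proof -
 let ?J = "\<integral>r. min (r\<^sup>2 / R) (2 * r) \<partial>nu"
 assume J: "0 <= ?J"
 have "0 <= real CARD('d) * ?J" "0 <= sg\<^sup>2 / R" using J R0 by simp_all
 moreover have "(real CARD('d) + 1) * rem R = real CARD('d) * (sg\<^sup>2 / R) + sg\<^sup>2 / R + real CARD('d) * ?J + ?J" unfolding rem_def by (simp only: distrib_left distrib_right mult_1_left)
 ultimately show ?thesis by linarith
qed
 from divide_right_mono[OF this, of R] show ?thesis using R0 by (simp add: add_divide_distrib)
qed
 finally show ?thesis unfolding z_def .
qed

end

section \<open>Laws of large numbers\<close>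

context levy_proc
begin

lemma maximal_kf:
 fixes A :: "real^('d option)^'m"
 assumes R: "R \<ge> 1" and A: "A ~= 0" and st: "0 <= s" "s < t" and B: "B \<in> sets (F s)" and d: "dl > 0"
 shows "\<exists>E\<in>sets M. prob E <= prob B * (KE TYPE('d) * epsR R * (t - s)) / dl\<^sup>2 &
 (\<forall>om\<in>B - E. \<forall>u\<in>{s..t}. \<bar>Mt (kf R c A) (Gkf R c A) s u om\<bar> <= dl)"
proof -
 have R0: "R > 0" using R by simp
 show ?thesis by (rule maximal[OF fld_kf[OF R0 A] bnd_kf[OF R] C2b_kf[OF R0] st B Gam_kf[OF R0 A] d])
qed

lemma Gb_drift: "A ~= 0 ==> Gb (drift A) (KG TYPE('d))" for A :: "real^('d option)^'m" unfolding Gb_def using drift_measurable drift_bound by blast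

lemma Gb_Gkf: "R \<ge> 1 ==> A ~= 0 ==> Gb (Gkf R c A) (3 * KG TYPE('d))" for A :: "real^('d option)^'m" by (rule Gb_Gf[OF fld_kf bnd_kf]) auto

lemma KG1: "1 <= KG TYPE('d)"
proof -
 have "0 <= (\<integral>r. wt r \<partial>nu)" by (simp add: wt_nonneg)
 then show ?thesis unfolding KG_def by simp
qed

lemma BC:
 assumes "!!n. E n \<in> sets M" "summable q" "!!n. prob (E n) <= q n"
 shows "AE om in M. eventually (%n. om \<notin> E n) sequentially"
proof -
 have "summable (%n. prob (E n))" by (rule summable_comparison_test'[OF assms(2)]) (use assms(3) in auto)
 then have "AE om in M. eventually (%n. om \<in> space M - E n) sequentially" by (intro borel_cantelli_AE1 assms(1)) (auto simp: less_top[symmetric])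
 then show ?thesis by eventually_elim (auto elim: eventually_mono)
qed

lemma AE_all_eps:
 assumes "!!n::nat. AE om in M. P om (1 / real (Suc n))" "!!om ep ep'. P om ep ==> ep <= ep' ==> P om ep'"
 shows "AE om in M. \<forall>ep>0. P om ep"
proof -
 have "AE om in M. \<forall>n::nat. P om (1 / real (Suc n))" using assms(1) by (simp add: AE_all_countable)
 then show ?thesis
proof eventually_elim
case (elim om)
 show ?case
proof (intro allI impI)
 fix ep :: real assume "ep > 0"
 then obtain n where "1 / real (Suc n) < ep" using reals_Archimedean[of ep] by (auto simp: inverse_eq_divide)
 then show "P om ep" using elim assms(2)[of om "1 / real (Suc n)" ep] by simp
qed
qed
qed

text \<open>Apply the maximal inequality on [0, 2^k] to the logarithm truncated at scale ka 2^k and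
  centred at its initial value. Outside a summable family of events the truncated value stays below
  1 in modulus; there \<open>phi\<close> is the identity and \<open>phi1\<close> is 1, so the
  estimate is one for the logarithm itself.\<close>

lemma LLN_block:
 fixes A :: "real^('d option)^'m"
 assumes A: "A ~= 0" and d: "0 < dl" "dl <= 1/4"
 shows "AE om in M. eventually (%k. \<forall>t\<in>{0..2^k}.
 \<bar>lnF A (X t om) - lnF A pId - ig (drift A) 0 t om\<bar> <= 8 * KG TYPE('d) * dl * 2^k) sequentially"
proof -
 \<comment> \<open>The drift is bounded by \<open>KG\<close>, so over time 2^k it moves the rescaled
   logarithm by at most 1/4. This leaves room for the martingale part and the linearisation
   error.\<close>
 define ka where "ka = 4 * KG TYPE('d)"
 have k1: "ka \<ge> 1" "ka > 0" using KG1 by (auto simp: ka_def)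
 define R where "R k = ka * 2^k" for k :: nat
 have R1: "R k \<ge> 1" for k unfolding R_def using mult_mono[OF k1(1) one_le_power[of 2 k]] k1(2) by simp
 have R0: "R k > 0" for k using R1[of k] by simp
 define c where "c k = lnF A pId / R k" for k
 have "\<exists>E\<in>sets M. prob E <= prob (space M) * (KE TYPE('d) * epsR (R k) * (2^k - 0)) / dl\<^sup>2 &
 (\<forall>om\<in>space M - E. \<forall>u\<in>{0..2^k}. \<bar>Mt (kf (R k) (c k) A) (Gkf (R k) (c k) A) 0 u om\<bar> <= dl)" for k by (rule maximal_kf[OF R1 A _ _ _ d(1)]) (simp_all, metis sets.top space_F)
 then have "\<forall>k. \<exists>E. E \<in> sets M & prob E <= KE TYPE('d) * epsR (R k) * 2^k / dl\<^sup>2 &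
 (\<forall>om\<in>space M - E. \<forall>u\<in>{0..2^k}. \<bar>Mt (kf (R k) (c k) A) (Gkf (R k) (c k) A) 0 u om\<bar> <= dl)" by (simp only: prob_space diff_zero mult_1_left Bex_def simp_thms)
 from choice[OF this] obtain E where E: "!!k. E k \<in> sets M" "!!k. prob (E k) <= KE TYPE('d) * epsR (R k) * 2^k / dl\<^sup>2"
 "!!k om u. om \<in> space M - E k ==> u \<in> {0..2^k} ==> \<bar>Mt (kf (R k) (c k) A) (Gkf (R k) (c k) A) 0 u om\<bar> <= dl" by blast
 have sm: "summable (%k. KE TYPE('d) * epsR (R k) * 2^k / dl\<^sup>2)" using summable_mult[OF summable_epsR_dyadic[OF k1(2)], of "KE TYPE('d) / dl\<^sup>2"] by (simp add: R_def mult_ac)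
 have bc: "AE om in M. eventually (%k. om \<notin> E k) sequentially" by (rule BC[OF E(1) sm E(2)])
 have "filterlim R at_top sequentially"
proof (rule filterlim_at_top_mono[OF filterlim_real_sequentially], rule always_eventually, rule allI)
 fix k :: nat
 have "real k <= 1 * 2^k" using of_nat_less_two_power[of k, where 'a=real] by simp
 also have "... <= R k" unfolding R_def by (rule mult_right_mono[OF k1(1)]) simp
 finally show "real k <= R k" .
qed
 then have "(%k. (real CARD('d) + 1) * rem (R k)) \<longlonglongrightarrow> (real CARD('d) + 1) * 0" by (intro tendsto_mult_left rem_tendsto R1)
 then have rl: "eventually (%k. (real CARD('d) + 1) * rem (R k) < dl) sequentially" using d by (intro order_tendstoD(2)) auto
 show ?thesis using bc AE_space
proof eventually_elim
case (elim om)
 note w = elim(2)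
 show ?case using elim(1) rl
proof eventually_elim
case (elim k)
 show ?case
proof
 fix t :: real assume t: "t \<in> {0..2^k}"
 then have t0: "0 <= t" "t <= 2^k" by auto
 let ?G = "Gkf (R k) (c k) A" and ?et = "(real CARD('d) + 1) * rem (R k)"
 define z where "z u = lnF A (X u om) / R k - c k" for u
 have gG: "Gb ?G (3 * KG TYPE('d))" by (rule Gb_Gkf[OF R1 A])
 have gD: "Gb (drift A) (KG TYPE('d))" by (rule Gb_drift[OF A])
 have eta: "0 <= ?et" using rem_nonneg[OF R0] by simp
 have fX: "kf (R k) (c k) A (X u om) = phi (z u)" if "0 <= u" for u using kf_eq[OF A X_G[OF w that]] by (simp add: z_def)
 have f0: "kf (R k) (c k) A (X 0 om) = 0" using fX[of 0] X_0[OF w] phi_id[of 0] by (simp add: z_def c_def)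
 have m: "\<bar>phi (z u) - ig ?G 0 u om\<bar> <= dl" if "0 <= u" "u <= 2^k" for u using E(3)[of om k u] elim(1) w that f0 fX[OF that(1)] by (simp add: Mt_def)
 have Gx: "\<bar>?G x\<bar> <= KG TYPE('d) / R k + ?et / R k" if x: "x \<in> Gtilde" for x
proof -
 have "\<bar>phi1 (lnF A x / R k - c k) / R k * drift A x\<bar> <= 1 / R k * KG TYPE('d)" unfolding abs_mult using phi1_bounds[of "lnF A x / R k - c k"] R0[of k] drift_bound[OF A x] by (intro mult_mono) (auto simp: divide_right_mono)
 then show ?thesis using Gkf_expand[OF R1 A x, of k "c k"] unfolding times_divide_eq_left mult_1_left by linarith
qed
 have igb: "\<bar>ig ?G 0 u om\<bar> <= 1/4 + dl" if u: "0 <= u" "u <= 2^k" for u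
proof -
 have "Gb ?G (KG TYPE('d) / R k + ?et / R k)" using gG Gx by (auto simp: Gb_def)
 from ig_lebesgue(4)[OF this order_refl u(1) w]
 have "\<bar>ig ?G 0 u om\<bar> <= (KG TYPE('d) + ?et) / R k * u" by (simp add: add_divide_distrib)
 also have "... <= (KG TYPE('d) + ?et) / R k * 2^k" using u KG_nonneg[where 'd='d] eta R0[of k] by (intro mult_left_mono divide_nonneg_pos) auto
 also have "... = (KG TYPE('d) + ?et) / ka" by (simp add: R_def)
 also have "... = KG TYPE('d) / ka + ?et / ka" by (simp add: add_divide_distrib)
 also have "... <= 1/4 + dl"
proof (rule add_mono)
 show "KG TYPE('d) / ka <= 1/4" using KG1 by (simp add: ka_def)
 have "?et / ka <= ?et" using eta k1 by (simp add: divide_le_eq mult_left_mono[of 1 ka ?et, simplified])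
 then show "?et / ka <= dl" using elim(2) by linarith
qed
 finally show ?thesis .
qed
 \<comment> \<open>At most 1/4 from the drift, dl from linearisation and dl from the martingale
   part, with dl <= 1/4. \<open>phi_inv\<close> turns this bound on the truncated value into one on
   the untruncated value.\<close>
 have z1: "\<bar>z u\<bar> < 1" if u: "0 <= u" "u <= 2^k" for u
proof (rule phi_inv)
 show "\<bar>phi (z u)\<bar> < 1" using m[OF u] igb[OF u] d by linarith
qed
 have c1: "\<bar>?G (X u om) - 1 / R k * drift A (X u om)\<bar> <= ?et / R k" if u: "0 <= u" "u <= 2^k" for u using Gkf_expand[OF R1 A X_G[OF w u(1)], of k "c k"] z1[OF u] by (simp add: z_def[symmetric] phi1_cases(1))
 have "\<bar>ig ?G 0 t om - 1 / R k * ig (drift A) 0 t om\<bar> <= ?et / R k * t"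
proof -
 have iG: "(%u. ?G (X u om)) integrable_on {0..t}" by (rule ig_lebesgue(3)[OF gG order_refl t0(1) w])
 have iD: "(%u. 1 / R k * drift A (X u om)) integrable_on {0..t}" using integrable_on_cmult_left[OF ig_lebesgue(3)[OF gD order_refl t0(1) w], of "1 / R k"] by (simp only: of_real_eq_id id_apply)
 have "norm (integral {0..t} (%u. ?G (X u om) - 1 / R k * drift A (X u om))) <= integral {0..t} (%u. ?et / R k)" by (rule integral_norm_bound_integral[OF integrable_diff[OF iG iD]]) (use c1 t0 in auto)
 then show ?thesis using t0 Henstock_Kurzweil_Integration.integral_diff[OF iG iD] by (simp add: ig_def mult_ac)
qed
 also have "... <= ?et / R k * 2^k" using t0 eta R0[of k] by (intro mult_left_mono divide_nonneg_pos) auto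
 also have "... = ?et / ka" by (simp add: R_def)
 also have "... <= ?et" using eta k1 by (simp add: divide_le_eq mult_left_mono[of 1 ka ?et, simplified])
 also have "... <= dl" using elim(2) by simp
 finally have i1: "\<bar>ig ?G 0 t om - 1 / R k * ig (drift A) 0 t om\<bar> <= dl" .
 have "\<bar>z t - ig ?G 0 t om\<bar> <= dl" using m[OF t0] z1[OF t0] phi_id[of "z t"] by simp
 then have "\<bar>z t - 1 / R k * ig (drift A) 0 t om\<bar> <= 2 * dl" using i1 by linarith
 moreover have "z t - 1 / R k * ig (drift A) 0 t om = (lnF A (X t om) - lnF A pId - ig (drift A) 0 t om) / R k" by (simp add: z_def c_def diff_divide_distrib)
 ultimately have "\<bar>lnF A (X t om) - lnF A pId - ig (drift A) 0 t om\<bar> <= 2 * dl * R k" using R0[of k] by (simp add: pos_divide_le_eq)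
 then show "\<bar>lnF A (X t om) - lnF A pId - ig (drift A) 0 t om\<bar> <= 8 * KG TYPE('d) * dl * 2^k" by (simp add: R_def ka_def mult_ac)
qed
qed
qed
qed

text \<open>Each large t lies in a block [0, 2^k] with 2^k <= 2 t, so a block error proportional to
  2^k is proportional to t.\<close>

lemma LLN:
 fixes A :: "real^('d option)^'m"
 assumes A: "A ~= 0"
 shows "AE om in M. \<forall>ep>0. eventually (%t. \<bar>lnF A (X t om) - ig (drift A) 0 t om\<bar> <= ep * t) at_top"
proof (rule AE_all_eps)
 fix n :: nat
 define e where "e = 1 / real (Suc n)"
 have e: "0 < e" "e <= 1" by (auto simp: e_def)
 have KG: "KG TYPE('d) > 0" using KG1 by simp
 \<comment> \<open>The factor 32 makes the block error e/4 times 2^k, hence at most e t / 2; the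
   other half of e t absorbs the initial value.\<close>
 define dl where "dl = e / (32 * KG TYPE('d))"
 have "e / (32 * KG TYPE('d)) <= e / (32 * 1)" using KG1 e by (intro divide_left_mono) auto
 then have "dl <= e / 32" by (simp only: dl_def mult_1_right)
 then have d: "0 < dl" "dl <= 1/4" using e KG by (simp add: dl_def, linarith)
 have dk: "8 * KG TYPE('d) * dl = e / 4" using KG by (simp add: dl_def)
 from LLN_block[OF A d] 
 show "AE om in M. eventually (%t. \<bar>lnF A (X t om) - ig (drift A) 0 t om\<bar> <= 1 / real (Suc n) * t) at_top"
proof eventually_elim
case (elim om)
 then obtain k0 where k0: "!!k t. k \<ge> k0 ==> 0 <= t ==> t <= 2^k ==> \<bar>lnF A (X t om) - lnF A pId - ig (drift A) 0 t om\<bar> <= e / 4 * 2^k" unfolding eventually_sequentially dk by (auto simp only: atLeastAtMost_iff Ball_def)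
 define t1 where "t1 = max (2^k0) (max 1 (2 * \<bar>lnF A pId\<bar> / e))"
 show ?case unfolding e_def[symmetric]
proof (rule eventually_at_top_linorderI[of t1])
 fix t assume "t1 <= t"
 then have t: "2^k0 <= t" "1 <= t" "2 * \<bar>lnF A pId\<bar> / e <= t" by (auto simp: t1_def)
 have lnA: "\<bar>lnF A pId\<bar> <= e * t / 2" using t(3) e by (simp add: pos_divide_le_eq mult.commute)
 define k where "k = (LEAST k. t <= 2^k)"
 have ex: "\<exists>k. t <= 2^k" using real_arch_pow[of 2 t] by (auto intro: less_imp_le)
 have kt: "t <= 2^k" unfolding k_def using ex by (rule LeastI_ex)
 have kk: "k0 <= k"
proof (rule ccontr)
 assume "\<not> k0 <= k"
 then have "(2::real)^k < 2^k0" by (intro power_strict_increasing) auto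
 then show False using kt t(1) by linarith
qed
 have k2: "2^k <= 2 * t"
proof (cases k)
case 0
 then show ?thesis using t by simp
next
case (Suc j)
 then have "\<not> t <= 2^j" using not_less_Least[of j "%k. t <= 2^k"] by (simp add: k_def)
 then show ?thesis using Suc by simp
qed
 have "\<bar>lnF A (X t om) - lnF A pId - ig (drift A) 0 t om\<bar> <= e / 4 * 2^k" using k0[OF kk _ kt] t by simp
 also have "... <= e / 4 * (2 * t)" using k2 e by (intro mult_left_mono) auto
 finally have "\<bar>lnF A (X t om) - lnF A pId - ig (drift A) 0 t om\<bar> <= e * t / 2" by simp
 then show "\<bar>lnF A (X t om) - ig (drift A) 0 t om\<bar> <= e * t" using lnA by linarith
qed
qed
next
 fix om and ep ep' :: real
 assume ev: "eventually (%t. \<bar>lnF A (X t om) - ig (drift A) 0 t om\<bar> <= ep * t) at_top" and le: "ep <= ep'"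
 show "eventually (%t. \<bar>lnF A (X t om) - ig (drift A) 0 t om\<bar> <= ep' * t) at_top" using ev eventually_ge_at_top[of 0] by eventually_elim (use le in \<open>meson mult_right_mono order_trans\<close>)
qed

section \<open>Subexponential growth over unit time intervals\<close>

lemma Gkf_small:
 fixes A :: "real^('d option)^'m"
 assumes R: "R \<ge> 1" and A: "A ~= 0" and x: "x \<in> Gtilde"
 shows "\<bar>Gkf R c A x\<bar> <= (KG TYPE('d) + (real CARD('d) + 1) * rem 1) / R"
proof -
 have R0: "R > 0" using R by simp
 have "\<bar>phi1 (lnF A x / R - c) / R * drift A x\<bar> <= 1 / R * KG TYPE('d)" unfolding abs_mult using phi1_bounds[of "lnF A x / R - c"] R0 drift_bound[OF A x] by (intro mult_mono) (auto simp: divide_right_mono)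
 moreover have "(real CARD('d) + 1) * rem R / R <= (real CARD('d) + 1) * rem 1 / R"
proof -
 have "rem R <= rem 1" unfolding rem_def
proof (intro add_mono integral_mono integrable_rem min.mono)
 have "y / R <= y / 1" if "0 <= y" for y using R that by (intro divide_left_mono) auto
 then show "sg\<^sup>2 / R <= sg\<^sup>2 / 1" "!!r. r\<^sup>2 / R <= r\<^sup>2 / 1" by auto
qed (use R in auto)
 then show ?thesis using R0 by (intro divide_right_mono mult_left_mono) auto
qed
 ultimately show ?thesis using Gkf_expand[OF R A x, of c] unfolding add_divide_distrib times_divide_eq_left mult_1_left by linarith
qed

text \<open>Over unit time intervals the increments \<open>g\<^sub>n\<^sup>-\<^sup>1 g\<^sub>u\<close> grow subexponentially in \<open>n\<close>. The base point \<open>g\<^sub>n\<close> is random;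
 it is replaced by a nearby element of a countable dense set.\<close>

lemma unit_increment_eps:
 assumes e: "ep > 0"
 shows "AE om in M. eventually (%n. \<forall>u\<in>{real n..real n + 1}.
 norm (matrix_inv (fst (X (real n) om)) ** fst (X u om)) <= 2 * exp (ep * real n)) sequentially"
proof -
 obtain D :: "'d mmat set" where D: "countable D" "!!U. open U ==> U ~= {} ==> \<exists>q\<in>D. q \<in> U" using countable_dense_setE by blast
 have "D ~= {}" using D(2)[of UNIV] by auto
 define q where "q = from_nat_into D"
 have qD: "range q = D" unfolding q_def by (rule range_from_nat_into[OF \<open>D ~= {}\<close> D(1)])
 define near where "near i n om \<longleftrightarrow> norm (q i ** fst (X (real n) om) - mat 1) < 1/2" for i n om
 have near_ex: "\<exists>i. near i n om" if w: "om \<in> space M" for n om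
proof -
 let ?g = "fst (X (real n) om)"
 have g: "?g \<in> Ggrp" using X_G[OF w, of "real n"] by (auto simp: Gtilde_def)
 have "open {a. norm (a ** ?g - mat 1) < 1/2}" by (intro open_Collect_less continuous_intros)
 moreover have "matrix_inv ?g \<in> {a. norm (a ** ?g - mat 1) < 1/2}" using g by simp
 ultimately obtain a where "a \<in> D" "norm (a ** ?g - mat 1) < 1/2" using D(2) by blast
 then show ?thesis using qD unfolding near_def by (metis rangeE)
qed
 \<comment> \<open>The first index i for which q_i nearly inverts the position at time n. This gives
   a partition by events known at time n, on each of which the left factor q_i is
   deterministic.\<close>
 define B where "B i n = {om \<in> space M. near i n om & (\<forall>j<i. \<not> near j n om)}" for i n
 have nearF: "{om \<in> space (F (real n)). near i n om} \<in> sets (F (real n))" for i n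
proof -
 have [measurable]: "X (real n) \<in> borel_measurable (F (real n))" by (rule X_F) auto
 have "(%om. norm (q i ** fst (X (real n) om) - mat 1)) \<in> borel_measurable (F (real n))" by measurable
 then show ?thesis unfolding near_def by measurable
qed
 have BF: "B i n \<in> sets (F (real n))" for i n
proof -
 have "{om \<in> space (F (real n)). \<forall>j\<in>{..<i}. \<not> near j n om} \<in> sets (F (real n))" by (rule sets.sets_Collect_finite_All[OF sets.sets_Collect_neg[OF nearF]]) simp
 moreover have "{om \<in> space (F (real n)). near i n om} \<in> sets (F (real n))" by (rule nearF)
 ultimately have "{om \<in> space (F (real n)). near i n om} \<inter> {om \<in> space (F (real n)). \<forall>j\<in>{..<i}. \<not> near j n om} \<in> sets (F (real n))" by blast
 then show ?thesis by (rule back_subst[of "%S. S \<in> sets (F (real n))"]) (auto simp: B_def)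
qed
 have BM: "B i n \<in> sets M" for i n using BF subalg by (auto simp: subalgebra_def)
 have Bdisj: "disjoint_family (%i. B i n)" for n unfolding disjoint_family_on_def
proof (intro ballI impI)
 fix j k :: nat assume "j ~= k"
 then show "B j n \<inter> B k n = {}" by (cases j k rule: linorder_cases) (auto simp: B_def)
qed
 have Bcov: "\<exists>i. om \<in> B i n" if w: "om \<in> space M" for n om
proof -
 let ?i = "LEAST i. near i n om"
 have "near ?i n om" using near_ex[OF w] by (rule LeastI_ex)
 then show ?thesis using w not_less_Least unfolding B_def by blast
qed
 define N0 where "N0 = norm (mat 1 :: 'd mmat)"
 have N1: "1 <= N0"
proof -
 have "N0\<^sup>2 = (\<Sum>j\<in>(UNIV::'d option set). (norm (mat 1 *v axis j (1::real)))\<^sup>2)" unfolding N0_def by (rule norm_matrix_cols)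
 also have "... \<ge> 1" by (simp add: sum_option)
 finally show ?thesis unfolding N0_def using power2_le_imp_le[of 1 "norm (mat 1 :: 'd mmat)"] by simp
qed
 have q0: "q i ~= 0" if "near i n om" for i n om
proof
 assume "q i = 0"
 then have "norm (- mat 1 :: 'd mmat) < 1/2" using that by (simp add: near_def bounded_bilinear.zero_left[OF bounded_bilinear_matrix_mult])
 then show False using N1 by (simp add: N0_def)
qed
 define R where "R n = max 1 (ep * real n)" for n
 have R1: "R n \<ge> 1" for n by (simp add: R_def)
 have "\<exists>E\<in>sets M. prob E <= prob (B i n) * (KE TYPE('d) * epsR (R n)) * 16 &
 (\<forall>om\<in>B i n - E. \<forall>u\<in>{real n..real n + 1}. \<bar>Mt (kf (R n) 0 (q i)) (Gkf (R n) 0 (q i)) (real n) u om\<bar> <= 1/4)" for i n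
proof (cases "q i = 0")
case True
 then have "B i n = {}" using q0 by (auto simp: B_def)
 then show ?thesis by (intro bexI[of _ "{}"]) auto
next
case False
 have "real n \<ge> 0" "real n < real n + 1" "0 < (1/4::real)" by simp_all
 from maximal_kf[OF R1 False this(1,2) BF this(3), of i n 0] show ?thesis by (simp add: power2_eq_square)
qed
 then obtain E where E: "!!i n. E i n \<in> sets M" "!!i n. prob (E i n) <= prob (B i n) * (KE TYPE('d) * epsR (R n)) * 16"
 "!!i n om u. om \<in> B i n - E i n ==> u \<in> {real n..real n + 1} ==> \<bar>Mt (kf (R n) 0 (q i)) (Gkf (R n) 0 (q i)) (real n) u om\<bar> <= 1/4" by metis
 have KE0: "0 <= KE TYPE('d)" by (simp add: KE_def)
 \<comment> \<open>The maximal inequality on \<open>B i n\<close> carries the factor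
   \<open>prob (B i n)\<close>. Summing over the partition costs nothing, and the total is again of
   order \<open>epsR (R n)\<close>.\<close>
 have EU: "prob (\<Union>i. E i n) <= KE TYPE('d) * epsR (R n) * 16" for n
proof -
 have sB: "(%i. prob (B i n)) sums prob (\<Union>i. B i n)" by (rule finite_measure_UNION) (use BM Bdisj in auto)
 have sB': "(%i. prob (B i n) * (KE TYPE('d) * epsR (R n)) * 16) sums (prob (\<Union>i. B i n) * (KE TYPE('d) * epsR (R n)) * 16)" by (intro sums_mult2 sB)
 have sE: "summable (%i. prob (E i n))" by (rule summable_comparison_test'[OF sums_summable[OF sB']]) (use E(2) in auto)
 have "prob (\<Union>i. E i n) <= (\<Sum>i. prob (E i n))" by (rule finite_measure_subadditive_countably) (use E(1) sE in auto)
 also have "... <= (\<Sum>i. prob (B i n) * (KE TYPE('d) * epsR (R n)) * 16)" by (rule suminf_le[OF E(2) sE sums_summable[OF sB']])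
 also have "... = prob (\<Union>i. B i n) * (KE TYPE('d) * epsR (R n)) * 16" using sB' by (rule sums_unique[symmetric])
 also have "... <= 1 * (KE TYPE('d) * epsR (R n)) * 16" using KE0 epsR_nonneg by (intro mult_right_mono mult_nonneg_nonneg) auto
 finally show ?thesis by simp
qed
 have sm: "summable (%n. KE TYPE('d) * epsR (R n) * 16)"
proof -
 have "eventually (%n. epsR (R n) = epsR (ep * real n)) sequentially" using eventually_ge_at_top[of "nat \<lceil>1 / ep\<rceil>"]
proof eventually_elim
case (elim n)
 then have "1 / ep <= real n" by linarith
 then have "1 <= ep * real n" using e by (simp add: field_simps)
 then show ?case by (simp add: R_def)
qed
 then have "summable (%n. epsR (R n))" using summable_cong[of "%n. epsR (R n)" "%n. epsR (ep * real n)"] summable_epsR_scaled[OF e] by blast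
 then show ?thesis by (intro summable_mult summable_mult2)
qed
 have bc: "AE om in M. eventually (%n. om \<notin> (\<Union>i. E i n)) sequentially" by (rule BC[OF _ sm EU]) (use E(1) in auto)
 define C0 where "C0 = KG TYPE('d) + (real CARD('d) + 1) * rem 1"
 define c0 where "c0 = ln (N0 + 1/2)"
 have c0: "0 <= c0" using N1 by (simp add: c0_def)
 have C00: "0 <= C0" using KG_nonneg[where 'd='d] rem_nonneg[of 1] by (simp add: C0_def)
 show ?thesis using bc AE_space
proof eventually_elim
case (elim om)
 note w = elim(2)
 show ?case using elim(1) eventually_ge_at_top[of "nat \<lceil>(4 * (C0 + c0) + 1) / ep\<rceil>"]
proof eventually_elim
case (elim n)
 have "(4 * (C0 + c0) + 1) / ep <= real n" using elim(2) by linarith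
 then have en: "4 * (C0 + c0) + 1 <= ep * real n" using e by (simp add: field_simps)
 then have Rn: "R n = ep * real n" "4 * (C0 + c0) + 1 <= R n" using c0 C00 by (auto simp: R_def)
 have R0: "R n > 0" using R1[of n] by simp
 obtain i where i: "om \<in> B i n" using Bcov[OF w] by blast
 then have nr: "near i n om" by (simp add: B_def)
 have qi: "q i ~= 0" by (rule q0[OF nr])
 show ?case
proof
 fix u assume u: "u \<in> {real n..real n + 1}"
 then have u0: "0 <= u" "real n <= u" "u <= real n + 1" by auto
 let ?g = "fst (X (real n) om)" and ?h = "fst (X u om)"
 have gG: "?g \<in> Ggrp" "?h \<in> Ggrp" using X_G[OF w, of "real n"] X_G[OF w u0(1)] by (auto simp: Gtilde_def)
 have m: "\<bar>Mt (kf (R n) 0 (q i)) (Gkf (R n) 0 (q i)) (real n) u om\<bar> <= 1/4" using E(3)[of om i n u] i elim(1) u by auto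
 have "Gb (Gkf (R n) 0 (q i)) (C0 / R n)" using Gb_Gkf[OF R1 qi] Gkf_small[OF R1 qi] by (auto simp: Gb_def C0_def)
 from ig_lebesgue(4)[OF this _ u0(2) w] have "\<bar>ig (Gkf (R n) 0 (q i)) (real n) u om\<bar> <= C0 / R n * (u - real n)" by simp
 also have "... <= C0 / R n * 1" using u0 C00 R0 by (intro mult_left_mono divide_nonneg_pos) auto
 also have "... <= 1/4" using Rn(2) R0 c0 C00 by (simp add: field_simps)
 finally have i1: "\<bar>ig (Gkf (R n) 0 (q i)) (real n) u om\<bar> <= 1/4" .
 have "norm (q i ** ?g) <= N0 + 1/2" using N1 nr norm_triangle_sub[of "q i ** ?g" "mat 1"] unfolding near_def N0_def by linarith
 moreover have qg: "norm (q i ** ?g) > 0" using N1 mult_Ggrp_nonzero[OF qi gG(1)] by simp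
 ultimately have "lnF (q i) (X (real n) om) <= c0" unfolding lnF_def c0_def using N1 by (subst ln_le_cancel_iff) auto
 then have "lnF (q i) (X (real n) om) / R n - 0 <= c0 / R n" using R0 by (simp add: divide_right_mono)
 then have "phi (lnF (q i) (X (real n) om) / R n - 0) <= phi (c0 / R n)" by (rule phi_mono)
 also have "... <= c0 / R n" using phi_lipschitz[of "c0 / R n" 0] phi_id[of 0] c0 R0 by simp
 also have "... <= 1/4" using Rn(2) R0 c0 C00 by (simp add: field_simps)
 finally have f0: "kf (R n) 0 (q i) (X (real n) om) <= 1/4" by (subst kf_eq[OF qi X_G[OF w]]) auto
 have "kf (R n) 0 (q i) (X u om) < 1" using m i1 f0 unfolding Mt_def by linarith
 then have "phi (lnF (q i) (X u om) / R n - 0) < 1" by (simp add: kf_eq[OF qi X_G[OF w u0(1)]])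
 then have "lnF (q i) (X u om) / R n < 1" using phi_less_1 by simp
 then have "ln (norm (q i ** ?h)) < ep * real n" using R0 Rn(1) by (simp add: lnF_def field_simps)
 then have qh: "norm (q i ** ?h) <= exp (ep * real n)" using mult_Ggrp_nonzero[OF qi gG(2)] by (metis exp_le_cancel_iff exp_ln less_imp_le zero_less_norm_iff)
 let ?Y = "matrix_inv ?g ** ?h"
 \<comment> \<open>Since q_i g_n is within 1/2 of the identity, half of the norm of Y can be
   absorbed on the left, which produces the factor 2 in the claim.\<close>
 have "q i ** ?h = (q i ** ?g) ** ?Y" by (metis Ggrp_matrix_inv(2)[OF gG(1)] matrix_mul_assoc matrix_mul_rid)
 also have "... = ?Y + (q i ** ?g - mat 1) ** ?Y" by (simp add: matrix_add_mult)
 finally have "?Y = q i ** ?h - (q i ** ?g - mat 1) ** ?Y" by (simp add: algebra_simps)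
 then have "norm ?Y <= norm (q i ** ?h) + norm ((q i ** ?g - mat 1) ** ?Y)" by (metis norm_triangle_ineq4)
 also have "norm ((q i ** ?g - mat 1) ** ?Y) <= 1/2 * norm ?Y" using norm_matrix_mult_le[of "q i ** ?g - mat 1" ?Y] mult_right_mono[of "norm (q i ** ?g - mat 1)" "1/2" "norm ?Y"] nr unfolding near_def by (simp add: less_imp_le order_trans)
 finally show "norm ?Y <= 2 * exp (ep * real n)" using qh by linarith
qed
qed
qed
qed

lemma unit_increment:
 "AE om in M. \<forall>ep>0. eventually (%n. \<forall>u\<in>{real n..real n + 1}.
 norm (matrix_inv (fst (X (real n) om)) ** fst (X u om)) <= 2 * exp (ep * real n)) sequentially"
proof (rule AE_all_eps)
 show "AE om in M. eventually (%k. \<forall>u\<in>{real k..real k + 1}.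
 norm (matrix_inv (fst (X (real k) om)) ** fst (X u om)) <= 2 * exp (1 / real (Suc n) * real k)) sequentially" for n by (rule unit_increment_eps) simp
 fix om and ep ep' :: real
 assume ev: "eventually (%n. \<forall>u\<in>{real n..real n + 1}.
 norm (matrix_inv (fst (X (real n) om)) ** fst (X u om)) <= 2 * exp (ep * real n)) sequentially" and le: "ep <= ep'"
 show "eventually (%n. \<forall>u\<in>{real n..real n + 1}.
 norm (matrix_inv (fst (X (real n) om)) ** fst (X u om)) <= 2 * exp (ep' * real n)) sequentially" using ev
proof eventually_elim
case (elim n)
 have "2 * exp (ep * real n) <= 2 * exp (ep' * real n)" using le by (simp add: mult_right_mono)
 then show ?case using elim by (meson order_trans)
qed
qed

end

section \<open>The drift of the logarithmic norm of a vector\<close>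

text \<open>The one-row matrix v^t Q. Multiplied by g it becomes the transpose of Q g^-1 v, because
  g^t Q = Q g^-1; so \<open>lnF (row v)\<close> is ln |g^-1 v|.\<close>

definition row :: "'d::finite mvec => real^('d option)^unit" where
 "row v = (\<chi> i. Qmat *v v)"

lemma matrix_mult_row: "(A ** B) $ i = transpose B *v (A $ i)" for A :: "real^'n^'m" by (simp add: vec_eq_iff matrix_matrix_mult_def transpose_def matrix_vector_mult_def mult.commute del: transpose_matrix_vector)

lemma row_nonzero: "v ~= 0 ==> row v ~= 0"
proof
 assume v: "v ~= 0" and "row v = 0"
 then have "row v $ () = 0" by simp
 then have "Qmat *v v = 0" by (simp add: row_def)
 then show False using norm_Qmat_mult[of v] v by (simp del: norm_Qmat_mult)
qed

lemma norm_unit_row: "norm A = norm (A $ ())" for A :: "real^'n^unit"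
proof -
 have "(norm A)\<^sup>2 = (norm (A $ ()))\<^sup>2" by (simp add: norm_matrix_rows UNIV_unit)
 then show ?thesis by simp
qed

lemma transpose_Qmat:
 assumes "g \<in> Ggrp" shows "transpose g *v (Qmat *v v) = Qmat *v (matrix_inv g *v v)" by (simp add: Ggrp_inverse(3)[OF assms] matrix_vector_mul_assoc Qmat_Qmat_left matrix_mul_assoc[symmetric] del: transpose_matrix_vector)

lemma row_mult: "g \<in> Ggrp ==> (row v ** g) $ i = Qmat *v (matrix_inv g *v v)" by (simp add: matrix_mult_row row_def transpose_Qmat del: transpose_matrix_vector)

lemma lnF_row: "x \<in> Gtilde ==> lnF (row v) x = ln (norm (matrix_inv (fst x) *v v))" by (auto simp: lnF_def norm_unit_row row_mult Gtilde_def)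

lemma row_lnF1:
 fixes v :: "'d::finite mvec"
 assumes x: "x \<in> Gtilde"
 defines "y \<equiv> matrix_inv (fst x) *v v"
 shows "lnF1 (row v) x th = - 2 * y $ None * inner (sp y) th / (norm y)\<^sup>2"
 and "(norm (row v ** fst x ** Vth th))\<^sup>2 = (inner (sp y) th)\<^sup>2 + (y $ None)\<^sup>2 * (norm th)\<^sup>2"
 and "norm (row v ** fst x) = norm y"
proof -
 have g: "fst x \<in> Ggrp" using x by (auto simp: Gtilde_def)
 have r: "(row v ** fst x ** Vth th) $ i = mk (- inner th (sp y)) (y $ None *\<^sub>R th)" for i unfolding matrix_mult_row[of "row v ** fst x"] Vth_sym row_mult[OF g] y_def[symmetric] by (simp add: Vth_mult Qmat_mult)
 show n: "norm (row v ** fst x) = norm y" by (simp add: norm_unit_row row_mult[OF g] y_def)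
 show "(norm (row v ** fst x ** Vth th))\<^sup>2 = (inner (sp y) th)\<^sup>2 + (y $ None)\<^sup>2 * (norm th)\<^sup>2" by (simp add: norm_unit_row r norm_mvec inner_commute power_mult_distrib)
 have "inner (row v ** fst x ** Vth th) (row v ** fst x) = - 2 * y $ None * inner (sp y) th" unfolding inner_vec_def[of "row v ** fst x ** Vth th"] r row_mult[OF g] y_def[symmetric] by (simp add: UNIV_unit inner_mvec Qmat_mult inner_commute)
 then show "lnF1 (row v) x th = - 2 * y $ None * inner (sp y) th / (norm y)\<^sup>2" by (simp add: lnF1_def n)
qed

text \<open>The jump increment of ln |y| averaged over the directions th and -th, where z is the
  share of the squared time component in |y|^2 and be the squared product of th with the spatial
  part of y / |y|. Averaging cancels the compensator. The 4 comes from two halves: the average and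
  the logarithm of a square.\<close>

definition Kr :: "real => real => real => real" where
 "Kr r z be = ln (1 + (sinh r)\<^sup>2 * (4 * (z + be) - 16 * z * be) + 4 * ((sinh r)\<^sup>2)\<^sup>2 * (z - be)\<^sup>2) / 4"

lemma Kr_measurable [measurable]: "(%p. Kr (f p) z (h p)) \<in> borel_measurable N"
 if [measurable]: "f \<in> borel_measurable N" "h \<in> borel_measurable N"
proof -
 have [measurable]: "sinh \<in> borel_measurable (borel :: real measure)" by (intro borel_measurable_continuous_onI continuous_intros)
 show ?thesis unfolding Kr_def by measurable
qed

text \<open>The two factors are the squared norms of \<open>y\<close> boosted in the directions \<open>th\<close> and \<open>-th\<close>.\<close>

lemma boost_product:
 fixes a b2 B C S :: real
 assumes "C\<^sup>2 = 1 + S\<^sup>2"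
 shows "(2 * (a * C - S * B)\<^sup>2 - a\<^sup>2 + b2) * (2 * (a * C + S * B)\<^sup>2 - a\<^sup>2 + b2)
 = (a\<^sup>2 + b2)\<^sup>2 + S\<^sup>2 * (4 * (a\<^sup>2 + b2) * (a\<^sup>2 + B\<^sup>2) - 16 * a\<^sup>2 * B\<^sup>2) + 4 * (S\<^sup>2)\<^sup>2 * (a\<^sup>2 - B\<^sup>2)\<^sup>2"
proof -
 let ?U = "2 * a\<^sup>2 * C\<^sup>2 + 2 * B\<^sup>2 * S\<^sup>2 - a\<^sup>2 + b2"
 have 1: "?U = (a\<^sup>2 + b2) + 2 * S\<^sup>2 * (a\<^sup>2 + B\<^sup>2)" unfolding assms by (simp add: algebra_simps)
 have "(2 * (a * C - S * B)\<^sup>2 - a\<^sup>2 + b2) * (2 * (a * C + S * B)\<^sup>2 - a\<^sup>2 + b2)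
 = ?U\<^sup>2 - 16 * a\<^sup>2 * B\<^sup>2 * C\<^sup>2 * S\<^sup>2" by algebra
 also have "... = ((a\<^sup>2 + b2) + 2 * S\<^sup>2 * (a\<^sup>2 + B\<^sup>2))\<^sup>2 - 16 * a\<^sup>2 * B\<^sup>2 * (1 + S\<^sup>2) * S\<^sup>2" by (simp only: 1[unfolded assms] assms)
 also have "... = (a\<^sup>2 + b2)\<^sup>2 + S\<^sup>2 * (4 * (a\<^sup>2 + b2) * (a\<^sup>2 + B\<^sup>2) - 16 * a\<^sup>2 * B\<^sup>2) + 4 * (S\<^sup>2)\<^sup>2 * (a\<^sup>2 - B\<^sup>2)\<^sup>2" by algebra
 finally show ?thesis .
qed

context levy_measure
begin

lemma dint_uminus:
 fixes k :: "real => real^'d::finite => real"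
 assumes k: "dom k b"
 shows "dom (%r th. k r (- th)) b" "dint (%r th. k r (- th)) = dint k"
proof -
 have m: "(%p. k (fst p) (snd p)) \<in> borel_measurable (borel \<Otimes>\<^sub>M borel)" using k by (simp add: dom_def)
 have "(%p. (fst p, - snd p)) \<in> (borel \<Otimes>\<^sub>M borel) \<rightarrow>\<^sub>M (borel \<Otimes>\<^sub>M (borel :: (real^'d) measure))" by measurable
 from measurable_compose[OF this m] show "dom (%r th. k r (- th)) b" using k by (simp add: dom_def)
 have "(%th. k r th) \<in> borel_measurable borel" for r using measurable_compose[OF measurable_Pair1'[of r borel borel] m] by simp
 from sphere_unif_integral_uminus[OF this] show "dint (%r th. k r (- th)) = dint k" by (simp add: dint_def)
qed

text \<open>The drift of ln |y| in terms of y / |y|: z is its squared time component and c its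
  spatial part. The polynomial is half the sum of the second derivatives in the boost
  directions.\<close>

definition DF :: "'d::finite itself => real => real^'d => real" where
 "DF _ z c = sg\<^sup>2 * (1 + (real CARD('d) - 5) * z + 4 * z\<^sup>2) + dint (%r th. Kr r z ((inner c th)\<^sup>2))"

text \<open>With y = g^-1 v, the squared norm after a boost is explicit in the time component of y
  and its product with th. The antipodal symmetry of the sphere permits averaging over th and -th,
  so that only the normalised vector y / |y| enters.\<close>

lemma drift_row:
 fixes v :: "'d::finite mvec"
 assumes v: "v ~= 0" and x: "x \<in> Gtilde"
 defines "y \<equiv> matrix_inv (fst x) *v v"
 defines "z \<equiv> (y $ None)\<^sup>2 / (norm y)\<^sup>2" and "c \<equiv> (1 / norm y) *\<^sub>R sp y"
 shows "drift (row v) x = DF TYPE('d) z c" "(norm c)\<^sup>2 = 1 - z" "dom (%r th. Kr r z ((inner c th)\<^sup>2)) wt" "0 <= z"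
 "qform v v = (y $ None)\<^sup>2 - (norm (sp y))\<^sup>2" "(norm y)\<^sup>2 > 0"
proof -
 define a where "a = y $ None"
 define b where "b = sp y"
 define m where "m = (norm y)\<^sup>2"
 have g: "fst x \<in> Ggrp" using x by (auto simp: Gtilde_def)
 have y0: "y ~= 0" using v Ggrp_matrix_inv(4)[OF g, of v] unfolding y_def by (metis matrix_vector_mult_0_right)
 have m: "m > 0" "m = a\<^sup>2 + (norm b)\<^sup>2" using y0 by (simp add: m_def, simp add: m_def a_def b_def norm_mvec)
 have gy: "fst x *v y = v" unfolding y_def by (rule Ggrp_matrix_inv(4)[OF g])
 have q: "qform v v = a\<^sup>2 - (norm b)\<^sup>2"
proof -
 have "qform u u = (u $ None)\<^sup>2 - (norm (sp u))\<^sup>2" for u :: "'d mvec" unfolding qform_sp power2_norm_eq_inner unfolding power2_eq_square ..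
 then show ?thesis using qform_Ggrp[OF g, of y y] unfolding gy a_def b_def by metis
qed
 then show "qform v v = (y $ None)\<^sup>2 - (norm (sp y))\<^sup>2" by (simp add: a_def b_def)
 show "(norm y)\<^sup>2 > 0" using y0 by simp
 have z: "z = a\<^sup>2 / m" by (simp add: z_def a_def m_def)
 show "0 <= z" by (simp add: z_def)
 have c2: "(inner c th)\<^sup>2 = (inner b th)\<^sup>2 / m" for th by (simp add: c_def b_def m_def power_divide)
 show nc: "(norm c)\<^sup>2 = 1 - z"
proof -
 have "(norm c)\<^sup>2 = (norm b)\<^sup>2 / m" by (simp add: c_def b_def m_def power_divide)
 moreover have "(norm b)\<^sup>2 = m - a\<^sup>2" using m(2) by simp
 ultimately show ?thesis using m(1) by (simp add: z diff_divide_distrib)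
qed
 have A: "row v ~= 0" by (rule row_nonzero[OF v])
 have l1: "lnF1 (row v) x th = - 2 * a * inner b th / m" for th using row_lnF1(1)[OF x, of v th] by (simp add: a_def b_def m_def y_def)
 have "lnF2 (row v) x (axis i 1) = 2 * ((b $ i)\<^sup>2 + a\<^sup>2) / m - 8 * a\<^sup>2 / m\<^sup>2 * (b $ i)\<^sup>2" for i unfolding lnF2_def l1 row_lnF1(2)[OF x] row_lnF1(3)[OF x] y_def[symmetric] by (simp add: inner_axis a_def b_def m_def power_divide power_mult_distrib)
 then have "(\<Sum>i\<in>UNIV. lnF2 (row v) x (axis i 1))
 = 2 * ((\<Sum>i\<in>UNIV. (b $ i)\<^sup>2) + real CARD('d) * a\<^sup>2) / m - 8 * a\<^sup>2 / m\<^sup>2 * (\<Sum>i\<in>UNIV. (b $ i)\<^sup>2)" by (simp add: sum_subtractf sum.distrib sum_distrib_left[symmetric] sum_divide_distrib[symmetric])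
 also have "(\<Sum>i\<in>UNIV. (b $ i)\<^sup>2) = m - a\<^sup>2" unfolding m(2) norm_vec2[of b] by simp
 also have "2 * ((m - a\<^sup>2) + real CARD('d) * a\<^sup>2) / m - 8 * a\<^sup>2 / m\<^sup>2 * (m - a\<^sup>2) = 2 * (1 + (real CARD('d) - 5) * z + 4 * z\<^sup>2)" unfolding z using m(1) by (simp add: field_simps power2_eq_square)
 finally have s2: "(\<Sum>i\<in>UNIV. lnF2 (row v) x (axis i 1)) = 2 * (1 + (real CARD('d) - 5) * z + 4 * z\<^sup>2)" .
 have P: "lnF (row v) (mv x r th) = ln (2 * (a * cosh r - sinh r * inner b th)\<^sup>2 - a\<^sup>2 + (norm b)\<^sup>2) / 2"
 "0 < 2 * (a * cosh r - sinh r * inner b th)\<^sup>2 - a\<^sup>2 + (norm b)\<^sup>2" if t: "norm th = 1" for r th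
proof -
 have G: "mv x r th \<in> Gtilde" by (rule mv_Gtilde[OF x t])
 then have G': "fst (mv x r th) \<in> Ggrp" by (auto simp: Gtilde_def)
 let ?w = "matrix_inv (fst (mv x r th)) *v v"
 have w0: "?w ~= 0" using v Ggrp_matrix_inv(4)[OF G', of v] by (metis matrix_vector_mult_0_right)
 have "qform v (fst (mv x r th) *v ev None) = qform (fst x *v y) (fst x *v (boost r th *v ev None))" by (simp add: mv_def gy matrix_vector_mul_assoc)
 also have "... = a * cosh r - sinh r * inner b th" unfolding qform_Ggrp[OF g] using t by (simp add: boost_ev_None qform_sp a_def b_def)
 finally have w: "(norm ?w)\<^sup>2 = 2 * (a * cosh r - sinh r * inner b th)\<^sup>2 - a\<^sup>2 + (norm b)\<^sup>2" unfolding norm_matrix_inv[OF G'] q by simp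
 then show "0 < 2 * (a * cosh r - sinh r * inner b th)\<^sup>2 - a\<^sup>2 + (norm b)\<^sup>2" using w0 by (metis zero_less_norm_iff zero_less_power)
 have "ln ((norm ?w)\<^sup>2) = 2 * ln (norm ?w)" using w0 by (simp add: ln_realpow)
 then show "lnF (row v) (mv x r th) = ln (2 * (a * cosh r - sinh r * inner b th)\<^sup>2 - a\<^sup>2 + (norm b)\<^sup>2) / 2" unfolding lnF_row[OF G] w[symmetric] by simp
qed
 have lx: "lnF (row v) x = ln m / 2" using y0 by (simp add: lnF_row[OF x] m_def ln_realpow y_def[symmetric])
 define k where "k = Jf (lnF (row v)) (lnF1 (row v)) x"
 have dk: "dom k wt" using Jf_lnF_dom[OF A x] by (simp add: k_def)
 \<comment> \<open>The compensator is odd in th and drops out; the two logarithms combine into one,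
   whose argument is \<open>boost_product\<close> divided by |y|^4.\<close>
 have keq: "1/2 * k r th + 1/2 * k r (- th) = Kr r z ((inner c th)\<^sup>2)" if t: "norm th = 1" for r th
proof -
 have lnp: "ln (u * v / m\<^sup>2) = ln u + ln v - 2 * ln m" if "0 < u" "0 < v" for u v using that m(1) by (simp add: ln_div ln_mult_pos ln_realpow)
 let ?P = "%th. 2 * (a * cosh r - sinh r * inner b th)\<^sup>2 - a\<^sup>2 + (norm b)\<^sup>2"
 have t': "norm (- th) = 1" using t by simp
 have Jk: "k r th = lnF (row v) (mv x r th) - lnF (row v) x - (if r <= 1 then r else 0) * lnF1 (row v) x th" for th unfolding k_def Jf_def lnF1_linear[symmetric] ..
 have "1/2 * k r th + 1/2 * k r (- th) = (ln (?P th) + ln (?P (- th)) - 2 * ln m) / 4" unfolding Jk P(1)[OF t] P(1)[OF t'] lx l1 by (simp add: field_simps)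
 also have "... = ln (?P th * ?P (- th) / m\<^sup>2) / 4" by (simp only: lnp[OF P(2)[OF t, of r] P(2)[OF t', of r]])
 also have "?P th * ?P (- th) = m\<^sup>2 + (sinh r)\<^sup>2 * (4 * m * (a\<^sup>2 + (inner b th)\<^sup>2) - 16 * a\<^sup>2 * (inner b th)\<^sup>2) + 4 * ((sinh r)\<^sup>2)\<^sup>2 * (a\<^sup>2 - (inner b th)\<^sup>2)\<^sup>2"
proof -
 have "(cosh r)\<^sup>2 = 1 + (sinh r)\<^sup>2" using cosh_square_eq[of r] by simp
 from boost_product[OF this, of a "inner b th" "(norm b)\<^sup>2"] show ?thesis unfolding m(2) by simp
qed
 also have "... / m\<^sup>2 = 1 + (sinh r)\<^sup>2 * (4 * (z + (inner c th)\<^sup>2) - 16 * z * (inner c th)\<^sup>2) + 4 * ((sinh r)\<^sup>2)\<^sup>2 * (z - (inner c th)\<^sup>2)\<^sup>2"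
proof -
 have d: "u / m - w / m = (u - w) / m" "u / m + w / m = (u + w) / m" for u w by (simp_all add: diff_divide_distrib add_divide_distrib)
 have "4 * ((a\<^sup>2 + w) / m) - 16 * (a\<^sup>2 / m) * (w / m) = (4 * m * (a\<^sup>2 + w) - 16 * a\<^sup>2 * w) / m\<^sup>2" for w using m(1) by (simp add: field_simps power2_eq_square)
 then show ?thesis unfolding c2 z d using m(1) by (simp add: add_divide_distrib power_divide)
qed
 finally show ?thesis unfolding Kr_def .
qed
 have mK: "(%p. Kr (fst p) z ((inner c (snd p))\<^sup>2)) \<in> borel_measurable (borel \<Otimes>\<^sub>M borel)" by measurable
 note du = dint_uminus[OF dk]
 show dK: "dom (%r th. Kr r z ((inner c th)\<^sup>2)) wt" unfolding dom_def
proof (intro conjI allI impI mK)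
 show "integrable nu wt" using dk by (simp add: dom_def)
 fix r :: real and th :: "real^'d" assume r: "0 < r" and t: "norm th = 1"
 have "\<bar>k r th\<bar> <= wt r" "\<bar>k r (- th)\<bar> <= wt r" using dk du(1) r t unfolding dom_def by blast+
 then show "\<bar>Kr r z ((inner c th)\<^sup>2)\<bar> <= wt r" unfolding keq[OF t, symmetric] by linarith
qed
 have "dint (%r th. Kr r z ((inner c th)\<^sup>2)) = dint (%r th. 1/2 * k r th + 1/2 * k r (- th))" by (rule dint_cong[OF dK dom_linear[OF dk du(1)]]) (rule keq[symmetric])
 also have "... = 1/2 * dint k + 1/2 * dint (%r th. k r (- th))" by (rule dint_linear[OF dk du(1)])
 finally have "dint (%r th. Kr r z ((inner c th)\<^sup>2)) = dint k" unfolding du(2) by simp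
 then show "drift (row v) x = DF TYPE('d) z c" unfolding drift_def Gf_def s2 DF_def k_def by simp
qed

text \<open>Rotation invariance of the sphere measure. As |c|^2 = 1 - z for the vectors that occur,
  the drift is a function of z alone.\<close>

lemma DF_norm:
 fixes c d :: "real^'d::finite"
 assumes "norm c = norm d" shows "DF TYPE('d) z c = DF TYPE('d) z d"
proof -
 have "(\<integral>th. Kr r z ((inner c th)\<^sup>2) \<partial>sphere_unif) = (\<integral>th. Kr r z ((inner d th)\<^sup>2) \<partial>sphere_unif)" for r by (rule sphere_unif_inner[of "%s. Kr r z (s\<^sup>2)", OF _ assms]) measurable
 then show ?thesis by (simp add: DF_def dint_def)
qed

text \<open>g^-1 v is null as well, so its squared time component is exactly half of its squared
  norm. Hence z = 1/2 for every g, and the drift is one constant.\<close>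

lemma drift_null:
 fixes v :: "'d::finite mvec"
 assumes v: "v ~= 0" "qform v v = 0" and x: "x \<in> Gtilde" and c: "(norm c)\<^sup>2 = 1/2"
 shows "drift (row v) x = DF TYPE('d) (1/2) c" "dom (%r th. Kr r (1/2) ((inner c th)\<^sup>2)) wt"
proof -
 note d = drift_row[OF v(1) x]
 let ?y = "matrix_inv (fst x) *v v"
 have z: "(?y $ None)\<^sup>2 / (norm ?y)\<^sup>2 = 1/2" using d(5,6) v(2) norm_mvec[of ?y] by (simp add: field_simps)
 let ?c = "(1 / norm ?y) *\<^sub>R sp ?y"
 have nn: "(norm ?c)\<^sup>2 = (norm c)\<^sup>2" unfolding d(2) z c by simp
 then have n: "norm ?c = norm c" by (rule power2_eq_imp_eq[OF _ norm_ge_zero norm_ge_zero])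
 show e: "drift (row v) x = DF TYPE('d) (1/2) c" using d(1) DF_norm[OF n, of "1/2"] z by simp
 show "dom (%r th. Kr r (1/2) ((inner c th)\<^sup>2)) wt" unfolding dom_def
proof (intro conjI allI impI)
 show "(%p. Kr (fst p) (1/2) ((inner c (snd p))\<^sup>2)) \<in> borel_measurable (borel \<Otimes>\<^sub>M borel)" by measurable
 show "integrable nu wt" by (rule integrable_wt)
 fix r :: real and th :: "real^'d" assume r: "0 < r" and t: "norm th = 1"
 obtain T where T: "orthogonal_transformation T" "T c = ?c" using orthogonal_transformation_exists[OF n[symmetric]] by blast
 have "norm (T th) = 1" using T(1) t by (simp add: orthogonal_transformation)
 then have "\<bar>Kr r (1/2) ((inner ?c (T th))\<^sup>2)\<bar> <= wt r" using d(3) r z unfolding dom_def by simp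
 then show "\<bar>Kr r (1/2) ((inner c th)\<^sup>2)\<bar> <= wt r" using T(1) unfolding T(2)[symmetric] orthogonal_transformation_def by simp
qed
qed

text \<open>On a line (c . th)^2 = |c|^2 = 1/2 = z, where the argument of the logarithm in
  \<open>Kr\<close> is 1; the polynomial becomes 1 - 2 + 1.\<close>

lemma DF_line:
 fixes c :: "real^'d::finite"
 assumes 1: "CARD('d) = 1" and c: "(norm c)\<^sup>2 = 1/2" and d: "dom (%r th. Kr r (1/2) ((inner c th)\<^sup>2)) wt"
 shows "DF TYPE('d) (1/2) c = 0"
proof -
 obtain i :: 'd where i: "UNIV = {i}" using 1 card_1_singletonE by metis
 have "Kr r (1/2) ((inner c th)\<^sup>2) = 0" if "norm th = 1" for r th
proof -
 have "(inner c th)\<^sup>2 = (norm c)\<^sup>2 * (norm th)\<^sup>2" by (simp add: norm_vec2 inner_vec_def i power_mult_distrib)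
 then have h: "(inner c th)\<^sup>2 = 1/2" using that c by simp
 show ?thesis unfolding Kr_def h by simp
qed
 moreover have "dom (%r th::real^'d. 0) (%r. 0)" by (simp add: dom_def)
 ultimately have "dint (%r th. Kr r (1/2) ((inner c th)\<^sup>2)) = dint (%r th::real^'d. 0)" using dint_cong[OF d] by blast
 also have "... = 0" by (simp add: dint_def)
 finally show ?thesis by (simp add: DF_def 1 power2_eq_square)
qed

section \<open>A positive lower bound for the drift when d >= 2\<close>

lemma Kr_lower:
 assumes r: "0 < r" and z: "0 <= z" and b: "0 <= be" "z + be <= 1"
 shows "min 1 (r\<^sup>2) / 32 * (4 * (z + be) - 16 * z * be) <= Kr r z be"
proof -
 define w where "w = 4 * (z + be) - 16 * z * be"
 \<comment> \<open>From sinh r >= r/2. As w lies in [0, 4], the product u w is at most 1 and ln(1 +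
   u w) >= u w / 2. The constant 1/32 is 1/4 from u, 1/2 from the logarithm and 1/4 from
   \<open>Kr\<close>.\<close>
 define u where "u = min 1 (r\<^sup>2) / 4"
 have "(z + be)\<^sup>2 <= z + be" using mult_left_mono[OF b(2), of "z + be"] z b by (simp add: power2_eq_square)
 then have "4 * z * be <= z + be" using zero_le_power2[of "z - be"] by (simp add: power2_eq_square algebra_simps)
 then have w0: "0 <= w" by (simp add: w_def)
 have w4: "w <= 4" 
proof -
 have "0 <= 16 * z * be" using z b by (intro mult_nonneg_nonneg) auto
 moreover have "w = 4 * (z + be) - 16 * z * be" by (rule w_def)
 moreover have "4 * (z + be) <= 4" using b(2) by simp
 ultimately show ?thesis by linarith
qed
 have u: "0 <= u" "u <= 1/4" by (auto simp: u_def)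
 have "r / 2 <= sinh r" 
proof -
 have "1 + r <= exp r" by (rule exp_ge_add_one_self)
 moreover have "exp (- r) <= 1" using r by simp
 ultimately have "r <= exp r - exp (- r)" by linarith
 then have "r / 2 <= (exp r - exp (- r)) / 2" by simp
 then show ?thesis by (simp add: sinh_field_def)
qed
 from power_mono[OF this, of 2] have us: "u <= (sinh r)\<^sup>2" using r by (simp add: u_def power_divide)
 have uw: "0 <= u * w" "u * w <= 1" using mult_mono[OF u(2) w4] u w0 by auto
 have "u * w / 2 <= u * w / (1 + u * w)" using uw by (intro divide_left_mono) auto
 also have "... = 1 - 1 / (1 + u * w)" using uw by (simp add: field_simps)
 also have "... <= ln (1 + u * w)" using ln_le_minus_one[of "1 / (1 + u * w)"] uw by (simp add: ln_div)
 also have "... <= ln (1 + (sinh r)\<^sup>2 * w + 4 * ((sinh r)\<^sup>2)\<^sup>2 * (z - be)\<^sup>2)"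
proof -
 have "u * w <= (sinh r)\<^sup>2 * w" by (rule mult_right_mono[OF us w0])
 moreover have "0 <= 4 * ((sinh r)\<^sup>2)\<^sup>2 * (z - be)\<^sup>2" by simp
 ultimately show ?thesis using uw by (subst ln_le_cancel_iff) linarith+
qed
 finally show ?thesis unfolding Kr_def w_def u_def by simp
qed

text \<open>Averaging the bound of \<open>Kr_lower\<close> with E (c . th)^2 = (1 - z)/d gives 4/d
  times Q = 1 + (d - 5) z + 4 z^2, the polynomial of the diffusion part. So both noise sources
  contribute a positive multiple of Q, and one of them is present.\<close>

lemma drift_lower:
 assumes d: "CARD('d::finite) \<ge> 2" and nd: "sg ~= 0 \<or> emeasure nu (space nu) ~= 0"
 shows "\<exists>ka>0. \<forall>v::'d mvec. v ~= 0 --> (\<forall>x\<in>Gtilde. ka <= drift (row v) x)"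
proof -
 let ?d = "real CARD('d)"
 let ?I = "\<integral>r. min 1 (r\<^sup>2) \<partial>nu"
 define ka where "ka = 7/16 * (sg\<^sup>2 + 1 / (8 * ?d) * ?I)"
 have im: "integrable nu (%r. min 1 (r\<^sup>2))" using integrable_min[of 1] by simp
 have d0: "?d \<ge> 2" using d by simp
 have I0: "0 <= ?I" by simp
 have "0 < sg\<^sup>2 + 1 / (8 * ?d) * ?I"
proof (cases "sg = 0")
case True
 then have e: "emeasure nu (space nu) ~= 0" using nd by simp
 have "?I ~= 0"
proof
 assume "?I = 0"
 then have "AE r in nu. min 1 (r\<^sup>2) = 0" using integral_nonneg_eq_0_iff_AE[OF im] by simp
 then have "AE r in nu. False" using nu_pos by eventually_elim (auto simp: min_def split: if_splits)
 then have "emeasure nu (space nu) = 0" using AE_iff_measurable[OF sets.top, of nu "%r. False"] by simp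
 then show False using e by simp
qed
 then have "0 < ?I" using I0 by linarith
 then show ?thesis using d0 by (intro add_nonneg_pos mult_pos_pos) auto
next
case False
 then show ?thesis using d0 I0 by (intro add_pos_nonneg mult_nonneg_nonneg) auto
qed
 then have k0: "ka > 0" by (simp add: ka_def)
 show ?thesis
proof (intro exI[of _ ka] conjI k0 allI impI ballI)
 fix v :: "'d mvec" and x :: "'d pg" assume v: "v ~= 0" and x: "x \<in> Gtilde"
 note dr = drift_row[OF v x]
 define y where "y = matrix_inv (fst x) *v v"
 define z where "z = (y $ None)\<^sup>2 / (norm y)\<^sup>2"
 define c where "c = (1 / norm y) *\<^sub>R sp y"
 note dd = dr[folded y_def, folded z_def c_def]
 \<comment> \<open>For d = 2 this is (2 z - 3/4)^2 + 7/16, and a larger d only adds the nonnegative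
   term (d - 2) z; hence the bound 7/16.\<close>
 define Q where "Q = 1 + (?d - 5) * z + 4 * z\<^sup>2"
 have Q: "7/16 <= Q"
proof -
 have "(2 - ?d) * z <= 0" using dd(4) d0 by (simp add: mult_nonpos_nonneg)
 moreover have "0 <= (2 * z - 3/4)\<^sup>2" by simp
 ultimately show ?thesis unfolding Q_def by (simp add: power2_eq_square algebra_simps)
qed
 interpret S: prob_space "sphere_unif :: (real^'d) measure" by (rule prob_space_sphere_unif)
 have bt: "(inner c th)\<^sup>2 <= 1 - z" if "norm th = 1" for th
proof -
 have "(inner c th)\<^sup>2 <= (norm c)\<^sup>2 * (norm th)\<^sup>2" using Cauchy_Schwarz_ineq[of c th] by (simp add: power2_norm_eq_inner)
 then show ?thesis using that dd(2) by simp
qed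
 have setsS: "sets (sphere_unif :: (real^'d) measure) = sets borel" by (simp add: sphere_unif_def)
 have ib: "integrable sphere_unif (%th. (inner c th)\<^sup>2)" by (rule S.integrable_const_bound[where B = "1 - z"])
 (use AE_sphere_unif[where 'd='d] in \<open>auto elim!: eventually_mono simp: bt measurable_cong_sets[OF setsS refl]\<close>)
 have low: "min 1 (r\<^sup>2) / 32 * (4 / ?d * Q) <= (\<integral>th. Kr r z ((inner c th)\<^sup>2) \<partial>sphere_unif)" if r: "r > 0" for r
proof -
 have iK: "integrable sphere_unif (%th. Kr r z ((inner c th)\<^sup>2))"
proof (rule S.integrable_const_bound[where B = "wt r"])
 show "AE th in sphere_unif. norm (Kr r z ((inner c th)\<^sup>2)) <= wt r" using AE_sphere_unif[where 'd='d] by eventually_elim (use dd(3) r in \<open>auto simp: dom_def\<close>)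
 show "(%th. Kr r z ((inner c th)\<^sup>2)) \<in> borel_measurable sphere_unif" unfolding measurable_cong_sets[OF setsS refl] by measurable
qed
 let ?l = "%th. min 1 (r\<^sup>2) / 32 * (4 * (z + (inner c th)\<^sup>2) - 16 * z * (inner c th)\<^sup>2)"
 have le: "?l = (%th. min 1 (r\<^sup>2) / 32 * (4 * z + (4 - 16 * z) * (inner c th)\<^sup>2))" by (simp add: algebra_simps)
 have "(\<integral>th. ?l th \<partial>sphere_unif) = min 1 (r\<^sup>2) / 32 * (4 * z + (4 - 16 * z) * ((1 - z) / ?d))" unfolding le using ib S.prob_space by (simp add: sphere_unif_square dd(2))
 also have "4 * z + (4 - 16 * z) * ((1 - z) / ?d) = 4 / ?d * Q" using d0 by (simp add: Q_def field_simps power2_eq_square)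
 finally have e: "(\<integral>th. ?l th \<partial>sphere_unif) = min 1 (r\<^sup>2) / 32 * (4 / ?d * Q)" .
 have "integrable sphere_unif ?l" unfolding le using ib by simp
 moreover have "AE th in sphere_unif. ?l th <= Kr r z ((inner c th)\<^sup>2)" using AE_sphere_unif[where 'd='d]
proof eventually_elim
case (elim th)
 show ?case by (rule Kr_lower[OF r dd(4)]) (use bt[OF elim] in auto)
qed
 ultimately show ?thesis unfolding e[symmetric] using iK by (intro integral_mono_AE)
qed
 have "1 / (8 * ?d) * Q * ?I = (\<integral>r. min 1 (r\<^sup>2) / 32 * (4 / ?d * Q) \<partial>nu)" by (simp add: mult_ac)
 also have "... <= dint (%r th. Kr r z ((inner c th)\<^sup>2))" unfolding dint_def
proof (rule integral_mono_AE)
 show "integrable nu (%r. min 1 (r\<^sup>2) / 32 * (4 / ?d * Q))" using im by simp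
 show "integrable nu (%r. \<integral>th. Kr r z ((inner c th)\<^sup>2) \<partial>sphere_unif)" by (rule dom_outer(1)[OF dd(3)])
 show "AE r in nu. min 1 (r\<^sup>2) / 32 * (4 / ?d * Q) <= (\<integral>th. Kr r z ((inner c th)\<^sup>2) \<partial>sphere_unif)" using nu_pos by eventually_elim (rule low)
qed
 finally have 1: "1 / (8 * ?d) * Q * ?I <= dint (%r th. Kr r z ((inner c th)\<^sup>2))" .
 have "ka <= Q * (sg\<^sup>2 + 1 / (8 * ?d) * ?I)" unfolding ka_def using Q I0 d0 by (intro mult_right_mono add_nonneg_nonneg mult_nonneg_nonneg) auto
 also have "... = sg\<^sup>2 * Q + 1 / (8 * ?d) * Q * ?I" by (simp add: algebra_simps)
 also have "... <= DF TYPE('d) z c" using 1 unfolding DF_def Q_def by simp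
 finally show "ka <= drift (row v) x" using dd(1) by simp
qed
qed

end

section \<open>The translation component\<close>

context levy_measure
begin

text \<open>Boosts fix the translation part, so for the diffusion and jump terms the factor k(xi) is
  a constant; the derivative along H_0 enters additively through h.\<close>

lemma Gf_scale:
 "Gf (%x. k (snd x) * (a + b * f x)) (%x th. k (snd x) * (b * d1 x th)) (%x th. k (snd x) * (b * d2 x th)) h x
 = h x + k (snd x) * b * Gf f d1 d2 (%x. 0) x"
 "Gam (%x. k (snd x) * (a + b * f x)) (%x th. k (snd x) * (b * d1 x th)) x = (k (snd x) * b)\<^sup>2 * Gam f d1 x"
proof -
 let ?c = "k (snd x) * b"
 have J: "Jf (%x. k (snd x) * (a + b * f x)) (%x th. k (snd x) * (b * d1 x th)) x = (%r th. ?c * Jf f d1 x r th)" by (intro ext) (simp add: Jf_def mv_def algebra_simps sum_distrib_left)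
 have D: "(%r th. (k (snd (mv x r th)) * (a + b * f (mv x r th)) - k (snd x) * (a + b * f x))\<^sup>2)
 = (%r th. ?c\<^sup>2 * (f (mv x r th) - f x)\<^sup>2)" by (intro ext) (simp add: mv_def algebra_simps power2_eq_square)
 have d: "dint (%r th. c * l r th) = c * dint l" for c :: real and l :: "real => real^'a => real" by (simp add: dint_def)
 show "Gf (%x. k (snd x) * (a + b * f x)) (%x th. k (snd x) * (b * d1 x th)) (%x th. k (snd x) * (b * d2 x th)) h x
 = h x + ?c * Gf f d1 d2 (%x. 0) x" unfolding Gf_def J d by (simp add: sum_distrib_left[symmetric] mult.assoc[symmetric] distrib_left)
 show "Gam (%x. k (snd x) * (a + b * f x)) (%x th. k (snd x) * (b * d1 x th)) x = ?c\<^sup>2 * Gam f d1 x" unfolding Gam_def D d by (simp add: sum_distrib_left[symmetric] mult.assoc[symmetric] distrib_left power_mult_distrib)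
qed

end

context levy_proc
begin

text \<open>One-sided limits give a bound near every time, and bisection glues them over the compact
  interval.\<close>

lemma path_bounded:
 assumes w: "om \<in> space M" and T: "0 <= T"
 shows "\<exists>B. \<forall>s\<in>{0..T}. norm (X s om) <= B"
proof -
 define P where "P a b \<longleftrightarrow> (\<exists>B. \<forall>s. 0 <= s --> a <= s --> s <= b --> norm (X s om) <= B)" for a b
 have "P 0 T"
proof (rule Bolzano[OF T])
 fix a b c assume "P a b" "P b c"
 then obtain B B' where B: "!!s. 0 <= s ==> a <= s ==> s <= b ==> norm (X s om) <= B" "!!s. 0 <= s ==> b <= s ==> s <= c ==> norm (X s om) <= B'" unfolding P_def by metis
 have "norm (X s om) <= max B B'" if "0 <= s" "a <= s" "s <= c" for s using B[of s] that by (cases "s <= b") (auto intro: order_trans)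
 then show "P a c" unfolding P_def by blast
next
 fix x :: real assume x: "0 <= x" "x <= T"
 have "((%s. X s om) \<longlongrightarrow> X x om) (at_right x)" using X_right[OF w x(1)] by (simp add: continuous_within)
 from tendstoD[OF tendsto_norm[OF this], of 1] have "eventually (%s. norm (X s om) <= norm (X x om) + 1) (at_right x)" by (auto elim!: eventually_mono simp: dist_real_def)
 then obtain b where b: "b > x" "!!y. y > x ==> y < b ==> norm (X y om) <= norm (X x om) + 1" unfolding eventually_at_right_field by blast
 have "\<exists>a<x. \<exists>B. \<forall>y. 0 <= y --> a < y --> y < x --> norm (X y om) <= B"
proof (cases "x = 0")
case True
 then show ?thesis by (intro exI[of _ "-1"]) auto
next
case False
 then have "0 < x" using x by simp
 from X_left[OF w this] obtain l where "((%s. X s om) \<longlongrightarrow> l) (at_left x)" by blast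
 from tendstoD[OF tendsto_norm[OF this], of 1] have "eventually (%s. norm (X s om) <= norm l + 1) (at_left x)" by (auto elim!: eventually_mono simp: dist_real_def)
 then show ?thesis unfolding eventually_at_left_field by blast
qed
 then obtain a B where a: "a < x" "!!y. 0 <= y ==> a < y ==> y < x ==> norm (X y om) <= B" by blast
 show "\<exists>d>0. \<forall>a b. a <= x & x <= b & b - a < d --> P a b"
proof (intro exI[of _ "min (b - x) (x - a)"] conjI allI impI)
 show "0 < min (b - x) (x - a)" using a b by simp
 fix u v assume uv: "u <= x & x <= v & v - u < min (b - x) (x - a)"
 have "norm (X s om) <= max B (norm (X x om) + 1)" if s: "0 <= s" "u <= s" "s <= v" for s
proof (cases s x rule: linorder_cases)
case less
 then show ?thesis using a(2)[of s] s uv by auto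
next
case greater
 then show ?thesis using b(2)[of s] s uv by auto
qed auto
 then show "P u v" unfolding P_def by blast
qed
qed
 then obtain B where "\<forall>s. 0 <= s --> 0 <= s --> s <= T --> norm (X s om) <= B" unfolding P_def by blast
 then show ?thesis by (intro exI[of _ B] ballI) simp
qed

text \<open>The translation has no martingale part: test with \<open>phi\<close> of xi_j / rh times
  a cutoff in g at scale R. The carre du champ is O(\<open>epsR R\<close>) and the generator differs
  from the H_0 derivative by O(1/R). Along R = n + 1 Borel-Cantelli makes both errors small, and on
  a path bounded by rh all cutoffs are eventually inactive. The bound on the path is random; with
  rh, T, l and j countable the exceptional sets can be united.\<close>

lemma translation_approx:
 fixes T rh l :: nat and j :: "'d option"
 assumes r: "rh \<ge> 1"
 shows "AE om in M. \<forall>B. (\<forall>s\<in>{0..real T}. norm (X s om) <= B) --> B <= real rh -->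
 (\<forall>u\<in>{0..real T}. (%s. (fst (X s om) *v ev None) $ j) integrable_on {0..u} &
 \<bar>snd (X u om) $ j - integral {0..u} (%s. (fst (X s om) *v ev None) $ j)\<bar> <= real rh / real (Suc l))"
proof (cases "T = 0")
case True
 show ?thesis using AE_space 
proof eventually_elim
case (elim om)
 have "f integrable_on {0}" for f :: "real => real" using integrable_on_refl[of f 0] by (simp add: cbox_interval)
 then show ?case using elim by (auto simp: True X_0 pId_def)
qed
next
case False
 \<comment> \<open>Half of the allowed error goes to the martingale part, half to the O(1/R) part of
   the generator.\<close>
 define dl where "dl = 1 / (2 * real (Suc l))"
 have d0: "dl > 0" by (simp add: dl_def)
 have r0: "real rh > 0" "real rh \<ge> 1" using r by auto
 let ?I = "mat 1 :: 'd mmat"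
 have I0: "?I ~= 0" by (simp add: mat_def vec_eq_iff)
 define k where "k = (%xi :: 'd mvec. phi (xi $ j / real rh))"
 define k' where "k' = (%x :: 'd pg. phi1 (snd x $ j / real rh) / real rh * (fst x *v ev None) $ j)"
 define c1 where "c1 R x = 1/2 + (-1/4) * kf R 6 ?I x" for R x
 define f where "f R x = k (snd x) * (1/2 + (-1/4) * kf R 6 ?I x)" for R x
 define d1 where "d1 R x th = k (snd x) * ((-1/4) * kf1 R 6 ?I x th)" for R x th
 define d2 where "d2 R x th = k (snd x) * ((-1/4) * kf2 R 6 ?I x th)" for R x th
 define h where "h R x = k' x * c1 R x" for R x
 have kb: "\<bar>k xi\<bar> <= 2" for xi by (simp add: k_def phi_bound)
 have f2: "fld (%x. k (snd x)) (%x th. 0) (%x th. 0) k'"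
proof (rule fld_snd)
 show "k \<in> borel_measurable borel" unfolding k_def by measurable
 show "k' \<in> borel_measurable borel" unfolding k'_def by measurable
 fix x :: "'d pg"
 let ?v = "fst x *v ev None"
 have "((%s. (snd x + s *\<^sub>R ?v) $ j / real rh) has_real_derivative ?v $ j / real rh) (at 0)" using r0 by (auto intro!: derivative_eq_intros)
 from DERIV_chain2[where g = "%s. (snd x + s *\<^sub>R ?v) $ j / real rh" and x = 0, OF phi_deriv this]
 show "((%s. k (snd x + s *\<^sub>R ?v)) has_real_derivative k' x) (at 0)" by (simp add: k_def k'_def)
qed
 have F: "fld (f R) (d1 R) (d2 R) (h R)" if R: "R > 0" for R using fld_mult[OF f2 fld_affine[OF fld_kf[OF R I0], of "1/2" "-1/4" 6]] unfolding f_def[abs_def] d1_def[abs_def] d2_def[abs_def] h_def[abs_def] c1_def by (simp only: mult_zero_right mult_zero_left add_0_right add_0_left)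
 have c1b: "0 <= c1 R x" "c1 R x <= 1" if "R > 0" for R x
proof -
 obtain th :: "real^'d" where "norm th = 1" using vector_choose_size[of 1] by auto
 from kf_bounds(1)[OF that this, of 6 ?I x] show "0 <= c1 R x" "c1 R x <= 1" by (auto simp: c1_def abs_le_iff)
qed
 have hb: "\<bar>h R x\<bar> <= exp (9 * R)" if R: "R \<ge> 1" and x: "x \<in> Gtilde" for R x
proof (cases "c1 R x = 0")
case True
 then show ?thesis by (simp add: h_def)
next
case False
 have R0: "R > 0" using R by simp
 have "lnF ?I x / R - 6 < 3"
proof (rule ccontr)
 assume "\<not> lnF ?I x / R - 6 < 3"
 then have "phi (lnF ?I x / R - 6) = 2" by (intro phi_top) simp
 then show False using False kf_eq[OF I0 x, of R 6] by (simp add: c1_def)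
qed
 then have "lnF ?I x < 9 * R" using R0 by (simp add: pos_divide_less_eq)
 moreover have gn: "fst x \<in> Ggrp" "norm (fst x) > 0" using x mult_Ggrp_nonzero[OF I0, of "fst x"] by (auto simp: Gtilde_def)
 moreover have "norm (fst x) = exp (lnF ?I x)" using gn(2) by (simp add: lnF_def)
 ultimately have ng: "norm (fst x) <= exp (9 * R)" by simp
 have "\<bar>(fst x *v ev None) $ j\<bar> <= norm (fst x *v ev None)" by (rule component_le_norm_cart)
 also have "... <= norm (fst x) * norm (ev None :: 'd mvec)" by (rule norm_matrix_vector_le)
 finally have v: "\<bar>(fst x *v ev None) $ j\<bar> <= exp (9 * R)" using ng by (simp add: ev_def norm_axis_1)
 have "\<bar>phi1 (snd x $ j / real rh) / real rh\<bar> <= 1" using phi1_bounds[of "snd x $ j / real rh"] r0 by (simp add: divide_le_eq)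
 from mult_mono[OF this v] have "\<bar>k' x\<bar> <= exp (9 * R)" by (simp add: k'_def abs_mult)
 from mult_mono[OF this, of "\<bar>c1 R x\<bar>" 1] show ?thesis using c1b[OF R0, of x] by (simp add: h_def abs_mult)
qed
 have Bn: "bnd (2 + exp (9 * R)) (f R) (d1 R) (d2 R) (h R)" if R: "R \<ge> 1" for R unfolding bnd_def
proof (intro ballI conjI allI impI)
 have R0: "R > 0" using R by simp
 fix x :: "'d pg" assume x: "x \<in> Gtilde"
 have "\<bar>f R x\<bar> = \<bar>k (snd x)\<bar> * \<bar>c1 R x\<bar>" by (simp add: f_def c1_def abs_mult)
 also have "... <= 2 * 1" by (intro mult_mono kb) (use c1b[OF R0, of x] in auto)
 finally show "\<bar>f R x\<bar> <= 2 + exp (9 * R)" using exp_ge_zero[of "9 * R"] by linarith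
 show "\<bar>h R x\<bar> <= 2 + exp (9 * R)" using hb[OF R x] by simp
 fix th :: "real^'d" assume t: "norm th = 1"
 have 1: "1 / R <= 1" "1 / R\<^sup>2 <= 1" using R by (auto simp: divide_le_eq_1)
 have "\<bar>kf1 R 6 ?I x th\<bar> <= 1" "\<bar>kf2 R 6 ?I x th\<bar> <= 3" using kf_bounds(2,3)[OF R0 t, of 6 ?I x] 1 by linarith+
 then have "\<bar>d1 R x th\<bar> <= 2 * (1/4 * 1)" "\<bar>d2 R x th\<bar> <= 2 * (1/4 * 3)" unfolding d1_def d2_def abs_mult by (intro mult_mono kb; simp)+
 then show "\<bar>d1 R x th\<bar> <= 2 + exp (9 * R)" "\<bar>d2 R x th\<bar> <= 2 + exp (9 * R)" using exp_ge_zero[of "9 * R"] by linarith+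
qed
 have C2: "C2b (f R)" if R: "R > 0" for R
proof -
 have "bounded_linear (%x :: 'd pg. snd x $ j / real rh)" by (intro bounded_linear_compose[OF bounded_linear_divide] bounded_linear_compose[OF bounded_linear_vec_nth] bounded_linear_snd)
 moreover have "continuous_on UNIV phi2" by (rule phi2_continuous)
 ultimately have "C2b (%x :: 'd pg. phi (snd x $ j / real rh))" by (intro C2b_compose[OF C2b_linear phi_deriv phi1_deriv])
 then show ?thesis unfolding f_def[abs_def] k_def by (intro C2b_mult C2b_add C2b_const C2b_kf[OF R])
qed
 have Gm: "Gam (f R) (d1 R) x <= KE TYPE('d) * epsR R" if R: "R > 0" and x: "x \<in> Gtilde" for R x
proof -
 have "\<bar>k (snd x) * (-1/4)\<bar> <= 1" using kb[of "snd x"] by (simp add: abs_mult)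
 then have "(k (snd x) * (-1/4))\<^sup>2 <= 1" by (simp only: abs_square_le_1)
 moreover have "Gam (f R) (d1 R) x = (k (snd x) * (-1/4))\<^sup>2 * Gam (kf R 6 ?I) (kf1 R 6 ?I) x" unfolding f_def[abs_def] d1_def[abs_def] by (rule Gf_scale(2))
 moreover have "Gam (kf R 6 ?I) (kf1 R 6 ?I) x <= KE TYPE('d) * epsR R" by (rule Gam_kf[OF R I0 x])
 moreover have "0 <= KE TYPE('d) * epsR R" by (simp add: KE_def epsR_nonneg)
 ultimately show ?thesis using mult_mono[of "(k (snd x) * (-1/4))\<^sup>2" 1 "Gam (kf R 6 ?I) (kf1 R 6 ?I) x" "KE TYPE('d) * epsR R"]
 Gam_nonneg[where f = "kf R 6 ?I"] by (cases "0 <= Gam (kf R 6 ?I) (kf1 R 6 ?I) x") (auto simp: mult_nonneg_nonpos intro: order_trans)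
qed
 define C0 where "C0 = KG TYPE('d) + (real CARD('d) + 1) * rem 1"
 have Gh: "\<bar>Gf (f R) (d1 R) (d2 R) (h R) x - h R x\<bar> <= C0 / R" if R: "R \<ge> 1" and x: "x \<in> Gtilde" for R x
proof -
 have "Gf (f R) (d1 R) (d2 R) (h R) x - h R x = k (snd x) * (-1/4) * Gkf R 6 ?I x" unfolding f_def[abs_def] d1_def[abs_def] d2_def[abs_def] Gf_scale(1) by simp
 moreover have "\<bar>k (snd x) * (-1/4) * Gkf R 6 ?I x\<bar> <= 1 * (C0 / R)" unfolding abs_mult[of "k (snd x) * (-1/4)"] using kb[of "snd x"] Gkf_small[OF R I0 x, of 6] by (intro mult_mono) (auto simp: abs_mult C0_def)
 ultimately show ?thesis by simp
qed
 have "\<exists>E\<in>sets M. prob E <= prob (space M) * (KE TYPE('d) * epsR (real (Suc n)) * (real T - 0)) / dl\<^sup>2 &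
 (\<forall>om\<in>space M - E. \<forall>u\<in>{0..real T}. \<bar>Mt (f (real (Suc n))) (Gf (f (real (Suc n))) (d1 (real (Suc n))) (d2 (real (Suc n))) (h (real (Suc n)))) 0 u om\<bar> <= dl)" for n
proof -
 have sF: "space M \<in> sets (F 0)" by (metis sets.top space_F)
 have R: "real (Suc n) > 0" "real (Suc n) \<ge> 1" by simp_all
 have T: "(0::real) < real T" using False by simp
 show ?thesis by (rule maximal[OF F[OF R(1)] Bn[OF R(2)] C2[OF R(1)] order_refl T sF Gm[OF R(1)] d0])
qed
 then have "\<forall>n. \<exists>E. E \<in> sets M & prob E <= KE TYPE('d) * real T / dl\<^sup>2 * epsR (real (Suc n)) &
 (\<forall>om\<in>space M - E. \<forall>u\<in>{0..real T}. \<bar>Mt (f (real (Suc n))) (Gf (f (real (Suc n))) (d1 (real (Suc n))) (d2 (real (Suc n))) (h (real (Suc n)))) 0 u om\<bar> <= dl)" by (simp only: prob_space diff_zero mult_1_left Bex_def mult_ac times_divide_eq_left times_divide_eq_right simp_thms)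
 from choice[OF this] obtain E where E: "!!n. E n \<in> sets M" "!!n. prob (E n) <= KE TYPE('d) * real T / dl\<^sup>2 * epsR (real (Suc n))"
 "!!n om u. om \<in> space M - E n ==> u \<in> {0..real T} ==> \<bar>Mt (f (real (Suc n))) (Gf (f (real (Suc n))) (d1 (real (Suc n))) (d2 (real (Suc n))) (h (real (Suc n)))) 0 u om\<bar> <= dl" by blast
 have sm: "summable (%n. KE TYPE('d) * real T / dl\<^sup>2 * epsR (real (Suc n)))" using summable_epsR by (intro summable_mult) (simp only: summable_Suc_iff[of "%n. epsR (real n)"])
 have "AE om in M. eventually (%n. om \<notin> E n) sequentially" by (rule BC[OF E(1) sm E(2)])
 then show ?thesis using AE_space
proof eventually_elim
case (elim om)
 note w = elim(2)
 show ?case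
proof (intro allI impI ballI)
 fix B u assume B: "\<forall>s\<in>{0..real T}. norm (X s om) <= B" and Br: "B <= real rh" and u: "u \<in> {0..real T}"
 let ?p = "%s. (fst (X s om) *v ev None) $ j"
 have "eventually (%n. ln (B + 1) / 3 <= real (Suc n) & C0 * real T / dl <= real (Suc n)) sequentially" using eventually_ge_at_top[of "nat \<lceil>max (ln (B + 1) / 3) (C0 * real T / dl)\<rceil>"] by eventually_elim linarith
 with elim(1) have "eventually (%n. om \<notin> E n & ln (B + 1) / 3 <= real (Suc n) & C0 * real T / dl <= real (Suc n)) sequentially" by eventually_elim simp
 then obtain n where n: "om \<notin> E n" "ln (B + 1) / 3 <= real (Suc n)" "C0 * real T / dl <= real (Suc n)" using eventually_happens trivial_limit_sequentially by blast
 define R where "R = real (Suc n)"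
 have R: "R \<ge> 1" "R > 0" by (simp_all add: R_def)
 have s: "f R (X s om) = snd (X s om) $ j / real rh" "h R (X s om) = ?p s / real rh" "X s om \<in> Gtilde" if s: "s \<in> {0..real T}" for s
proof -
 show G: "X s om \<in> Gtilde" using s by (intro X_G[OF w]) auto
 have nb: "norm (X s om) <= B" using B s by blast
 have "\<bar>snd (X s om) $ j\<bar> <= norm (snd (X s om))" by (rule component_le_norm_cart)
 also have "... <= norm (X s om)" by (metis norm_snd_le prod.collapse)
 finally have "\<bar>snd (X s om) $ j / real rh\<bar> <= 1" using nb Br r0 by (simp add: divide_le_eq)
 note ph = phi_id[OF this] phi1_cases(1)[OF this]
 have gp: "norm (fst (X s om)) > 0" using G mult_Ggrp_nonzero[OF I0, of "fst (X s om)"] by (auto simp: Gtilde_def)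
 have "norm (fst (X s om)) <= B + 1" using norm_fst_le[of "fst (X s om)" "snd (X s om)"] nb by simp
 then have "ln (norm (fst (X s om))) <= ln (B + 1)" using gp by (subst ln_le_cancel_iff) linarith+
 then have "lnF ?I (X s om) <= ln (B + 1)" by (simp add: lnF_def)
 also have "... <= 3 * R" using n(2) by (simp add: R_def)
 finally have "lnF ?I (X s om) / R - 6 <= -3" using R by (simp add: pos_divide_le_eq)
 then have "kf R 6 ?I (X s om) = -2" using kf_eq[OF I0 G, of R 6] phi_bot by simp
 then show "f R (X s om) = snd (X s om) $ j / real rh" "h R (X s om) = ?p s / real rh" using ph by (simp_all add: f_def h_def c1_def k_def k'_def)
qed
 have u0: "0 <= u" using u by simp
 let ?G = "Gf (f R) (d1 R) (d2 R) (h R)"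
 have GG: "Gb ?G ((2 + exp (9 * R)) * KG TYPE('d))" by (rule Gb_Gf[OF F[OF R(2)] Bn[OF R(1)]])
 have Gh': "Gb (h R) (exp (9 * R))" using fldD(2)[OF F[OF R(2)]] hb[OF R(1)] by (simp add: Gb_def)
 note iG = ig_lebesgue(3)[OF GG order_refl u0 w] and ih = ig_lebesgue(3)[OF Gh' order_refl u0 w]
 have ipr: "(%s. ?p s / real rh) integrable_on {0..u}" by (rule integrable_eq[OF ih]) (use s(2) u in auto)
 from integrable_on_cmult_left[OF this, of "real rh"] have ip: "?p integrable_on {0..u}" using r0 by simp
 have "ig (h R) 0 u om = integral {0..u} (%s. ?p s / real rh)" unfolding ig_def by (rule Henstock_Kurzweil_Integration.integral_cong) (use s(2) u in auto)
 then have h: "ig (h R) 0 u om = integral {0..u} ?p / real rh" by simp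
 have "norm (integral {0..u} (%s. ?G (X s om) - h R (X s om))) <= integral {0..u} (%s. C0 / R)" by (rule integral_norm_bound_integral[OF integrable_diff[OF iG ih]]) (use Gh[OF R(1) s(3)] u in auto)
 then have 1: "\<bar>ig ?G 0 u om - ig (h R) 0 u om\<bar> <= u * (C0 / R)" using Henstock_Kurzweil_Integration.integral_diff[OF iG ih] u0 by (simp add: ig_def)
 have C0: "0 <= C0" using KG_nonneg[where 'd='d] rem_nonneg[of 1] by (simp add: C0_def)
 have "u * (C0 / R) <= real T * (C0 / R)" using u C0 R by (intro mult_right_mono) auto
 also have "... <= dl" 
proof -
 have "C0 * real T / dl <= R" using n(3) by (simp only: R_def)
 then show ?thesis using R d0 by (simp add: pos_divide_le_eq mult_ac)
qed
 finally have 2: "u * (C0 / R) <= dl" .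
 have X0: "f R (X 0 om) = 0" using s(1)[of 0] X_0[OF w] by (simp add: pId_def)
 have "\<bar>Mt (f R) ?G 0 u om\<bar> <= dl" unfolding R_def by (rule E(3)) (use w n(1) u in auto)
 then have "\<bar>snd (X u om) $ j / real rh - ig ?G 0 u om\<bar> <= dl" using s(1)[OF u] X0 by (simp add: Mt_def)
 then have "\<bar>snd (X u om) $ j / real rh - integral {0..u} ?p / real rh\<bar> <= 2 * dl" using 1 2 h by linarith
 moreover have "2 * dl = 1 / real (Suc l)"
proof -
 have "2 * (1 / (2 * x)) = 1 / x" for x :: real by simp
 then show ?thesis unfolding dl_def .
qed
 ultimately have "\<bar>(snd (X u om) $ j - integral {0..u} ?p) / real rh\<bar> <= 1 / real (Suc l)" by (simp only: diff_divide_distrib)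
 then have "\<bar>snd (X u om) $ j - integral {0..u} ?p\<bar> / real rh <= 1 / real (Suc l)" by simp
 then have "\<bar>snd (X u om) $ j - integral {0..u} ?p\<bar> <= real rh / real (Suc l)" using r0 by (simp only: pos_divide_le_eq times_divide_eq_left mult_1_left)
 with ip show "?p integrable_on {0..u} & \<bar>snd (X u om) $ j - integral {0..u} ?p\<bar> <= real rh / real (Suc l)" by blast
qed
qed
qed

text \<open>For a given path choose integers above the time and the path bound, then let the
  precision 1/(l+1) tend to 0 in every coordinate. This recovers xi_t = int_0^t g_s e_0 ds from the
  martingale problem.\<close>

lemma translation: "AE om in M. \<forall>t\<ge>0. ((%s. fst (X s om) *v ev None) has_integral snd (X t om)) {0..t}"
proof -
 have "AE om in M. \<forall>T rh l. \<forall>j. \<forall>B. (\<forall>s\<in>{0..real T}. norm (X s om) <= B) --> B <= real (Suc rh) -->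
 (\<forall>u\<in>{0..real T}. (%s. (fst (X s om) *v ev None) $ j) integrable_on {0..u} &
 \<bar>snd (X u om) $ j - integral {0..u} (%s. (fst (X s om) *v ev None) $ j)\<bar> <= real (Suc rh) / real (Suc l))" unfolding AE_all_countable by (intro allI translation_approx) simp
 then show ?thesis using AE_space
proof eventually_elim
case (elim om)
 show ?case
proof (intro allI impI)
 fix t :: real assume t: "0 <= t"
 obtain T :: nat where T: "t <= real T" using real_arch_simple by blast
 obtain B where B: "\<forall>s\<in>{0..real T}. norm (X s om) <= B" using path_bounded[OF elim(2), of "real T"] by auto
 obtain rh :: nat where "B <= real rh" using real_arch_simple by blast
 then have rh: "B <= real (Suc rh)" by simp
 have tt: "t \<in> {0..real T}" using t T by simp
 have i: "(%s. (fst (X s om) *v ev None) $ j) integrable_on {0..t}" for j using elim(1)[rule_format, OF _ rh tt] B by blast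
 have b: "\<bar>snd (X t om) $ j - integral {0..t} (%s. (fst (X s om) *v ev None) $ j)\<bar> <= real (Suc rh) / real (Suc l)" for j l using elim(1)[rule_format, OF _ rh tt] B by blast
 have "snd (X t om) $ j = integral {0..t} (%s. (fst (X s om) *v ev None) $ j)" for j
proof -
 have "(%l. real (Suc rh) / real (Suc l)) \<longlonglongrightarrow> 0" using LIMSEQ_inverse_real_of_nat[THEN tendsto_mult_right_zero, of "real (Suc rh)"] by (simp add: divide_inverse)
 from LIMSEQ_le_const[OF this, of "\<bar>snd (X t om) $ j - integral {0..t} (%s. (fst (X s om) *v ev None) $ j)\<bar>"] b
 show ?thesis by auto
qed
 then have "((%s. (fst (X s om) *v ev None) $ j) has_integral snd (X t om) $ j) {0..t}" for j using integrable_integral[OF i] by metis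
 then show "((%s. fst (X s om) *v ev None) has_integral snd (X t om)) {0..t}" by (subst has_integral_componentwise_iff) (auto simp: Basis_vec_def inner_axis)
qed
qed
qed

end

section \<open>Paths with exponential growth\<close>

lemma qform_le: "\<bar>qform u v\<bar> <= norm u * norm v" using Cauchy_Schwarz_ineq2[of u "Qmat *v v"] by (simp add: qform_Qmat)

lemma qform_self: "qform u u = (u $ None)\<^sup>2 - (norm (sp u))\<^sup>2" unfolding qform_sp power2_norm_eq_inner unfolding power2_eq_square ..

lemma growth_bound:
 fixes f :: "real => real"
 assumes e: "eventually (%t. f t <= K * exp (ka * t)) at_top" and b: "!!T. 0 <= T ==> \<exists>B. \<forall>t\<in>{0..T}. f t <= B"
 shows "\<exists>C>0. \<forall>t\<ge>0. f t <= C * exp (ka * t)"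
proof -
 obtain T0 where T0: "!!t. t \<ge> T0 ==> f t <= K * exp (ka * t)" using e unfolding eventually_at_top_linorder by blast
 define T where "T = max T0 0"
 have "\<exists>B. \<forall>t\<in>{0..T}. f t <= B" by (rule b) (simp add: T_def)
 then obtain B where B: "!!t. t \<in> {0..T} ==> f t <= B" by blast
 define C where "C = max 1 (max K (\<bar>B\<bar> * exp (\<bar>ka\<bar> * T)))"
 show ?thesis
proof (intro exI[of _ C] conjI allI impI)
 show "0 < C" by (simp add: C_def)
 fix t :: real assume t: "0 <= t"
 show "f t <= C * exp (ka * t)"
proof (cases "t <= T")
case True
 have "- \<bar>ka\<bar> * T <= - \<bar>ka\<bar> * t" using True by (intro mult_left_mono_neg) auto
 also have "... <= ka * t" using t by (intro mult_right_mono) auto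
 finally have e: "1 <= exp (\<bar>ka\<bar> * T + ka * t)" by simp
 have "f t <= \<bar>B\<bar>" using B[of t] True t by (auto intro: order_trans)
 also have "... <= \<bar>B\<bar> * exp (\<bar>ka\<bar> * T + ka * t)" using mult_left_mono[OF e, of "\<bar>B\<bar>"] by simp
 also have "... = (\<bar>B\<bar> * exp (\<bar>ka\<bar> * T)) * exp (ka * t)" by (simp add: exp_add)
 also have "... <= C * exp (ka * t)" by (intro mult_right_mono) (auto simp: C_def)
 finally show ?thesis .
next
case False
 then have "f t <= K * exp (ka * t)" by (intro T0) (simp add: T_def)
 also have "... <= C * exp (ka * t)" by (intro mult_right_mono) (auto simp: C_def)
 finally show ?thesis .
qed
qed
qed

text \<open>Unit increments form a geometric series, so the values at integers are Cauchy with a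
  geometric tail; between integers the increment bound itself is used, at the cost of a factor
  e^ka.\<close>

lemma geometric_convergence:
 fixes w :: "real => 'a::banach"
 assumes k: "ka > 0" and inc: "eventually (%n. \<forall>u\<in>{real n..real n + 1}. norm (w u - w (real n)) <= K * exp (- ka * real n)) sequentially"
 shows "\<exists>l K'. (w \<longlongrightarrow> l) at_top & eventually (%t. norm (w t - l) <= K' * exp (- ka * t)) at_top"
proof -
 obtain N where N: "!!n u. n \<ge> N ==> real n <= u ==> u <= real n + 1 ==> norm (w u - w (real n)) <= K * exp (- ka * real n)" using inc unfolding eventually_sequentially Ball_def atLeastAtMost_iff by blast
 define q where "q = exp (- ka)"
 have q: "0 < q" "q < 1" using k by (auto simp: q_def)
 have K0: "0 <= K" using order_trans[OF norm_ge_zero N[of N "real N"]] by (simp add: zero_le_mult_iff)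
 \<comment> \<open>The sum of the geometric series, that is the solution of K + D q = D, which is
   the invariant of the telescoping induction.\<close>
 define D where "D = K / (1 - q)"
 have D0: "0 <= D" using K0 q by (simp add: D_def)
 have D: "K + D * q = D" using q by (simp add: D_def field_simps)
 have tele: "norm (w (real (n + j)) - w (real n)) <= D * exp (- ka * real n)" if "n \<ge> N" for n j using that
proof (induction j arbitrary: n)
case 0
 then show ?case using D0 by simp
next
case (Suc j)
 have "norm (w (real (Suc n + j)) - w (real (Suc n))) <= D * exp (- ka * real (Suc n))" using Suc by (intro Suc.IH) simp
 also have "... = D * q * exp (- ka * real n)" by (simp add: q_def exp_add[symmetric] algebra_simps)
 finally have 1: "norm (w (real (Suc n + j)) - w (real (Suc n))) <= D * q * exp (- ka * real n)" .
 have 2: "norm (w (real (Suc n)) - w (real n)) <= K * exp (- ka * real n)" using Suc by (intro N) auto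
 have "norm (w (real (n + Suc j)) - w (real n)) <= norm (w (real (Suc n + j)) - w (real (Suc n))) + norm (w (real (Suc n)) - w (real n))" using norm_triangle_ineq[of "w (real (Suc n + j)) - w (real (Suc n))" "w (real (Suc n)) - w (real n)"] by simp
 also have "... <= (K + D * q) * exp (- ka * real n)" using 1 2 by (simp add: distrib_right)
 finally show ?case unfolding D .
qed
 have ez: "(%t. C * exp (- ka * t)) \<longlonglongrightarrow> 0" for C
proof -
 have "(%n. C * q ^ n) \<longlonglongrightarrow> C * 0" using q by (intro tendsto_intros LIMSEQ_power_zero) auto
 moreover have "exp (- ka * real n) = q ^ n" for n by (simp add: q_def exp_of_nat_mult[symmetric] mult.commute)
 ultimately show ?thesis by simp
qed
 have "Cauchy (%n. w (real n))"
proof (rule CauchyI')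
 fix e :: real assume "0 < e"
 then have "eventually (%n. D * exp (- ka * real n) < e) sequentially" using order_tendstoD(2)[OF ez[of D]] by blast
 then obtain n where n: "n \<ge> N" "D * exp (- ka * real m) < e" if "m \<ge> n" for m unfolding eventually_sequentially by (metis nat_le_linear order_trans)
 have "dist (w (real m)) (w (real m')) < e" if "m \<ge> max n N" "m < m'" for m m'
proof -
 have "norm (w (real (m + (m' - m))) - w (real m)) <= D * exp (- ka * real m)" using that by (intro tele) simp
 then show ?thesis using that n(2)[of m] by (simp add: dist_norm norm_minus_commute)
qed
 then show "\<exists>M. \<forall>m\<ge>M. \<forall>n>m. dist (w (real m)) (w (real n)) < e" by blast
qed
 then obtain l where l: "(%n. w (real n)) \<longlonglongrightarrow> l" using Cauchy_convergent convergent_def by blast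
 have nl: "norm (w (real n) - l) <= D * exp (- ka * real n)" if "n \<ge> N" for n
proof -
 have "(%j. w (real (n + j))) \<longlonglongrightarrow> l" using LIMSEQ_ignore_initial_segment[OF l, of n] by (simp add: add.commute)
 then have "(%j. norm (w (real (n + j)) - w (real n))) \<longlonglongrightarrow> norm (l - w (real n))" by (intro tendsto_intros)
 from LIMSEQ_le_const2[OF this] have "norm (l - w (real n)) <= D * exp (- ka * real n)" using tele[OF that] by blast
 then show ?thesis by (simp add: norm_minus_commute)
qed
 define K' where "K' = (K + D) * exp ka"
 have ev: "eventually (%t. norm (w t - l) <= K' * exp (- ka * t)) at_top"
proof (rule eventually_at_top_linorderI[of "real N + 1"])
 fix t assume t: "real N + 1 <= t"
 define n where "n = nat \<lfloor>t\<rfloor>"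
 have n: "n \<ge> N" "real n <= t" "t <= real n + 1" using t by (auto simp: n_def; linarith)+
 have "norm (w t - l) <= norm (w t - w (real n)) + norm (w (real n) - l)" using norm_triangle_ineq[of "w t - w (real n)" "w (real n) - l"] by simp
 also have "... <= (K + D) * exp (- ka * real n)" using N[OF n] nl[OF n(1)] by (simp add: distrib_right)
 also have "... <= (K + D) * exp (ka + - ka * t)"
proof -
 have "ka * t <= ka * (real n + 1)" using n k by (intro mult_left_mono) auto
 then show ?thesis using K0 D0 by (intro mult_left_mono) (auto simp: algebra_simps)
qed
 finally show "norm (w t - l) <= K' * exp (- ka * t)" by (simp only: K'_def exp_add mult.assoc)
qed
 have "((%t. K' * exp (- ka * t)) \<longlongrightarrow> 0) at_top"
proof -
 have "filterlim (%t. - ka * t) at_bot at_top" using filterlim_tendsto_neg_mult_at_bot[OF tendsto_const _ filterlim_ident, of "- ka"] k by simp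
 from tendsto_mult_right_zero[OF filterlim_compose[OF exp_at_bot this]] show ?thesis .
qed
 from Lim_null_comparison[OF ev this] have "(w \<longlongrightarrow> l) at_top" by (rule LIM_zero_cancel)
 with ev show ?thesis by blast
qed

lemma rate_limit:
 fixes D N :: "real => real"
 assumes k: "0 < k1" "0 < k2" and N: "!!t. t \<ge> 0 ==> k1 * D t <= N t & N t <= k2 * D t"
 and up: "!!ep. ep > 0 ==> \<exists>C>0. eventually (%t. D t <= C * exp ((al + ep) * t)) at_top"
 and lo: "!!ep. ep > 0 ==> \<exists>c>0. eventually (%t. c * exp ((al - ep) * t) <= D t) at_top"
 shows "((%t. ln (N t) / t) \<longlongrightarrow> al) at_top"
proof (rule tendstoI)
 fix e :: real assume e: "0 < e"
 define ep where "ep = e / 2"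
 have e2: "ep > 0" using e by (simp add: ep_def)
 obtain C c where C: "C > 0" "eventually (%t. D t <= C * exp ((al + ep) * t)) at_top"
 and c: "c > 0" "eventually (%t. c * exp ((al - ep) * t) <= D t) at_top" using up[OF e2] lo[OF e2] by blast
 \<comment> \<open>From this time on the constants k1 c and k2 C cost less than ep t in the
   logarithm.\<close>
 let ?T = "max 1 (2 * (\<bar>ln (k1 * c)\<bar> + \<bar>ln (k2 * C)\<bar> + 1) / e)"
 show "eventually (%t. dist (ln (N t) / t) al < e) at_top" using C(2) c(2) eventually_ge_at_top[of ?T]
proof eventually_elim
case (elim t)
 have t: "t > 0" "2 * (\<bar>ln (k1 * c)\<bar> + \<bar>ln (k2 * C)\<bar> + 1) / e <= t" using elim(3) by auto
 then have te: "\<bar>ln (k1 * c)\<bar> + \<bar>ln (k2 * C)\<bar> + 1 <= ep * t" using e by (simp add: ep_def pos_divide_le_eq mult_ac)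
 have "k1 * (c * exp ((al - ep) * t)) <= N t" "N t <= k2 * (C * exp ((al + ep) * t))" using N[of t] t(1) elim(1,2) k mult_left_mono[OF elim(1), of k2] mult_left_mono[OF elim(2), of k1] by linarith+
 then have a: "(k1 * c) * exp ((al - ep) * t) <= N t" "N t <= (k2 * C) * exp ((al + ep) * t)" by (simp_all only: mult.assoc)
 have p: "0 < (k1 * c) * exp ((al - ep) * t)" using k c by simp
 have Np: "0 < N t" using a(1) p by linarith
 have "ln ((k1 * c) * exp ((al - ep) * t)) <= ln (N t)" using a(1) p Np by simp
 moreover have "ln (N t) <= ln ((k2 * C) * exp ((al + ep) * t))" using a(2) Np by simp
 moreover have "ln ((k1 * c) * exp ((al - ep) * t)) = ln (k1 * c) + (al - ep) * t" using k c by (simp add: ln_mult_pos)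
 moreover have "ln ((k2 * C) * exp ((al + ep) * t)) = ln (k2 * C) + (al + ep) * t" using k C by (simp add: ln_mult_pos)
 ultimately have "ln (k1 * c) + (al - ep) * t <= ln (N t)" "ln (N t) <= ln (k2 * C) + (al + ep) * t" by linarith+
 then have "\<bar>ln (N t) - al * t\<bar> < 2 * (ep * t)" using te unfolding left_diff_distrib distrib_right by linarith
 then have "\<bar>ln (N t) - al * t\<bar> < 2 * ep * t" by simp
 then have "\<bar>ln (N t) - al * t\<bar> / t < e" using t(1) by (simp add: ep_def pos_divide_less_eq)
 moreover have "\<bar>ln (N t) / t - al\<bar> = \<bar>ln (N t) - al * t\<bar> / t"
proof -
 have "ln (N t) / t - al = (ln (N t) - al * t) / t" using t(1) by (simp add: diff_divide_distrib)
 then show ?thesis using t(1) by (simp add: abs_divide)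
qed
 ultimately show ?case by (simp add: dist_real_def)
qed
qed

section \<open>Null directions and deterministic paths with a growth rate\<close>

lemma null_parallel:
 assumes n: "qform et et = 0" "et ~= 0" and u: "qform u et = 0" "0 <= qform u u"
 shows "\<exists>c. u = c *\<^sub>R et"
proof -
 have "et $ None ~= 0"
proof
 assume "et $ None = 0"
 then have "(norm et)\<^sup>2 = 0" using n(1) norm_mvec[of et] by (simp add: qform_inner power2_norm_eq_inner)
 then show False using n(2) by simp
qed
 \<comment> \<open>Subtracting the multiple of et that kills the time component leaves the q-square
   unchanged; a purely spatial vector with nonnegative q-square is zero.\<close>
 define u' where "u' = u - (u $ None / et $ None) *\<^sub>R et"
 have "u' $ None = 0" using \<open>et $ None ~= 0\<close> by (simp add: u'_def)
 moreover have "qform u' u' = qform u u" using n u qform_commute[of et u] by (simp add: u'_def qform_diff_left qform_diff_right qform_scaleR_left qform_scaleR_right)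
 ultimately have "(norm u')\<^sup>2 <= 0" using u(2) by (simp add: qform_inner power2_norm_eq_inner)
 then have "u' = 0" by simp
 then show ?thesis unfolding u'_def by (intro exI[of _ "u $ None / et $ None"]) simp
qed

text \<open>The future null vector of the boundary point with horospherical coordinate w, normalised
  by q(eta, zeta) = 2. Every future null ray except that of zeta arises in this way.\<close>

definition eta :: "'d::finite => real^'d => 'd mvec" where
 "eta i1 w = nexp i1 w *v (ev None + ev (Some i1))"

text \<open>The properties that almost every trajectory has, collected so that the rest is
  deterministic. The rate al may be 0 here, as happens for d = 1; positivity is added in
  \<open>transient_path\<close>.\<close>

locale path =
 fixes i1 :: "'d::finite" and g :: "real => 'd mmat" and xi :: "real => 'd mvec" and al :: real
 assumes G: "!!t. 0 <= t ==> g t \<in> Ggrp"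
 and bd: "!!T. 0 <= T ==> \<exists>B. \<forall>t\<in>{0..T}. norm (g t) <= B"
 and inc: "!!ep. ep > 0 ==> eventually (%n. \<forall>u\<in>{real n..real n + 1}. norm (matrix_inv (g (real n)) ** g u) <= 2 * exp (ep * real n)) sequentially"
 and gr: "!!ep. ep > 0 ==> eventually (%t. \<bar>ln (hgt i1 (g t)) - al * t\<bar> <= ep * t) at_top"
 and xi: "!!t. 0 <= t ==> ((%s. g s *v ev None) has_integral xi t) {0..t}"
begin

abbreviation "p t \<equiv> g t *v ev None"
abbreviation "h t \<equiv> hgt i1 (g t)"
abbreviation "w t \<equiv> hor i1 (g t)"

lemma hp: "0 <= t ==> h t > 0" using hgt_pos G by blast

lemma p_eq: "0 <= t ==> p t = (h t / 2) *\<^sub>R eta i1 (w t) + (1 / (2 * h t)) *\<^sub>R zeta i1" unfolding eta_def by (rule orbit_eq[OF G])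

lemma p_bounded: "0 <= T ==> \<exists>B. \<forall>t\<in>{0..T}. norm (p t) <= B"
proof -
 assume T: "0 <= T"
 obtain B where "\<forall>t\<in>{0..T}. norm (g t) <= B" using bd[OF T] by blast
 moreover have "norm (p t) <= norm (g t)" for t using norm_matrix_vector_le[of "g t" "ev None"] by (simp add: ev_def norm_axis_1)
 ultimately have "\<forall>t\<in>{0..T}. norm (p t) <= B" using order_trans by blast
 then show ?thesis by blast
qed

lemma norm_zeta: "norm (zeta i1) <= 2" using norm_triangle_ineq4[of "ev None :: 'd mvec" "ev (Some i1)"] by (simp add: ev_def norm_axis_1)

lemma h_le: "0 <= t ==> h t <= 2 * norm (p t) & 1 / h t <= 2 * norm (p t)"
proof -
 assume t: "0 <= t"
 have 1: "h t <= norm (p t) * norm (zeta i1)" using qform_le[of "p t" "zeta i1"] by (simp add: hgt_def)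
 have 2: "h t <= 2 * norm (p t)" using order_trans[OF 1 mult_left_mono[OF norm_zeta]] by simp
 let ?a = "p t $ None" and ?b = "p t $ Some i1"
 have "(?b)\<^sup>2 <= (norm (sp (p t)))\<^sup>2" using component_le_norm_cart[of "sp (p t)" i1] by (simp add: abs_le_square_iff[symmetric])
 then have "1 <= ?a\<^sup>2 - ?b\<^sup>2" using Ggrp_orbit(1)[OF G[OF t]] unfolding qform_self by linarith
 also have "... = h t * (?a - ?b)" by (simp add: hgt_def qform_zeta power2_eq_square algebra_simps)
 also have "... <= h t * (2 * norm (p t))" using component_le_norm_cart[of "p t" None] component_le_norm_cart[of "p t" "Some i1"] hp[OF t] by (intro mult_left_mono) linarith+
 finally have "1 / h t <= 2 * norm (p t)" using hp[OF t] by (simp add: pos_divide_le_eq mult_ac)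
 with 2 show ?thesis by blast
qed

lemma h_growth:
 assumes e: "ep > 0"
 shows "\<exists>C>0. \<forall>t\<ge>0. h t <= C * exp ((al + ep) * t) & 1 / h t <= C * exp ((ep - al) * t)"
proof -
 have ev: "eventually (%t. h t <= 1 * exp ((al + ep) * t)) at_top" "eventually (%t. 1 / h t <= 1 * exp ((ep - al) * t)) at_top"
proof -
 have "eventually (%t. h t <= 1 * exp ((al + ep) * t) & 1 / h t <= 1 * exp ((ep - al) * t)) at_top" using gr[OF e] eventually_ge_at_top[of 0]
proof eventually_elim
case (elim t)
 have a: "ln (h t) <= (al + ep) * t" "- ln (h t) <= (ep - al) * t" using elim(1) by (auto simp: algebra_simps abs_le_iff)
 have "exp (ln (h t)) <= exp ((al + ep) * t)" "exp (- ln (h t)) <= exp ((ep - al) * t)" using a by simp_all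
 then show ?case using hp[OF elim(2)] by (simp add: exp_minus inverse_eq_divide)
qed
 then show "eventually (%t. h t <= 1 * exp ((al + ep) * t)) at_top" "eventually (%t. 1 / h t <= 1 * exp ((ep - al) * t)) at_top" by (auto elim: eventually_mono)
qed
 have b: "\<exists>B. \<forall>t\<in>{0..T}. h t <= B" "\<exists>B. \<forall>t\<in>{0..T}. 1 / h t <= B" if T: "0 <= T" for T
proof -
 obtain B where "\<forall>t\<in>{0..T}. norm (p t) <= B" using p_bounded[OF T] by blast
 then have "\<forall>t\<in>{0..T}. h t <= 2 * B & 1 / h t <= 2 * B" using h_le by (smt (verit) atLeastAtMost_iff)
 then show "\<exists>B. \<forall>t\<in>{0..T}. h t <= B" "\<exists>B. \<forall>t\<in>{0..T}. 1 / h t <= B" by blast+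
qed
 obtain C1 C2 where C: "C1 > 0" "\<forall>t\<ge>0. h t <= C1 * exp ((al + ep) * t)" "C2 > 0" "\<forall>t\<ge>0. 1 / h t <= C2 * exp ((ep - al) * t)" using growth_bound[OF ev(1) b(1)] growth_bound[OF ev(2) b(2)] by blast
 show ?thesis
proof (intro exI[of _ "max C1 C2"] conjI allI impI)
 fix t :: real assume t: "0 <= t"
 show "h t <= max C1 C2 * exp ((al + ep) * t)" using C(2) t by (rule_tac order_trans[OF _ mult_right_mono[of C1]]) auto
 show "1 / h t <= max C1 C2 * exp ((ep - al) * t)" using C(4) t by (rule_tac order_trans[OF _ mult_right_mono[of C2]]) auto
qed (use C in simp)
qed

lemma xi_bound:
 assumes t: "0 <= t" and b: "!!s. 0 <= s ==> s <= t ==> norm (p s) <= B" and B: "0 <= B"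
 shows "norm (xi t) <= B * t" using has_integral_bound[OF B, of p "xi t" 0 t] xi[OF t] b t by (simp add: content_real)

lemma t_exp: "ep > 0 ==> t <= exp (ep * t) / ep" for t ep :: real
proof -
 have "t * ep <= exp (ep * t)" using exp_ge_add_one_self[of "ep * t"] unfolding mult.commute[of t] by linarith
 then show "ep > 0 ==> t <= exp (ep * t) / ep" by (simp add: pos_le_divide_eq)
qed

end

locale transient_path = path i1 g xi al
 for i1 :: "'d::finite" and g :: "real => 'd mmat" and xi :: "real => 'd mvec" and al :: real +
 assumes a0: "al > 0"
begin

text \<open>In \<open>hor_dist\<close> the numerator q(p_u, p_n) is a matrix entry of the increment
  over a unit interval and hence subexponential, while the two heights in the denominator grow at
  rate al each. So |w_u - w_n| decays like e^(-al n) up to subexponential factors.\<close>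

lemma hor_limit: "\<exists>l. l $ i1 = 0 & (w \<longlongrightarrow> l) at_top & (\<forall>ep>0. \<exists>C>0. \<forall>t\<ge>0. norm (w t - l) <= C * exp ((ep - al) * t))"
proof -
 have step: "\<exists>K. eventually (%n. \<forall>u\<in>{real n..real n + 1}. norm (w u - w (real n)) <= K * exp (- (al - ep) * real n)) sequentially"
 if e: "0 < ep" "ep < al" for ep
proof -
 define d where "d = ep / 2"
 have d: "d > 0" "d < al" using e by (auto simp: d_def)
 obtain C where C: "C > 0" "!!t. t \<ge> 0 ==> 1 / h t <= C * exp ((d - al) * t)" using h_growth[OF d(1)] by blast
 have "eventually (%n. \<forall>u\<in>{real n..real n + 1}. norm (w u - w (real n)) <= (2 * C) * exp (- (al - ep) * real n)) sequentially" using inc[OF d(1)]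
proof eventually_elim
case (elim n)
 show ?case
proof
 fix u assume u: "u \<in> {real n..real n + 1}"
 then have u0: "0 <= u" "real n <= u" using order_trans[of 0 "real n" u] by auto
 have Gs: "g u \<in> Ggrp" "g (real n) \<in> Ggrp" using G u0 by auto
 have "qform (p u) (p (real n)) = (matrix_inv (g (real n)) *v p u) $ None" using qform_matrix_inv[OF Gs(2), of "p u" "ev None"] by (simp add: qform_ev_None)
 also have "... <= norm ((matrix_inv (g (real n)) ** g u) *v ev None)" using component_le_norm_cart[of "matrix_inv (g (real n)) *v p u" None] by (simp add: matrix_vector_mul_assoc)
 also have "... <= 2 * exp (d * real n) * 1" using norm_matrix_vector_le[of "matrix_inv (g (real n)) ** g u" "ev None"] elim u by (force simp: ev_def norm_axis_1)
 finally have q: "qform (p u) (p (real n)) <= 2 * exp (d * real n)" by simp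
 have hh: "1 / h u * (1 / h (real n)) <= C * exp ((d - al) * real n) * (C * exp ((d - al) * real n))"
proof (intro mult_mono)
 have "(d - al) * u <= (d - al) * real n" using u0 d by (intro mult_left_mono_neg) auto
 then have "C * exp ((d - al) * u) <= C * exp ((d - al) * real n)" using C by simp
 then show "1 / h u <= C * exp ((d - al) * real n)" using C(2)[OF u0(1)] by linarith
 show "1 / h (real n) <= C * exp ((d - al) * real n)" by (rule C(2)) simp
qed (use C hp[of "real n"] in auto)
 have "(norm (w u - w (real n)))\<^sup>2 <= 2 * qform (p u) (p (real n)) / (h u * h (real n))" by (rule hor_dist[OF Gs])
 also have "... = 2 * qform (p u) (p (real n)) * (1 / h u * (1 / h (real n)))" by simp
 also have "... <= 2 * (2 * exp (d * real n)) * (1 / h u * (1 / h (real n)))" using q hp[OF u0(1)] hp[of "real n"] by (intro mult_right_mono) auto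
 also have "... <= 2 * (2 * exp (d * real n)) * (C * exp ((d - al) * real n) * (C * exp ((d - al) * real n)))" by (intro mult_left_mono hh) auto
 also have "... = (2 * C)\<^sup>2 * exp (d * real n + (d - al) * real n + (d - al) * real n)" by (simp only: exp_add power2_eq_square mult.assoc mult.left_commute mult.commute)
 also have "... <= (2 * C)\<^sup>2 * exp (2 * (- (al - ep) * real n))"
proof -
 have "d * real n <= ep * real n" using d e by (intro mult_right_mono) (auto simp: d_def)
 then show ?thesis by (intro mult_left_mono) (auto simp: d_def algebra_simps)
qed
 also have "... = (2 * C * exp (- (al - ep) * real n))\<^sup>2" by (simp add: power_mult_distrib exp_double)
 finally show "norm (w u - w (real n)) <= (2 * C) * exp (- (al - ep) * real n)" by (rule power2_le_imp_le) (use C in simp)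
qed
qed
 then show ?thesis by blast
qed
 have lim: "\<exists>l K. (w \<longlongrightarrow> l) at_top & eventually (%t. norm (w t - l) <= K * exp (- (al - ep) * t)) at_top" if "0 < ep" "ep < al" for ep using step[OF that] geometric_convergence[of "al - ep" w] that by auto
 obtain l where l: "(w \<longlongrightarrow> l) at_top" using lim[of "al / 2"] a0 by auto
 have z: "((%t. w t $ i1) \<longlongrightarrow> 0) at_top" by (simp add: hor_i1)
 have li: "l $ i1 = 0" by (rule tendsto_unique[OF trivial_limit_at_top_linorder tendsto_vec_nth[OF l] z])
 \<comment> \<open>A crude local bound, needed only to extend an eventual estimate to all t >= 0 by
   \<open>growth_bound\<close>.\<close>
 have bw: "\<exists>B. \<forall>t\<in>{0..T}. norm (w t - l) <= B" if T: "0 <= T" for T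
proof -
 obtain B where B: "\<forall>t\<in>{0..T}. norm (p t) <= B" using p_bounded[OF T] by blast
 have "norm (w t - l) <= norm (w 0) + norm l + (1 + 2 * (B * B) * ((2 * B) * (2 * B)))" if t: "t \<in> {0..T}" for t
proof -
 have t0: "0 <= t" using t by simp
 have z: "0 \<in> {0..T}" using T by simp
 have B0: "0 <= B" using B z norm_ge_zero order_trans by blast
 have "(norm (w t - w 0))\<^sup>2 <= 2 * qform (p t) (p 0) / (h t * h 0)" using G t by (intro hor_dist) auto
 also have "... = 2 * qform (p t) (p 0) * (1 / h t * (1 / h 0))" by simp
 also have "... <= 2 * (B * B) * ((2 * B) * (2 * B))"
proof (rule mult_mono)
 have "qform (p t) (p 0) <= norm (p t) * norm (p 0)" using qform_le[of "p t" "p 0"] by simp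
 also have "... <= B * B" using B t z B0 by (intro mult_mono) auto
 finally show "2 * qform (p t) (p 0) <= 2 * (B * B)" by simp
 have 1: "1 / h t <= 2 * B" using h_le[OF t0] B t by force
 have 2: "1 / h 0 <= 2 * B" using h_le[of 0] B z by force
 show "1 / h t * (1 / h 0) <= (2 * B) * (2 * B)" by (rule mult_mono[OF 1 2]) (use hp[of 0] B0 in auto)
qed (use hp[of 0] hp[OF t0] B0 in auto)
 finally have 1: "(norm (w t - w 0))\<^sup>2 <= 2 * (B * B) * ((2 * B) * (2 * B))" .
 have "norm (w t - w 0) <= 1 + (norm (w t - w 0))\<^sup>2" using zero_le_power2[of "norm (w t - w 0) - 1/2"] by (simp add: power2_eq_square algebra_simps)
 then have "norm (w t - w 0) <= 1 + 2 * (B * B) * ((2 * B) * (2 * B))" using 1 by linarith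
 moreover have "norm (w t - l) <= norm (w t - w 0) + norm (w 0) + norm l" using norm_triangle_ineq[of "w t - w 0" "w 0 - l"] norm_triangle_ineq4[of "w 0" l] by simp
 ultimately show ?thesis by linarith
qed
 then show ?thesis by blast
qed
 have "\<exists>C>0. \<forall>t\<ge>0. norm (w t - l) <= C * exp ((ep - al) * t)" if e: "ep > 0" for ep
proof -
 define d where "d = min ep (al / 2)"
 have d: "0 < d" "d < al" "d <= ep" using e a0 by (auto simp: d_def)
 obtain l' K where l': "(w \<longlongrightarrow> l') at_top" "eventually (%t. norm (w t - l') <= K * exp (- (al - d) * t)) at_top" using lim[OF d(1,2)] by blast
 have ll: "l' = l" by (rule tendsto_unique[OF trivial_limit_at_top_linorder l'(1) l])
 have "eventually (%t. norm (w t - l) <= K * exp ((d - al) * t)) at_top" using l'(2) unfolding ll by simp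
 from growth_bound[OF this bw] obtain C where C: "C > 0" "\<forall>t\<ge>0. norm (w t - l) <= C * exp ((d - al) * t)" by blast
 have "norm (w t - l) <= C * exp ((ep - al) * t)" if t: "t \<ge> 0" for t
proof -
 have "(d - al) * t <= (ep - al) * t" using d t by (intro mult_right_mono) auto
 then have "C * exp ((d - al) * t) <= C * exp ((ep - al) * t)" using C(1) by simp
 then show ?thesis using C(2) t by force
qed
 then show ?thesis using C(1) by blast
qed
 with l li show ?thesis by blast
qed

end

section \<open>Boundary null vectors and norms of conjugates\<close>

lemma norm_mk0: "norm (mk 0 w) = norm w"
proof -
 have "(norm (mk 0 w))\<^sup>2 = (norm w)\<^sup>2" by (simp add: norm_mvec)
 then show ?thesis by simp
qed

lemma eta_eq: "w $ i1 = 0 ==> eta i1 w = ev None + ev (Some i1) + 2 *\<^sub>R mk 0 w + (norm w)\<^sup>2 *\<^sub>R zeta i1" unfolding eta_def by (rule nexp_e1(1))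

lemma eta_dist:
 assumes "w $ i1 = 0" "v $ i1 = 0"
 shows "norm (eta i1 w - eta i1 v) <= (2 + 2 * (norm w + norm v)) * norm (w - v)"
proof -
 have z: "norm (zeta i1) <= 2" using norm_triangle_ineq4[of "ev None :: 'a mvec" "ev (Some i1)"] by (simp add: ev_def norm_axis_1)
 have "eta i1 w - eta i1 v = 2 *\<^sub>R mk 0 (w - v) + ((norm w)\<^sup>2 - (norm v)\<^sup>2) *\<^sub>R zeta i1" unfolding eta_eq[OF assms(1)] eta_eq[OF assms(2)] by (rule mvec_eqI) (simp_all add: algebra_simps)
 then have "norm (eta i1 w - eta i1 v) <= 2 * norm (w - v) + \<bar>(norm w)\<^sup>2 - (norm v)\<^sup>2\<bar> * norm (zeta i1)" using norm_triangle_ineq[of "2 *\<^sub>R mk 0 (w - v)" "((norm w)\<^sup>2 - (norm v)\<^sup>2) *\<^sub>R zeta i1"] by (simp add: norm_mk0)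
 also have "\<bar>(norm w)\<^sup>2 - (norm v)\<^sup>2\<bar> = \<bar>norm w - norm v\<bar> * (norm w + norm v)" by (simp add: power2_eq_square square_diff_square_factored abs_mult mult.commute)
 also have "\<bar>norm w - norm v\<bar> * (norm w + norm v) * norm (zeta i1) <= norm (w - v) * (norm w + norm v) * 2" by (intro mult_mono z norm_triangle_ineq3) auto
 finally show ?thesis by (simp add: algebra_simps)
qed

lemma eta_null:
 assumes "w $ i1 = 0" shows "qform (eta i1 w) (eta i1 w) = 0" "eta i1 w ~= 0" "eta i1 w $ None > 0"
proof -
 show "qform (eta i1 w) (eta i1 w) = 0" unfolding eta_def by (simp add: nexp_Ggrp assms qform_add_left qform_add_right qform_ev_None) (simp add: qform_sp ev_None ev_Some sp_simps inner_axis)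
 show "eta i1 w $ None > 0" unfolding eta_eq[OF assms] by (simp add: ev_None ev_Some add_pos_nonneg)
 then show "eta i1 w ~= 0" by auto
qed

lemma qform_tendsto:
 assumes "(f \<longlongrightarrow> a) F" "(k \<longlongrightarrow> b) F" shows "((%t. qform (f t) (k t)) \<longlongrightarrow> qform a b) F" unfolding qform_Qmat by (intro tendsto_inner assms bounded_linear.tendsto[OF matrix_vector_mul_bounded_linear])

lemma qform_combine:
 "qform y (a *\<^sub>R u + b *\<^sub>R z) = a * qform y u + b * qform y z"
 "qform (Z *v (a *\<^sub>R u + b *\<^sub>R z)) (c *\<^sub>R v + d *\<^sub>R z') = a * c * qform (Z *v u) v + a * d * qform (Z *v u) z'
 + b * c * qform (Z *v z) v + b * d * qform (Z *v z) z'"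
 "qform (Z *v (a *\<^sub>R u + b *\<^sub>R z)) (Z *v (a *\<^sub>R u + b *\<^sub>R z)) = a\<^sup>2 * qform (Z *v u) (Z *v u)
 + 2 * a * b * qform (Z *v u) (Z *v z) + b\<^sup>2 * qform (Z *v z) (Z *v z)" using qform_commute[of "Z *v u" "Z *v z"] by (simp_all add: matrix_vector_right_distrib matrix_vector_mult_scaleR qform_add_left qform_add_right qform_scaleR_left
 qform_scaleR_right algebra_simps power2_eq_square)

lemma norm_matrix_inv_le:
 assumes g: "g \<in> Ggrp" shows "norm (matrix_inv g *v y) <= 2 * \<bar>qform y (g *v ev None)\<bar> + norm y"
proof (rule power2_le_imp_le)
 let ?q = "qform y (g *v ev None)"
 have "- qform y y <= norm y * norm y" using qform_le[of y y] by simp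
 then have "(norm (matrix_inv g *v y))\<^sup>2 <= 2 * ?q\<^sup>2 + (norm y)\<^sup>2" unfolding norm_matrix_inv[OF g] by (simp add: power2_eq_square)
 also have "... <= (2 * \<bar>?q\<bar> + norm y)\<^sup>2"
proof -
 have "0 <= \<bar>?q\<bar> * norm y" "0 <= ?q\<^sup>2" by simp_all
 moreover have "(2 * \<bar>?q\<bar> + norm y)\<^sup>2 = 4 * ?q\<^sup>2 + 4 * (\<bar>?q\<bar> * norm y) + (norm y)\<^sup>2" by (simp add: power2_sum power_mult_distrib)
 ultimately show ?thesis by linarith
qed
 finally show "(norm (matrix_inv g *v y))\<^sup>2 <= (2 * \<bar>?q\<bar> + norm y)\<^sup>2" .
qed simp

lemma norm_matrix_inv_ge:
 assumes g: "g \<in> Ggrp" shows "\<bar>qform y (g *v ev None)\<bar> <= norm (matrix_inv g *v y)" using component_le_norm_cart[of "matrix_inv g *v y" None] qform_matrix_inv[OF g, of y "ev None"] by (simp add: qform_ev_None)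

lemma norm_lieG_conj_le:
 assumes "Z \<in> lieG" "g \<in> Ggrp"
 shows "norm (matrix_inv g ** Z ** g) <= 2 * (norm Z * norm (g *v ev None)) + (1 + \<bar>trace (Z ** Z)\<bar>)"
proof (rule power2_le_imp_le)
 let ?u = "Z *v (g *v ev None)" and ?T = "\<bar>trace (Z ** Z)\<bar>" and ?P = "norm Z * norm (g *v ev None)"
 have "- qform ?u ?u <= norm ?u * norm ?u" using qform_le[of ?u ?u] by simp
 also have "... <= ?P * ?P" by (intro mult_mono norm_matrix_vector_le) auto
 finally have "(norm (matrix_inv g ** Z ** g))\<^sup>2 <= 4 * (?P * ?P) + ?T" unfolding norm_lieG_conj[OF assms] by linarith
 also have "... <= (2 * ?P + (1 + ?T))\<^sup>2"
proof -
 have "0 <= ?P * (1 + ?T)" "0 <= ?T * ?T" by simp_all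
 moreover have "(2 * ?P + (1 + ?T))\<^sup>2 = 4 * (?P * ?P) + 4 * (?P * (1 + ?T)) + 1 + 2 * ?T + ?T * ?T" by (simp add: power2_eq_square algebra_simps)
 ultimately show ?thesis by linarith
qed
 finally show "(norm (matrix_inv g ** Z ** g))\<^sup>2 <= (2 * ?P + (1 + ?T))\<^sup>2" .
qed simp

lemma norm_lieG_conj_ge:
 assumes "Z \<in> lieG" "g \<in> Ggrp"
 shows "- qform (Z *v (g *v ev None)) (Z *v (g *v ev None)) <= (norm (matrix_inv g ** Z ** g))\<^sup>2"
proof -
 let ?u = "Z *v (g *v ev None)"
 have "- qform ?u ?u <= (norm (matrix_inv g *v ?u))\<^sup>2" unfolding norm_matrix_inv[OF assms(2)] by simp
 also have "matrix_inv g *v ?u = (matrix_inv g ** Z ** g) *v ev None" by (simp add: matrix_vector_mul_assoc matrix_mul_assoc)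
 also have "(norm ...)\<^sup>2 <= (norm (matrix_inv g ** Z ** g))\<^sup>2" using norm_matrix_vector_le[of "matrix_inv g ** Z ** g" "ev None"] by (intro power_mono) (simp_all add: ev_def norm_axis_1)
 finally show ?thesis .
qed

context path
begin

text \<open>The norms of the two components of Ad(g~_t^-1)(Z, x), that is of the flow derivative
  read in the left-invariant frame (\<open>finsler_dflow\<close>).\<close>

definition Dn :: "'d mmat => 'd mvec => real => real" where
 "Dn Z x t = norm (matrix_inv (g t) ** Z ** g t) + norm (matrix_inv (g t) *v (x + Z *v xi t))"

end

section \<open>Growth rates along a transient path\<close>

context transient_path
begin

lemma exp_decay: "((%t. C * exp ((al/2 - al) * t)) \<longlongrightarrow> 0) at_top"
proof -
 have "filterlim (%t. (al/2 - al) * t) at_bot at_top" using filterlim_tendsto_neg_mult_at_bot[OF tendsto_const _ filterlim_ident, of "al/2 - al"] a0 by simp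
 from tendsto_mult_right_zero[OF filterlim_compose[OF exp_at_bot this]] show ?thesis .
qed

lemma eta_limit: "\<exists>l. l $ i1 = 0 & (w \<longlongrightarrow> l) at_top &
 (\<forall>ep>0. \<exists>C>0. \<forall>t\<ge>0. norm (eta i1 (w t) - eta i1 l) <= C * exp ((ep - al) * t))"
proof -
 obtain l where l: "l $ i1 = 0" "(w \<longlongrightarrow> l) at_top" "!!ep. ep > 0 ==> \<exists>C>0. \<forall>t\<ge>0. norm (w t - l) <= C * exp ((ep - al) * t)" using hor_limit by blast
 obtain W where W: "W > 0" "!!t. t \<ge> 0 ==> norm (w t - l) <= W * exp ((al/2 - al) * t)" using l(3)[of "al/2"] a0 by auto
 have W1: "norm (w t) <= W + norm l" if "t \<ge> 0" for t
proof -
 have "(al/2 - al) * t <= 0" using a0 that by (simp add: mult_nonpos_nonneg)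
 then have "W * exp ((al/2 - al) * t) <= W * 1" using W(1) by (intro mult_left_mono) auto
 then show ?thesis using W(2)[OF that] norm_triangle_ineq[of "w t - l" l] by simp
qed
 let ?L = "2 + 2 * ((W + norm l) + norm l)"
 have "\<exists>C>0. \<forall>t\<ge>0. norm (eta i1 (w t) - eta i1 l) <= C * exp ((ep - al) * t)" if e: "ep > 0" for ep
proof -
 obtain C where C: "C > 0" "!!t. t \<ge> 0 ==> norm (w t - l) <= C * exp ((ep - al) * t)" using l(3)[OF e] by blast
 have L0: "0 < ?L" using W(1) by (simp add: add_pos_nonneg)
 have "norm (eta i1 (w t) - eta i1 l) <= (?L * C) * exp ((ep - al) * t)" if t: "t \<ge> 0" for t
proof -
 have "norm (eta i1 (w t) - eta i1 l) <= (2 + 2 * (norm (w t) + norm l)) * norm (w t - l)" by (rule eta_dist[OF hor_i1 l(1)])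
 also have "... <= ?L * (C * exp ((ep - al) * t))" using W1[OF t] C(2)[OF t] L0 by (intro mult_mono) auto
 finally show ?thesis by simp
qed
 then show ?thesis using L0 C(1) by (intro exI[of _ "?L * C"]) simp
qed
 with l show ?thesis by blast
qed

text \<open>The horospherical limit: n_infinity is \<open>nexp i1 wl\<close>, and
  \<open>eta i1 wl\<close> spans the null direction towards which g_t e_0 escapes.\<close>

definition wl :: "real^'d" where "wl = (SOME l. l $ i1 = 0 & (w \<longlongrightarrow> l) at_top &
 (\<forall>ep>0. \<exists>C>0. \<forall>t\<ge>0. norm (eta i1 (w t) - eta i1 l) <= C * exp ((ep - al) * t)))"

lemma wl: "wl $ i1 = 0" "(w \<longlongrightarrow> wl) at_top" "ep > 0 ==> \<exists>C>0. \<forall>t\<ge>0. norm (eta i1 (w t) - eta i1 wl) <= C * exp ((ep - al) * t)" using someI_ex[OF eta_limit] unfolding wl_def[symmetric] by blast+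

abbreviation "et t \<equiv> eta i1 (w t)"
abbreviation "etl \<equiv> eta i1 wl"

lemma common_bound:
 assumes e: "0 < d" "d < al"
 shows "\<exists>C\<ge>1. \<forall>t\<ge>0. h t <= C * exp ((al + d) * t) & 1 / h t <= C * exp ((d - al) * t)
 & norm (et t - etl) <= C * exp ((d - al) * t) & norm (et t) <= C"
proof -
 obtain C1 where C1: "C1 > 0" "!!t. t \<ge> 0 ==> h t <= C1 * exp ((al + d) * t) & 1 / h t <= C1 * exp ((d - al) * t)" using h_growth[OF e(1)] by blast
 obtain C2 where C2: "C2 > 0" "!!t. t \<ge> 0 ==> norm (et t - etl) <= C2 * exp ((d - al) * t)" using wl(3)[OF e(1)] by blast
 define C where "C = 1 + C1 + C2 + norm etl"
 have C: "C \<ge> 1" "C1 <= C" "C2 <= C" "C2 + norm etl <= C" using C1 C2 by (auto simp: C_def)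
 have "h t <= C * exp ((al + d) * t) & 1 / h t <= C * exp ((d - al) * t)
 & norm (et t - etl) <= C * exp ((d - al) * t) & norm (et t) <= C" if t: "t \<ge> 0" for t
proof (intro conjI)
 have m: "C1 * exp x <= C * exp x" "C2 * exp x <= C * exp x" for x using C by (auto intro: mult_right_mono)
 show "h t <= C * exp ((al + d) * t)" "1 / h t <= C * exp ((d - al) * t)" "norm (et t - etl) <= C * exp ((d - al) * t)" using C1(2)[OF t] C2(2)[OF t] m by (meson order_trans)+
 have "(d - al) * t <= 0" using e t by (simp add: mult_nonpos_nonneg)
 then have "C2 * exp ((d - al) * t) <= C2 * 1" using C2(1) by (intro mult_left_mono) auto
 then show "norm (et t) <= C" using C2(2)[OF t] C(4) norm_triangle_ineq[of "et t - etl" etl] by simp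
qed
 then show ?thesis using C(1) by blast
qed

text \<open>The critical term is q(Z xi_t, p_t) = int_0^t q(Z p_s, p_t) ds, since norms alone give
  only e^(2 al t). Antisymmetry gives q(Z eta_s, eta_s) = 0, so the leading part of the integrand
  contains eta_t - eta_s, which is O(e^(-al s)). This cancels the growth of h_s and leaves e^(al
  t).\<close>

lemma upper:
 assumes Z: "Z \<in> lieG" and e: "ep > 0"
 shows "\<exists>C>0. eventually (%t. Dn Z x t <= C * exp ((al + ep) * t)) at_top"
proof -
 \<comment> \<open>Every growth estimate and every integration over [0, t] may lose a factor e^(d
   t), at most four in total; d < al keeps the decaying terms decaying.\<close>
 define d where "d = min (ep / 8) (al / 2)"
 have d: "0 < d" "d < al" "4 * d <= ep" using e a0 by (auto simp: d_def)
 obtain C where C: "C \<ge> 1" and B: "!!t. t \<ge> 0 ==> h t <= C * exp ((al + d) * t)" "!!t. t \<ge> 0 ==> 1 / h t <= C * exp ((d - al) * t)"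
 "!!t. t \<ge> 0 ==> norm (et t - etl) <= C * exp ((d - al) * t)" "!!t. t \<ge> 0 ==> norm (et t) <= C" using common_bound[OF d(1,2)] by blast
 define P where "P = 2 * (C * C)"
 have P0: "P > 0" using C by (simp add: P_def)
 have pb: "norm (p t) <= P * exp ((al + d) * t)" if t: "t \<ge> 0" for t
proof -
 have h0: "h t > 0" by (rule hp[OF t])
 have "norm (p t) <= norm ((h t / 2) *\<^sub>R et t) + norm ((1 / (2 * h t)) *\<^sub>R zeta i1)" unfolding p_eq[OF t] by (rule norm_triangle_ineq)
 also have "... = h t / 2 * norm (et t) + 1 / h t * (norm (zeta i1) / 2)" using h0 by simp
 also have "... <= (C * exp ((al + d) * t)) * C + (C * exp ((d - al) * t)) * 1" using B(1,2,4)[OF t] norm_zeta h0 C by (intro add_mono mult_mono) auto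
 also have "(C * exp ((d - al) * t)) * 1 <= (C * exp ((al + d) * t)) * C"
proof -
 have "(d - al) * t <= (al + d) * t" using a0 t by (intro mult_right_mono) auto
 then show ?thesis using C by (intro mult_mono) auto
qed
 finally show ?thesis by (simp add: P_def algebra_simps)
qed
 have xb: "norm (xi t) <= (P / d) * exp ((al + 2 * d) * t)" if t: "t \<ge> 0" for t
proof -
 have "norm (p s) <= P * exp ((al + d) * t)" if "0 <= s" "s <= t" for s
proof -
 have "(al + d) * s <= (al + d) * t" using that a0 d by (intro mult_left_mono) auto
 then have "P * exp ((al + d) * s) <= P * exp ((al + d) * t)" using P0 by simp
 then show ?thesis using pb[OF that(1)] by linarith
qed
 then have "norm (xi t) <= (P * exp ((al + d) * t)) * t" using P0 by (intro xi_bound[OF t]) auto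
 also have "... <= (P * exp ((al + d) * t)) * (exp (d * t) / d)" using P0 by (intro mult_left_mono t_exp d) auto
 also have "... = (P / d) * exp ((al + d) * t + d * t)" unfolding exp_add by simp
 finally show ?thesis by (simp add: algebra_simps)
qed
 define K where "K = 2 * (C * C * (C * C)) * norm Z"
 have K0: "0 <= K" using C by (simp add: K_def)
 have qs: "\<bar>qform (Z *v p s) (p t)\<bar> <= K * exp ((al + 3 * d) * t)" if st: "0 <= s" "s <= t" for s t
proof -
 have t: "0 <= t" using st by simp
 note hs = hp[OF st(1)] and ht = hp[OF t]
 let ?E = "exp ((al + 3 * d) * t)"
 \<comment> \<open>These two identities remove the diagonal terms, the only ones whose estimate
   would exceed e^(al t).\<close>
 have "qform (Z *v et s) (et s) = 0" "qform (Z *v zeta i1) (zeta i1) = 0" by (rule lieG_qform_self[OF Z])+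
 then have q: "qform (Z *v p s) (p t) = 1/4 * (h s * h t * qform (Z *v et s) (et t - et s)
 + h s * (1 / h t) * qform (Z *v et s) (zeta i1) + 1 / h s * h t * qform (Z *v zeta i1) (et t))" unfolding p_eq[OF st(1)] p_eq[OF t] qform_combine(2) qform_diff_right[of "Z *v et s" "et t"] using hs ht by (simp add: field_simps)
 have nZ: "norm (Z *v et s) <= norm Z * C" "norm (Z *v zeta i1) <= norm Z * 2" using norm_matrix_vector_le[of Z "et s"] mult_left_mono[OF B(4)[OF st(1)], of "norm Z"]
 norm_matrix_vector_le[of Z "zeta i1"] mult_left_mono[OF norm_zeta, of "norm Z"] by auto
 have es: "(al + d) * s <= (al + d) * t" "d * s <= d * t" "(d - al) * t <= (d - al) * s" "(d - al) * s <= 0" "0 <= d * t" using st t a0 d by (auto intro: mult_left_mono mult_left_mono_neg simp: mult_nonpos_nonneg)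
 have 1: "\<bar>h s * h t * qform (Z *v et s) (et t - et s)\<bar> <= 2 * (C * C * (C * C)) * norm Z * ?E"
proof -
 have "norm (et t - et s) <= norm (et t - etl) + norm (et s - etl)" using norm_triangle_ineq4[of "et t - etl" "et s - etl"] by simp
 also have "... <= C * exp ((d - al) * s) + C * exp ((d - al) * s)"
proof -
 have "C * exp ((d - al) * t) <= C * exp ((d - al) * s)" using C es by simp
 then show ?thesis using B(3)[OF t] B(3)[OF st(1)] by linarith
qed
 finally have n: "norm (et t - et s) <= 2 * C * exp ((d - al) * s)" by simp
 have "\<bar>qform (Z *v et s) (et t - et s)\<bar> <= norm (Z *v et s) * norm (et t - et s)" by (rule qform_le)
 also have "... <= (norm Z * C) * (2 * C * exp ((d - al) * s))" by (intro mult_mono nZ n) (use C in auto)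
 finally have a: "\<bar>qform (Z *v et s) (et t - et s)\<bar> <= (norm Z * C) * (2 * C * exp ((d - al) * s))" .
 have b: "h s * h t <= (C * exp ((al + d) * s)) * (C * exp ((al + d) * t))" by (intro mult_mono B st(1) t) (use C hs ht in auto)
 have "\<bar>h s * h t * qform (Z *v et s) (et t - et s)\<bar> = h s * h t * \<bar>qform (Z *v et s) (et t - et s)\<bar>" using hs ht by (simp add: abs_mult)
 also have "... <= (C * exp ((al + d) * s)) * (C * exp ((al + d) * t)) * ((norm Z * C) * (2 * C * exp ((d - al) * s)))" by (rule mult_mono[OF b a]) (use C in auto)
 also have "... = 2 * (C * C * (C * C)) * norm Z * exp ((al + d) * s + (al + d) * t + (d - al) * s)" by (simp only: exp_add mult.assoc mult.left_commute mult.commute)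
 also have "... <= 2 * (C * C * (C * C)) * norm Z * ?E"
proof -
 have "(al + d) * s + (al + d) * t + (d - al) * s = (al + d) * t + 2 * (d * s)" by (simp add: algebra_simps)
 also have "... <= (al + 3 * d) * t" using es(2) by (simp add: algebra_simps)
 finally show ?thesis using C by (intro mult_left_mono) auto
qed
 finally show ?thesis .
qed
 have C34: "C * C * C <= C * C * (C * C)" using C mult_left_mono[of 1 C "C * C * C"] by (simp add: mult.assoc)
 have sm: "2 * (C * C * C) * norm Z * exp y <= 2 * (C * C * (C * C)) * norm Z * ?E" if "y <= (al + d) * t" for y
proof -
 have "exp y <= ?E" using that es(5) by (simp add: algebra_simps)
 then show ?thesis using C34 C by (intro mult_mono) auto
qed
 have 2: "\<bar>h s * (1 / h t) * qform (Z *v et s) (zeta i1)\<bar> <= 2 * (C * C * (C * C)) * norm Z * ?E"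
proof -
 have "\<bar>qform (Z *v et s) (zeta i1)\<bar> <= norm (Z *v et s) * norm (zeta i1)" by (rule qform_le)
 also have "... <= (norm Z * C) * 2" by (intro mult_mono nZ norm_zeta) (use C in auto)
 finally have a: "\<bar>qform (Z *v et s) (zeta i1)\<bar> <= (norm Z * C) * 2" .
 have b: "h s * (1 / h t) <= (C * exp ((al + d) * s)) * (C * exp ((d - al) * t))" by (intro mult_mono B st(1) t) (use C hs ht in auto)
 have "\<bar>h s * (1 / h t) * qform (Z *v et s) (zeta i1)\<bar> = h s * (1 / h t) * \<bar>qform (Z *v et s) (zeta i1)\<bar>" using hs ht by (simp add: abs_mult)
 also have "... <= (C * exp ((al + d) * s)) * (C * exp ((d - al) * t)) * ((norm Z * C) * 2)" by (rule mult_mono[OF b a]) (use C in auto)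
 also have "... = 2 * (C * C * C) * norm Z * exp ((al + d) * s + (d - al) * t)" by (simp only: exp_add mult.assoc mult.left_commute mult.commute)
 also have "... <= 2 * (C * C * (C * C)) * norm Z * ?E" using es by (intro sm) linarith
 finally show ?thesis .
qed
 have 3: "\<bar>1 / h s * h t * qform (Z *v zeta i1) (et t)\<bar> <= 2 * (C * C * (C * C)) * norm Z * ?E"
proof -
 have "\<bar>qform (Z *v zeta i1) (et t)\<bar> <= norm (Z *v zeta i1) * norm (et t)" by (rule qform_le)
 also have "... <= (norm Z * 2) * C" by (intro mult_mono nZ B t) auto
 finally have a: "\<bar>qform (Z *v zeta i1) (et t)\<bar> <= (norm Z * 2) * C" .
 have b: "1 / h s * h t <= (C * exp ((d - al) * s)) * (C * exp ((al + d) * t))" by (intro mult_mono B st(1) t) (use C hs ht in auto)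
 have "\<bar>1 / h s * h t * qform (Z *v zeta i1) (et t)\<bar> = 1 / h s * h t * \<bar>qform (Z *v zeta i1) (et t)\<bar>" using hs ht by (simp add: abs_mult)
 also have "... <= (C * exp ((d - al) * s)) * (C * exp ((al + d) * t)) * ((norm Z * 2) * C)" by (rule mult_mono[OF b a]) (use C in auto)
 also have "... = 2 * (C * C * C) * norm Z * exp ((d - al) * s + (al + d) * t)" by (simp only: exp_add mult.assoc mult.left_commute mult.commute)
 also have "... <= 2 * (C * C * (C * C)) * norm Z * ?E" using es by (intro sm) linarith
 finally show ?thesis .
qed
 have Kp: "0 <= 2 * (C * C * (C * C)) * norm Z * ?E" using C by simp
 have gen: "\<bar>1/4 * (u + v + z)\<bar> <= b" if "\<bar>u\<bar> <= b" "\<bar>v\<bar> <= b" "\<bar>z\<bar> <= b" "0 <= b" for u v z b :: real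
proof -
 have "\<bar>u + v + z\<bar> <= 3 * b" using that by linarith
 then show ?thesis using that(4) by (simp add: abs_mult)
qed
 show ?thesis unfolding q K_def by (rule gen[OF 1 2 3 Kp])
qed
 have qx: "\<bar>qform (Z *v xi t) (p t)\<bar> <= (K / d) * exp ((al + 4 * d) * t)" if t: "t \<ge> 0" for t
proof -
 have bl: "bounded_linear (%v. qform (Z *v v) (p t))" unfolding qform_Qmat by (intro bounded_linear_compose[OF bounded_linear_inner_left] matrix_vector_mul_bounded_linear)
 have "((%s. qform (Z *v p s) (p t)) has_integral qform (Z *v xi t) (p t)) {0..t}" using has_integral_linear[OF xi[OF t] bl] by (simp add: o_def)
 then have "norm (qform (Z *v xi t) (p t)) <= (K * exp ((al + 3 * d) * t)) * t" using has_integral_bound[of "K * exp ((al + 3 * d) * t)" "%s. qform (Z *v p s) (p t)" "qform (Z *v xi t) (p t)" 0 t] qs t K0 by (simp add: content_real)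
 also have "... <= (K * exp ((al + 3 * d) * t)) * (exp (d * t) / d)" using K0 by (intro mult_left_mono t_exp d) auto
 also have "... = (K / d) * exp ((al + 3 * d) * t + d * t)" unfolding exp_add by simp
 finally show ?thesis by (simp add: algebra_simps)
qed
 define T where "T = 1 + \<bar>trace (Z ** Z)\<bar>"
 define Q where "Q = 2 * (norm Z * P) + T + (2 * (norm x * P + K / d) + (norm x + norm Z * (P / d)))"
 have Q0: "Q > 0" using P0 K0 d unfolding Q_def T_def by (intro add_pos_nonneg add_nonneg_pos add_nonneg_nonneg mult_nonneg_nonneg divide_nonneg_nonneg) auto
 have "Dn Z x t <= Q * exp ((al + ep) * t)" if t: "t \<ge> 0" for t
proof -
 let ?E = "exp ((al + ep) * t)"
 have em: "exp ((al + k * d) * t) <= ?E" if "k <= 4" for k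
proof -
 have "k * d <= 4 * d" using that d by (intro mult_right_mono) auto
 then have "al + k * d <= al + ep" using d by linarith
 then have "(al + k * d) * t <= (al + ep) * t" using t by (rule mult_right_mono)
 then show ?thesis by simp
qed
 have "0 <= (al + ep) * t" using a0 e t by simp
 then have E1: "1 <= ?E" by simp
 have m1: "c * exp ((al + k * d) * t) <= c * ?E" if "k <= 4" "0 <= c" for c k using em[OF that(1)] that(2) by (rule mult_left_mono)
 have p': "norm (p t) <= P * ?E" by (rule order_trans[OF pb[OF t] m1[of 1 P, unfolded mult_1_left]]) (use P0 in auto)
 have x': "norm (xi t) <= (P / d) * ?E" by (rule order_trans[OF xb[OF t] m1[of 2 "P / d"]]) (use P0 d in auto)
 have q': "\<bar>qform (Z *v xi t) (p t)\<bar> <= (K / d) * ?E" by (rule order_trans[OF qx[OF t] m1[of 4 "K / d"]]) (use K0 d in auto)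
 have "norm (matrix_inv (g t) ** Z ** g t) <= 2 * (norm Z * norm (p t)) + T" unfolding T_def by (rule norm_lieG_conj_le[OF Z G[OF t]])
 also have "... <= 2 * (norm Z * (P * ?E)) + T * ?E"
proof -
 have "T <= T * ?E" by (rule order_trans[OF _ mult_left_mono[OF E1]]) (auto simp: T_def)
 then show ?thesis using mult_left_mono[OF p', of "norm Z"] norm_ge_zero[of Z] by linarith
qed
 finally have 1: "norm (matrix_inv (g t) ** Z ** g t) <= 2 * (norm Z * (P * ?E)) + T * ?E" .
 have "\<bar>qform x (p t)\<bar> <= norm x * (P * ?E)" using qform_le[of x "p t"] mult_left_mono[OF p', of "norm x"] by simp
 then have 2: "\<bar>qform (x + Z *v xi t) (p t)\<bar> <= norm x * (P * ?E) + (K / d) * ?E" using q' by (simp add: qform_add_left)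
 have "norm (Z *v xi t) <= norm Z * ((P / d) * ?E)" using norm_matrix_vector_le[of Z "xi t"] mult_left_mono[OF x', of "norm Z"] by simp
 moreover have "norm x <= norm x * ?E" using mult_left_mono[OF E1, of "norm x"] by simp
 ultimately have 3: "norm (x + Z *v xi t) <= norm x * ?E + norm Z * ((P / d) * ?E)" using norm_triangle_ineq[of x "Z *v xi t"] by linarith
 have "Dn Z x t <= (2 * (norm Z * (P * ?E)) + T * ?E) + (2 * (norm x * (P * ?E) + (K / d) * ?E) + (norm x * ?E + norm Z * ((P / d) * ?E)))" unfolding Dn_def by (rule add_mono[OF 1 order_trans[OF norm_matrix_inv_le[OF G[OF t]] add_mono[OF mult_left_mono[OF 2] 3]]]) simp
 also have "... = Q * ?E" unfolding Q_def by (simp only: distrib_right mult.assoc distrib_left)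
 finally show ?thesis .
qed
 then have "eventually (%t. Dn Z x t <= Q * exp ((al + ep) * t)) at_top" by (intro eventually_at_top_linorderI[of 0])
 with Q0 show ?thesis by blast
qed

lemma inverse_h: "((%t. 1 / h t) \<longlongrightarrow> 0) at_top" and eta_tendsto: "(et \<longlongrightarrow> etl) at_top"
proof -
 have "0 < al / 2" "al / 2 < al" using a0 by auto
 from common_bound[OF this] obtain C where B: "!!t. t \<ge> 0 ==> 1 / h t <= C * exp ((al/2 - al) * t)"
 "!!t. t \<ge> 0 ==> norm (et t - etl) <= C * exp ((al/2 - al) * t)" by blast
 show "((%t. 1 / h t) \<longlongrightarrow> 0) at_top" by (rule Lim_null_comparison[OF eventually_at_top_linorderI[of 0] exp_decay[of C]]) (use B(1) hp in \<open>simp add: less_imp_le\<close>)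
 have "((%t. et t - etl) \<longlongrightarrow> 0) at_top" by (rule Lim_null_comparison[OF eventually_at_top_linorderI[of 0] exp_decay[of C]]) (rule B(2))
 then show "(et \<longlongrightarrow> etl) at_top" by (rule LIM_zero_cancel)
qed

lemma lower_of_h:
 assumes k: "ka > 0" and ev: "eventually (%t. ka * h t <= f t) at_top" and e: "ep > 0"
 shows "\<exists>c>0. eventually (%t. c * exp ((al - ep) * t) <= f t) at_top"
proof -
 obtain C where C: "C > 0" "!!t. t \<ge> 0 ==> 1 / h t <= C * exp ((ep - al) * t)" using h_growth[OF e] by blast
 have "eventually (%t. (ka / C) * exp ((al - ep) * t) <= f t) at_top" using ev eventually_ge_at_top[of 0]
proof eventually_elim
case (elim t)
 have h0: "h t > 0" by (rule hp[OF elim(2)])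
 have "1 <= (C * exp ((ep - al) * t)) * h t" using C(2)[OF elim(2)] h0 by (simp add: pos_divide_le_eq)
 then have "exp ((al - ep) * t) * 1 <= exp ((al - ep) * t) * ((C * exp ((ep - al) * t)) * h t)" by (intro mult_left_mono) auto
 also have "... = C * h t * exp ((al - ep) * t + (ep - al) * t)" by (simp only: exp_add mult.assoc mult.left_commute mult.commute)
 also have "(al - ep) * t + (ep - al) * t = 0" by (simp add: algebra_simps)
 finally have "exp ((al - ep) * t) <= C * h t" by simp
 then have "(ka / C) * exp ((al - ep) * t) <= (ka / C) * (C * h t)" using k C(1) by (intro mult_left_mono) auto
 then show ?case using elim(1) C(1) by simp
qed
 then show ?thesis using k C(1) by (intro exI[of _ "ka / C"]) simp
qed

text \<open>By \<open>p_eq\<close>, q(y, p_t) / h_t tends to q(y, etl) / 2, and q(y, p_t) is the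
  time component of g_t^-1 y.\<close>

lemma lower_vector:
 assumes y: "qform y etl ~= 0"
 shows "\<exists>ka>0. eventually (%t. ka * h t <= norm (matrix_inv (g t) *v y)) at_top"
proof -
 let ?k = "\<bar>qform y etl\<bar> / 4"
 have "((%t. \<bar>1/2 * qform y (et t) + 1/2 * (1 / h t)\<^sup>2 * qform y (zeta i1)\<bar>) \<longlongrightarrow> \<bar>1/2 * qform y etl + 1/2 * 0\<^sup>2 * qform y (zeta i1)\<bar>) at_top" by (intro tendsto_intros qform_tendsto eta_tendsto inverse_h)
 moreover have "?k < \<bar>1/2 * qform y etl + 1/2 * 0\<^sup>2 * qform y (zeta i1)\<bar>" using y by simp
 ultimately have "eventually (%t. ?k < \<bar>1/2 * qform y (et t) + 1/2 * (1 / h t)\<^sup>2 * qform y (zeta i1)\<bar>) at_top" by (rule order_tendstoD(1))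
 then have "eventually (%t. ?k * h t <= norm (matrix_inv (g t) *v y)) at_top" using eventually_ge_at_top[of 0]
proof eventually_elim
case (elim t)
 have h0: "h t > 0" by (rule hp[OF elim(2)])
 have "qform y (p t) = (1/2 * qform y (et t) + 1/2 * (1 / h t)\<^sup>2 * qform y (zeta i1)) * h t" unfolding p_eq[OF elim(2)] qform_combine(1) using h0 by (simp add: field_simps power2_eq_square)
 then have "\<bar>qform y (p t)\<bar> = \<bar>1/2 * qform y (et t) + 1/2 * (1 / h t)\<^sup>2 * qform y (zeta i1)\<bar> * h t" using h0 by (simp only: abs_mult abs_of_pos)
 also have "... \<ge> ?k * h t" using elim(1) h0 by (intro mult_right_mono) auto
 finally show ?case using norm_matrix_inv_ge[OF G[OF elim(2)], of y] by linarith
qed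
 then show ?thesis using y by (intro exI[of _ ?k]) simp
qed

text \<open>- q(Z p_t, Z p_t) / h_t^2 tends to - q(Z etl, Z etl) / 4, which is positive, and the
  numerator is dominated by the squared norm of the conjugate.\<close>

lemma lower_matrix:
 assumes Z: "Z \<in> lieG" and neg: "qform (Z *v etl) (Z *v etl) < 0"
 shows "\<exists>ka>0. eventually (%t. ka * h t <= norm (matrix_inv (g t) ** Z ** g t)) at_top"
proof -
 let ?q = "qform (Z *v etl) (Z *v etl)"
 let ?F = "%t. - 1/4 * qform (Z *v et t) (Z *v et t) - 1/2 * (1 / h t)\<^sup>2 * qform (Z *v et t) (Z *v zeta i1) - 1/4 * ((1 / h t)\<^sup>2)\<^sup>2 * qform (Z *v zeta i1) (Z *v zeta i1)"
 have Ze: "((%t. Z *v et t) \<longlongrightarrow> Z *v etl) at_top" by (rule bounded_linear.tendsto[OF matrix_vector_mul_bounded_linear eta_tendsto])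
 have "(?F \<longlongrightarrow> - 1/4 * ?q - 1/2 * 0\<^sup>2 * qform (Z *v etl) (Z *v zeta i1) - 1/4 * (0\<^sup>2)\<^sup>2 * qform (Z *v zeta i1) (Z *v zeta i1)) at_top" by (intro tendsto_intros qform_tendsto Ze inverse_h)
 moreover have "- ?q / 8 < - 1/4 * ?q - 1/2 * 0\<^sup>2 * qform (Z *v etl) (Z *v zeta i1) - 1/4 * (0\<^sup>2)\<^sup>2 * qform (Z *v zeta i1) (Z *v zeta i1)" using neg by simp
 ultimately have "eventually (%t. - ?q / 8 < ?F t) at_top" by (rule order_tendstoD(1))
 then have "eventually (%t. sqrt (- ?q / 8) * h t <= norm (matrix_inv (g t) ** Z ** g t)) at_top" using eventually_ge_at_top[of 0]
proof eventually_elim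
case (elim t)
 have h0: "h t > 0" by (rule hp[OF elim(2)])
 have "- qform (Z *v p t) (Z *v p t) = ?F t * (h t)\<^sup>2"
proof -
 have gen: "- ((x / 2)\<^sup>2 * a + 2 * (x / 2) * (1 / (2 * x)) * b + (1 / (2 * x))\<^sup>2 * c)
 = (- 1/4 * a - 1/2 * (1 / x)\<^sup>2 * b - 1/4 * ((1 / x)\<^sup>2)\<^sup>2 * c) * x\<^sup>2" if "0 < x" for x a b c :: real
proof -
 define y where "y = 1 / x"
 have y: "x * y = 1" "1 / (2 * x) = y / 2" using that by (simp_all add: y_def)
 have "(- 1/4 * a - 1/2 * y\<^sup>2 * b - 1/4 * (y\<^sup>2)\<^sup>2 * c) * x\<^sup>2 = - 1/4 * a * x\<^sup>2 - 1/2 * (x * y)\<^sup>2 * b - 1/4 * y\<^sup>2 * (x * y)\<^sup>2 * c" by algebra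
 also have "... = - 1/4 * a * x\<^sup>2 - 1/2 * b - 1/4 * y\<^sup>2 * c" by (simp add: y(1))
 also have "... = - ((x / 2)\<^sup>2 * a + (x * y) / 2 * b + (y / 2)\<^sup>2 * c)" by (simp add: y(1) power_divide)
 finally show ?thesis unfolding y(2) y_def[symmetric] by simp
qed
 show ?thesis unfolding p_eq[OF elim(2)] qform_combine(3) by (rule gen[OF h0])
qed
 moreover have "- ?q / 8 * (h t)\<^sup>2 <= ?F t * (h t)\<^sup>2" by (rule mult_right_mono[OF less_imp_le[OF elim(1)] zero_le_power2])
 ultimately have "- ?q / 8 * (h t)\<^sup>2 <= (norm (matrix_inv (g t) ** Z ** g t))\<^sup>2" using norm_lieG_conj_ge[OF Z G[OF elim(2)]] by linarith
 moreover have "(sqrt (- ?q / 8) * h t)\<^sup>2 = - ?q / 8 * (h t)\<^sup>2"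
proof -
 have "0 <= - ?q / 8" using neg by simp
 then show ?thesis by (simp only: power_mult_distrib real_sqrt_pow2)
qed
 ultimately have "(sqrt (- ?q / 8) * h t)\<^sup>2 <= (norm (matrix_inv (g t) ** Z ** g t))\<^sup>2" by (simp only:)
 then show ?case by (rule power2_le_imp_le[OF _ norm_ge_zero])
qed
 then show ?thesis using neg by (intro exI[of _ "sqrt (- ?q / 8)"]) simp
qed

text \<open>If y is orthogonal to the limit direction, then q(y, p_t) sees only h_t (eta_t - etl)
  and 1/h_t, both subexponential, and so is |g_t^-1 y|. Combined with the positive drift for every
  fixed vector, this shows that a fixed vector is almost surely not orthogonal to etl.\<close>

lemma slow_vector:
 assumes y: "qform y etl = 0" and k: "ka > 0"
 shows "\<not> eventually (%t. ka * t <= ln (norm (matrix_inv (g t) *v y))) at_top"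
proof
 assume ev: "eventually (%t. ka * t <= ln (norm (matrix_inv (g t) *v y))) at_top"
 \<comment> \<open>The norm is then at most K e^(2 d t) with 2 d <= ka/2, which loses against e^(ka
   t) once t >= 2 (ln K + 1) / ka.\<close>
 define d where "d = min (ka / 4) (al / 2)"
 have d: "0 < d" "d < al" "4 * d <= ka" using k a0 by (auto simp: d_def)
 obtain C where C: "C \<ge> 1" and B: "!!t. t \<ge> 0 ==> h t <= C * exp ((al + d) * t)" "!!t. t \<ge> 0 ==> 1 / h t <= C * exp ((d - al) * t)"
 "!!t. t \<ge> 0 ==> norm (et t - etl) <= C * exp ((d - al) * t)" using common_bound[OF d(1,2)] by blast
 define K where "K = norm y * (C * C) + norm y * (2 * C) + norm y + 1"
 have K1: "K \<ge> 1" using C by (simp add: K_def)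
 have up: "norm (matrix_inv (g t) *v y) <= K * exp (2 * d * t)" if t: "t \<ge> 0" for t
proof -
 have h0: "h t > 0" by (rule hp[OF t])
 have E1: "1 <= exp (2 * d * t)" using d t by simp
 have "2 * qform y (p t) = h t * qform y (et t - etl) + 1 / h t * qform y (zeta i1)" unfolding p_eq[OF t] qform_combine(1) qform_diff_right[of y "et t"] using h0 y by (simp add: field_simps)
 then have "2 * \<bar>qform y (p t)\<bar> <= \<bar>h t * qform y (et t - etl)\<bar> + \<bar>1 / h t * qform y (zeta i1)\<bar>" by linarith
 also have "... = h t * \<bar>qform y (et t - etl)\<bar> + 1 / h t * \<bar>qform y (zeta i1)\<bar>" using h0 by (simp add: abs_mult)
 also have "... <= (C * exp ((al + d) * t)) * (norm y * (C * exp ((d - al) * t))) + (C * exp ((d - al) * t)) * (norm y * 2)"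
proof (intro add_mono mult_mono B t)
 show "\<bar>qform y (et t - etl)\<bar> <= norm y * (C * exp ((d - al) * t))" using qform_le[of y "et t - etl"] mult_left_mono[OF B(3)[OF t], of "norm y"] by simp
 show "\<bar>qform y (zeta i1)\<bar> <= norm y * 2" using qform_le[of y "zeta i1"] mult_left_mono[OF norm_zeta, of "norm y"] by simp
qed (use C in auto)
 also have "... = norm y * (C * C) * exp ((al + d) * t + (d - al) * t) + norm y * (2 * C) * exp ((d - al) * t)" by (simp only: exp_add mult.assoc mult.left_commute mult.commute)
 also have "... <= norm y * (C * C) * exp (2 * d * t) + norm y * (2 * C) * exp (2 * d * t)"
proof -
 have "(d - al) * t <= 2 * d * t" using d a0 t by (intro mult_right_mono) auto
 moreover have "(al + d) * t + (d - al) * t = 2 * d * t" by (simp add: algebra_simps)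
 ultimately show ?thesis using C by (intro add_mono mult_left_mono) auto
qed
 finally have "2 * \<bar>qform y (p t)\<bar> <= norm y * (C * C) * exp (2 * d * t) + norm y * (2 * C) * exp (2 * d * t)" .
 moreover have "norm y <= norm y * exp (2 * d * t)" using mult_left_mono[OF E1, of "norm y"] by simp
 moreover have "K * exp (2 * d * t) = norm y * (C * C) * exp (2 * d * t) + norm y * (2 * C) * exp (2 * d * t) + norm y * exp (2 * d * t) + exp (2 * d * t)" unfolding K_def by (simp only: distrib_right mult_1_left)
 ultimately show ?thesis using norm_matrix_inv_le[OF G[OF t], of y] E1 by linarith
qed
 have "eventually (%t. ka * t <= ln (norm (matrix_inv (g t) *v y)) & 0 < t & 2 * (ln K + 1) / ka <= t) at_top" using ev eventually_gt_at_top[of 0] eventually_ge_at_top[of "2 * (ln K + 1) / ka"] by eventually_elim simp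
 then obtain t where t: "ka * t <= ln (norm (matrix_inv (g t) *v y))" "0 < t" "2 * (ln K + 1) / ka <= t" using eventually_happens trivial_limit_at_top_linorder by blast
 have "0 < ka * t" using k t by simp
 then have "norm (matrix_inv (g t) *v y) ~= 0" using t(1) by (auto simp: ln_0)
 then have "0 < norm (matrix_inv (g t) *v y)" by simp
 then have "ln (norm (matrix_inv (g t) *v y)) <= ln (K * exp (2 * d * t))" using up[of t] t(2) by (subst ln_le_cancel_iff) linarith+
 also have "... = ln K + 2 * d * t" using K1 by (simp add: ln_mult_pos)
 also have "... <= ln K + ka * t / 2" using d t by simp
 finally have "ka * t <= 2 * ln K" using t(1) by linarith
 moreover have "2 * (ln K + 1) <= ka * t" using t(3) k by (simp add: pos_divide_le_eq mult.commute)
 then have "2 * ln K + 2 <= ka * t" by (simp add: distrib_left)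
 ultimately show False by linarith
qed

lemma rate:
 assumes Z: "Z \<in> lieG" and c: "qform (Z *v etl) (Z *v etl) < 0 \<or> Z = 0 & qform x etl ~= 0"
 and k: "0 < k1" "0 < k2" and N: "!!t. t \<ge> 0 ==> k1 * Dn Z x t <= N t & N t <= k2 * Dn Z x t"
 shows "((%t. ln (N t) / t) \<longlongrightarrow> al) at_top"
proof (rule rate_limit[OF k N upper[OF Z]])
 have "\<exists>ka>0. eventually (%t. ka * h t <= Dn Z x t) at_top"
proof (cases "qform (Z *v etl) (Z *v etl) < 0")
case True
 then obtain ka where "ka > 0" "eventually (%t. ka * h t <= norm (matrix_inv (g t) ** Z ** g t)) at_top" using lower_matrix[OF Z] by blast
 then show ?thesis by (intro exI[of _ ka]) (auto simp: Dn_def elim!: eventually_mono intro: order_trans)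
next
case False
 then have "Z = 0" "qform x etl ~= 0" using c by auto
 then obtain ka where "ka > 0" "eventually (%t. ka * h t <= norm (matrix_inv (g t) *v x)) at_top" using lower_vector by blast
 then show ?thesis using \<open>Z = 0\<close> by (intro exI[of _ ka]) (auto simp: Dn_def elim!: eventually_mono intro: order_trans)
qed
 then show "\<exists>c>0. eventually (%t. c * exp ((al - ep) * t) <= Dn Z x t) at_top" if "ep > 0" for ep using lower_of_h that by blast
qed

end

section \<open>The Finsler norm of the flow\<close>

lemma subspace_lieT: "subspace (lieT :: 'd::finite pg set)"
proof -
 have 0: "(0 :: 'd mmat) \<in> lieG" by (simp add: lieG_def)
 have 1: "x + y \<in> lieG" if x: "x \<in> lieG" and y: "y \<in> lieG" for x y :: "'d mmat" unfolding lieG_def mem_Collect_eq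
proof (intro conjI allI)
 fix i j
 show "(x + y) $ None $ None = 0" by (simp add: lieG_None[OF x] lieG_None[OF y])
 show "(x + y) $ None $ Some i = (x + y) $ Some i $ None" by (simp only: vector_add_component lieG_sym[OF x] lieG_sym[OF y])
 show "(x + y) $ Some i $ Some j = - (x + y) $ Some j $ Some i" unfolding vector_add_component lieG_antisym[OF x, of i j] lieG_antisym[OF y, of i j] by (rule minus_add_distrib[symmetric])
qed
 have 2: "c *\<^sub>R x \<in> lieG" if x: "x \<in> lieG" for c and x :: "'d mmat" unfolding lieG_def mem_Collect_eq
proof (intro conjI allI)
 fix i j
 show "(c *\<^sub>R x) $ None $ None = 0" by (simp add: lieG_None[OF x])
 show "(c *\<^sub>R x) $ None $ Some i = (c *\<^sub>R x) $ Some i $ None" by (simp only: vector_scaleR_component lieG_sym[OF x])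
 have "x $ Some i $ Some j = - x $ Some j $ Some i" by (rule lieG_antisym[OF x])
 then have "c * x $ Some i $ Some j = c * (- x $ Some j $ Some i)" by (rule arg_cong)
 then show "(c *\<^sub>R x) $ Some i $ Some j = - (c *\<^sub>R x) $ Some j $ Some i" unfolding vector_scaleR_component real_scaleR_def mult_minus_right .
qed
 show ?thesis unfolding subspace_def lieT_def using 0 1 2 by (simp add: zero_prod_def split_beta)
qed

text \<open>\<open>norm_on\<close> constrains N on the subspace only, so the equivalence with the
  Euclidean norm is proved within it: an orthonormal basis gives the upper bound and with it
  continuity, and compactness of the unit sphere of S gives the lower bound.\<close>

lemma norm_on_bounds:
 fixes N :: "'a::euclidean_space => real"
 assumes S: "subspace S" and N: "norm_on S N"
 shows "\<exists>k1>0. \<exists>k2>0. \<forall>x\<in>S. k1 * norm x <= N x & N x <= k2 * norm x"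
proof -
 have N0: "0 <= N x" "N x = 0 \<longleftrightarrow> x = 0" "N (c *\<^sub>R x) = \<bar>c\<bar> * N x" if "x \<in> S" for x c using N that unfolding norm_on_def by blast+
 have Nt: "N (x + y) <= N x + N y" if "x \<in> S" "y \<in> S" for x y using N that unfolding norm_on_def by blast
 obtain B where B: "B \<subseteq> S" "pairwise orthogonal B" "!!x. x \<in> B ==> norm x = 1" "independent B" "span B = S" using orthonormal_basis_subspace[OF S] by metis
 have fB: "finite B" by (rule independent_imp_finite[OF B(4)])
 define k2 where "k2 = 1 + (\<Sum>b\<in>B. N b)"
 have s0: "0 <= (\<Sum>b\<in>B. N b)" using B(1) N0(1) by (intro sum_nonneg) auto
 have Ns: "N (\<Sum>b\<in>A. f b *\<^sub>R b) <= (\<Sum>b\<in>A. \<bar>f b\<bar> * N b) & (\<Sum>b\<in>A. f b *\<^sub>R b) \<in> S" if "finite A" "A \<subseteq> B" for A f using that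
proof (induction rule: finite_induct)
case empty
 then show ?case using N0(2)[OF subspace_0[OF S]] subspace_0[OF S] by simp
next
case (insert b A)
 then have b: "b \<in> S" "f b *\<^sub>R b \<in> S" using B(1) subspace_scale[OF S] by auto
 have "N (f b *\<^sub>R b + (\<Sum>b\<in>A. f b *\<^sub>R b)) <= \<bar>f b\<bar> * N b + (\<Sum>b\<in>A. \<bar>f b\<bar> * N b)" using Nt[OF b(2), of "\<Sum>b\<in>A. f b *\<^sub>R b"] insert N0(3)[OF b(1), of "f b"] by auto
 then show ?case using insert b subspace_add[OF S b(2)] by auto
qed
 have up: "N x <= k2 * norm x" if x: "x \<in> S" for x
proof -
 have "x = (\<Sum>b\<in>B. inner x b *\<^sub>R b)" using orthonormal_basis_expand[OF B(2,3) _ fB, of x] x B(5) by simp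
 then have "N x <= (\<Sum>b\<in>B. \<bar>inner x b\<bar> * N b)" using Ns[OF fB order_refl, of "inner x"] by simp
 also have "... <= (\<Sum>b\<in>B. norm x * N b)"
proof (intro sum_mono mult_right_mono)
 fix b assume b: "b \<in> B"
 show "\<bar>inner x b\<bar> <= norm x" using Cauchy_Schwarz_ineq2[of x b] B(3)[OF b] by simp
 show "0 <= N b" using b B(1) N0(1) by auto
qed
 also have "... = norm x * (\<Sum>b\<in>B. N b)" by (rule sum_distrib_left[symmetric])
 also have "... <= norm x * k2" unfolding k2_def by (rule mult_left_mono) simp_all
 also have "... = k2 * norm x" by (rule mult.commute)
 finally show ?thesis .
qed
 have k2: "k2 > 0" using s0 by (simp add: k2_def)
 have "continuous_on S N"
proof (rule continuous_onI)
 fix x e assume x: "x \<in> S" and e: "(0::real) < e"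
 show "\<exists>d>0. \<forall>x'\<in>S. dist x' x < d --> dist (N x') (N x) <= e"
proof (intro exI[of _ "e / k2"] conjI ballI impI)
 show "0 < e / k2" using e k2 by simp
 fix y assume y: "y \<in> S" "dist y x < e / k2"
 have d: "y - x \<in> S" "x - y \<in> S" using subspace_diff[OF S] x y by auto
 have "N y <= N x + N (y - x)" using Nt[OF x d(1)] by simp
 moreover have "N x <= N y + N (x - y)" using Nt[OF y(1) d(2)] by simp
 moreover have "N (y - x) <= e" "N (x - y) <= e" using up[OF d(1)] up[OF d(2)] y(2) k2 by (auto simp: dist_norm norm_minus_commute pos_less_divide_eq mult.commute)
 ultimately show "dist (N y) (N x) <= e" by (simp add: dist_real_def)
qed
qed
 have "\<exists>k1>0. \<forall>x\<in>S. k1 * norm x <= N x"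
proof (cases "S \<inter> sphere 0 1 = {}")
case True
 have "x = 0" if "x \<in> S" for x
proof (rule ccontr)
 assume "x ~= 0"
 then have "(1 / norm x) *\<^sub>R x \<in> S \<inter> sphere 0 1" using subspace_scale[OF S that] by simp
 then show False using True by blast
qed
 then have "1 * norm x <= N x" if "x \<in> S" for x using N0(1)[OF that] that by (metis mult_1_left norm_zero)
 then show ?thesis by (intro exI[of _ 1]) simp
next
case False
 have "compact (S \<inter> sphere 0 1)" using closed_subspace[OF S] by (simp add: closed_Int_compact)
 from continuous_attains_inf[OF this False continuous_on_subset[OF \<open>continuous_on S N\<close>]]
 obtain u where u: "u \<in> S" "norm u = 1" "!!y. y \<in> S ==> norm y = 1 ==> N u <= N y" by auto
 have "u ~= 0" using u(2) by auto
 then have nu: "N u > 0" using N0(1)[OF u(1)] N0(2)[OF u(1)] by linarith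
 have "N u * norm x <= N x" if x: "x \<in> S" for x
proof (cases "x = 0")
case True
 then show ?thesis using N0(1)[OF x] by simp
next
case False
 have "N u <= N ((1 / norm x) *\<^sub>R x)" by (rule u(3)) (use False subspace_scale[OF S x] in auto)
 also have "... = \<bar>1 / norm x\<bar> * N x" by (rule N0(3)[OF x])
 finally show ?thesis using False by (simp add: pos_le_divide_eq)
qed
 then show ?thesis using nu by blast
qed
 with up k2 show ?thesis by blast
qed

lemma frechet_affine:
 assumes "bounded_linear f" shows "frechet_derivative (%h. c + f h) (at x) = f"
proof -
 have "(f has_derivative f) (at x)" by (rule bounded_linear_imp_has_derivative[OF assms])
 then have "((%h. c + f h) has_derivative (%h. 0 + f h)) (at x)" by (intro has_derivative_add has_derivative_const)
 from frechet_derivative_at[OF this, unfolded add_0_left] show ?thesis by (rule sym)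
qed

lemma bounded_linear_pair_mult:
 "bounded_linear (%h :: 'd::finite pg. (fst h ** g, snd h + fst h *v xi))"
 "bounded_linear (%h :: 'd::finite pg. (k ** fst h, k *v snd h))"
proof -
 have 1: "bounded_linear (%h :: 'd pg. fst h ** g)" "bounded_linear (%h :: 'd pg. k ** fst h)" by (intro bounded_linear_compose[OF bounded_bilinear.bounded_linear_left[OF bounded_bilinear_matrix_mult]]
 bounded_linear_compose[OF bounded_bilinear.bounded_linear_right[OF bounded_bilinear_matrix_mult]] bounded_linear_fst)+
 have 2: "bounded_linear (%h :: 'd pg. fst h *v xi)" by (rule linear_conv_bounded_linear[THEN iffD1], rule linearI)
 (simp_all add: matrix_vector_mult_add_rdistrib scaleR_matrix_vector_assoc)
 have 3: "bounded_linear (%h :: 'd pg. k *v snd h)" by (rule bounded_linear_compose[OF matrix_vector_mul_bounded_linear bounded_linear_snd])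
 show "bounded_linear (%h :: 'd pg. (fst h ** g, snd h + fst h *v xi))" by (intro bounded_linear_Pair 1 bounded_linear_add bounded_linear_snd 2)
 show "bounded_linear (%h :: 'd pg. (k ** fst h, k *v snd h))" by (intro bounded_linear_Pair 1 3)
qed

text \<open>Left and right multiplication are affine in the ambient vector space, so their
  derivatives are the linear parts. Their composition is the adjoint action of the inverse of
  gt.\<close>

lemma finsler_dflow:
 "finsler N gt (dflow gt Y) = N (matrix_inv (fst gt) ** fst Y ** fst gt, matrix_inv (fst gt) *v (snd Y + fst Y *v snd gt))"
proof -
 have 1: "dflow gt Y = (fst Y ** fst gt, snd Y + fst Y *v snd gt)" using fun_cong[OF frechet_affine[OF bounded_linear_pair_mult(1)[of "fst gt" "snd gt"], of 0 pId], of Y] by (simp add: dflow_def pmult_def)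
 have "(%h. pmult (pinv gt) h) = (%h. (0, - (matrix_inv (fst gt) *v snd gt)) + (matrix_inv (fst gt) ** fst h, matrix_inv (fst gt) *v snd h))" by (simp add: pmult_def pinv_def)
 from frechet_affine[OF bounded_linear_pair_mult(2), of "(0, - (matrix_inv (fst gt) *v snd gt))" "matrix_inv (fst gt)" gt, folded this]
 have e: "frechet_derivative (%h. pmult (pinv gt) h) (at gt) = (%h. (matrix_inv (fst gt) ** fst h, matrix_inv (fst gt) *v snd h))" .
 show ?thesis unfolding finsler_def e 1 by (simp add: matrix_mul_assoc)
qed

lemma (in path) finsler_bounds:
 assumes N: "norm_on lieT N" and Y: "Y \<in> lieT" and x: "!!t. xi t = snd (gt t)" "!!t. g t = fst (gt t)"
 shows "\<exists>k1>0. \<exists>k2>0. \<forall>t\<ge>0. k1 * Dn (fst Y) (snd Y) t <= finsler N (gt t) (dflow (gt t) Y)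
 & finsler N (gt t) (dflow (gt t) Y) <= k2 * Dn (fst Y) (snd Y) t"
proof -
 obtain k1 k2 where k: "k1 > 0" "k2 > 0" "!!x. x \<in> lieT ==> k1 * norm x <= N x & N x <= k2 * norm x" using norm_on_bounds[OF subspace_lieT N] by metis
 have "(k1 / 2) * Dn (fst Y) (snd Y) t <= finsler N (gt t) (dflow (gt t) Y)
 & finsler N (gt t) (dflow (gt t) Y) <= k2 * Dn (fst Y) (snd Y) t" if t: "t \<ge> 0" for t
proof -
 let ?a = "matrix_inv (g t) ** fst Y ** g t" and ?b = "matrix_inv (g t) *v (snd Y + fst Y *v xi t)"
 have f: "finsler N (gt t) (dflow (gt t) Y) = N (?a, ?b)" unfolding finsler_dflow x ..
 have "?a \<in> lieG" using Y by (intro lieG_conj G t) (auto simp: lieT_def)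
 then have "(?a, ?b) \<in> lieT" by (simp add: lieT_def)
 note kk = k(3)[OF this]
 have "norm (?a, ?b) <= norm ?a + norm ?b" by (rule norm_Pair_le)
 then have 1: "k2 * norm (?a, ?b) <= k2 * Dn (fst Y) (snd Y) t" using k(2) by (simp add: Dn_def)
 have "norm ?a <= norm (?a, ?b)" "norm ?b <= norm (?a, ?b)" by (rule norm_fst_le norm_snd_le)+
 then have "(k1 / 2) * Dn (fst Y) (snd Y) t <= (k1 / 2) * (2 * norm (?a, ?b))" using k(1) unfolding Dn_def by (intro mult_left_mono) auto
 then show ?thesis using 1 kk unfolding f by simp
qed
 then show ?thesis using k(1,2) by (intro exI[of _ "k1 / 2"] conjI exI[of _ k2]) auto
qed

section \<open>The Oseledets subspaces\<close>

definition Vz :: "'d::finite => 'd pg => 'd pg set" where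
 "Vz i1 gI = Adt gI ` {A + B | A B. A \<in> Ut_zero i1 & B \<in> Ut_plus i1}"

lemma zero_Ut: "0 \<in> Ut_zero i1" "0 \<in> Ut_plus i1"
proof -
 have "(0::'a mmat) = 0 + 0" by simp
 then show "0 \<in> Ut_zero i1" unfolding Ut_zero_def zero_prod_def by (auto simp: calM_def span_zero intro!: exI[of _ "0::'a mmat"])
 show "0 \<in> Ut_plus i1" by (auto simp: Ut_plus_def calNbar_def zero_prod_def span_zero)
qed

lemma Vminus_subset: "Adt gI ` Ut_plus i1 \<subseteq> Vz i1 gI" unfolding Vz_def
proof (rule image_mono, rule subsetI)
 fix B assume "B \<in> Ut_plus i1"
 then have "0 + B \<in> {A + B | A B. A \<in> Ut_zero i1 & B \<in> Ut_plus i1}" using zero_Ut(1) by blast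
 then show "B \<in> {A + B | A B. A \<in> Ut_zero i1 & B \<in> Ut_plus i1}" by (simp only: add_0_left)
qed

lemma zero_Vminus: "0 \<in> Adt gI ` Ut_plus i1"
proof -
 have "Adt gI 0 = 0" by (simp add: Adt_def zero_prod_def matrix_scaleR_mult(2)[of _ 0 0, simplified] matrix_scaleR_mult(1)[of 0 0, simplified])
 then show ?thesis using zero_Ut(2) by (metis image_eqI)
qed

text \<open>Checked on the spanning vectors: V_1 fixes e_0 + e_1, the rotations and the elements V_i
  + V_1i kill it, and the vectors spanning U^0 and U^+ are q-orthogonal to it. These are the only
  properties of the middle subspace needed to exclude Y from it.\<close>

lemma eigenspace_e1:
 fixes i1 :: "'d::finite"
 defines "e \<equiv> ev None + ev (Some i1)"
 assumes A: "A \<in> Ut_zero i1" and B: "B \<in> Ut_plus i1"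
 shows "\<exists>c. fst (A + B) *v e = c *\<^sub>R e" "qform (snd (A + B)) e = 0"
proof -
 let ?P = "{M :: 'd mmat. \<exists>c. M *v e = c *\<^sub>R e}"
 have sP: "subspace ?P" unfolding subspace_def
proof (intro conjI ballI allI)
 show "0 \<in> ?P" by (auto intro: exI[of _ 0])
 fix x y c assume x: "x \<in> ?P" and y: "y \<in> ?P"
 then obtain a b where ab: "x *v e = a *\<^sub>R e" "y *v e = b *\<^sub>R e" by auto
 have "(x + y) *v e = (a + b) *\<^sub>R e" by (simp add: matrix_vector_mult_add_rdistrib ab scaleR_add_left)
 then show "x + y \<in> ?P" by blast
next
 fix c x assume "x \<in> ?P"
 then obtain a where "x *v e = a *\<^sub>R e" by auto
 then have "(c *\<^sub>R x) *v e = (c * a) *\<^sub>R e" by (simp add: scaleR_matrix_vector_assoc[symmetric])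
 then show "c *\<^sub>R x \<in> ?P" by blast
qed
 have sQ: "subspace {u. qform u e = 0}" unfolding subspace_def by (auto simp: qform_add_left qform_scaleR_left qform_zero_left)
 have "Vb i1 *v e = 1 *\<^sub>R e" by (rule mvec_eqI) (simp_all add: Vb_mult e_def ev_None ev_Some sp_simps axis_1_nth)
 then have "{Vb i1} \<subseteq> ?P" by blast
 then have 1: "span {Vb i1} \<subseteq> ?P" by (rule span_minimal[OF _ sP])
 have "Vij i j *v e = 0 *\<^sub>R e" if "i ~= i1" "j ~= i1" for i j using that by (intro mvec_eqI) (auto simp: Vij_mult e_def ev_None ev_Some axis_1_nth)
 then have 2: "calM i1 \<subseteq> ?P" unfolding calM_def by (intro span_minimal sP) blast
 have "(Vb i + Vij i1 i) *v e = 0 *\<^sub>R e" if "i ~= i1" for i using that by (intro mvec_eqI) (auto simp: matrix_vector_mult_add_rdistrib Vb_mult Vij_mult e_def ev_None ev_Some axis_1_nth)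
 then have 3: "calNbar i1 \<subseteq> ?P" unfolding calNbar_def by (intro span_minimal sP) blast
 obtain A1 A2 where A12: "fst A = A1 + A2" "A1 \<in> span {Vb i1}" "A2 \<in> calM i1" "snd A \<in> span {ev (Some i) | i. i ~= i1}" using A unfolding Ut_zero_def by force
 have B1: "fst B \<in> calNbar i1" "snd B \<in> span {e}" using B unfolding Ut_plus_def e_def by force+
 have "A1 \<in> ?P" "A2 \<in> ?P" "fst B \<in> ?P" using A12 B1 1 2 3 by blast+
 then have "A1 + A2 + fst B \<in> ?P" by (intro subspace_add[OF sP])
 then show "\<exists>c. fst (A + B) *v e = c *\<^sub>R e" using A12(1) by simp
 have "qform (ev (Some i)) e = 0" if "i ~= i1" for i using that by (simp add: qform_sp e_def ev_None ev_Some sp_simps inner_axis axis_1_nth)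
 then have 4: "span {ev (Some i) | i. i ~= i1} \<subseteq> {u. qform u e = 0}" by (intro span_minimal sQ) blast
 have "qform e e = 0" by (simp add: qform_sp e_def ev_None ev_Some sp_simps inner_axis axis_1_nth)
 then have 5: "span {e} \<subseteq> {u. qform u e = 0}" by (intro span_minimal sQ) blast
 show "qform (snd (A + B)) e = 0" 
proof -
 have "snd A \<in> {u. qform u e = 0}" "snd B \<in> {u. qform u e = 0}" using A12(4) B1(2) 4 5 by blast+
 then show ?thesis by (simp add: qform_add_left)
qed
qed

text \<open>Ad of an element with rotation part n_infinity carries the property of e_0 + e_1 over to
  its image eta. If the matrix part vanishes, the translation term in Ad vanishes too, and
  orthogonality is transported by the isometry.\<close>

lemma Vz_eta:
 assumes l: "l $ i1 = 0" and Y: "Y \<in> Vz i1 (nexp i1 l, v)"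
 shows "\<exists>c. fst Y *v eta i1 l = c *\<^sub>R eta i1 l" "fst Y = 0 ==> qform (snd Y) (eta i1 l) = 0"
proof -
 obtain A B where AB: "A \<in> Ut_zero i1" "B \<in> Ut_plus i1" "Y = Adt (nexp i1 l, v) (A + B)" using Y unfolding Vz_def by blast
 have n: "nexp i1 l \<in> Ggrp" by (rule nexp_Ggrp[OF l])
 obtain c where c: "fst (A + B) *v (ev None + ev (Some i1)) = c *\<^sub>R (ev None + ev (Some i1))" using eigenspace_e1(1)[OF AB(1,2)] by blast
 have f: "fst Y = nexp i1 l ** fst (A + B) ** matrix_inv (nexp i1 l)" unfolding AB(3) Adt_def by simp
 have "fst Y *v eta i1 l = nexp i1 l *v (fst (A + B) *v (matrix_inv (nexp i1 l) *v (nexp i1 l *v (ev None + ev (Some i1)))))" unfolding f eta_def by (simp only: matrix_vector_mul_assoc matrix_mul_assoc)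
 also have "... = c *\<^sub>R eta i1 l" unfolding Ggrp_matrix_inv(3)[OF n] c eta_def by (simp only: matrix_vector_mult_scaleR)
 finally show "\<exists>c. fst Y *v eta i1 l = c *\<^sub>R eta i1 l" by blast
 assume "fst Y = 0"
 then have "snd Y = nexp i1 l *v snd (A + B)" unfolding f unfolding AB(3) Adt_def by simp
 then show "qform (snd Y) (eta i1 l) = 0" unfolding eta_def using eigenspace_e1(2)[OF AB(1,2)] by (simp only: qform_Ggrp[OF n])
qed

lemma nexp_tendsto: "(f \<longlongrightarrow> l) F ==> ((%t. nexp i1 (f t)) \<longlongrightarrow> nexp i1 l) F" unfolding nexp_def Nw_def by (intro tendsto_intros tendsto_matrix_mult)

text \<open>Future null eigenvectors of \<open>Z\<close> for eigenvalues \<open>c ~= -c'\<close> are parallel, so at most two eigenvalues occur.\<close>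

lemma null_eigenvalues:
 assumes Z: "Z \<in> lieG"
 shows "finite {c. \<exists>w. w $ i1 = 0 & Z *v eta i1 w = c *\<^sub>R eta i1 w}" (is "finite ?S")
proof (cases "?S = {}")
case False
 then obtain c w where w: "w $ i1 = 0" "Z *v eta i1 w = c *\<^sub>R eta i1 w" by blast
 have "?S \<subseteq> {c, -c}"
proof
 fix c' assume "c' \<in> ?S"
 then obtain w' where w': "w' $ i1 = 0" "Z *v eta i1 w' = c' *\<^sub>R eta i1 w'" by blast
 have "(c + c') * qform (eta i1 w) (eta i1 w') = 0" using lieG_qform[OF Z, of "eta i1 w" "eta i1 w'"] unfolding w w' by (simp add: qform_scaleR_left qform_scaleR_right algebra_simps)
 then consider "c' = - c" | "qform (eta i1 w') (eta i1 w) = 0" by (auto simp: qform_commute add_eq_0_iff)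
 then show "c' \<in> {c, -c}"
proof cases
case 2
 note n = eta_null[OF w(1)] and n' = eta_null[OF w'(1)]
 obtain k where k: "eta i1 w' = k *\<^sub>R eta i1 w" using null_parallel[OF n(1,2) 2] n'(1) by auto
 have "k ~= 0" using k n'(2) by auto
 have "c' *\<^sub>R (k *\<^sub>R eta i1 w) = Z *v (k *\<^sub>R eta i1 w)" using w'(2) unfolding k by (rule sym)
 also have "... = k *\<^sub>R (c *\<^sub>R eta i1 w)" by (simp only: matrix_vector_mult_scaleR w(2))
 finally have "c' *\<^sub>R (k *\<^sub>R eta i1 w) = k *\<^sub>R (c *\<^sub>R eta i1 w)" .
 then have "(c' * k) *\<^sub>R eta i1 w = (k * c) *\<^sub>R eta i1 w" unfolding scaleR_scaleR .
 then have "c' * k = k * c" unfolding scaleR_cancel_right using n(2) by blast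
 then have "k * c' = k * c" unfolding mult.commute[of c'] .
 then have "c' = c" unfolding mult_cancel_left using \<open>k ~= 0\<close> by blast
 then show ?thesis by blast
qed auto
qed
 then show ?thesis by (rule finite_subset) simp
next
case True
 show ?thesis unfolding True by (rule finite.emptyI)
qed

section \<open>Almost sure path properties\<close>

context levy_measure
begin

text \<open>A vector with squared norm 1 - z at z = 1/2; by \<open>DF_norm\<close> only this norm
  enters \<open>lyapunov\<close>.\<close>

definition half :: "'d::finite => real^'d" where "half i1 = sqrt (1/2) *\<^sub>R axis i1 1"

lemma norm_half: "(norm (half i1))\<^sup>2 = 1/2" by (simp add: half_def norm_axis_1)

definition lyapunov :: "'d::finite => real" where "lyapunov i1 = DF TYPE('d) (1/2) (half i1)"

end

context levy_proc
begin

lemma null_growth: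
 fixes v :: "'d mvec" and i1 :: 'd
 assumes v: "v ~= 0" "qform v v = 0"
 shows "AE om in M. \<forall>ep>0. eventually (%t. \<bar>ln (norm (matrix_inv (fst (X t om)) *v v)) - lyapunov i1 * t\<bar> <= ep * t) at_top" using LLN[OF row_nonzero[OF v(1)]] AE_space
proof eventually_elim
case (elim om)
 note w = elim(2)
 show ?case
proof (intro allI impI)
 fix ep :: real assume "ep > 0"
 then have "eventually (%t. \<bar>lnF (row v) (X t om) - ig (drift (row v)) 0 t om\<bar> <= ep * t) at_top" using elim(1) by blast
 then show "eventually (%t. \<bar>ln (norm (matrix_inv (fst (X t om)) *v v)) - lyapunov i1 * t\<bar> <= ep * t) at_top" using eventually_ge_at_top[of 0]
proof eventually_elim
case (elim t)
 have "ig (drift (row v)) 0 t om = ig (%x. lyapunov i1) 0 t om" by (rule ig_cong[OF order_refl w]) (simp add: lyapunov_def drift_null(1)[OF v _ norm_half])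
 also have "... = lyapunov i1 * t" using elim(2) by (simp add: ig_def)
 finally show ?case using elim(1) unfolding lnF_row[OF X_G[OF w elim(2)]] by simp
qed
qed
qed

text \<open>The height grows at the rate of null vectors: zeta is null, so
  \<open>norm_matrix_inv\<close> gives |g^-1 zeta|^2 = 2 q(zeta, p)^2, that is a norm of sqrt 2
  times the height, and the law of large numbers for zeta applies.\<close>

lemma path_AE: "AE om in M. path i1 (%t. fst (X t om)) (%t. snd (X t om)) (lyapunov i1)"
proof -
 have z0: "(zeta i1 :: 'd mvec) ~= 0"
proof
 assume "(zeta i1 :: 'd mvec) = 0"
 then have "(zeta i1 :: 'd mvec) $ None = 0" by simp
 then show False by (simp add: ev_None ev_Some)
qed
 have zn: "qform (zeta i1) (zeta i1 :: 'd mvec) = 0" unfolding qform_zeta by (simp add: ev_None ev_Some axis_1_nth)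
 show ?thesis using null_growth[OF z0 zn, of i1] unit_increment translation AE_space
proof eventually_elim
case (elim om)
 note w = elim(4)
 show ?case
proof
 show G: "fst (X t om) \<in> Ggrp" if "0 <= t" for t using X_G[OF w that] by (auto simp: Gtilde_def)
 show "\<exists>B. \<forall>t\<in>{0..T}. norm (fst (X t om)) <= B" if "0 <= T" for T

proof -
 obtain B where B: "\<forall>s\<in>{0..T}. norm (X s om) <= B" using path_bounded[OF w \<open>0 <= T\<close>] by blast
 have "norm (fst (X t om)) <= norm (X t om)" for t using norm_fst_le[of "fst (X t om)" "snd (X t om)"] by simp
 then have "\<forall>t\<in>{0..T}. norm (fst (X t om)) <= B" using B order_trans by blast
 then show ?thesis by blast
qed
 show "((%s. fst (X s om) *v ev None) has_integral snd (X t om)) {0..t}" if "0 <= t" for t using elim(3) that by blast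
 fix ep :: real assume e: "ep > 0"
 show "eventually (%n. \<forall>u\<in>{real n..real n + 1}. norm (matrix_inv (fst (X (real n) om)) ** fst (X u om)) <= 2 * exp (ep * real n)) sequentially" using elim(2) e by blast
 have "eventually (%t. \<bar>ln (norm (matrix_inv (fst (X t om)) *v zeta i1)) - lyapunov i1 * t\<bar> <= ep / 2 * t) at_top" using elim(1) e by (meson half_gt_zero)
 then show "eventually (%t. \<bar>ln (hgt i1 (fst (X t om))) - lyapunov i1 * t\<bar> <= ep * t) at_top" using eventually_ge_at_top[of 0] eventually_ge_at_top[of "ln 2 / ep"]
proof eventually_elim
case (elim t)
 note g = G[OF elim(2)]
 let ?n = "norm (matrix_inv (fst (X t om)) *v zeta i1)"
 have h0: "hgt i1 (fst (X t om)) > 0" by (rule hgt_pos[OF g])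
 have "?n\<^sup>2 = 2 * (hgt i1 (fst (X t om)))\<^sup>2" unfolding norm_matrix_inv[OF g] hgt_def zn by (simp add: qform_commute)
 then have "?n\<^sup>2 = (sqrt 2 * hgt i1 (fst (X t om)))\<^sup>2" unfolding power_mult_distrib real_sqrt_pow2[OF zero_le_numeral] .
 then have "?n = sqrt 2 * hgt i1 (fst (X t om))" by (rule power2_eq_imp_eq) (use h0 in simp_all)
 then have "ln ?n = ln 2 / 2 + ln (hgt i1 (fst (X t om)))" using h0 by (simp add: ln_mult_pos ln_sqrt)
 moreover have "ln 2 <= ep * t" using elim(3) e by (simp add: pos_divide_le_eq mult.commute)
 moreover have "0 <= ln (2::real)" by simp
 moreover have "\<bar>ln ?n - lyapunov i1 * t\<bar> <= ep * t / 2" using elim(1) by simp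
 moreover have "\<bar>u - a\<bar> <= b" if "v = z / 2 + u" "z <= b" "0 <= z" "\<bar>v - a\<bar> <= b / 2" for u v z a b :: real using that by linarith
 ultimately show ?case by blast
qed
qed
qed
qed

lemma alpha_limit: "AE om in M. ((%t. iw_alpha i1 (fst (X t om)) / t) \<longlongrightarrow> lyapunov i1) at_top" using path_AE[of i1]
proof eventually_elim
case (elim om)
 interpret path i1 "%t. fst (X t om)" "%t. snd (X t om)" "lyapunov i1" by (rule elim)
 show ?case
proof (rule tendstoI)
 fix e :: real assume e: "0 < e"
 then have "0 < e / 2" by simp
 from gr[OF this] eventually_gt_at_top[of 0]
 show "eventually (%t. dist (iw_alpha i1 (fst (X t om)) / t) (lyapunov i1) < e) at_top"
proof eventually_elim
case (elim t)
 have t: "0 <= t" "0 < t" using elim(2) by auto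
 have "ln (hgt i1 (fst (X t om))) / t - lyapunov i1 = (ln (hgt i1 (fst (X t om))) - lyapunov i1 * t) / t" using t by (simp add: diff_divide_distrib)
 then have "\<bar>ln (hgt i1 (fst (X t om))) / t - lyapunov i1\<bar> = \<bar>ln (hgt i1 (fst (X t om))) - lyapunov i1 * t\<bar> / t" using t by (simp add: abs_divide)
 also have "... <= e / 2" using elim(1) t by (simp add: pos_divide_le_eq)
 finally show ?case unfolding iw_alpha_eq[OF G[OF t(1)]] dist_real_def using e by simp
qed
qed
qed

text \<open>The drift along a null vector is the constant \<open>lyapunov i1\<close>, so the uniform
  lower bound applies to it. For general v the time integral of the drift is at least ka t, and half
  of ka is given away to the error in the law of large numbers.\<close>

lemma lyapunov_pos:
 assumes "CARD('d) \<ge> 2" "sg ~= 0 \<or> emeasure nu (space nu) ~= 0"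
 shows "lyapunov (i1::'d) > 0"
 and "v ~= 0 ==> \<exists>ka>0. AE om in M. eventually (%t. ka * t <= ln (norm (matrix_inv (fst (X t om)) *v (v :: 'd mvec)))) at_top"
proof -
 obtain ka where k: "ka > 0" "!!v x. v ~= (0 :: 'd mvec) ==> x \<in> Gtilde ==> ka <= drift (row v) x" using drift_lower[where 'd='d, OF assms] by blast
 have z0: "(zeta i1 :: 'd mvec) ~= 0"
proof
 assume "(zeta i1 :: 'd mvec) = 0"
 then have "(zeta i1 :: 'd mvec) $ None = 0" by simp
 then show False by (simp add: ev_None ev_Some)
qed
 have zn: "qform (zeta i1) (zeta i1 :: 'd mvec) = 0" unfolding qform_zeta by (simp add: ev_None ev_Some axis_1_nth)
 have pG: "(pId :: 'd pg) \<in> Gtilde" by (simp add: pId_def Gtilde_def mat_1_Ggrp)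
 show "lyapunov i1 > 0" using k(2)[OF z0 pG] k(1) drift_null(1)[OF z0 zn pG norm_half[of i1]] by (simp add: lyapunov_def)
 assume v: "v ~= 0"
 have "AE om in M. eventually (%t. ka / 2 * t <= ln (norm (matrix_inv (fst (X t om)) *v v))) at_top" using LLN[OF row_nonzero[OF v]] AE_space
proof eventually_elim
case (elim om)
 note w = elim(2)
 have "ka / 2 > 0" using k by simp
 then have "eventually (%t. \<bar>lnF (row v) (X t om) - ig (drift (row v)) 0 t om\<bar> <= ka / 2 * t) at_top" using elim(1) by blast
 then show ?case using eventually_ge_at_top[of 0]
proof eventually_elim
case (elim t)
 have "ka * (t - 0) <= ig (drift (row v)) 0 t om" by (rule ig_mono_ge[OF Gb_drift[OF row_nonzero[OF v]] order_refl elim(2) w k(2)[OF v]])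
 then have "ka / 2 * t + ka / 2 * t <= ig (drift (row v)) 0 t om" by simp
 moreover have "u <= a" if "u + u <= b" "\<bar>a - b\<bar> <= u" for u a b :: real using that by linarith
 ultimately show ?case using elim(1) unfolding lnF_row[OF X_G[OF w elim(2)]] by blast
qed
qed
 then show "\<exists>ka>0. AE om in M. eventually (%t. ka * t <= ln (norm (matrix_inv (fst (X t om)) *v v))) at_top" using k(1) by (intro exI[of _ "ka / 2"]) simp
qed

text \<open>If the conjugate Z part failed to grow, Z would have the limit direction etl as an
  eigenvector for some c in the finite set S. Then y = Z u + c u is orthogonal to etl for every u,
  by antisymmetry of Z. Choosing for each c in S one u with y nonzero leaves finitely many fixed
  vectors, and almost surely none of them is orthogonal to etl. If Z = 0, the vector part of Y is
  tested directly. The same dichotomy excludes Y from the middle subspace and supplies the lower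
  growth bound.\<close>

lemma generic_rate:
 assumes d: "CARD('d) \<ge> 2" "sg ~= 0 \<or> emeasure nu (space nu) ~= 0"
 and N: "norm_on lieT N" and Y: "Y \<in> lieT" "Y ~= 0"
 shows "AE om in M. Y \<notin> Vz i1 (Lim at_top (%t. iw_N i1 (fst (X t om))), v om) &
 ((%t. ln (finsler N (X t om) (dflow (X t om) Y)) / t) \<longlongrightarrow> lyapunov i1) at_top"
proof -
 define Z where "Z = fst Y"
 have Z: "Z \<in> lieG" using Y by (auto simp: Z_def lieT_def)
 define S where "S = {c. \<exists>w. w $ i1 = 0 & Z *v eta i1 w = c *\<^sub>R eta i1 w}"
 have fS: "finite S" unfolding S_def by (rule null_eigenvalues[OF Z])
 \<comment> \<open>Otherwise Z is the scalar -c; its time-time entry is 0, so c = 0 and Z =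
   0.\<close>
 have "\<exists>u. Z *v u + c *\<^sub>R u ~= 0" if Z0: "Z ~= 0" for c
proof (rule ccontr)
 assume "\<not> ?thesis"
 then have zu: "Z *v u = (- c) *\<^sub>R u" for u by (simp add: add_eq_0_iff)
 have "(Z *v ev None) $ None = Z $ None $ None" by (simp add: ev_def matrix_vector_mult_basis column_def)
 then have "c = 0" using zu[of "ev None"] lieG_None[OF Z] by (simp add: ev_None)
 then show False using zu Z0 by (simp add: matrix_eq)
qed
 then obtain u where u: "!!c. Z ~= 0 ==> Z *v u c + c *\<^sub>R u c ~= 0" by metis
 define T where "T = (if Z = 0 then {snd Y} else (%c. Z *v u c + c *\<^sub>R u c) ` S)"
 have fT: "finite T" using fS by (simp add: T_def)
 have T0: "y ~= 0" if "y \<in> T" for y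
proof (cases "Z = 0")
case True
 then show ?thesis using that Y(2) by (auto simp: T_def Z_def prod_eq_iff zero_prod_def)
next
case False
 then show ?thesis using that u by (auto simp: T_def)
qed
 have "AE om in M. \<forall>y\<in>T. \<exists>ka>0. eventually (%t. ka * t <= ln (norm (matrix_inv (fst (X t om)) *v y))) at_top"
proof (rule AE_finite_allI[OF fT])
 fix y assume "y \<in> T"
 then obtain ka where "ka > 0" "AE om in M. eventually (%t. ka * t <= ln (norm (matrix_inv (fst (X t om)) *v y))) at_top" using lyapunov_pos(2)[OF d T0] by blast
 then show "AE om in M. \<exists>ka>0. eventually (%t. ka * t <= ln (norm (matrix_inv (fst (X t om)) *v y))) at_top" by (auto elim!: eventually_mono)
qed
 then show ?thesis using path_AE[of i1]
proof eventually_elim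
case (elim om)
 interpret transient_path i1 "%t. fst (X t om)" "%t. snd (X t om)" "lyapunov i1" by (intro transient_path.intro elim(2) transient_path_axioms.intro lyapunov_pos(1) d)
 have q: "qform y etl ~= 0" if "y \<in> T" for y using elim(1) that slow_vector by blast
 note n = eta_null[OF wl(1)]
 have c: "qform (Z *v etl) (Z *v etl) < 0 \<or> Z = 0 & qform (snd Y) etl ~= 0"
proof (cases "Z = 0")
case True
 then show ?thesis using q by (simp add: T_def)
next
case False
 have "qform (Z *v etl) (Z *v etl) < 0"
\<comment> \<open>Z etl is orthogonal to etl, so a nonnegative q-square makes it a multiple of etl
  by \<open>null_parallel\<close>.\<close>
proof (rule ccontr)
 assume "\<not> ?thesis"
 then obtain c where c: "Z *v etl = c *\<^sub>R etl" using null_parallel[OF n(1,2) lieG_qform_self[OF Z]] by fastforce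
 then have "c \<in> S" using wl(1) by (auto simp: S_def)
 then have "Z *v u c + c *\<^sub>R u c \<in> T" using False by (simp add: T_def)
 from q[OF this] show False using lieG_qform[OF Z, of "u c" etl] unfolding c by (simp add: qform_add_left qform_scaleR_left qform_scaleR_right)
qed
 then show ?thesis ..
qed
 have "((%t. nexp i1 (hor i1 (fst (X t om)))) \<longlongrightarrow> nexp i1 wl) at_top" by (rule nexp_tendsto[OF wl(2)])
 moreover have "eventually (%t. nexp i1 (hor i1 (fst (X t om))) = iw_N i1 (fst (X t om))) at_top" by (rule eventually_at_top_linorderI[of 0]) (simp add: iw_N_eq G)
 ultimately have "((%t. iw_N i1 (fst (X t om))) \<longlongrightarrow> nexp i1 wl) at_top" by (rule Lim_transform_eventually)
 then have L: "Lim at_top (%t. iw_N i1 (fst (X t om))) = nexp i1 wl" by (intro tendsto_Lim) simp_all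
 have "Y \<notin> Vz i1 (nexp i1 wl, v om)"
proof
 assume "Y \<in> Vz i1 (nexp i1 wl, v om)"
 note V = Vz_eta[OF wl(1) this, folded Z_def]
 obtain k where "Z *v etl = k *\<^sub>R etl" using V(1) by blast
 then have "qform (Z *v etl) (Z *v etl) = 0" using n(1) by (simp add: qform_scaleR_left qform_scaleR_right)
 then show False using c V(2) by auto
qed
 moreover obtain k1 k2 where k: "k1 > 0" "k2 > 0" "!!t. t \<ge> 0 ==> k1 * Dn (fst Y) (snd Y) t <= finsler N (X t om) (dflow (X t om) Y)
 & finsler N (X t om) (dflow (X t om) Y) <= k2 * Dn (fst Y) (snd Y) t" using finsler_bounds[OF N Y(1), of "%t. X t om"] by auto
 have "((%t. ln (finsler N (X t om) (dflow (X t om) Y)) / t) \<longlongrightarrow> lyapunov i1) at_top" by (rule rate[OF Z c k(1,2)]) (use k(3) in \<open>simp add: Z_def\<close>)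
 ultimately show ?case unfolding L by blast
qed
qed

text \<open>For d = 1 the two null vectors e_0 + e_1 and e_0 - e_1 both have growth rate 0, and
  together they determine the time component of p_t. Hence p_t, g_t, its inverse and xi_t are
  subexponential, and since Y is recovered by undoing the conjugation, its norm can neither grow nor
  decay exponentially.\<close>

lemma line_rate:
 assumes d: "CARD('d) = 1" and N: "norm_on lieT N" and Y: "Y \<in> lieT" "Y ~= 0"
 shows "lyapunov (i1 :: 'd) = 0"
 and "AE om in M. ((%t. ln (finsler N (X t om) (dflow (X t om) Y)) / t) \<longlongrightarrow> 0) at_top"
proof -
 let ?e = "ev None + ev (Some i1) :: 'd mvec"
 have e0: "?e ~= 0"
proof
 assume "?e = 0"
 then have "?e $ None = 0" by simp
 then show False by (simp add: ev_None ev_Some)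
qed
 have en: "qform ?e ?e = 0" by (simp add: qform_sp ev_None ev_Some sp_simps inner_axis axis_1_nth)
 have pG: "(pId :: 'd pg) \<in> Gtilde" by (simp add: pId_def Gtilde_def mat_1_Ggrp)
 show L0: "lyapunov i1 = 0" unfolding lyapunov_def by (rule DF_line[OF d norm_half drift_null(2)[OF e0 en pG norm_half]])
 show "AE om in M. ((%t. ln (finsler N (X t om) (dflow (X t om) Y)) / t) \<longlongrightarrow> 0) at_top" using path_AE[of i1] null_growth[OF e0 en, of i1]
proof eventually_elim
case (elim om)
 interpret path i1 "%t. fst (X t om)" "%t. snd (X t om)" 0 using elim(1) unfolding L0 .
 let ?g = "%t. fst (X t om)"
 have Z: "fst Y \<in> lieG" using Y by (auto simp: lieT_def)
 \<comment> \<open>Here c = 2, and \<open>norm_Ggrp\<close> gives |g|^2 = 2 |p|^2 <= (2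
   |p|)^2.\<close>
 define c where "c = 1 + real CARD('d)"
 have gn: "norm (?g t) <= c * norm (?g t *v ev None)" if t: "t \<ge> 0" for t
proof -
 have p1: "1 <= (norm (?g t *v ev None))\<^sup>2" using Ggrp_orbit(2,4)[OF G[OF t]] one_le_power[of "(?g t *v ev None) $ None" 2] by linarith
 have "(norm (?g t))\<^sup>2 = 2 * (norm (?g t *v ev None))\<^sup>2" unfolding norm_Ggrp[OF G[OF t]] d by simp
 also have "... <= (c * norm (?g t *v ev None))\<^sup>2" by (simp add: c_def d power_mult_distrib)
 finally show ?thesis by (rule power2_le_imp_le) (simp add: c_def)
qed
 have pe: "\<exists>C\<ge>1. \<forall>t\<ge>0. norm (p t) <= C * exp (ep * t)" if e: "ep > 0" for ep
proof -
 have "eventually (%t. norm (p t) <= 2 * exp (ep * t)) at_top" using gr[OF e] elim(2)[rule_format, OF e] eventually_ge_at_top[of 0]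
proof eventually_elim
case (elim t)
 note g = G[OF elim(3)]
 have h0: "h t > 0" by (rule hp[OF elim(3)])
 have "ln (h t) <= ep * t" using elim(1) by simp
 then have "exp (ln (h t)) <= exp (ep * t)" by (simp only: exp_le_cancel_iff)
 then have 1: "h t <= exp (ep * t)" unfolding exp_ln[OF h0] .
 let ?n = "norm (matrix_inv (?g t) *v ?e)"
 have q: "\<bar>qform ?e (p t)\<bar> <= ?n" by (rule norm_matrix_inv_ge[OF g])
 have "?n ~= 0" using e0 Ggrp_matrix_inv(4)[OF g, of ?e] by auto
 moreover have "ln ?n <= ep * t" using elim(2) by (simp add: L0)
 ultimately have 2: "?n <= exp (ep * t)"
proof -
 assume n: "?n ~= 0" and l: "ln ?n <= ep * t"
 have "0 < ?n" using n norm_ge_zero[of "matrix_inv (?g t) *v ?e"] by linarith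
 moreover have "exp (ln ?n) <= exp (ep * t)" using l by (simp only: exp_le_cancel_iff)
 ultimately show ?thesis by (simp only: exp_ln)
qed
 \<comment> \<open>The two null coordinates of p add up to twice its time component, which bounds
   all of p because q(p, p) = 1.\<close>
 have "qform ?e (p t) + h t = 2 * (p t) $ None" using qform_add_right[of "p t" ?e "zeta i1"] by (simp add: hgt_def qform_commute[of ?e]  qform_add_right qform_diff_right qform_ev_None)
 then have 3: "(p t) $ None <= exp (ep * t)" using 1 2 q by linarith
 have "(norm (p t))\<^sup>2 <= (2 * exp (ep * t))\<^sup>2"
proof -
 have "((p t) $ None)\<^sup>2 <= (exp (ep * t))\<^sup>2" using 3 Ggrp_orbit(2)[OF g] by (intro power_mono) auto
 moreover have "n <= 4 * b" if "a <= b" "n = 2 * a - 1" "0 <= b" for a b n :: real using that by linarith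
 ultimately have "(norm (p t))\<^sup>2 <= 4 * (exp (ep * t))\<^sup>2" using Ggrp_orbit(4)[OF g] zero_le_power2 by blast
 moreover have "(2 * exp (ep * t))\<^sup>2 = 4 * (exp (ep * t))\<^sup>2" unfolding power_mult_distrib by simp
 ultimately show ?thesis by (simp only:)
qed
 then show ?case by (rule power2_le_imp_le) simp
qed
 from growth_bound[OF this p_bounded] obtain C where C: "C > 0" "!!t. t \<ge> 0 ==> norm (p t) <= C * exp (ep * t)" by blast
 have "norm (p t) <= (1 + C) * exp (ep * t)" if "t \<ge> 0" for t using C(2)[OF that] by (simp add: distrib_right add_increasing)
 then show ?thesis using C(1) by (intro exI[of _ "1 + C"]) simp
qed
 have up: "\<exists>C>0. eventually (%t. Dn (fst Y) (snd Y) t <= C * exp ((0 + ep) * t)) at_top" if e: "ep > 0" for ep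
proof -
 \<comment> \<open>Three factors e^(d t) can occur together: one from the inverse of g and two from
   the bound on xi, where the time integral costs an additional one.\<close>
 define d where "d = ep / 3"
 have d: "d > 0" "ep = 3 * d" using e by (auto simp: d_def)
 obtain C where C: "C \<ge> 1" "!!t. t \<ge> 0 ==> norm (p t) <= C * exp (d * t)" using pe[OF d(1)] by blast
 define K where "K = c * C"
 have K: "K > 0" using C(1) by (simp add: K_def c_def)
 define Q where "Q = K * norm (fst Y) * K + K * (norm (snd Y) + norm (fst Y) * (C / d)) + 1"
 have Q0: "Q > 0" unfolding Q_def using K C d by (intro add_nonneg_pos add_nonneg_nonneg mult_nonneg_nonneg divide_nonneg_nonneg) auto
 have "Dn (fst Y) (snd Y) t <= Q * exp ((0 + ep) * t)" if t: "t \<ge> 0" for t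
proof -
 let ?x = "exp (d * t)"
 have x1: "1 <= ?x" using d t by simp
 have x3: "exp ((0 + ep) * t) = ?x * (?x * ?x)" by (simp add: d(2) exp_add[symmetric] algebra_simps)
 have g1: "norm (?g t) <= K * ?x" using order_trans[OF gn[OF t] mult_left_mono[OF C(2)[OF t]]] by (simp add: K_def c_def mult.assoc)
 have g2: "norm (matrix_inv (?g t)) <= K * ?x" using g1 norm_matrix_inv_Ggrp[OF G[OF t]] by simp
 have "norm (p s) <= C * ?x" if "0 <= s" "s <= t" for s
proof -
 have "C * exp (d * s) <= C * ?x" using that d C by simp
 then show ?thesis using C(2)[OF that(1)] by linarith
qed
 then have "norm (snd (X t om)) <= (C * ?x) * t" using C(1) by (intro xi_bound[OF t]) auto
 also have "... <= (C * ?x) * (?x / d)" using C(1) by (intro mult_left_mono t_exp d) auto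
 finally have x2: "norm (snd (X t om)) <= (C / d) * (?x * ?x)" by simp
 have "norm (matrix_inv (?g t) ** fst Y ** ?g t) <= norm (matrix_inv (?g t)) * norm (fst Y) * norm (?g t)" by (rule order_trans[OF norm_matrix_mult_le mult_right_mono[OF norm_matrix_mult_le]]) simp
 also have "... <= (K * ?x) * norm (fst Y) * (K * ?x)" using K by (intro mult_mono g1 g2) auto
 also have "... = K * norm (fst Y) * K * (1 * (?x * ?x))" by simp
 also have "... <= K * norm (fst Y) * K * (?x * (?x * ?x))" using K x1 by (intro mult_left_mono mult_right_mono) auto
 finally have 1: "norm (matrix_inv (?g t) ** fst Y ** ?g t) <= K * norm (fst Y) * K * (?x * (?x * ?x))" .
 have xx: "1 <= ?x * ?x" using mult_mono[OF x1 x1] by simp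
 have "norm (snd Y + fst Y *v snd (X t om)) <= norm (snd Y) + norm (fst Y) * norm (snd (X t om))" using norm_triangle_ineq[of "snd Y" "fst Y *v snd (X t om)"] norm_matrix_vector_le[of "fst Y" "snd (X t om)"] by linarith
 also have "... <= norm (snd Y) * (?x * ?x) + norm (fst Y) * ((C / d) * (?x * ?x))" using mult_left_mono[OF xx, of "norm (snd Y)"] mult_left_mono[OF x2, of "norm (fst Y)"] by simp
 finally have s: "norm (snd Y + fst Y *v snd (X t om)) <= norm (snd Y) * (?x * ?x) + norm (fst Y) * ((C / d) * (?x * ?x))" .
 have "norm (matrix_inv (?g t) *v (snd Y + fst Y *v snd (X t om))) <= norm (matrix_inv (?g t)) * norm (snd Y + fst Y *v snd (X t om))" by (rule norm_matrix_vector_le)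
 also have "... <= (K * ?x) * (norm (snd Y) * (?x * ?x) + norm (fst Y) * ((C / d) * (?x * ?x)))" using K by (intro mult_mono g2 s) auto
 finally have "Dn (fst Y) (snd Y) t <= K * norm (fst Y) * K * (?x * (?x * ?x)) + (K * ?x) * (norm (snd Y) * (?x * ?x) + norm (fst Y) * ((C / d) * (?x * ?x)))" using 1 unfolding Dn_def by linarith
 also have "... = (Q - 1) * (?x * (?x * ?x))" unfolding Q_def by (simp only: add_diff_cancel_right' distrib_right distrib_left mult.assoc mult.left_commute mult.commute)
 also have "... <= Q * (?x * (?x * ?x))" by (intro mult_right_mono) auto
 finally show ?thesis unfolding x3 .
qed
 then have "eventually (%t. Dn (fst Y) (snd Y) t <= Q * exp ((0 + ep) * t)) at_top" by (intro eventually_at_top_linorderI[of 0])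
 with Q0 show ?thesis by blast
qed
 have lo: "\<exists>c>0. eventually (%t. c * exp ((0 - ep) * t) <= Dn (fst Y) (snd Y) t) at_top" if e: "ep > 0" for ep
proof -
 define d where "d = ep / 2"
 have d: "d > 0" "ep = 2 * d" using e by (auto simp: d_def)
 obtain C where C: "C \<ge> 1" "!!t. t \<ge> 0 ==> norm (p t) <= C * exp (d * t)" using pe[OF d(1)] by blast
 define K where "K = c * C"
 have K: "K \<ge> 1" using C(1) mult_mono[of 1 c 1 C] by (simp add: K_def c_def)
 define a where "a = (if fst Y = 0 then norm (snd Y) else norm (fst Y))"
 have a: "a > 0" using Y(2) by (auto simp: a_def prod_eq_iff zero_prod_def)
 have "a / (K * K) * exp ((0 - ep) * t) <= Dn (fst Y) (snd Y) t" if t: "t \<ge> 0" for t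
proof -
 let ?x = "exp (d * t)"
 have x1: "1 <= ?x" using d t by simp
 have g1: "norm (?g t) <= K * ?x" using order_trans[OF gn[OF t] mult_left_mono[OF C(2)[OF t]]] by (simp add: K_def c_def mult.assoc)
 have g2: "norm (matrix_inv (?g t)) <= K * ?x" using g1 norm_matrix_inv_Ggrp[OF G[OF t]] by simp
 have Kx: "1 <= K * ?x" using mult_mono[OF K x1] K by simp
 have D0: "0 <= Dn (fst Y) (snd Y) t" by (simp add: Dn_def)
 \<comment> \<open>Conjugate back, or apply g to g^-1 x if Z = 0, and bound g and its inverse by the
   subexponential factor; at most two such factors are lost.\<close>
 have "a <= (K * ?x) * Dn (fst Y) (snd Y) t * (K * ?x)"
proof (cases "fst Y = 0")
case True
 have "norm (?g t *v (matrix_inv (?g t) *v snd Y)) <= norm (?g t) * norm (matrix_inv (?g t) *v snd Y)" by (rule norm_matrix_vector_le)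
 also have "... <= (K * ?x) * Dn (fst Y) (snd Y) t" using g1 Kx by (intro mult_mono) (auto simp: Dn_def True)
 also have "... = (K * ?x) * Dn (fst Y) (snd Y) t * 1" by simp
 also have "... <= (K * ?x) * Dn (fst Y) (snd Y) t * (K * ?x)" using Kx D0 K by (intro mult_left_mono mult_nonneg_nonneg) auto
 finally show ?thesis unfolding Ggrp_matrix_inv(4)[OF G[OF t]] by (simp add: a_def True)
next
case False
 have "?g t ** (matrix_inv (?g t) ** fst Y ** ?g t) ** matrix_inv (?g t) = (?g t ** matrix_inv (?g t)) ** fst Y ** (?g t ** matrix_inv (?g t))" by (simp only: matrix_mul_assoc)
 also have "... = fst Y" by (simp only: Ggrp_matrix_inv(2)[OF G[OF t]] matrix_mul_lid matrix_mul_rid)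
 finally have "norm (fst Y) = norm (?g t ** (matrix_inv (?g t) ** fst Y ** ?g t) ** matrix_inv (?g t))" by (rule arg_cong[OF sym])
 also have "... <= norm (?g t) * norm (matrix_inv (?g t) ** fst Y ** ?g t) * norm (matrix_inv (?g t))" by (rule order_trans[OF norm_matrix_mult_le mult_right_mono[OF norm_matrix_mult_le norm_ge_zero]])
 also have "... <= (K * ?x) * Dn (fst Y) (snd Y) t * (K * ?x)" using g1 g2 Kx D0 by (intro mult_mono) (auto simp: Dn_def)
 finally show ?thesis by (simp add: a_def False)
qed
 also have "... = (K * K) * (exp (ep * t) * Dn (fst Y) (snd Y) t)"
proof -
 have "exp (ep * t) = ?x * ?x" by (simp only: d(2) mult_2 distrib_right exp_add)
 then show ?thesis by (simp only: mult.assoc mult.left_commute mult.commute)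
qed
 finally have le: "a <= (K * K) * (exp (ep * t) * Dn (fst Y) (snd Y) t)" .
 have KK: "0 < K * K" using K by (intro mult_pos_pos) linarith+
 have "a / (K * K) <= exp (ep * t) * Dn (fst Y) (snd Y) t" unfolding pos_divide_le_eq[OF KK] using le by (simp only: mult.assoc mult.left_commute mult.commute)
 then have "a / (K * K) * exp ((0 - ep) * t) <= exp (ep * t) * Dn (fst Y) (snd Y) t * exp ((0 - ep) * t)" by (rule mult_right_mono) simp
 also have "... = (exp (ep * t) * exp ((0 - ep) * t)) * Dn (fst Y) (snd Y) t" by (simp only: mult.assoc mult.left_commute mult.commute)
 also have "exp (ep * t) * exp ((0 - ep) * t) = 1"
proof -
 have "ep * t + (0 - ep) * t = 0" by (simp add: algebra_simps)
 then show ?thesis unfolding exp_add[symmetric] by simp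
qed
 also have "1 * Dn (fst Y) (snd Y) t = Dn (fst Y) (snd Y) t" by simp
 finally show ?thesis .
qed
 then have "eventually (%t. a / (K * K) * exp ((0 - ep) * t) <= Dn (fst Y) (snd Y) t) at_top" by (intro eventually_at_top_linorderI[of 0])
 then show ?thesis using a K by (intro exI[of _ "a / (K * K)"]) simp
qed
 obtain k1 k2 where k: "k1 > 0" "k2 > 0" "!!t. t \<ge> 0 ==> k1 * Dn (fst Y) (snd Y) t <= finsler N (X t om) (dflow (X t om) Y)
 & finsler N (X t om) (dflow (X t om) Y) <= k2 * Dn (fst Y) (snd Y) t" using finsler_bounds[OF N Y(1), of "%t. X t om"] by auto
 show ?case by (rule rate_limit[OF k up lo])
qed
qed

end

theorem theorem1:
 fixes \<sigma> :: real and \<nu> :: "real measure" and M :: "'w measure"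
  and gt :: "real \<Rightarrow> 'w \<Rightarrow> 'd::finite pg" and i1 :: 'd
  and N :: "'d pg \<Rightarrow> real" and Y :: "'d pg"
 assumes sigma_nonneg: "\<sigma> \<ge> 0"
  and nu_borel: "sets \<nu> = sets borel"
  and nu_support: "emeasure \<nu> {..0} = 0"
  and nu_levy: "(\<integral>\<^sup>+ r. ennreal (min 1 (r\<^sup>2)) \<partial>\<nu>) < \<infinity>"
  and nondeg: "\<sigma> > 0 \<or> emeasure \<nu> (space \<nu>) \<noteq> 0"
  and nu_moment: "(\<integral>\<^sup>+ r. ennreal (r * indicator {1..} r) \<partial>\<nu>) < \<infinity>"
  and levy: "left_levy_process \<sigma> \<nu> M gt"
  and normN: "norm_on lieT N"
  and Y_lie: "Y \<in> lieT"
 shows "\<exists>\<alpha>::real.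
   (AE \<omega> in M. ((\<lambda>t. iw_alpha i1 (fst (gt t \<omega>)) / t) \<longlongrightarrow> \<alpha>) at_top) \<and>
   (AE \<omega> in M.
    let nInf = Lim at_top (\<lambda>t. iw_N i1 (fst (gt t \<omega>)));
      lamInf = Lim at_top (\<lambda>t. - (1/2) * qform (matrix_inv nInf *v snd (gt t \<omega>))
                           (ev None + ev (Some i1)));
      gInf = (nInf, lamInf *\<^sub>R (ev None - ev (Some i1)));
      Vminus = Adt gInf ` Ut_plus i1;
      Vzero = Adt gInf ` {A + B | A B. A \<in> Ut_zero i1 \<and> B \<in> Ut_plus i1};
      lyap = (\<lambda>t. ln (finsler N (gt t \<omega>) (dflow (gt t \<omega>) Y)) / t)
    in (Y \<notin> Vzero \<longrightarrow> (lyap \<longlongrightarrow> \<alpha>) at_top) \<and>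
      (Y \<in> Vzero - Vminus \<longrightarrow> (lyap \<longlongrightarrow> 0) at_top) \<and>
      (Y \<in> Vminus - {0} \<longrightarrow> (lyap \<longlongrightarrow> - \<alpha>) at_top))"
proof -
 interpret levy_proc \<sigma> \<nu> M gt using nu_borel nu_support nu_levy nu_moment levy by (simp add: levy_proc_def levy_measure_def levy_proc_axioms_def)
 have nd: "\<sigma> \<noteq> 0 \<or> emeasure \<nu> (space \<nu>) \<noteq> 0" using nondeg by auto
 define gI where "gI \<omega> = (let nInf = Lim at_top (\<lambda>t. iw_N i1 (fst (gt t \<omega>)))
 in (nInf, Lim at_top (\<lambda>t. - (1/2) * qform (matrix_inv nInf *v snd (gt t \<omega>)) (ev None + ev (Some i1))) *\<^sub>R zeta i1))" for \<omega>
 define ly where "ly \<omega> = (\<lambda>t. ln (finsler N (gt t \<omega>) (dflow (gt t \<omega>) Y)) / t)" for \<omega>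
 \<comment> \<open>The nonzero vector falls under the transient case d >= 2 or the degenerate case d
   = 1.\<close>
 consider "Y = 0" | "Y \<noteq> 0" "CARD('d) \<ge> 2" | "Y \<noteq> 0" "CARD('d) = 1" using zero_less_card_finite[where 'a='d] by linarith
 then have "AE \<omega> in M. Y = 0 \<or> Y \<notin> Vz i1 (gI \<omega>) \<and> (ly \<omega> \<longlongrightarrow> lyapunov i1) at_top \<or> lyapunov i1 = 0 \<and> (ly \<omega> \<longlongrightarrow> 0) at_top"
proof cases
case 2
 show ?thesis using generic_rate[OF 2(2) nd normN Y_lie 2(1), of i1 "\<lambda>\<omega>. snd (gI \<omega>)"] by eventually_elim (simp add: gI_def ly_def Let_def)
next
case 3
 note L = line_rate(1)[OF 3(2) normN Y_lie 3(1), of i1]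
 show ?thesis using line_rate(2)[OF 3(2) normN Y_lie 3(1)] by eventually_elim (simp add: ly_def L)
qed simp
 \<comment> \<open>Zero lies in both subspaces, so for Y = 0 no case applies. Outside the middle
   subspace only the first case applies, and for exponent 0 the three limits coincide.\<close>
 then have "AE \<omega> in M. (Y \<notin> Vz i1 (gI \<omega>) \<longrightarrow> (ly \<omega> \<longlongrightarrow> lyapunov i1) at_top) \<and>
 (Y \<in> Vz i1 (gI \<omega>) - Adt (gI \<omega>) ` Ut_plus i1 \<longrightarrow> (ly \<omega> \<longlongrightarrow> 0) at_top) \<and>
 (Y \<in> Adt (gI \<omega>) ` Ut_plus i1 - {0} \<longrightarrow> (ly \<omega> \<longlongrightarrow> - lyapunov i1) at_top)"
proof eventually_elim
case (elim \<omega>)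
 then show ?case using Vminus_subset[of "gI \<omega>" i1] zero_Vminus[of "gI \<omega>" i1] by auto
qed
 then show ?thesis by (intro exI[of _ "lyapunov i1"] conjI alpha_limit) (simp only: gI_def ly_def Vz_def Let_def)
qed

end
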